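(* Let $\Omega\subset\subset\mathbb{C}^{n}$ be a smoothly bounded domain with Bergman projection $B$, and assume that Condition R holds, i.e. $B(C^\infty(\overline\Omega))\subseteq C^\infty(\overline\Omega)$. Then for every $k\in\mathbb{N}$ there is a constant $C_k>0$ such that $$\|Bf\|_k\leq C_k\|f\|$$ for all conjugate holomorphic functions $f$ in $L^2(\Omega)$. In particular, for such $f$, $Bf$ is smooth up to the boundary, i.e. $Bf\in C^\infty(\overline\Omega)$.
   Context: $\mathbb{N}=\{1,2,\dots\}$. $\Omega\subset\subset\mathbb{C}^n$ is a bounded domain with smooth boundary. $\|\cdot\|$ is the $L^2(\Omega)$ norm with respect to Lebesgue measure. $\|f\|_k^2=\sum_{|\alpha|\le k}\|D^\alpha f\|^2$ is the norm of the $L^2$ Sobolev space $H^k(\Omega)$ of complex-valued functions (all real partial derivatives of order at most $k$). The Bergman projection $B$ is the orthogonal projection of $L^2(\Omega)$ onto its closed subspace $A^0(\Omega)$ of square-integrable holomorphic functions. $C^\infty(\overline\Omega)$ denotes the functions smooth up to the boundary. A function $f$ is conjugate holomorphic if $\overline f$ is holomorphic. *)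

theory Defs
  imports "HOL-Analysis.Analysis" "HOL-Library.Multiset"
begin

section \<open>Partial derivatives and smooth functions\<close>

text \<open>For \<open>'a = complex ^ 'n\<close> the set \<open>Basis\<close> consists of the vectors \<open>axis j 1\<close> and
  \<open>axis j \<i>\<close>, so the derivatives below are the real partial derivatives
  $\partial/\partial x_j$ and $\partial/\partial y_j$.\<close>

definition partial :: "'a::euclidean_space \<Rightarrow> ('a \<Rightarrow> 'b::real_normed_vector) \<Rightarrow> 'a \<Rightarrow> 'b" where
  "partial b f x = frechet_derivative f (at x) b"

definition partials :: "'a::euclidean_space list \<Rightarrow> ('a \<Rightarrow> 'b::real_normed_vector) \<Rightarrow> 'a \<Rightarrow> 'b" where
  "partials bs f = foldr partial bs f"

text \<open>Meant for open \<open>S\<close>. The clause for \<open>bs = []\<close> makes \<open>f\<close> itself differentiable, so that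
  every \<^const>\<open>partial\<close> is only ever taken of a differentiable function.\<close>

definition smooth_on :: "'a::euclidean_space set \<Rightarrow> ('a \<Rightarrow> 'b::real_normed_vector) \<Rightarrow> bool" where
  "smooth_on S f \<longleftrightarrow>
     (\<forall>bs. set bs \<subseteq> Basis \<longrightarrow> (\<forall>x\<in>S. partials bs f differentiable (at x)))"

text \<open>The space $C^\infty(\overline\Omega)$: all derivatives extend continuously from \<open>\<Omega>\<close> to the
  closure. Only the restriction of \<open>f\<close> to \<open>\<Omega>\<close> matters.\<close>

definition smooth_up_to_boundary :: "'a::euclidean_space set \<Rightarrow> ('a \<Rightarrow> complex) set" where
  "smooth_up_to_boundary \<Omega> = {f. smooth_on \<Omega> f \<and>
     (\<forall>bs. set bs \<subseteq> Basis \<longrightarrow>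
        (\<exists>g. continuous_on (closure \<Omega>) g \<and> (\<forall>x\<in>\<Omega>. g x = partials bs f x)))}"

definition smoothly_bounded_domain :: "'a::euclidean_space set \<Rightarrow> bool" where
  "smoothly_bounded_domain \<Omega> \<longleftrightarrow>
     open \<Omega> \<and> connected \<Omega> \<and> \<Omega> \<noteq> {} \<and> bounded \<Omega> \<and>
     (\<exists>U (r :: 'a \<Rightarrow> real). open U \<and> frontier \<Omega> \<subseteq> U \<and> smooth_on U r \<and>
        \<Omega> \<inter> U = {x \<in> U. r x < 0} \<and>
        (\<forall>x\<in>frontier \<Omega>. frechet_derivative r (at x) \<noteq> (\<lambda>_. 0)))"

section \<open>Square-integrable functions and Sobolev spaces\<close>

definition L2 :: "'a::euclidean_space set \<Rightarrow> ('a \<Rightarrow> complex) set" where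
  "L2 \<Omega> = {f \<in> borel_measurable (lebesgue_on \<Omega>).
     integrable (lebesgue_on \<Omega>) (\<lambda>x. (cmod (f x))\<^sup>2)}"

definition L2_inner :: "'a::euclidean_space set \<Rightarrow> ('a \<Rightarrow> complex) \<Rightarrow> ('a \<Rightarrow> complex) \<Rightarrow> complex" where
  "L2_inner \<Omega> f g = (LINT x|lebesgue_on \<Omega>. f x * cnj (g x))"

definition L2_norm :: "'a::euclidean_space set \<Rightarrow> ('a \<Rightarrow> complex) \<Rightarrow> real" where
  "L2_norm \<Omega> f = sqrt (LINT x|lebesgue_on \<Omega>. (cmod (f x))\<^sup>2)"

text \<open>Multi-indices assign an order of differentiation to each real coordinate direction; they are
  set to \<open>0\<close> off \<open>Basis\<close>, which makes them finite in number.\<close>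

definition multi_indices :: "nat \<Rightarrow> ('a::euclidean_space \<Rightarrow> nat) set" where
  "multi_indices k = {\<alpha>. (\<forall>b. b \<notin> Basis \<longrightarrow> \<alpha> b = 0) \<and> (\<Sum>b\<in>Basis. \<alpha> b) \<le> k}"

lemma finite_multi_indices: "finite (multi_indices k)"
proof (rule finite_subset)
  show "multi_indices k \<subseteq>
      {\<alpha>. \<forall>b::'a. (b \<in> Basis \<longrightarrow> \<alpha> b \<in> {..k}) \<and> (b \<notin> Basis \<longrightarrow> \<alpha> b = 0)}"
    unfolding multi_indices_def
    by (auto intro: order_trans[OF member_le_sum[OF _ _ finite_Basis]])
  show "finite {\<alpha>. \<forall>b::'a. (b \<in> Basis \<longrightarrow> \<alpha> b \<in> {..k}) \<and> (b \<notin> Basis \<longrightarrow> \<alpha> b = 0)}"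
    by (rule finite_set_of_finite_funs) auto
qed

text \<open>The order in which the derivatives are taken is irrelevant for smooth functions, the only ones
  to which this operator is applied.\<close>

definition multi_partial :: "('a::euclidean_space \<Rightarrow> nat) \<Rightarrow> ('a \<Rightarrow> complex) \<Rightarrow> 'a \<Rightarrow> complex" where
  "multi_partial \<alpha> = partials (SOME bs. \<forall>b. count_list bs b = \<alpha> b)"

lemma multi_index_list_exists:
  assumes "\<alpha> \<in> multi_indices k"
  shows "\<exists>bs. \<forall>b. count_list bs b = \<alpha> b"
proof -
  have "finite {b. \<alpha> b > 0}"
    by (rule finite_subset[OF _ finite_Basis]) (use assms in \<open>auto simp: multi_indices_def\<close>)
  moreover obtain bs where "mset bs = Abs_multiset \<alpha>"
    using ex_mset by blast
  ultimately have "\<forall>b. count_list bs b = \<alpha> b"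
    by (metis count_Abs_multiset count_mset)
  then show ?thesis by blast
qed

definition test_functions :: "'a::euclidean_space set \<Rightarrow> ('a \<Rightarrow> complex) set" where
  "test_functions \<Omega> = {\<phi>. smooth_on UNIV \<phi> \<and>
     (\<exists>K. compact K \<and> K \<subseteq> \<Omega> \<and> (\<forall>x. x \<notin> K \<longrightarrow> \<phi> x = 0))}"

definition is_weak_derivative ::
    "'a::euclidean_space set \<Rightarrow> ('a \<Rightarrow> nat) \<Rightarrow> ('a \<Rightarrow> complex) \<Rightarrow> ('a \<Rightarrow> complex) \<Rightarrow> bool" where
  "is_weak_derivative \<Omega> \<alpha> f g \<longleftrightarrow> g \<in> L2 \<Omega> \<and>
     (\<forall>\<phi>\<in>test_functions \<Omega>.
        (LINT x|lebesgue_on \<Omega>. f x * multi_partial \<alpha> \<phi> x) =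
        (-1) ^ (\<Sum>b\<in>Basis. \<alpha> b) * (LINT x|lebesgue_on \<Omega>. g x * \<phi> x))"

text \<open>Weak derivatives are unique up to null sets, so the choice does not affect
  \<open>sobolev_norm\<close>, which is meaningful only on \<open>sobolev_space\<close>.\<close>

definition weak_derivative ::
    "'a::euclidean_space set \<Rightarrow> ('a \<Rightarrow> nat) \<Rightarrow> ('a \<Rightarrow> complex) \<Rightarrow> 'a \<Rightarrow> complex" where
  "weak_derivative \<Omega> \<alpha> f = (SOME g. is_weak_derivative \<Omega> \<alpha> f g)"

definition sobolev_space :: "'a::euclidean_space set \<Rightarrow> nat \<Rightarrow> ('a \<Rightarrow> complex) set" where
  "sobolev_space \<Omega> k = {f \<in> L2 \<Omega>. \<forall>\<alpha>\<in>multi_indices k. \<exists>g. is_weak_derivative \<Omega> \<alpha> f g}"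

definition sobolev_norm :: "'a::euclidean_space set \<Rightarrow> nat \<Rightarrow> ('a \<Rightarrow> complex) \<Rightarrow> real" where
  "sobolev_norm \<Omega> k f = sqrt (\<Sum>\<alpha>\<in>multi_indices k. (L2_norm \<Omega> (weak_derivative \<Omega> \<alpha> f))\<^sup>2)"

section \<open>Holomorphic functions and the Bergman projection\<close>

definition holomorphic_sv :: "(complex ^ 'n) set \<Rightarrow> (complex ^ 'n \<Rightarrow> complex) \<Rightarrow> bool" where
  "holomorphic_sv \<Omega> f \<longleftrightarrow>
     (\<forall>z\<in>\<Omega>. \<exists>D. (f has_derivative D) (at z) \<and> (\<forall>c v. D (c *s v) = c * D v))"

definition conj_holomorphic_sv :: "(complex ^ 'n) set \<Rightarrow> (complex ^ 'n \<Rightarrow> complex) \<Rightarrow> bool" where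
  "conj_holomorphic_sv \<Omega> f \<longleftrightarrow> holomorphic_sv \<Omega> (\<lambda>z. cnj (f z))"

definition bergman_space :: "(complex ^ 'n) set \<Rightarrow> (complex ^ 'n \<Rightarrow> complex) set" where
  "bergman_space \<Omega> = {h \<in> L2 \<Omega>. holomorphic_sv \<Omega> h}"

text \<open>The orthogonal projection onto the Bergman space. The holomorphic representative is determined
  at every point of \<open>\<Omega>\<close>; it is extended by \<open>0\<close> so that \<open>THE\<close> picks a unique function.\<close>

definition bergman_projection ::
    "(complex ^ 'n) set \<Rightarrow> (complex ^ 'n \<Rightarrow> complex) \<Rightarrow> complex ^ 'n \<Rightarrow> complex" where
  "bergman_projection \<Omega> f = (THE h. h \<in> bergman_space \<Omega> \<and> (\<forall>z. z \<notin> \<Omega> \<longrightarrow> h z = 0) \<and>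
     (\<forall>g\<in>bergman_space \<Omega>. L2_inner \<Omega> (\<lambda>z. f z - h z) g = 0))"

definition condition_R :: "(complex ^ 'n) set \<Rightarrow> bool" where
  "condition_R \<Omega> \<longleftrightarrow>
     bergman_projection \<Omega> ` smooth_up_to_boundary \<Omega> \<subseteq> smooth_up_to_boundary \<Omega>"

end

theory Submission
  imports Defs "HOL-Complex_Analysis.Complex_Analysis"
begin

text \<open>
  Let \<open>f\<close> be conjugate holomorphic and \<open>g\<close> holomorphic, both square-integrable. The projection of
  \<open>f\<close> is determined by the inner products of \<open>f\<close> with such functions \<open>g\<close>, that is, by the integrals
  of \<open>F = f * cnj g\<close>. The function \<open>F\<close> is again conjugate holomorphic, so it is annihilated by every
  vector field of type \<open>(1,0)\<close>. Let \<open>w\<close> be a smooth weight that is positive in the domain and vanishes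
  to first order at the boundary, and choose such a field \<open>X\<close> with \<open>X w = 1\<close> up to terms that
  vanish at the boundary. Integration by parts shows that the integral of \<open>F\<close> against the
  divergence of \<open>w * v * X\<close> is zero for every \<open>v\<close> with bounded derivatives. Modulo such
  divergences \<open>w ^ m * \<theta>\<close> may be replaced by \<open>w ^ (m + 1) * \<theta>'\<close>, so by induction \<open>1\<close> may be
  replaced by \<open>w ^ m * \<theta>\<close> for every \<open>m\<close>, with \<open>\<theta>\<close> independent of \<open>F\<close>
  (\<open>integral_vanishing_weight\<close>). Consequently \<open>f\<close> and \<open>f * w ^ m * \<theta>\<close> have the same projection
  (\<open>bergman_projection_vanishing_weight\<close>).

  By the Cauchy estimates, the derivatives of \<open>f\<close> of order at most \<open>k\<close> are bounded by the norm of
  \<open>f\<close> times a fixed negative power of \<open>w\<close> (\<open>symbols_bergman_ball\<close>). For large \<open>m\<close> the function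
  \<open>f * w ^ m * \<theta>\<close> therefore has bounded derivatives of order at most \<open>k\<close>. It need not be smooth up
  to the boundary, but its products with the cutoff functions \<open>exp (- \<epsilon> / w)\<close> are, and they form a
  Cauchy family in \<open>C\<^sup>k\<close>, uniformly for \<open>f\<close> in the unit ball (\<open>cutoff_products\<close>).

  Condition R yields a priori estimates: each derivative of the projection
  is bounded by finitely many derivatives of the given function (\<open>condition_R_estimate\<close>, a closed
  graph theorem). Applied to the cutoff products, these estimates show that each derivative
  of the projection of \<open>f\<close> is the uniform limit of functions that are uniformly continuous, and is
  bounded by a multiple of the norm of \<open>f\<close> (\<open>smoothing_estimate\<close>). This gives smoothness up to the
  boundary, and since the domain is bounded it implies the Sobolev estimates, once weak
  derivatives are identified with classical ones (\<open>multi_index_weak_derivative\<close> and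
  \<open>weak_derivative_norm\<close>).

  The basic properties of the Bergman space (Cauchy estimates, completeness, existence of the
  projection) all follow from one formula, which expresses a holomorphic function locally as its
  convolution with a smooth radial kernel (\<open>holomorphic_reproducing_formula\<close>).
\<close>

section \<open>Calculus of smooth functions\<close>

lemma partials_Nil [simp]: "partials [] f = f"
  by (simp add: partials_def)

lemma partials_Cons: "partials (b # bs) f = partial b (partials bs f)"
  by (simp add: partials_def)

lemma partials_snoc: "partials (bs @ [b]) f = partials bs (partial b f)"
  by (simp add: partials_def)

lemma partials_append: "partials (bs @ cs) f = partials bs (partials cs f)"
  by (simp add: partials_def)

lemma partial_eqI: "(f has_derivative D) (at x) \<Longrightarrow> partial b f x = D b"
  unfolding partial_def using frechet_derivative_at by metis

lemma partials_zero: "partials bs (\<lambda>x. 0) = (\<lambda>x. 0 :: 'b::real_normed_vector)"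
proof (induction bs)
  case (Cons b bs)
  have "partial b (\<lambda>x. 0 :: 'b) = (\<lambda>x. 0)" by (rule ext) (rule partial_eqI[OF has_derivative_const])
  then show ?case by (simp add: partials_Cons Cons)
qed simp

lemma has_derivative_cong_open:
  assumes "open S" "x \<in> S" "\<And>y. y \<in> S \<Longrightarrow> f y = g y"
  shows "(f has_derivative D) (at x) \<longleftrightarrow> (g has_derivative D) (at x)"
  using assms has_derivative_transform_within_open[of f D x UNIV S g]
    has_derivative_transform_within_open[of g D x UNIV S f] by auto

lemma partial_cong:
  assumes "open S" "x \<in> S" "\<And>y. y \<in> S \<Longrightarrow> f y = g y"
  shows "partial b f x = partial b g x"
  unfolding partial_def frechet_derivative_def
  using has_derivative_cong_open[OF assms] by simp

lemma differentiable_cong_open: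
  assumes "open S" "x \<in> S" "\<And>y. y \<in> S \<Longrightarrow> f y = g y"
  shows "f differentiable (at x) \<longleftrightarrow> g differentiable (at x)"
  unfolding differentiable_def using has_derivative_cong_open[OF assms] by simp

lemma partials_cong:
  assumes "open S" "x \<in> S" "\<And>y. y \<in> S \<Longrightarrow> f y = g y"
  shows "partials bs f x = partials bs g x"
  using assms(2)
proof (induction bs arbitrary: x)
  case Nil
  then show ?case using assms(3) by simp
next
  case (Cons b bs)
  show ?case unfolding partials_Cons
    using partial_cong[OF assms(1) Cons.prems] Cons.IH by blast
qed

lemma smooth_on_cong:
  assumes "open S" "\<And>y. y \<in> S \<Longrightarrow> f y = g y"
  shows "smooth_on S f \<longleftrightarrow> smooth_on S g"
proof -
  have "partials bs f differentiable (at x) \<longleftrightarrow> partials bs g differentiable (at x)"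
    if "x \<in> S" for bs x
    by (rule differentiable_cong_open[OF assms(1) that partials_cong[OF assms(1) _ assms(2)]])
  then show ?thesis
    unfolding smooth_on_def by blast
qed

lemma smooth_on_differentiable: "smooth_on S f \<Longrightarrow> x \<in> S \<Longrightarrow> f differentiable (at x)"
  unfolding smooth_on_def by (metis empty_set empty_subsetI partials_Nil)

lemma smooth_on_partials:
  assumes "smooth_on S f" "set bs \<subseteq> Basis"
  shows "smooth_on S (partials bs f)"
  using assms unfolding smooth_on_def partials_append[symmetric] by simp

lemma smooth_on_partial:
  "smooth_on S f \<Longrightarrow> b \<in> Basis \<Longrightarrow> smooth_on S (partial b f)"
  using smooth_on_partials[of S f "[b]"] by (simp add: partials_Cons)

lemma smooth_on_subset: "smooth_on S f \<Longrightarrow> T \<subseteq> S \<Longrightarrow> smooth_on T f"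
  unfolding smooth_on_def by blast

lemma smooth_on_local:
  assumes "\<And>x. x \<in> S \<Longrightarrow> \<exists>T. x \<in> T \<and> smooth_on T f"
  shows "smooth_on S f"
  using assms unfolding smooth_on_def by blast

lemma smooth_on_continuous: "smooth_on S f \<Longrightarrow> continuous_on S f"
  by (meson continuous_at_imp_continuous_on differentiable_imp_continuous_within
      smooth_on_differentiable)

lemma smooth_on_partials_continuous:
  "smooth_on S f \<Longrightarrow> set bs \<subseteq> Basis \<Longrightarrow> continuous_on S (partials bs f)"
  using smooth_on_continuous smooth_on_partials by blast

lemma has_derivative_partial:
  fixes f :: "'a::euclidean_space \<Rightarrow> 'b::real_normed_vector"
  assumes "f differentiable (at x)"
  shows "(f has_derivative (\<lambda>h. \<Sum>b\<in>Basis. (h \<bullet> b) *\<^sub>R partial b f x)) (at x)"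
proof -
  let ?D = "frechet_derivative f (at x)"
  have d: "(f has_derivative ?D) (at x)"
    using assms frechet_derivative_works by blast
  then have lin: "linear ?D"
    by (rule has_derivative_linear)
  have "?D h = (\<Sum>b\<in>Basis. (h \<bullet> b) *\<^sub>R partial b f x)" for h
    by (subst (1) euclidean_representation[of h, symmetric], subst linear_sum[OF lin])
       (simp add: linear_cmul[OF lin] partial_def)
  then show ?thesis using d by presburger
qed

lemma smooth_on_has_derivative:
  assumes "smooth_on S f" "x \<in> S"
  shows "(f has_derivative (\<lambda>h. \<Sum>b\<in>Basis. (h \<bullet> b) *\<^sub>R partial b f x)) (at x)"
  using assms smooth_on_differentiable has_derivative_partial by blast

lemma partial_expand:
  assumes "f differentiable (at x)"
  shows "partial v f x = (\<Sum>b\<in>Basis. (v \<bullet> b) *\<^sub>R partial b f x)"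
  using partial_eqI[OF has_derivative_partial[OF assms]] .

text \<open>Smoothness is a greatest fixed point: a class of differentiable functions that is stable
  under partial derivatives consists of smooth functions.\<close>

lemma smooth_on_coinduct:
  assumes "open S" "f \<in> F"
    and "\<And>g x. g \<in> F \<Longrightarrow> x \<in> S \<Longrightarrow> g differentiable (at x)"
    and "\<And>g b. g \<in> F \<Longrightarrow> b \<in> Basis \<Longrightarrow> \<exists>h\<in>F. \<forall>x\<in>S. partial b g x = h x"
  shows "smooth_on S f"
proof -
  have "\<exists>h\<in>F. \<forall>x\<in>S. partials bs f x = h x" if "set bs \<subseteq> Basis" for bs
    using that
  proof (induction bs)
    case Nil
    then show ?case using assms(2) by auto
  next
    case (Cons b bs)
    then obtain h where h: "h \<in> F" "\<forall>x\<in>S. partials bs f x = h x" by auto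
    obtain k where k: "k \<in> F" "\<forall>x\<in>S. partial b h x = k x"
      using assms(4)[OF h(1), of b] Cons.prems by auto
    have "partials (b # bs) f x = k x" if "x \<in> S" for x
      unfolding partials_Cons using partial_cong[OF assms(1) that] h(2) k(2) that by metis
    then show ?case using k(1) by blast
  qed
  then show ?thesis
    unfolding smooth_on_def using assms(3) differentiable_cong_open[OF assms(1)] by metis
qed

inductive_set smooth_ring ::
    "'a::euclidean_space set \<Rightarrow> ('a \<Rightarrow> 'b::real_normed_algebra) set \<Rightarrow> ('a \<Rightarrow> 'b) set"
  for S F where
  gen: "f \<in> F \<Longrightarrow> f \<in> smooth_ring S F"
| smooth: "smooth_on S f \<Longrightarrow> f \<in> smooth_ring S F"
| add: "f \<in> smooth_ring S F \<Longrightarrow> g \<in> smooth_ring S F \<Longrightarrow> (\<lambda>x. f x + g x) \<in> smooth_ring S F"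
| mult: "f \<in> smooth_ring S F \<Longrightarrow> g \<in> smooth_ring S F \<Longrightarrow> (\<lambda>x. f x * g x) \<in> smooth_ring S F"

lemma partial_add:
  assumes "f differentiable (at x)" "g differentiable (at x)"
  shows "partial b (\<lambda>x. f x + g x) x = partial b f x + partial b g x"
  unfolding partial_def[of b f] partial_def[of b g]
  by (rule partial_eqI[OF has_derivative_add])
     (use assms frechet_derivative_works in blast)+

lemma partial_mult:
  fixes f g :: "'a::euclidean_space \<Rightarrow> 'b::real_normed_algebra"
  assumes "f differentiable (at x)" "g differentiable (at x)"
  shows "partial b (\<lambda>x. f x * g x) x = partial b f x * g x + f x * partial b g x"
proof -
  have "((\<lambda>x. f x * g x) has_derivative (\<lambda>h. f x * frechet_derivative g (at x) h
      + frechet_derivative f (at x) h * g x)) (at x)"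
    by (rule has_derivative_mult) (use assms frechet_derivative_works in blast)+
  from partial_eqI[OF this] show ?thesis by (simp add: partial_def)
qed

text \<open>The derivatives of the generators only need to be polynomials in the generators with smooth
  coefficients. This yields stability of smoothness under products, reciprocals, and
  compositions with solutions of differential equations.\<close>

lemma smooth_on_coinduct_ring:
  fixes f :: "'a::euclidean_space \<Rightarrow> 'b::real_normed_algebra"
  assumes "open S" "f \<in> smooth_ring S F"
    and "\<And>g x. g \<in> F \<Longrightarrow> x \<in> S \<Longrightarrow> g differentiable (at x)"
    and "\<And>g b. g \<in> F \<Longrightarrow> b \<in> Basis \<Longrightarrow> \<exists>h\<in>smooth_ring S F. \<forall>x\<in>S. partial b g x = h x"
  shows "smooth_on S f"
proof (rule smooth_on_coinduct[where F="smooth_ring S F", OF assms(1,2)])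
  show dif: "g differentiable (at x)" if "g \<in> smooth_ring S F" "x \<in> S" for g x
    using that
    by (induction) (auto intro: assms(3) smooth_on_differentiable differentiable_add
        differentiable_mult)
  show "\<exists>h\<in>smooth_ring S F. \<forall>x\<in>S. partial b g x = h x"
    if "g \<in> smooth_ring S F" "b \<in> Basis" for g b
    using that(1)
  proof induction
    case (gen f)
    then show ?case using assms(4) that(2) by blast
  next
    case (smooth f)
    then show ?case using smooth_on_partial[OF _ that(2)] smooth_ring.smooth by blast
  next
    case (add f g)
    then obtain h k where "h \<in> smooth_ring S F" "\<forall>x\<in>S. partial b f x = h x"
      "k \<in> smooth_ring S F" "\<forall>x\<in>S. partial b g x = k x" by blast
    then show ?case using add dif
      by (intro bexI[of _ "\<lambda>x. h x + k x"]) (auto simp: partial_add intro: smooth_ring.add)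
  next
    case (mult f g)
    then obtain h k where "h \<in> smooth_ring S F" "\<forall>x\<in>S. partial b f x = h x"
      "k \<in> smooth_ring S F" "\<forall>x\<in>S. partial b g x = k x" by blast
    then show ?case using mult dif
      by (intro bexI[of _ "\<lambda>x. h x * g x + f x * k x"])
         (auto simp: partial_mult intro: smooth_ring.add smooth_ring.mult)
  qed
qed

lemma smooth_on_mult:
  fixes f g :: "'a::euclidean_space \<Rightarrow> 'b::real_normed_algebra"
  assumes "open S" "smooth_on S f" "smooth_on S g"
  shows "smooth_on S (\<lambda>x. f x * g x)"
  by (rule smooth_on_coinduct_ring[where F="{}"])
     (use assms in \<open>auto intro: smooth_ring.intros\<close>)

lemma smooth_on_const: "smooth_on S (\<lambda>x. c)"
proof (rule smooth_on_subset[of UNIV])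
  show "smooth_on UNIV (\<lambda>x::'a. c)"
  proof (rule smooth_on_coinduct[where F="range (\<lambda>c x. c)"])
    fix g :: "'a \<Rightarrow> 'b" and b :: 'a assume "g \<in> range (\<lambda>c x. c)"
    then show "\<exists>h\<in>range (\<lambda>c x. c). \<forall>x\<in>UNIV. partial b g x = h x"
      by (intro bexI[of _ "\<lambda>x. 0"]) (auto intro!: partial_eqI has_derivative_const)
  qed auto
qed auto

lemma partial_bounded_linear:
  assumes "bounded_linear L" "f differentiable (at x)"
  shows "partial b (\<lambda>x. L (f x)) x = L (partial b f x)"
  unfolding partial_def[of b f]
  by (rule partial_eqI[OF bounded_linear.has_derivative[OF assms(1)]])
     (use assms frechet_derivative_works in blast)

lemma smooth_on_compose_bounded_linear:
  assumes "open S" "bounded_linear L" "smooth_on S f"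
  shows "smooth_on S (\<lambda>x. L (f x))"
proof (rule smooth_on_coinduct[where F="{\<lambda>x. L (g x) | g. smooth_on S g}", OF assms(1)])
  fix g :: "'a \<Rightarrow> 'c" and x assume "g \<in> {\<lambda>x. L (g x) | g. smooth_on S g}" "x \<in> S"
  then obtain k where k: "g = (\<lambda>x. L (k x))" "k differentiable (at x)"
    using smooth_on_differentiable by blast
  show "g differentiable (at x)"
    unfolding k(1) using bounded_linear.has_derivative[OF assms(2)] k(2)
    unfolding differentiable_def by blast
next
  fix g :: "'a \<Rightarrow> 'c" and b :: 'a
  assume "g \<in> {\<lambda>x. L (g x) | g. smooth_on S g}" "b \<in> Basis"
  then obtain k where k: "g = (\<lambda>x. L (k x))" "smooth_on S k" by blast
  show "\<exists>h\<in>{\<lambda>x. L (g x) | g. smooth_on S g}. \<forall>x\<in>S. partial b g x = h x"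
    by (intro bexI[of _ "\<lambda>x. L (partial b k x)"])
       (use k \<open>b \<in> Basis\<close> smooth_on_differentiable[OF k(2)] in
         \<open>auto simp: partial_bounded_linear[OF assms(2)] intro: smooth_on_partial\<close>)
qed (use assms in auto)

lemma partials_bounded_linear:
  assumes "open S" "bounded_linear L" "smooth_on S f" "x \<in> S" "set bs \<subseteq> Basis"
  shows "partials bs (\<lambda>x. L (f x)) x = L (partials bs f x)"
  using assms(4,5)
proof (induction bs arbitrary: x)
  case (Cons b bs)
  have "partials (b # bs) (\<lambda>x. L (f x)) x = partial b (\<lambda>x. L (partials bs f x)) x"
    unfolding partials_Cons
    by (rule partial_cong[OF assms(1) Cons.prems(1)]) (use Cons in auto)
  also have "\<dots> = L (partials (b # bs) f x)"
    unfolding partials_Cons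
    by (rule partial_bounded_linear[OF assms(2)])
       (use Cons smooth_on_differentiable[OF smooth_on_partials[OF assms(3)]] in auto)
  finally show ?case .
qed simp

lemma smooth_on_add:
  assumes "open S" "smooth_on S f" "smooth_on S g"
  shows "smooth_on S (\<lambda>x. f x + g x)"
proof (rule smooth_on_coinduct[where F="{\<lambda>x. f x + g x | f g. smooth_on S f \<and> smooth_on S g}", OF assms(1)])
  fix h :: "'a \<Rightarrow> 'b" and b :: 'a
  assume "h \<in> {\<lambda>x. f x + g x | f g. smooth_on S f \<and> smooth_on S g}" "b \<in> Basis"
  then obtain f g where k: "h = (\<lambda>x. f x + g x)" "smooth_on S f" "smooth_on S g" by blast
  show "\<exists>h'\<in>{\<lambda>x. f x + g x | f g. smooth_on S f \<and> smooth_on S g}. \<forall>x\<in>S. partial b h x = h' x"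
    by (intro bexI[of _ "\<lambda>x. partial b f x + partial b g x"])
       (use k \<open>b \<in> Basis\<close> in
         \<open>auto simp: partial_add smooth_on_differentiable intro: smooth_on_partial\<close>)
qed (use assms in \<open>auto intro: differentiable_add smooth_on_differentiable\<close>)

lemma partials_add:
  assumes "open S" "smooth_on S f" "smooth_on S g" "x \<in> S" "set bs \<subseteq> Basis"
  shows "partials bs (\<lambda>x. f x + g x) x = partials bs f x + partials bs g x"
  using assms(4,5)
proof (induction bs arbitrary: x)
  case (Cons b bs)
  have "partials (b # bs) (\<lambda>x. f x + g x) x = partial b (\<lambda>x. partials bs f x + partials bs g x) x"
    unfolding partials_Cons
    by (rule partial_cong[OF assms(1) Cons.prems(1)]) (use Cons in auto)
  also have "\<dots> = partials (b # bs) f x + partials (b # bs) g x"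
    unfolding partials_Cons
    by (rule partial_add)
       (use Cons.prems in \<open>auto intro!: smooth_on_differentiable smooth_on_partials assms\<close>)
  finally show ?case .
qed simp

lemma smooth_on_minus: "open S \<Longrightarrow> smooth_on S f \<Longrightarrow> smooth_on S (\<lambda>x. - f x)"
  using smooth_on_compose_bounded_linear[OF _ bounded_linear_minus[OF bounded_linear_ident]] by blast

lemma smooth_on_diff:
  "open S \<Longrightarrow> smooth_on S f \<Longrightarrow> smooth_on S g \<Longrightarrow> smooth_on S (\<lambda>x. f x - g x)"
  using smooth_on_add[of S f "\<lambda>x. - g x"] smooth_on_minus by auto

lemma partials_diff:
  assumes "open S" "smooth_on S f" "smooth_on S g" "x \<in> S" "set bs \<subseteq> Basis"
  shows "partials bs (\<lambda>x. f x - g x) x = partials bs f x - partials bs g x"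
  using partials_add[OF assms(1,2) smooth_on_minus[OF assms(1,3)] assms(4,5)]
    partials_bounded_linear[OF assms(1) bounded_linear_minus[OF bounded_linear_ident] assms(3-5)]
  by simp

lemma smooth_on_sum:
  assumes "open S" "\<And>i. i \<in> I \<Longrightarrow> smooth_on S (f i)"
  shows "smooth_on S (\<lambda>x. \<Sum>i\<in>I. f i x)"
  using assms(2)
proof (induction I rule: infinite_finite_induct)
  case (insert i I)
  then show ?case using smooth_on_add[OF assms(1), of "f i"] by auto
qed (auto simp: smooth_on_const)

lemma smooth_on_prod:
  fixes f :: "_ \<Rightarrow> _ \<Rightarrow> 'b::real_normed_field"
  assumes "open S" "\<And>i. i \<in> I \<Longrightarrow> smooth_on S (f i)"
  shows "smooth_on S (\<lambda>x. \<Prod>i\<in>I. f i x)"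
  using assms(2)
proof (induction I rule: infinite_finite_induct)
  case (insert i I)
  then show ?case using smooth_on_mult[OF assms(1), of "f i"] by auto
qed (auto simp: smooth_on_const)

lemma smooth_on_power:
  fixes f :: "_ \<Rightarrow> 'b::real_normed_field"
  assumes "open S" "smooth_on S f"
  shows "smooth_on S (\<lambda>x. f x ^ n)"
  using smooth_on_prod[OF assms(1), of "{..<n}" "\<lambda>_. f"] assms(2) by simp

lemma partial_inverse:
  fixes f :: "'a::euclidean_space \<Rightarrow> 'b::real_normed_field"
  assumes "f differentiable (at x)" "f x \<noteq> 0"
  shows "partial b (\<lambda>x. inverse (f x)) x = - (inverse (f x) * partial b f x * inverse (f x))"
proof -
  have "(f has_derivative frechet_derivative f (at x)) (at x)"
    using assms frechet_derivative_works by blast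
  from partial_eqI[OF Deriv.has_derivative_inverse[of f x, OF assms(2) this]]
  show ?thesis by (simp add: partial_def)
qed

lemma smooth_on_inverse:
  fixes f :: "'a::euclidean_space \<Rightarrow> 'b::real_normed_field"
  assumes "open S" "smooth_on S f" "\<And>x. x \<in> S \<Longrightarrow> f x \<noteq> 0"
  shows "smooth_on S (\<lambda>x. inverse (f x))"
proof (rule smooth_on_coinduct_ring[where F="{\<lambda>x. inverse (f x)}", OF assms(1)])
  let ?R = "smooth_ring S {\<lambda>x. inverse (f x)}"
  show i: "(\<lambda>x. inverse (f x)) \<in> ?R" by (auto intro: smooth_ring.gen)
  fix g b assume g: "g \<in> {\<lambda>x. inverse (f x)}" and b: "b \<in> (Basis :: 'a set)"
  have "(\<lambda>x. inverse (f x) * inverse (f x) * (- partial b f x)) \<in> ?R"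
    by (intro smooth_ring.mult i smooth_ring.smooth smooth_on_minus smooth_on_partial assms b)
  then show "\<exists>h\<in>?R. \<forall>x\<in>S. partial b g x = h x"
    by (rule bexI[rotated])
       (use g assms in \<open>auto simp: partial_inverse smooth_on_differentiable\<close>)
qed (use assms smooth_on_differentiable in \<open>auto intro!: differentiable_inverse\<close>)

lemma smooth_on_bounded_linear:
  assumes "bounded_linear L"
  shows "smooth_on UNIV L"
proof (rule smooth_on_coinduct[where F="insert L (range (\<lambda>c x. c))"])
  show "\<exists>h\<in>insert L (range (\<lambda>c x. c)). \<forall>x\<in>UNIV. partial b g x = h x"
    if "g \<in> insert L (range (\<lambda>c x. c))" for g b
  proof (cases "g = L")
    case True
    then show ?thesis
      by (intro bexI[of _ "\<lambda>x. L b"])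
         (auto intro!: partial_eqI bounded_linear_imp_has_derivative assms)
  next
    case False
    then show ?thesis using that
      by (intro bexI[of _ "\<lambda>x. 0"]) (auto intro!: partial_eqI has_derivative_const)
  qed
qed (use assms bounded_linear_imp_differentiable in auto)

lemma partial_affine:
  fixes f :: "'a::euclidean_space \<Rightarrow> 'b::real_normed_vector"
  assumes "f differentiable (at (a + c *\<^sub>R x))"
  shows "partial b (\<lambda>x. f (a + c *\<^sub>R x)) x = c *\<^sub>R partial b f (a + c *\<^sub>R x)"
proof -
  let ?D = "frechet_derivative f (at (a + c *\<^sub>R x))"
  have d: "(f has_derivative ?D) (at (a + c *\<^sub>R x))"
    using assms frechet_derivative_works by blast
  have "((\<lambda>x. f (a + c *\<^sub>R x)) has_derivative (\<lambda>h. ?D (c *\<^sub>R h))) (at x)"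
    by (rule has_derivative_compose[where f="\<lambda>x. a + c *\<^sub>R x" and g=f, OF _ d])
       (auto intro!: derivative_eq_intros)
  from partial_eqI[OF this] show ?thesis
    using linear_cmul[OF has_derivative_linear[OF d]] by (simp add: partial_def)
qed

lemma differentiable_affine:
  fixes f :: "'a::euclidean_space \<Rightarrow> 'b::real_normed_vector"
  assumes "f differentiable (at (a + c *\<^sub>R x))"
  shows "(\<lambda>x. f (a + c *\<^sub>R x)) differentiable (at x)"
  using assms by (intro differentiable_compose[of f "\<lambda>x. a + c *\<^sub>R x"])
    (auto intro!: derivative_intros)

lemma partials_affine_UNIV:
  fixes f :: "'a::euclidean_space \<Rightarrow> 'b::real_normed_vector"
  assumes "smooth_on UNIV f" "set bs \<subseteq> Basis"
  shows "partials bs (\<lambda>x. f (a + c *\<^sub>R x)) = (\<lambda>x. c ^ length bs *\<^sub>R partials bs f (a + c *\<^sub>R x))"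
  using assms(2)
proof (induction bs)
  case (Cons b bs)
  have d: "partials bs f differentiable (at y)" for y
    using smooth_on_differentiable[OF smooth_on_partials[OF assms(1)]] Cons.prems by auto
  have "partials (b # bs) (\<lambda>x. f (a + c *\<^sub>R x)) x = c ^ length (b # bs) *\<^sub>R partials (b # bs) f (a + c *\<^sub>R x)" for x
    using Cons partial_bounded_linear[OF bounded_linear_scaleR_right differentiable_affine[OF d], where x=x and b=b]
    by (simp add: partials_Cons partial_affine[OF d])
  then show ?case by blast
qed simp

lemma smooth_on_affine_UNIV:
  fixes f :: "'a::euclidean_space \<Rightarrow> 'b::real_normed_vector"
  assumes "smooth_on UNIV f"
  shows "smooth_on UNIV (\<lambda>x. f (a + c *\<^sub>R x))"
  unfolding smooth_on_def
proof (intro allI impI ballI)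
  fix bs :: "'a list" and x :: 'a assume bs: "set bs \<subseteq> Basis"
  have "partials bs f differentiable (at y)" for y
    using smooth_on_differentiable[OF smooth_on_partials[OF assms bs]] by auto
  then have "(\<lambda>x. partials bs f (a + c *\<^sub>R x)) differentiable (at x)"
    using differentiable_affine by blast
  then show "partials bs (\<lambda>x. f (a + c *\<^sub>R x)) differentiable (at x)"
    unfolding partials_affine_UNIV[OF assms bs] by simp
qed

section \<open>Weighted symbol classes\<close>

text \<open>A set of functions is bounded in the symbol class of order \<open>m\<close> if each differentiation costs
  at most one power of the weight \<open>w\<close>, with constants that are uniform over the set. Only the
  derivatives of order at most \<open>N\<close> are controlled, which allows induction on \<open>N\<close>.\<close>

definition symbols :: "'a::euclidean_space set \<Rightarrow> ('a \<Rightarrow> real) \<Rightarrow> nat \<Rightarrow> real \<Rightarrow> ('a \<Rightarrow> complex) set \<Rightarrow> bool"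
  where "symbols \<Omega> w N m G \<longleftrightarrow> (\<forall>g\<in>G. smooth_on \<Omega> g) \<and>
    (\<exists>C. \<forall>g\<in>G. \<forall>bs. set bs \<subseteq> Basis \<and> length bs \<le> N \<longrightarrow>
       (\<forall>x\<in>\<Omega>. cmod (partials bs g x) \<le> C * w x powr (m - real (length bs))))"

lemma symbolsE:
  assumes "symbols \<Omega> w N m G"
  obtains C where "C \<ge> 0" "\<And>g bs x. g \<in> G \<Longrightarrow> set bs \<subseteq> Basis \<Longrightarrow> length bs \<le> N \<Longrightarrow> x \<in> \<Omega> \<Longrightarrow>
    cmod (partials bs g x) \<le> C * w x powr (m - real (length bs))"
proof -
  obtain C where C: "\<forall>g\<in>G. \<forall>bs. set bs \<subseteq> Basis \<and> length bs \<le> N \<longrightarrow>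
       (\<forall>x\<in>\<Omega>. cmod (partials bs g x) \<le> C * w x powr (m - real (length bs)))"
    using assms unfolding symbols_def by blast
  have "cmod (partials bs g x) \<le> max C 0 * w x powr (m - real (length bs))"
    if "g \<in> G" "set bs \<subseteq> Basis" "length bs \<le> N" "x \<in> \<Omega>" for g bs x
  proof -
    have "cmod (partials bs g x) \<le> C * w x powr (m - real (length bs))"
      using C that by blast
    also have "\<dots> \<le> max C 0 * w x powr (m - real (length bs))"
      by (intro mult_right_mono) auto
    finally show ?thesis .
  qed
  then show ?thesis using that[of "max C 0"] by auto
qed

lemma symbols_smooth: "symbols \<Omega> w N m G \<Longrightarrow> g \<in> G \<Longrightarrow> smooth_on \<Omega> g"
  unfolding symbols_def by blast

lemma symbols_mono_order: "symbols \<Omega> w N m G \<Longrightarrow> M \<le> N \<Longrightarrow> symbols \<Omega> w M m G"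
  unfolding symbols_def by (meson order_trans)

lemma symbols_cong:
  assumes "open \<Omega>" "symbols \<Omega> w N m G" "\<And>h. h \<in> H \<Longrightarrow> \<exists>g\<in>G. \<forall>x\<in>\<Omega>. g x = h x"
  shows "symbols \<Omega> w N m H"
proof -
  obtain C where C: "\<And>g bs x. g \<in> G \<Longrightarrow> set bs \<subseteq> Basis \<Longrightarrow> length bs \<le> N \<Longrightarrow> x \<in> \<Omega> \<Longrightarrow>
    cmod (partials bs g x) \<le> C * w x powr (m - real (length bs))"
    using symbolsE[OF assms(2)] by metis
  show ?thesis unfolding symbols_def
  proof (intro conjI ballI exI[of _ C] allI impI)
    fix h assume h: "h \<in> H"
    then obtain g where g: "g \<in> G" "\<And>x. x \<in> \<Omega> \<Longrightarrow> g x = h x" using assms(3) by blast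
    show "smooth_on \<Omega> h"
      using smooth_on_cong[of \<Omega> g h, OF assms(1) g(2)] symbols_smooth[OF assms(2) g(1)] by blast
    show "cmod (partials bs h x) \<le> C * w x powr (m - real (length bs))"
      if "set bs \<subseteq> Basis \<and> length bs \<le> N" "x \<in> \<Omega>" for bs x
      using C[OF g(1), of bs x] that partials_cong[of \<Omega> x g h bs, OF assms(1) that(2) g(2)] by simp
  qed
qed

lemma symbols_0:
  assumes "\<And>g. g \<in> G \<Longrightarrow> smooth_on \<Omega> g"
    "\<And>g x. g \<in> G \<Longrightarrow> x \<in> \<Omega> \<Longrightarrow> cmod (g x) \<le> C * w x powr m"
  shows "symbols \<Omega> w 0 m G"
  unfolding symbols_def using assms by (intro conjI ballI exI[of _ C]) auto

lemma symbols_Suc: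
  assumes "symbols \<Omega> w 0 m G" "\<And>b. b \<in> Basis \<Longrightarrow> symbols \<Omega> w N (m - 1) (partial b ` G)"
  shows "symbols \<Omega> w (Suc N) m G"
proof -
  obtain C0 where C0: "C0 \<ge> 0" "\<And>g bs x. g \<in> G \<Longrightarrow> set bs \<subseteq> Basis \<Longrightarrow> length bs \<le> 0 \<Longrightarrow> x \<in> \<Omega> \<Longrightarrow>
    cmod (partials bs g x) \<le> C0 * w x powr (m - real (length bs))"
    using symbolsE[OF assms(1)] by blast
  have "\<forall>b\<in>Basis. \<exists>C\<ge>0. \<forall>g\<in>G. \<forall>bs. set bs \<subseteq> Basis \<and> length bs \<le> N \<longrightarrow>
       (\<forall>x\<in>\<Omega>. cmod (partials bs (partial b g) x) \<le> C * w x powr (m - 1 - real (length bs)))"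
    using symbolsE[OF assms(2)] by (metis imageI)
  then obtain C where C: "\<And>b. b \<in> Basis \<Longrightarrow> C b \<ge> 0" "\<And>b g bs x. b \<in> Basis \<Longrightarrow> g \<in> G \<Longrightarrow>
     set bs \<subseteq> Basis \<Longrightarrow> length bs \<le> N \<Longrightarrow> x \<in> \<Omega> \<Longrightarrow>
     cmod (partials bs (partial b g) x) \<le> C b * w x powr (m - 1 - real (length bs))"
    by metis
  show ?thesis unfolding symbols_def
  proof (intro conjI ballI exI[of _ "C0 + sum C Basis"] allI impI)
    fix g assume g: "g \<in> G"
    show "smooth_on \<Omega> g" using assms(1) g symbols_smooth by blast
    fix bs :: "'a list" and x assume bs: "set bs \<subseteq> Basis \<and> length bs \<le> Suc N" and x: "x \<in> \<Omega>"
    show "cmod (partials bs g x) \<le> (C0 + sum C Basis) * w x powr (m - real (length bs))"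
    proof (cases bs rule: rev_cases)
      case Nil
      have "cmod (partials bs g x) \<le> C0 * w x powr (m - real (length bs))"
        using C0(2)[OF g, of "[]" x] Nil x by simp
      also have "\<dots> \<le> (C0 + sum C Basis) * w x powr (m - real (length bs))"
        by (intro mult_right_mono) (auto intro: sum_nonneg C)
      finally show ?thesis .
    next
      case (snoc cs b)
      then have b: "b \<in> Basis" and cs: "set cs \<subseteq> Basis" "length cs \<le> N" using bs by auto
      have "cmod (partials bs g x) \<le> C b * w x powr (m - 1 - real (length cs))"
        unfolding snoc partials_snoc by (rule C(2)[OF b g cs x])
      also have "\<dots> = C b * w x powr (m - real (length bs))"
        using snoc by (simp add: algebra_simps)
      also have "\<dots> \<le> (C0 + sum C Basis) * w x powr (m - real (length bs))"
        using member_le_sum[OF b, of C] C C0(1) by (intro mult_right_mono) auto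
      finally show ?thesis .
    qed
  qed
qed

lemma symbols_partial:
  assumes "symbols \<Omega> w (Suc N) m G" "b \<in> Basis"
  shows "symbols \<Omega> w N (m - 1) (partial b ` G)"
proof -
  obtain C where C: "\<And>g bs x. g \<in> G \<Longrightarrow> set bs \<subseteq> Basis \<Longrightarrow> length bs \<le> Suc N \<Longrightarrow> x \<in> \<Omega> \<Longrightarrow>
    cmod (partials bs g x) \<le> C * w x powr (m - real (length bs))"
    using symbolsE[OF assms(1)] by metis
  have "cmod (partials bs (partial b g) x) \<le> C * w x powr (m - 1 - real (length bs))"
    if "g \<in> G" "set bs \<subseteq> Basis" "length bs \<le> N" "x \<in> \<Omega>" for g bs x
    using C[OF that(1), of "bs @ [b]" x] that assms(2) by (simp add: partials_snoc algebra_simps)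
  then show ?thesis
    unfolding symbols_def
    using smooth_on_partial[OF symbols_smooth[OF assms(1)] assms(2)]
    by (intro conjI exI[of _ C]) auto
qed

lemma symbols_add:
  assumes "open \<Omega>" "symbols \<Omega> w N m G" "symbols \<Omega> w N m H"
  shows "symbols \<Omega> w N m {\<lambda>x. g x + h x | g h. g \<in> G \<and> h \<in> H}"
proof -
  obtain C where C: "\<And>g bs x. g \<in> G \<Longrightarrow> set bs \<subseteq> Basis \<Longrightarrow> length bs \<le> N \<Longrightarrow> x \<in> \<Omega> \<Longrightarrow>
    cmod (partials bs g x) \<le> C * w x powr (m - real (length bs))"
    using symbolsE[OF assms(2)] by metis
  obtain D where D: "\<And>g bs x. g \<in> H \<Longrightarrow> set bs \<subseteq> Basis \<Longrightarrow> length bs \<le> N \<Longrightarrow> x \<in> \<Omega> \<Longrightarrow>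
    cmod (partials bs g x) \<le> D * w x powr (m - real (length bs))"
    using symbolsE[OF assms(3)] by metis
  have "cmod (partials bs (\<lambda>x. g x + h x) x) \<le> (C + D) * w x powr (m - real (length bs))"
    if "g \<in> G" "h \<in> H" "set bs \<subseteq> Basis" "length bs \<le> N" "x \<in> \<Omega>" for g h bs x
    using C[OF that(1,3-5)] D[OF that(2-5)]
      partials_add[OF assms(1) symbols_smooth[OF assms(2) that(1)] symbols_smooth[OF assms(3) that(2)] that(5,3)]
      norm_triangle_ineq[of "partials bs g x" "partials bs h x"]
    by (simp add: distrib_right)
  then show ?thesis
    unfolding symbols_def
    using smooth_on_add[OF assms(1) symbols_smooth[OF assms(2)] symbols_smooth[OF assms(3)]]
    by (intro conjI exI[of _ "C + D"]) auto
qed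

lemma sum_memI: "u \<in> A \<Longrightarrow> v \<in> B \<Longrightarrow> (\<lambda>x. u x + v x) \<in> {\<lambda>x. g x + h x | g h. g \<in> A \<and> h \<in> B}"
  by blast

lemma symbols_mult:
  assumes "open \<Omega>" "\<And>x. x \<in> \<Omega> \<Longrightarrow> w x > 0" "symbols \<Omega> w N m G" "symbols \<Omega> w N n H"
  shows "symbols \<Omega> w N (m + n) {\<lambda>x. g x * h x | g h. g \<in> G \<and> h \<in> H}"
  using assms(3,4)
proof (induction N arbitrary: m n G H)
  case 0
  obtain C where C: "C \<ge> 0" "\<And>g bs x. g \<in> G \<Longrightarrow> set bs \<subseteq> Basis \<Longrightarrow> length bs \<le> 0 \<Longrightarrow> x \<in> \<Omega> \<Longrightarrow>
    cmod (partials bs g x) \<le> C * w x powr (m - real (length bs))"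
    using symbolsE[OF 0(1)] by blast
  obtain D where D: "D \<ge> 0" "\<And>g bs x. g \<in> H \<Longrightarrow> set bs \<subseteq> Basis \<Longrightarrow> length bs \<le> 0 \<Longrightarrow> x \<in> \<Omega> \<Longrightarrow>
    cmod (partials bs g x) \<le> D * w x powr (n - real (length bs))"
    using symbolsE[OF 0(2)] by blast
  have "cmod (g x * h x) \<le> (C * D) * w x powr (m + n)" if "g \<in> G" "h \<in> H" "x \<in> \<Omega>" for g h x
    using mult_mono[OF C(2)[OF that(1), of "[]" x] D(2)[OF that(2), of "[]" x]] that(3) C(1)
    by (simp add: norm_mult powr_add mult_ac)
  then show ?case
    by (intro symbols_0[where C="C * D"])
       (use 0 in \<open>auto intro: smooth_on_mult[OF assms(1)] symbols_smooth\<close>)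
next
  case (Suc N)
  note GH = symbols_mono_order[OF Suc.prems(1), of N] symbols_mono_order[OF Suc.prems(2), of N]
  have sm: "smooth_on \<Omega> g" "smooth_on \<Omega> h" if "g \<in> G" "h \<in> H" for g h
    using that Suc.prems symbols_smooth by blast+
  let ?P = "{\<lambda>x. g x * h x | g h. g \<in> G \<and> h \<in> H}"
  have zero: "symbols \<Omega> w 0 (m + n) ?P"
    by (rule symbols_mono_order[OF Suc.IH]) (use GH in auto)
  have "symbols \<Omega> w N (m + n - 1) (partial b ` ?P)" if b: "b \<in> Basis" for b
  proof (rule symbols_cong[OF assms(1)])
    have 1: "symbols \<Omega> w N (m + n - 1) {\<lambda>x. g x * h x | g h. g \<in> partial b ` G \<and> h \<in> H}"
      using Suc.IH[OF symbols_partial[OF Suc.prems(1) b] GH(2)] by (simp add: algebra_simps)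
    have 2: "symbols \<Omega> w N (m + n - 1) {\<lambda>x. g x * h x | g h. g \<in> G \<and> h \<in> partial b ` H}"
      using Suc.IH[OF GH(1) symbols_partial[OF Suc.prems(2) b]] by (simp add: algebra_simps)
    show "symbols \<Omega> w N (m + n - 1) {\<lambda>x. u x + v x | u v.
        u \<in> {\<lambda>x. g x * h x | g h. g \<in> partial b ` G \<and> h \<in> H} \<and>
        v \<in> {\<lambda>x. g x * h x | g h. g \<in> G \<and> h \<in> partial b ` H}}" (is "symbols _ _ _ _ ?S")
      by (rule symbols_add[OF assms(1) 1 2])
    fix k assume "k \<in> partial b ` ?P"
    then obtain g h where gh: "g \<in> G" "h \<in> H" "k = partial b (\<lambda>x. g x * h x)" by blast
    have u: "(\<lambda>x. partial b g x * h x) \<in> {\<lambda>x. g x * h x | g h. g \<in> partial b ` G \<and> h \<in> H}"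
      using gh by auto
    have v: "(\<lambda>x. g x * partial b h x) \<in> {\<lambda>x. g x * h x | g h. g \<in> G \<and> h \<in> partial b ` H}"
      using gh by auto
    have "(\<lambda>x. partial b g x * h x + g x * partial b h x) \<in> ?S"
      using sum_memI[OF u v] .
    moreover have "\<forall>x\<in>\<Omega>. partial b g x * h x + g x * partial b h x = k x"
      using gh sm partial_mult smooth_on_differentiable by metis
    ultimately show "\<exists>u\<in>?S. \<forall>x\<in>\<Omega>. u x = k x"
      by (intro bexI[where x="\<lambda>x. partial b g x * h x + g x * partial b h x"])
  qed
  then show ?case
    by (rule symbols_Suc[OF zero])
qed

lemma symbols_const:
  assumes "\<And>x. x \<in> \<Omega> \<Longrightarrow> w x > 0"
  shows "symbols \<Omega> w N 0 {\<lambda>x. c | c. cmod c \<le> C}"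
proof -
  have d: "partial b (\<lambda>x. c) = (\<lambda>x. 0)" for b :: 'a and c :: complex
    using partial_eqI[OF has_derivative_const] by blast
  then have z: "partials bs (\<lambda>x::'a. 0::complex) = (\<lambda>x. 0)" for bs
    by (induction bs) (simp_all add: partials_Cons)
  have p0: "partials bs (\<lambda>x::'a. c) = (if bs = [] then (\<lambda>x. c) else (\<lambda>x. 0))"
    for bs and c :: complex
    by (cases bs rule: rev_cases) (simp_all add: partials_snoc d z)
  have "cmod (partials bs (\<lambda>x. c) x) \<le> \<bar>C\<bar> * w x powr (0 - real (length bs))"
    if "cmod c \<le> C" "x \<in> \<Omega>" for bs c x
    using that assms[OF that(2)] unfolding p0 by auto
  then show ?thesis
    unfolding symbols_def by (intro conjI exI[of _ "\<bar>C\<bar>"]) (auto intro: smooth_on_const)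
qed

lemma symbols_family_mult:
  assumes "open \<Omega>" "\<And>x. x \<in> \<Omega> \<Longrightarrow> w x > 0"
    "symbols \<Omega> w N m (f ` I)" "symbols \<Omega> w N n (g ` I)"
  shows "symbols \<Omega> w N (m + n) ((\<lambda>i x. f i x * g i x) ` I)"
  by (rule symbols_cong[OF assms(1) symbols_mult[OF assms]]) auto

lemma symbols_family_add:
  assumes "open \<Omega>" "symbols \<Omega> w N m (f ` I)" "symbols \<Omega> w N m (g ` I)"
  shows "symbols \<Omega> w N m ((\<lambda>i x. f i x + g i x) ` I)"
  by (rule symbols_cong[OF assms(1) symbols_add[OF assms]]) auto

lemma symbols_family_const:
  assumes "open \<Omega>" "symbols \<Omega> w N m {v}"
  shows "symbols \<Omega> w N m ((\<lambda>i. v) ` I)"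
  by (rule symbols_cong[OF assms]) auto

lemma symbols_family_scalar:
  assumes "open \<Omega>" "\<And>x. x \<in> \<Omega> \<Longrightarrow> w x > 0" "\<And>i. i \<in> I \<Longrightarrow> cmod (c i) \<le> C"
    "symbols \<Omega> w N m (f ` I)"
  shows "symbols \<Omega> w N m ((\<lambda>i x. c i * f i x) ` I)"
proof -
  have "symbols \<Omega> w N 0 ((\<lambda>i x. c i) ` I)"
    by (rule symbols_cong[OF assms(1) symbols_const[of \<Omega> w N C, OF assms(2)]]) (use assms(3) in auto)
  from symbols_family_mult[OF assms(1,2) this assms(4)] show ?thesis by simp
qed

lemma symbols_inverse:
  assumes "open \<Omega>" "\<And>x. x \<in> \<Omega> \<Longrightarrow> w x > 0" "\<And>N. symbols \<Omega> w N m {v}"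
    and c: "c > 0" "\<And>x. x \<in> \<Omega> \<Longrightarrow> c * w x powr m \<le> cmod (v x)"
  shows "symbols \<Omega> w N (- m) {\<lambda>x. inverse (v x)}"
proof (induction N)
  case 0
  have v: "smooth_on \<Omega> v" using symbols_smooth[OF assms(3)] by blast
  have nz: "v x \<noteq> 0" if "x \<in> \<Omega>" for x
    using c(2)[OF that] assms(2)[OF that] c(1)
    by (smt (verit, best) mult_pos_pos norm_zero powr_gt_zero)
  have "cmod (inverse (v x)) \<le> (1 / c) * w x powr (- m)" if "x \<in> \<Omega>" for x
  proof -
    have "inverse (cmod (v x)) \<le> inverse (c * w x powr m)"
      using c assms(2)[OF that] that by (intro le_imp_inverse_le) auto
    then show ?thesis by (simp add: norm_inverse powr_minus inverse_eq_divide[symmetric] mult.commute)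
  qed
  then show ?case
    by (intro symbols_0[where C="1 / c"]) (auto intro: smooth_on_inverse[OF assms(1) v nz])
next
  case (Suc N)
  have v: "smooth_on \<Omega> v" using symbols_smooth[OF assms(3)] by blast
  have nz: "v x \<noteq> 0" if "x \<in> \<Omega>" for x
    using c(2)[OF that] assms(2)[OF that] c(1)
    by (smt (verit, best) mult_pos_pos norm_zero powr_gt_zero)
  have "symbols \<Omega> w N (- m - 1) (partial b ` {\<lambda>x. inverse (v x)})" if b: "b \<in> Basis" for b
  proof -
    let ?i = "\<lambda>x. inverse (v x)"
    have i: "symbols \<Omega> w N (- m) ((\<lambda>_. ?i) ` {()})" using Suc by simp
    have p: "symbols \<Omega> w N (m - 1) ((\<lambda>_. partial b v) ` {()})"
      using symbols_partial[OF assms(3) b] by simp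
    have "symbols \<Omega> w N (- m + (- m + (m - 1))) ((\<lambda>i x. -1 * (?i x * (?i x * partial b v x))) ` {()})"
      by (intro symbols_family_scalar[where C=1] symbols_family_mult assms(1,2) i p) auto
    moreover have "- m + (- m + (m - 1)) = - m - 1" by simp
    ultimately have s: "symbols \<Omega> w N (- m - 1) {\<lambda>x. -1 * (?i x * (?i x * partial b v x))}"
      by simp
    have "\<forall>x\<in>\<Omega>. -1 * (?i x * (?i x * partial b v x)) = partial b ?i x"
      using partial_inverse[OF smooth_on_differentiable[OF v] nz, where b=b] by simp
    then show ?thesis
      by (intro symbols_cong[OF assms(1) s]) simp
  qed
  then show ?case
    by (rule symbols_Suc[OF symbols_mono_order[OF Suc le0]])
qed

text \<open>For the weight \<open>1\<close> the order is irrelevant, and the symbols are the functions all of whose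
  derivatives are bounded.\<close>

definition smooth_bounded :: "'a::euclidean_space set \<Rightarrow> ('a \<Rightarrow> complex) \<Rightarrow> bool" where
  "smooth_bounded \<Omega> v \<longleftrightarrow> (\<forall>N. symbols \<Omega> (\<lambda>_. 1) N 0 {v})"

lemma symbols_weight_1: "symbols \<Omega> (\<lambda>_. 1) N m G \<Longrightarrow> symbols \<Omega> (\<lambda>_. 1) N n G"
  unfolding symbols_def by simp

lemma smooth_bounded_smooth: "smooth_bounded \<Omega> v \<Longrightarrow> smooth_on \<Omega> v"
  unfolding smooth_bounded_def symbols_def by blast

lemma smooth_boundedE:
  assumes "smooth_bounded \<Omega> v" "set bs \<subseteq> Basis"
  obtains C where "C \<ge> 0" "\<And>x. x \<in> \<Omega> \<Longrightarrow> cmod (partials bs v x) \<le> C"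
  using assms symbolsE[of \<Omega> "\<lambda>_. 1" "length bs" 0 "{v}"] unfolding smooth_bounded_def
  by (metis (no_types, lifting) insertI1 mult.right_neutral order_refl powr_one_eq_one)

lemma smooth_boundedI:
  assumes "smooth_on \<Omega> v" "\<And>bs. set bs \<subseteq> Basis \<Longrightarrow> \<exists>C. \<forall>x\<in>\<Omega>. cmod (partials bs v x) \<le> C"
  shows "smooth_bounded \<Omega> v"
  unfolding smooth_bounded_def symbols_def
proof (intro allI conjI)
  fix N
  let ?B = "{bs :: 'a list. set bs \<subseteq> Basis \<and> length bs \<le> N}"
  obtain C where C: "\<And>bs x. set bs \<subseteq> Basis \<Longrightarrow> x \<in> \<Omega> \<Longrightarrow> cmod (partials bs v x) \<le> C bs"
    using assms(2) by metis
  have "cmod (partials bs v x) \<le> (\<Sum>bs\<in>?B. \<bar>C bs\<bar>)" if "bs \<in> ?B" "x \<in> \<Omega>" for bs x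
  proof -
    have "\<bar>C bs\<bar> \<le> (\<Sum>bs\<in>?B. \<bar>C bs\<bar>)"
      by (intro member_le_sum that finite_lists_length_le) auto
    then show ?thesis using C[of bs x] that by auto
  qed
  then show "\<exists>C. \<forall>g\<in>{v}. \<forall>bs. set bs \<subseteq> Basis \<and> length bs \<le> N \<longrightarrow>
     (\<forall>x\<in>\<Omega>. cmod (partials bs g x) \<le> C * 1 powr (0 - real (length bs)))"
    by (intro exI[of _ "\<Sum>bs\<in>?B. \<bar>C bs\<bar>"]) auto
qed (use assms(1) in auto)

lemma smooth_bounded_add:
  "open \<Omega> \<Longrightarrow> smooth_bounded \<Omega> u \<Longrightarrow> smooth_bounded \<Omega> v \<Longrightarrow> smooth_bounded \<Omega> (\<lambda>x. u x + v x)"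
  unfolding smooth_bounded_def
  using symbols_family_add[of \<Omega> "\<lambda>_. 1" _ 0 "\<lambda>_. u" "{()}" "\<lambda>_. v"] by simp

lemma smooth_bounded_mult:
  "open \<Omega> \<Longrightarrow> smooth_bounded \<Omega> u \<Longrightarrow> smooth_bounded \<Omega> v \<Longrightarrow> smooth_bounded \<Omega> (\<lambda>x. u x * v x)"
  unfolding smooth_bounded_def
  using symbols_family_mult[of \<Omega> "\<lambda>_. 1" _ 0 "\<lambda>_. u" "{()}" 0 "\<lambda>_. v"] by simp

lemma smooth_bounded_const: "open \<Omega> \<Longrightarrow> smooth_bounded \<Omega> (\<lambda>x. c)"
  unfolding smooth_bounded_def
  by (intro allI symbols_cong[OF _ symbols_const[where C="cmod c" and w="\<lambda>_. 1"]]) auto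

lemma smooth_bounded_sum:
  "open \<Omega> \<Longrightarrow> (\<And>i. i \<in> I \<Longrightarrow> smooth_bounded \<Omega> (f i)) \<Longrightarrow> smooth_bounded \<Omega> (\<lambda>x. \<Sum>i\<in>I. f i x)"
  by (induction I rule: infinite_finite_induct) (auto intro: smooth_bounded_add smooth_bounded_const)

lemma smooth_bounded_power:
  "open \<Omega> \<Longrightarrow> smooth_bounded \<Omega> u \<Longrightarrow> smooth_bounded \<Omega> (\<lambda>x. u x ^ n)"
  by (induction n) (auto intro: smooth_bounded_mult smooth_bounded_const)

lemma smooth_bounded_partial:
  assumes "smooth_bounded \<Omega> v" "b \<in> Basis"
  shows "smooth_bounded \<Omega> (partial b v)"
  unfolding smooth_bounded_def
proof
  fix N
  have "symbols \<Omega> (\<lambda>_. 1) (Suc N) 0 {v}" using assms(1) unfolding smooth_bounded_def by blast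
  from symbols_partial[OF this assms(2)] show "symbols \<Omega> (\<lambda>_. 1) N 0 {partial b v}"
    by (auto intro: symbols_weight_1)
qed

lemma smooth_bounded_inverse:
  assumes "open \<Omega>" "smooth_bounded \<Omega> v" "c > 0" "\<And>x. x \<in> \<Omega> \<Longrightarrow> c \<le> cmod (v x)"
  shows "smooth_bounded \<Omega> (\<lambda>x. inverse (v x))"
  unfolding smooth_bounded_def
  using symbols_inverse[of \<Omega> "\<lambda>_. 1" 0 v c] assms unfolding smooth_bounded_def by simp

lemma symbols_smooth_bounded:
  assumes "\<And>x. x \<in> \<Omega> \<Longrightarrow> 0 < w x \<and> w x \<le> 1" "smooth_bounded \<Omega> v"
  shows "symbols \<Omega> w N 0 {v}"
proof -
  obtain C where C: "C \<ge> 0" "\<And>g bs x. g \<in> {v} \<Longrightarrow> set bs \<subseteq> Basis \<Longrightarrow> length bs \<le> N \<Longrightarrow> x \<in> \<Omega> \<Longrightarrow>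
    cmod (partials bs g x) \<le> C * 1 powr (0 - real (length bs))"
    using symbolsE[of \<Omega> "\<lambda>_. 1" N 0 "{v}"] assms(2) unfolding smooth_bounded_def by metis
  have "cmod (partials bs v x) \<le> C * w x powr (0 - real (length bs))"
    if "set bs \<subseteq> Basis" "length bs \<le> N" "x \<in> \<Omega>" for bs x
  proof -
    have "w x powr 0 \<le> w x powr (0 - real (length bs))"
      using assms(1)[OF that(3)] by (intro powr_mono') auto
    then have "C * 1 \<le> C * w x powr (0 - real (length bs))"
      using assms(1)[OF that(3)] C(1) by (intro mult_left_mono) auto
    then show ?thesis using C(2)[of v bs x] that by simp
  qed
  then show ?thesis
    unfolding symbols_def using smooth_bounded_smooth[OF assms(2)] by (intro conjI exI[of _ C]) auto
qed

lemma quadratic_has_derivative_zero: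
  fixes f :: "'a::real_normed_vector \<Rightarrow> 'b::real_normed_vector"
  assumes "\<And>y. norm (f y) \<le> C * (dist y x)\<^sup>2"
  shows "(f has_derivative (\<lambda>_. 0)) (at x)"
proof -
  have "f x = 0" using assms[of x] by simp
  moreover have "((\<lambda>y. C * dist y x) \<longlongrightarrow> C * dist x x) (at x)"
    by (intro tendsto_intros)
  moreover have "norm (f y) / norm (y - x) \<le> C * dist y x" if "y \<noteq> x" for y
    using assms[of y] that by (simp add: dist_norm field_simps power2_eq_square)
  ultimately show ?thesis
    by (intro has_derivativeI_sandwich[where e=1 and H="\<lambda>y. C * dist y x"]) auto
qed

lemma partial_chain:
  fixes f :: "'a::euclidean_space \<Rightarrow> 'b::real_normed_field"
  assumes "(g has_field_derivative d) (at (f x))" "f differentiable (at x)"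
  shows "partial b (\<lambda>x. g (f x)) x = d * partial b f x"
proof -
  have "(f has_derivative frechet_derivative f (at x)) (at x)"
    using assms(2) frechet_derivative_works by blast
  from has_derivative_compose[OF this assms(1)[unfolded has_field_derivative_def]]
  show ?thesis unfolding partial_def[of b f] by (rule partial_eqI)
qed

lemma differentiable_chain:
  fixes f :: "'a::euclidean_space \<Rightarrow> 'b::real_normed_field"
  assumes "(g has_field_derivative d) (at (f x))" "f differentiable (at x)"
  shows "(\<lambda>x. g (f x)) differentiable (at x)"
  using assms has_derivative_compose unfolding differentiable_def has_field_derivative_def by blast

lemma power_le_fact_exp: "0 \<le> x \<Longrightarrow> x ^ n \<le> fact n * exp (x::real)"
proof -
  assume x: "0 \<le> x"
  have "x ^ n /\<^sub>R fact n \<le> (\<Sum>k. x ^ k /\<^sub>R fact k)"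
    using sum_le_suminf[OF summable_exp_generic[of x], of "{n}"] x by simp
  then have "x ^ n / fact n \<le> exp x" by (simp add: exp_def divide_inverse mult.commute)
  then show ?thesis by (simp add: field_simps)
qed

lemma power_exp_minus_bounded: "0 \<le> x \<Longrightarrow> x ^ n * exp (- x) \<le> fact (n::nat)" for x :: real
  using power_le_fact_exp[of x n] by (simp add: exp_minus field_simps)

section \<open>Flat functions and defining functions\<close>

text \<open>The powers of \<open>1 / t\<close> make the family stable under differentiation.\<close>

definition flat :: "nat \<Rightarrow> real \<Rightarrow> real" where
  "flat k t = (if t > 0 then (1 / t) ^ k * exp (- (1 / t)) else 0)"

lemma flat_nonneg: "flat k t \<ge> 0"
  by (simp add: flat_def)

lemma flat_pos: "t > 0 \<Longrightarrow> flat k t > 0"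
  by (simp add: flat_def)

lemma flat_nonpos: "t \<le> 0 \<Longrightarrow> flat k t = 0"
  by (simp add: flat_def)

lemma flat_0_le_1: "flat 0 t \<le> 1"
  by (simp add: flat_def)

lemma flat_quadratic: "flat k t \<le> fact (k + 2) * t\<^sup>2"
proof (cases "t > 0")
  case True
  have "(1 / t) ^ k * exp (- (1 / t)) = t\<^sup>2 * ((1 / t) ^ (k + 2) * exp (- (1 / t)))"
    using True by (simp add: power_add field_simps power2_eq_square)
  also have "\<dots> \<le> t\<^sup>2 * fact (k + 2)"
    using True by (intro mult_left_mono power_exp_minus_bounded) auto
  finally show ?thesis using True by (simp add: flat_def mult.commute)
qed (simp add: flat_def)

lemma flat_derivative:
  "(flat k has_field_derivative flat (k + 2) t - real k * flat (k + 1) t) (at t)"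
proof -
  consider "t > 0" | "t < 0" | "t = 0" by linarith
  then show ?thesis
  proof cases
    case 1
    have "((\<lambda>z. z ^ k * exp (- z)) has_field_derivative
        (real k * z ^ (k - 1) * exp (- z) - z ^ k * exp (- z))) (at z)" for z :: real
      by (auto intro!: derivative_eq_intros)
    moreover have "((\<lambda>t. 1 / t) has_field_derivative - ((1 / t) * (1 / t))) (at t)"
      using 1 by (auto intro!: derivative_eq_intros)
    ultimately have d: "((\<lambda>t. (1 / t) ^ k * exp (- (1 / t))) has_field_derivative
        (real k * (1 / t) ^ (k - 1) * exp (- (1 / t)) - (1 / t) ^ k * exp (- (1 / t))) * - ((1 / t) * (1 / t))) (at t)"
      by (rule DERIV_chain2)
    have "real k * z ^ (k - 1) * z = real k * z ^ k" for z :: real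
      by (cases k) auto
    then have e: "(real k * z ^ (k - 1) * exp (- z) - z ^ k * exp (- z)) * - (z * z) =
        z ^ (k + 2) * exp (- z) - real k * (z ^ (k + 1) * exp (- z))" for z :: real
      by (simp add: algebra_simps) (metis mult.assoc mult.left_commute)
    have "flat j t = (1 / t) ^ j * exp (- (1 / t))" for j
      using 1 by (simp add: flat_def)
    then have "((\<lambda>t. (1 / t) ^ k * exp (- (1 / t))) has_field_derivative
        flat (k + 2) t - real k * flat (k + 1) t) (at t)"
      using d unfolding e by simp
    then show ?thesis
      by (rule has_field_derivative_transform_within_open[where S="{0<..}"]) (use 1 in \<open>auto simp: flat_def\<close>)
  next
    case 2
    have "((\<lambda>t. 0) has_field_derivative flat (k + 2) t - real k * flat (k + 1) t) (at t)"
      using 2 by (simp add: flat_def)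
    then show ?thesis
      by (rule has_field_derivative_transform_within_open[where S="{..<0}"]) (use 2 in \<open>auto simp: flat_def\<close>)
  next
    case 3
    have "norm (flat k y) \<le> fact (k + 2) * (dist y 0)\<^sup>2" for y
      using flat_quadratic[of k y] flat_nonneg[of k y] by simp
    from quadratic_has_derivative_zero[OF this] have "(flat k has_field_derivative 0) (at 0)"
      by (simp add: has_field_derivative_def lambda_zero)
    then show ?thesis using 3 by (simp add: flat_def)
  qed
qed

lemma smooth_on_flat:
  assumes "open S" "smooth_on S r"
  shows "smooth_on S (\<lambda>x. flat k (r x))"
proof (rule smooth_on_coinduct_ring[where F="range (\<lambda>k x. flat k (r x))", OF assms(1)])
  let ?R = "smooth_ring S (range (\<lambda>k x. flat k (r x)))"
  have g: "(\<lambda>x. flat k (r x)) \<in> ?R" for k by (auto intro: smooth_ring.gen)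
  show "(\<lambda>x. flat k (r x)) \<in> ?R" by (rule g)
  show "g differentiable (at x)" if "g \<in> range (\<lambda>k x. flat k (r x))" "x \<in> S" for g x
    using that differentiable_chain[OF flat_derivative smooth_on_differentiable[OF assms(2)]] by auto
  fix g :: "'a \<Rightarrow> real" and b :: 'a
  assume "g \<in> range (\<lambda>k x. flat k (r x))" and b: "b \<in> Basis"
  then obtain k where k: "g = (\<lambda>x. flat k (r x))" by auto
  have "(\<lambda>x. (flat (k + 2) (r x) + (- real k) * flat (k + 1) (r x)) * partial b r x) \<in> ?R"
    by (intro smooth_ring.add smooth_ring.mult g smooth_ring.smooth[OF smooth_on_partial] assms b
        smooth_ring.smooth[OF smooth_on_const])
  then show "\<exists>h\<in>?R. \<forall>x\<in>S. partial b g x = h x"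
    by (rule bexI[rotated])
       (use k partial_chain[OF flat_derivative smooth_on_differentiable[OF assms(2)], where b=b] in auto)
qed

text \<open>For bounded domains the continuous extension to the closure amounts to uniform continuity,
  which passes to uniform limits.\<close>

lemma smooth_up_to_boundary_iff:
  assumes "bounded \<Omega>"
  shows "f \<in> smooth_up_to_boundary \<Omega> \<longleftrightarrow>
    smooth_on \<Omega> f \<and> (\<forall>bs. set bs \<subseteq> Basis \<longrightarrow> uniformly_continuous_on \<Omega> (partials bs f))"
proof -
  have "(\<exists>g. continuous_on (closure \<Omega>) g \<and> (\<forall>x\<in>\<Omega>. g x = u x)) \<longleftrightarrow> uniformly_continuous_on \<Omega> u"
    for u :: "'a \<Rightarrow> complex"
  proof
    assume "\<exists>g. continuous_on (closure \<Omega>) g \<and> (\<forall>x\<in>\<Omega>. g x = u x)"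
    then obtain g where g: "continuous_on (closure \<Omega>) g" "\<forall>x\<in>\<Omega>. g x = u x" by blast
    have "uniformly_continuous_on (closure \<Omega>) g"
      using g(1) assms by (intro compact_uniformly_continuous) auto
    then have "uniformly_continuous_on \<Omega> g"
      using closure_subset[of \<Omega>] unfolding uniformly_continuous_on_def by (meson subsetD)
    then show "uniformly_continuous_on \<Omega> u"
      using g(2) unfolding uniformly_continuous_on_def by simp
  next
    assume "uniformly_continuous_on \<Omega> u"
    from uniformly_continuous_on_extension_on_closure[OF this]
    show "\<exists>g. continuous_on (closure \<Omega>) g \<and> (\<forall>x\<in>\<Omega>. g x = u x)"
      by (metis uniformly_continuous_imp_continuous)
  qed
  then show ?thesis unfolding smooth_up_to_boundary_def by auto
qed

text \<open>A smooth substitute for the distance to the boundary. The bound by the distance makes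
  functions that are small compared to the weight extend by zero across the boundary.\<close>

locale weighted_domain =
  fixes \<Omega> :: "'a::euclidean_space set" and w :: "'a \<Rightarrow> real" and K :: real
  assumes open_domain: "open \<Omega>" and bounded_domain: "bounded \<Omega>"
    and w_range: "\<And>x. x \<in> \<Omega> \<Longrightarrow> 0 < w x \<and> w x \<le> 1"
    and w_dist: "\<And>x y. x \<in> \<Omega> \<Longrightarrow> y \<notin> \<Omega> \<Longrightarrow> w x \<le> K * dist x y"
    and K_pos: "K > 0"
    and w_smooth: "smooth_bounded \<Omega> (\<lambda>x. complex_of_real (w x))"
begin

lemma zero_extension:
  assumes "\<And>x. x \<in> \<Omega> \<Longrightarrow> f differentiable (at x)" "\<And>x. x \<in> \<Omega> \<Longrightarrow> norm (f x) \<le> C * (w x)\<^sup>2"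
  shows "(\<lambda>x. if x \<in> \<Omega> then f x else 0) differentiable (at x)" (is "?g differentiable _")
    and "partial b (\<lambda>x. if x \<in> \<Omega> then f x else 0) x = (if x \<in> \<Omega> then partial b f x else 0)"
proof -
  have out: "(?g has_derivative (\<lambda>_. 0)) (at x)" if "x \<notin> \<Omega>"
  proof (rule quadratic_has_derivative_zero[where C="\<bar>C\<bar> * K\<^sup>2"])
    fix y
    show "norm (?g y) \<le> \<bar>C\<bar> * K\<^sup>2 * (dist y x)\<^sup>2"
    proof (cases "y \<in> \<Omega>")
      case True
      have "norm (f y) \<le> C * (w y)\<^sup>2" using assms(2) True by blast
      also have "\<dots> \<le> \<bar>C\<bar> * (w y)\<^sup>2" by (intro mult_right_mono) auto
      also have "\<dots> \<le> \<bar>C\<bar> * (K * dist y x)\<^sup>2"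
        using w_dist[OF True that] w_range[OF True] by (intro mult_left_mono power_mono) auto
      finally show ?thesis using True by (simp add: power_mult_distrib mult.assoc)
    qed auto
  qed
  show "?g differentiable (at x)"
    using differentiable_cong_open[OF open_domain, of x ?g f] assms(1) out differentiableI
    by (cases "x \<in> \<Omega>") auto
  show "partial b ?g x = (if x \<in> \<Omega> then partial b f x else 0)"
    using partial_cong[OF open_domain, of x ?g f b] partial_eqI[OF out, of b] by auto
qed

lemma flat_imp_smooth_up_to_boundary:
  assumes "smooth_on \<Omega> f"
    "\<And>bs. set bs \<subseteq> Basis \<Longrightarrow> \<exists>C. \<forall>x\<in>\<Omega>. cmod (partials bs f x) \<le> C * w x"
  shows "f \<in> smooth_up_to_boundary \<Omega>"
  unfolding smooth_up_to_boundary_def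
proof (intro CollectI conjI allI impI assms(1))
  fix bs :: "'a list" assume bs: "set bs \<subseteq> Basis"
  obtain C where C: "\<forall>x\<in>\<Omega>. cmod (partials bs f x) \<le> C * w x" using assms(2)[OF bs] by blast
  let ?g = "\<lambda>x. if x \<in> \<Omega> then partials bs f x else 0"
  have "isCont ?g x" for x
  proof (cases "x \<in> \<Omega>")
    case True
    have "isCont (partials bs f) x"
      using smooth_on_differentiable[OF smooth_on_partials[OF assms(1) bs] True]
      by (simp add: differentiable_imp_continuous_within)
    moreover have "\<forall>\<^sub>F y in nhds x. ?g y = partials bs f y"
      using eventually_nhds_in_open[OF open_domain True] by eventually_elim simp
    ultimately show ?thesis using isCont_cong[of ?g "partials bs f" x] by blast
  next
    case False
    have "((\<lambda>y. \<bar>C\<bar> * (K * dist y x)) \<longlongrightarrow> \<bar>C\<bar> * (K * dist x x)) (at x)"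
      by (intro tendsto_intros)
    then have "((\<lambda>y. \<bar>C\<bar> * (K * dist y x)) \<longlongrightarrow> 0) (at x)" by simp
    moreover have "norm (?g y) \<le> \<bar>C\<bar> * (K * dist y x)" for y
    proof (cases "y \<in> \<Omega>")
      case True
      have "cmod (partials bs f y) \<le> C * w y" using C True by blast
      also have "\<dots> \<le> \<bar>C\<bar> * w y" using w_range[OF True] by (intro mult_right_mono) auto
      also have "\<dots> \<le> \<bar>C\<bar> * (K * dist y x)"
        using w_dist[OF True False] by (intro mult_left_mono) auto
      finally show ?thesis using True by simp
    qed (use K_pos in auto)
    ultimately have "(?g \<longlongrightarrow> 0) (at x)"
      by (intro Lim_null_comparison[of ?g "\<lambda>y. \<bar>C\<bar> * (K * dist y x)"] always_eventually) auto
    then show ?thesis using False by (simp add: isCont_def)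
  qed
  then show "\<exists>g. continuous_on (closure \<Omega>) g \<and> (\<forall>x\<in>\<Omega>. g x = partials bs f x)"
    by (intro exI[of _ ?g]) (auto intro: continuous_at_imp_continuous_on)
qed

text \<open>The functions \<open>exp (- \<epsilon> / w)\<close> serve as cutoff functions: they are flat at the boundary and tend
  to \<open>1\<close> as \<open>\<epsilon> \<rightarrow> 0\<close>. The powers of \<open>\<epsilon> / w\<close> make the family stable under differentiation.\<close>

definition cut :: "nat \<Rightarrow> real \<Rightarrow> 'a \<Rightarrow> complex" where
  "cut k \<epsilon> x = complex_of_real ((\<epsilon> / w x) ^ k * exp (- (\<epsilon> / w x)))"

abbreviation W where "W \<equiv> (\<lambda>x. complex_of_real (w x))"

lemma W_nz: "x \<in> \<Omega> \<Longrightarrow> W x \<noteq> 0"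
  using w_range by fastforce

lemma W_smooth: "smooth_on \<Omega> W"
  using smooth_bounded_smooth[OF w_smooth] .

lemma cut_eq: "cut k \<epsilon> x = (of_real \<epsilon> * inverse (W x)) ^ k * exp (- (of_real \<epsilon> * inverse (W x)))"
  by (simp add: cut_def divide_inverse flip: exp_of_real)

lemma partial_cut:
  assumes "x \<in> \<Omega>"
  shows "cut k \<epsilon> differentiable (at x)"
    and "partial b (cut k \<epsilon>) x =
      (cut (k + 1) \<epsilon> x + (- of_nat k) * cut k \<epsilon> x) * (partial b W x * inverse (W x))"
proof -
  let ?g = "\<lambda>z::complex. z ^ k * exp (- z)"
  let ?u = "\<lambda>x. of_real \<epsilon> * inverse (W x)"
  have dW: "W differentiable (at x)" using smooth_on_differentiable[OF W_smooth assms] .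
  have g: "(?g has_field_derivative (of_nat k * z ^ (k - 1) * exp (- z) - z ^ k * exp (- z))) (at z)" for z
    by (auto intro!: derivative_eq_intros)
  have du: "?u differentiable (at x)"
    using dW W_nz[OF assms] by (intro derivative_intros) auto
  have pu: "partial b ?u x = - (?u x * (partial b W x * inverse (W x)))"
    using partial_bounded_linear[OF bounded_linear_mult_right[of "of_real \<epsilon>"], of "\<lambda>x. inverse (W x)" x b]
      dW W_nz[OF assms] partial_inverse[OF dW W_nz[OF assms], of b]
    by (simp add: differentiable_inverse mult_ac)
  have eq: "cut k \<epsilon> = (\<lambda>x. ?g (?u x))" by (simp add: cut_eq fun_eq_iff)
  show "cut k \<epsilon> differentiable (at x)" unfolding eq by (rule differentiable_chain[OF g du])
  have k: "of_nat k * z ^ (k - 1) * z = of_nat k * z ^ k" for z :: complex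
    by (cases k) auto
  have "partial b (cut k \<epsilon>) x = (of_nat k * ?u x ^ (k - 1) * exp (- ?u x) - ?u x ^ k * exp (- ?u x))
      * - (?u x * (partial b W x * inverse (W x)))"
    unfolding eq partial_chain[OF g du] pu ..
  also have "\<dots> = (?u x ^ (k + 1) * exp (- ?u x) - (of_nat k * ?u x ^ (k - 1) * ?u x) * exp (- ?u x))
      * (partial b W x * inverse (W x))"
    by (simp add: algebra_simps)
  also have "\<dots> = (cut (k + 1) \<epsilon> x + (- of_nat k) * cut k \<epsilon> x) * (partial b W x * inverse (W x))"
    unfolding k cut_eq by (simp add: algebra_simps)
  finally show "partial b (cut k \<epsilon>) x =
      (cut (k + 1) \<epsilon> x + (- of_nat k) * cut k \<epsilon> x) * (partial b W x * inverse (W x))" .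
qed

lemma smooth_on_cut: "smooth_on \<Omega> (cut k \<epsilon>)"
proof (rule smooth_on_coinduct_ring[where F="range (\<lambda>k. cut k \<epsilon>)", OF open_domain])
  let ?R = "smooth_ring \<Omega> (range (\<lambda>k. cut k \<epsilon>))"
  have g: "cut k \<epsilon> \<in> ?R" for k by (auto intro: smooth_ring.gen)
  show "cut k \<epsilon> \<in> ?R" by (rule g)
  show "g differentiable (at x)" if "g \<in> range (\<lambda>k. cut k \<epsilon>)" "x \<in> \<Omega>" for g x
    using that partial_cut by auto
  fix g b assume "g \<in> range (\<lambda>k. cut k \<epsilon>)" and b: "b \<in> (Basis :: 'a set)"
  then obtain k where k: "g = cut k \<epsilon>" by auto
  have "(\<lambda>x. (cut (k + 1) \<epsilon> x + (- of_nat k) * cut k \<epsilon> x) * (partial b W x * inverse (W x))) \<in> ?R"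
    by (intro smooth_ring.add smooth_ring.mult g smooth_ring.smooth[OF smooth_on_partial] W_smooth b
        smooth_ring.smooth[OF smooth_on_const] smooth_ring.smooth[OF smooth_on_inverse] open_domain W_nz)
  then show "\<exists>h\<in>?R. \<forall>x\<in>\<Omega>. partial b g x = h x"
    by (rule bexI[rotated]) (use k partial_cut in auto)
qed

lemma symbols_W: "symbols \<Omega> w N 1 {W}"
proof (cases N)
  case 0
  have "symbols \<Omega> w 0 1 {W}"
    using w_range W_smooth by (intro symbols_0[where C=1]) (auto simp: order.strict_implies_order)
  then show ?thesis using 0 by simp
next
  case (Suc M)
  have "symbols \<Omega> w 0 1 {W}"
    using w_range W_smooth by (intro symbols_0[where C=1]) (auto simp: order.strict_implies_order)
  then show ?thesis unfolding Suc
    by (rule symbols_Suc) (use symbols_smooth_bounded[OF w_range smooth_bounded_partial[OF w_smooth]] in auto)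
qed

lemma symbols_W_power: "symbols \<Omega> w N (real k) {\<lambda>x. W x ^ k}"
proof (induction k)
  case 0
  show ?case using symbols_smooth_bounded[OF w_range smooth_bounded_const[OF open_domain, of 1]] by simp
next
  case (Suc k)
  have "symbols \<Omega> w N (1 + real k) ((\<lambda>i x. W x * W x ^ k) ` {()})"
    by (rule symbols_family_mult) (use Suc symbols_W open_domain w_range in auto)
  then show ?case by (simp add: add.commute)
qed

lemma symbols_inverse_W: "symbols \<Omega> w N (- 1) {\<lambda>x. inverse (W x)}"
  by (rule symbols_inverse[where c=1, OF open_domain _ symbols_W])
     (use w_range in \<open>auto simp: order.strict_implies_order\<close>)

lemma symbols_log_derivative:
  "b \<in> Basis \<Longrightarrow> symbols \<Omega> w N (- 1) {\<lambda>x. partial b W x * inverse (W x)}"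
  using symbols_family_mult[OF open_domain, of w N 0 "\<lambda>_. partial b W" "{()}" "- 1" "\<lambda>_ x. inverse (W x)"]
    symbols_smooth_bounded[OF w_range smooth_bounded_partial[OF w_smooth]] symbols_inverse_W w_range
  by simp

lemma symbols_cut: "symbols \<Omega> w N 0 (cut k ` {0<..})"
proof (induction N arbitrary: k)
  case 0
  show ?case
  proof (rule symbols_0[where C="fact k"])
    fix g x assume "g \<in> cut k ` {0<..}" and x: "x \<in> \<Omega>"
    then obtain \<epsilon> where e: "\<epsilon> > 0" "g = cut k \<epsilon>" by auto
    have "\<epsilon> / w x \<ge> 0" using e w_range[OF x] by simp
    then have "cmod (cut k \<epsilon> x) \<le> fact k"
      using power_exp_minus_bounded[of "\<epsilon> / w x" k]
      unfolding cut_def norm_of_real by (simp add: abs_mult)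
    then show "cmod (g x) \<le> fact k * w x powr 0" using e w_range[OF x] by simp
  qed (use smooth_on_cut in auto)
next
  case (Suc N)
  show ?case
  proof (rule symbols_Suc[OF symbols_mono_order[OF Suc le0]])
    fix b :: 'a assume b: "b \<in> Basis"
    have "symbols \<Omega> w N (0 + - 1) ((\<lambda>\<epsilon> x. (cut (k + 1) \<epsilon> x + (- of_nat k) * cut k \<epsilon> x) *
        (partial b W x * inverse (W x))) ` {0<..})"
      by (intro symbols_family_mult symbols_family_add symbols_family_scalar[where C="real k"]
          symbols_family_const symbols_log_derivative open_domain Suc b)
         (use w_range in auto)
    then have "symbols \<Omega> w N (0 - 1) ((\<lambda>\<epsilon> x. (cut (k + 1) \<epsilon> x + (- of_nat k) * cut k \<epsilon> x) *
        (partial b W x * inverse (W x))) ` {0<..})" by simp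
    then show "symbols \<Omega> w N (0 - 1) (partial b ` cut k ` {0<..})"
      by (rule symbols_cong[OF open_domain]) (use partial_cut in auto)
  qed
qed

lemma cut_0: "cut 0 \<epsilon> x = of_real (exp (- (\<epsilon> / w x)))"
  by (simp add: cut_def)

text \<open>The difference between a cutoff function and \<open>1\<close> is small with respect to \<open>\<epsilon>\<close> at the price of
  one order.\<close>

lemma symbols_one_minus_cut:
  "symbols \<Omega> w N (- 1) ((\<lambda>\<epsilon> x. of_real (1 / \<epsilon>) * (1 - cut 0 \<epsilon> x)) ` {0<..})"
proof -
  let ?f = "\<lambda>\<epsilon> x. of_real (1 / \<epsilon>) * (1 - cut 0 \<epsilon> x)"
  have sm: "smooth_on \<Omega> (?f \<epsilon>)" for \<epsilon>
    by (intro smooth_on_mult smooth_on_diff smooth_on_const smooth_on_cut open_domain)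
  have "cmod (?f \<epsilon> x) \<le> 1 * w x powr (- 1)" if "\<epsilon> > 0" "x \<in> \<Omega>" for \<epsilon> x
  proof -
    have w: "w x > 0" using w_range that by auto
    have "1 - exp (- (\<epsilon> / w x)) \<le> \<epsilon> / w x" using exp_ge_add_one_self[of "- (\<epsilon> / w x)"] by linarith
    moreover have "exp (- (\<epsilon> / w x)) \<le> 1" using that w by simp
    moreover have "1 - cut 0 \<epsilon> x = of_real (1 - exp (- (\<epsilon> / w x)))" by (simp add: cut_0)
    ultimately have "cmod (1 - cut 0 \<epsilon> x) \<le> \<epsilon> / w x" by (simp del: of_real_diff)
    then show ?thesis using that w by (simp add: norm_mult norm_divide powr_minus field_simps)
  qed
  then have 0: "symbols \<Omega> w 0 (- 1) (?f ` {0<..})"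
    using sm by (intro symbols_0[where C=1]) auto
  show ?thesis
  proof (cases N)
    case (Suc M)
    show ?thesis unfolding Suc
    proof (rule symbols_Suc[OF 0])
      fix b :: 'a assume b: "b \<in> Basis"
      let ?h = "\<lambda>\<epsilon> x. -1 * (cut 0 \<epsilon> x * (inverse (W x) * (partial b W x * inverse (W x))))"
      have "symbols \<Omega> w M (- 1 + - 1) ((\<lambda>\<epsilon>::real. \<lambda>x. inverse (W x) * (partial b W x * inverse (W x))) ` {0<..})"
        by (rule symbols_family_mult)
           (use open_domain w_range in \<open>auto intro!: symbols_family_const symbols_log_derivative b symbols_inverse_W\<close>)
      from symbols_family_mult[OF open_domain _ symbols_cut this]
      have "symbols \<Omega> w M (0 + (- 1 + - 1)) ((\<lambda>\<epsilon> x. cut 0 \<epsilon> x *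
          (inverse (W x) * (partial b W x * inverse (W x)))) ` {0<..})"
        using w_range by blast
      from symbols_family_scalar[where c="\<lambda>_. -1" and C=1, OF open_domain _ _ this]
      have h: "symbols \<Omega> w M (- 1 - 1) (?h ` {0<..})"
        using w_range by simp
      have eq: "?h \<epsilon> x = partial b (?f \<epsilon>) x" if "\<epsilon> > 0" "x \<in> \<Omega>" for \<epsilon> x
      proof -
        have "((\<lambda>x. 1 - cut 0 \<epsilon> x) has_derivative (\<lambda>h. - frechet_derivative (cut 0 \<epsilon>) (at x) h)) (at x)"
          using partial_cut(1)[OF that(2), where k=0 and \<epsilon>=\<epsilon>]
          unfolding frechet_derivative_works by (auto intro!: derivative_eq_intros)
        from has_derivative_mult_right[OF this, of "of_real (1 / \<epsilon>)"]
        have "partial b (?f \<epsilon>) x = of_real (1 / \<epsilon>) * - partial b (cut 0 \<epsilon>) x"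
          unfolding partial_def[of b "cut 0 \<epsilon>"] by (rule partial_eqI)
        also have "\<dots> = of_real (1 / \<epsilon>) * - (cut 1 \<epsilon> x * (partial b W x * inverse (W x)))"
          using partial_cut(2)[OF that(2), where b=b and k=0 and \<epsilon>=\<epsilon>] by simp
        also have "cut 1 \<epsilon> x = of_real \<epsilon> * inverse (W x) * cut 0 \<epsilon> x"
          by (simp add: cut_eq)
        finally show ?thesis using that(1) by (simp add: mult_ac)
      qed
      show "symbols \<Omega> w M (- 1 - 1) (partial b ` ?f ` {0<..})"
      proof (rule symbols_cong[OF open_domain h])
        fix k assume "k \<in> partial b ` ?f ` {0<..}"
        then obtain \<epsilon> where \<epsilon>: "\<epsilon> > 0" "k = partial b (?f \<epsilon>)" by blast
        show "\<exists>g\<in>?h ` {0<..}. \<forall>x\<in>\<Omega>. g x = k x"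
        proof (rule bexI[of _ "?h \<epsilon>"])
          show "\<forall>x\<in>\<Omega>. ?h \<epsilon> x = k x" unfolding \<epsilon>(2) using eq[OF \<epsilon>(1)] by blast
        qed (use \<epsilon>(1) in blast)
      qed
    qed
  qed (use 0 in simp)
qed

text \<open>Trading powers of \<open>\<epsilon>\<close> for powers of the weight: \<open>cut 0 \<epsilon>\<close> is \<open>(w / \<epsilon>) ^ k * cut k \<epsilon>\<close>.\<close>

lemma symbols_cut_flat:
  assumes "\<epsilon> > 0"
  shows "symbols \<Omega> w N (real k) {cut 0 \<epsilon>}"
proof -
  have "symbols \<Omega> w N 0 {cut k \<epsilon>}"
    by (rule symbols_cong[OF open_domain symbols_cut[of N k]]) (use assms in auto)
  then have "symbols \<Omega> w N (real k + 0) ((\<lambda>_ x. W x ^ k * cut k \<epsilon> x) ` {()})"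
    by (intro symbols_family_mult) (use symbols_W_power open_domain w_range in auto)
  from symbols_family_scalar[where c="\<lambda>_. of_real ((1 / \<epsilon>) ^ k)" and C="(1 / \<epsilon>) ^ k", OF open_domain _ _ this]
  have *: "symbols \<Omega> w N (real k) {\<lambda>x. of_real ((1 / \<epsilon>) ^ k) * (W x ^ k * cut k \<epsilon> x)}"
    using w_range assms by (simp add: norm_power norm_divide)
  have "of_real ((1 / \<epsilon>) ^ k) * (W x ^ k * cut k \<epsilon> x) = cut 0 \<epsilon> x" if "x \<in> \<Omega>" for x
  proof -
    have "(1 / \<epsilon>) ^ k * (w x ^ k * (\<epsilon> / w x) ^ k) = 1"
      using assms w_range[OF that] by (simp add: power_divide)
    then have "(1 / \<epsilon>) ^ k * (w x ^ k * ((\<epsilon> / w x) ^ k * exp (- (\<epsilon> / w x)))) = exp (- (\<epsilon> / w x))"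
      by (metis mult.assoc mult_1)
    then show ?thesis
      unfolding cut_def by (simp only: of_real_mult[symmetric] of_real_power[symmetric]) simp
  qed
  then show ?thesis
    by (intro symbols_cong[OF open_domain *]) auto
qed

end

text \<open>The local defining function \<open>r\<close> is turned into a weight on the whole domain by composing it
  with a function that is constant below \<open>-\<delta>\<close>. Joining \<open>x\<close> to the nearest boundary point shows that
  the weight is at most a multiple of the distance to the complement. The weight is positive
  inside and its gradient does not vanish on the boundary, so the lower bound \<open>c\<close> exists by
  compactness of the closure.\<close>

lemma smoothly_bounded_domain_weight:
  fixes \<Omega> :: "'a::euclidean_space set"
  assumes "smoothly_bounded_domain \<Omega>"
  obtains w K c where "weighted_domain \<Omega> w K" "c > 0"
    "\<And>x. x \<in> \<Omega> \<Longrightarrow> c \<le> (\<Sum>b\<in>Basis. (partial b w x)\<^sup>2) + (w x)\<^sup>2"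
proof -
  obtain U and r :: "'a \<Rightarrow> real" where \<Omega>: "open \<Omega>" "\<Omega> \<noteq> {}" "bounded \<Omega>"
    and U: "open U" "frontier \<Omega> \<subseteq> U" and r: "smooth_on U r"
    and \<Omega>U: "\<Omega> \<inter> U = {x \<in> U. r x < 0}"
    and dr: "\<forall>x\<in>frontier \<Omega>. frechet_derivative r (at x) \<noteq> (\<lambda>_. 0)"
    using assms unfolding smoothly_bounded_domain_def by blast
  let ?F = "frontier \<Omega>"
  have F: "compact ?F" using \<Omega>(3) by (simp add: compact_frontier_bounded)
  have cl: "closure \<Omega> = \<Omega> \<union> ?F" using closure_Un_frontier by blast
  have F\<Omega>: "?F \<inter> \<Omega> = {}" using \<Omega>(1) frontier_disjoint_eq by blast
  have ccl: "compact (closure \<Omega>)" using \<Omega>(3) by simp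
  obtain e where e: "e > 0" "(\<Union>x\<in>?F. cball x e) \<subseteq> U"
    using compact_subset_open_imp_cball_epsilon_subset[OF F U] by blast
  define V where "V = (\<Union>x\<in>?F. ball x e)"
  have V: "open V" "?F \<subseteq> V" unfolding V_def using e(1) by (auto intro: centre_in_ball[THEN iffD2])
  have "compact (\<Union>x\<in>?F. cball x e)"
  proof -
    have "(\<Union>x\<in>?F. cball x e) = {x + y | x y. x \<in> ?F \<and> y \<in> cball 0 e}"
    proof (intro set_eqI iffI)
      fix z assume "z \<in> (\<Union>x\<in>?F. cball x e)"
      then obtain x where "x \<in> ?F" "dist x z \<le> e" by auto
      then show "z \<in> {x + y | x y. x \<in> ?F \<and> y \<in> cball 0 e}"
        by (intro CollectI exI[of _ x] exI[of _ "z - x"]) (auto simp: dist_norm norm_minus_commute)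
    next
      fix z assume "z \<in> {x + y | x y. x \<in> ?F \<and> y \<in> cball 0 e}"
      then obtain x y where "x \<in> ?F" "norm y \<le> e" "z = x + y" by auto
      then show "z \<in> (\<Union>x\<in>?F. cball x e)"
        by (intro UN_I[of x]) (auto simp: dist_norm)
    qed
    then show ?thesis using compact_sums[OF F compact_cball[of 0 e]] by simp
  qed
  then have "closure V \<subseteq> (\<Union>x\<in>?F. cball x e)"
    by (intro closure_minimal compact_imp_closed) (auto simp: V_def)
  then have clV: "closure V \<subseteq> U" using e(2) by blast
  define Z where "Z = closure \<Omega> \<inter> frontier V"
  have ZU: "Z \<subseteq> \<Omega> \<inter> U"
    using V clV cl unfolding Z_def frontier_def by (auto simp: interior_open)
  have "\<exists>\<delta>>0. \<forall>z\<in>Z. r z < - \<delta>"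
  proof (cases "Z = {}")
    case False
    have "compact Z" unfolding Z_def using ccl by (intro compact_Int_closed) auto
    moreover have "continuous_on Z r"
      using smooth_on_continuous[OF r] ZU continuous_on_subset by blast
    ultimately obtain z where z: "z \<in> Z" "\<forall>y\<in>Z. r y \<le> r z"
      using continuous_attains_sup False by blast
    have "r z < 0" using z(1) ZU \<Omega>U by blast
    then show ?thesis using z(2) by (intro exI[of _ "- r z / 2"]) auto
  qed (auto intro: exI[of _ 1])
  then obtain \<delta> where \<delta>: "\<delta> > 0" "\<And>z. z \<in> Z \<Longrightarrow> r z < - \<delta>" by blast
  \<comment> \<open>Where \<open>r < -\<delta>\<close>, in particular near the part \<open>Z\<close> of the boundary of \<open>V\<close>, both branches agree.\<close>
  define w where "w z = (if z \<in> V then flat 0 \<delta> - flat 0 (r z + \<delta>) else flat 0 \<delta>)" for z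
  define D where "D = \<Omega> \<union> V"
  have D: "open D" "closure \<Omega> \<subseteq> D" unfolding D_def using \<Omega>(1) V cl by auto
  have smU: "smooth_on U (\<lambda>z. flat 0 \<delta> - flat 0 (r z + \<delta>))"
    by (intro smooth_on_diff smooth_on_const smooth_on_flat smooth_on_add U r)
  have VU: "V \<subseteq> U" using clV closure_subset by blast
  have wV: "smooth_on V w"
    using smooth_on_cong[of V w "\<lambda>z. flat 0 \<delta> - flat 0 (r z + \<delta>)", OF V(1)]
      smooth_on_subset[OF smU VU] by (simp add: w_def)
  have wD: "smooth_on D w"
  proof (rule smooth_on_local)
    fix z assume z: "z \<in> D"
    consider "z \<in> V" | "z \<notin> closure V" | "z \<in> closure V" "z \<notin> V" by blast
    then show "\<exists>T. z \<in> T \<and> smooth_on T w"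
    proof cases
      case 1
      then show ?thesis using wV by blast
    next
      case 2
      have "smooth_on (- closure V) w"
        using smooth_on_cong[of "- closure V" w "\<lambda>z. flat 0 \<delta>"] smooth_on_const closure_subset[of V]
        by (force simp: w_def)
      then show ?thesis using 2 by blast
    next
      case 3
      then have "z \<in> Z" using z cl V(1) unfolding Z_def D_def frontier_def by (auto simp: interior_open)
      then have zr: "r z < - \<delta>" "z \<in> U" using \<delta>(2) ZU by auto
      have "{y \<in> U. r y < - \<delta>} = U \<inter> r -` {..< - \<delta>}" by auto
      then have o: "open {y \<in> U. r y < - \<delta>}"
        using continuous_open_preimage[OF smooth_on_continuous[OF r] U(1), of "{..< - \<delta>}"] by simp
      have "smooth_on {y \<in> U. r y < - \<delta>} w"
        using smooth_on_cong[of _ w "\<lambda>z. flat 0 \<delta>", OF o] smooth_on_const by (force simp: w_def flat_nonpos)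
      then show ?thesis using zr by (intro exI[of _ "{y \<in> U. r y < - \<delta>}"] conjI) simp_all
    qed
  qed
  have rF: "r x = 0" if "x \<in> ?F" for x
  proof -
    have xU: "x \<in> U" using that U by auto
    have "\<not> r x < 0" using that F\<Omega> \<Omega>U xU by blast
    moreover have "\<not> r x > 0"
    proof
      assume "r x > 0"
      have o: "open (U \<inter> r -` {0<..})"
        using continuous_open_preimage[OF smooth_on_continuous[OF r] U(1), of "{0<..}"] by simp
      moreover have "x \<in> U \<inter> r -` {0<..}" using xU \<open>r x > 0\<close> by auto
      moreover have "x \<in> closure \<Omega>" using that cl by auto
      ultimately obtain y where y: "y \<in> \<Omega>" "y \<in> U \<inter> r -` {0<..}"
        using open_Int_closure_eq_empty[OF o, of \<Omega>] by blast
      have "y \<in> {x \<in> U. r x < 0}" using y \<Omega>U by blast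
      then show False using y(2) by simp
    qed
    ultimately show ?thesis by simp
  qed
  have wF: "w x = 0" if "x \<in> ?F" for x
    using V(2) that rF by (auto simp: w_def)
  have flat_mono: "flat 0 s < flat 0 \<delta>" if "s < \<delta>" for s
  proof (cases "s > 0")
    case True
    then have "1 / \<delta> < 1 / s" using that by (simp add: frac_less2)
    then show ?thesis using True \<delta>(1) by (simp add: flat_def)
  qed (use \<delta>(1) in \<open>simp add: flat_def\<close>)
  have w_range: "0 < w x \<and> w x \<le> 1" if "x \<in> \<Omega>" for x
  proof (cases "x \<in> V")
    case True
    then have "r x < 0" using that VU \<Omega>U by blast
    then show ?thesis
      using flat_mono[of "r x + \<delta>"] flat_0_le_1[of \<delta>] flat_nonneg[of 0 "r x + \<delta>"] True by (simp add: w_def)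
  qed (use flat_0_le_1 flat_pos \<delta>(1) in \<open>simp add: w_def\<close>)
  have compl_bd: "\<exists>C. \<forall>x\<in>closure \<Omega>. norm (partials bs w x) \<le> C" if "set bs \<subseteq> Basis" for bs
  proof -
    have "continuous_on (closure \<Omega>) (partials bs w)"
      using smooth_on_partials_continuous[OF wD that] D(2) continuous_on_subset by blast
    then have "bounded (partials bs w ` closure \<Omega>)"
      using ccl compact_continuous_image compact_imp_bounded by blast
    then show ?thesis unfolding bounded_iff by auto
  qed
  have "\<forall>b\<in>Basis. \<exists>C. \<forall>x\<in>closure \<Omega>. \<bar>partial b w x\<bar> \<le> C"
    using compl_bd[of "[_]"] by (auto simp: partials_Cons)
  then obtain Cb where Cb: "\<And>b x. b \<in> Basis \<Longrightarrow> x \<in> closure \<Omega> \<Longrightarrow> \<bar>partial b w x\<bar> \<le> Cb b" by metis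
  define K where "K = 1 + (\<Sum>b\<in>(Basis::'a set). \<bar>Cb b\<bar>)"
  have K: "K > 0" unfolding K_def by (intro add_pos_nonneg sum_nonneg) auto
  have w_dist: "w x \<le> K * dist x y" if x: "x \<in> \<Omega>" and y: "y \<notin> \<Omega>" for x y
  proof -
    have ne: "- \<Omega> \<noteq> {}" "closed (- \<Omega>)" using y \<Omega>(1) by auto
    obtain p where p: "p \<in> - \<Omega>" "infdist x (- \<Omega>) = dist x p"
      using infdist_attains_inf[OF ne(2,1)] by blast
    define d where "d = dist x p"
    have dy: "d \<le> dist x z" if "z \<notin> \<Omega>" for z
      using infdist_le[of z "- \<Omega>" x] p(2) that unfolding d_def by auto
    have ball: "ball x d \<subseteq> \<Omega>" using dy by force
    have d0: "d > 0" using p(1) x unfolding d_def by auto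
    have pcl: "cball x d \<subseteq> closure \<Omega>"
      using closure_mono[OF ball] d0 by simp
    have pF: "p \<in> ?F" using pcl p(1) cl unfolding d_def by auto
    have "norm (w x - w p) \<le> K * norm (x - p)"
    proof (rule differentiable_bound[where S="cball x d" and f'="\<lambda>z h. \<Sum>b\<in>Basis. (h \<bullet> b) *\<^sub>R partial b w z"])
      fix z assume z: "z \<in> cball x d"
      then have zD: "z \<in> D" "z \<in> closure \<Omega>" using pcl D(2) by auto
      show "(w has_derivative (\<lambda>h. \<Sum>b\<in>Basis. (h \<bullet> b) *\<^sub>R partial b w z)) (at z within cball x d)"
        using smooth_on_has_derivative[OF wD zD(1)] has_derivative_at_withinI by blast
      show "onorm (\<lambda>h. \<Sum>b\<in>Basis. (h \<bullet> b) *\<^sub>R partial b w z) \<le> K"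
      proof (rule onorm_bound)
        fix h
        have "norm (\<Sum>b\<in>Basis. (h \<bullet> b) *\<^sub>R partial b w z) \<le> (\<Sum>b\<in>Basis. norm h * \<bar>Cb b\<bar>)"
        proof (rule sum_norm_le)
          fix b :: 'a assume b: "b \<in> Basis"
          have "\<bar>partial b w z\<bar> \<le> \<bar>Cb b\<bar>" using Cb[OF b zD(2)] by linarith
          then show "norm ((h \<bullet> b) *\<^sub>R partial b w z) \<le> norm h * \<bar>Cb b\<bar>"
            using Basis_le_norm[OF b, of h] by (auto simp: abs_mult intro: mult_mono)
        qed
        also have "\<dots> \<le> K * norm h"
          unfolding K_def by (simp add: sum_distrib_left[symmetric] algebra_simps)
        finally show "norm (\<Sum>b\<in>Basis. (h \<bullet> b) *\<^sub>R partial b w z) \<le> K * norm h" .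
      qed (use K in auto)
    qed (use d0 in \<open>auto simp: d_def\<close>)
    then have "w x \<le> K * d" using wF[OF pF] w_range[OF x] by (simp add: d_def dist_norm)
    also have "\<dots> \<le> K * dist x y" using dy[OF y] K by simp
    finally show ?thesis .
  qed
  have of_real: "bounded_linear complex_of_real" by (rule bounded_linear_of_real)
  have wsm: "smooth_on D (\<lambda>x. complex_of_real (w x))"
    by (rule smooth_on_compose_bounded_linear[OF D(1) of_real wD])
  have "smooth_bounded \<Omega> (\<lambda>x. complex_of_real (w x))"
  proof (rule smooth_boundedI)
    show "smooth_on \<Omega> (\<lambda>x. complex_of_real (w x))"
      using smooth_on_subset[OF wsm] unfolding D_def by blast
    fix bs :: "'a list" assume bs: "set bs \<subseteq> Basis"
    obtain C where "\<forall>x\<in>closure \<Omega>. norm (partials bs w x) \<le> C" using compl_bd[OF bs] by blast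
    moreover have "partials bs (\<lambda>x. complex_of_real (w x)) x = of_real (partials bs w x)" if "x \<in> \<Omega>" for x
      using partials_bounded_linear[OF D(1) of_real wD _ bs] that unfolding D_def by blast
    ultimately show "\<exists>C. \<forall>x\<in>\<Omega>. cmod (partials bs (\<lambda>x. complex_of_real (w x)) x) \<le> C"
      using closure_subset[of \<Omega>] by (intro exI[of _ C]) auto
  qed
  then have wd: "weighted_domain \<Omega> w K"
    using \<Omega> w_range w_dist K by unfold_locales auto
  let ?G = "\<lambda>x. (\<Sum>b\<in>Basis. (partial b w x)\<^sup>2) + (w x)\<^sup>2"
  have G: "continuous_on (closure \<Omega>) ?G"
  proof (intro continuous_intros)
    show "continuous_on (closure \<Omega>) w"
      using smooth_on_continuous[OF wD] D(2) continuous_on_subset by blast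
    show "continuous_on (closure \<Omega>) (partial b w)" if "b \<in> Basis" for b
      using smooth_on_continuous[OF smooth_on_partial[OF wD that]] D(2) continuous_on_subset by blast
  qed
  have "closure \<Omega> \<noteq> {}" using \<Omega>(2) by simp
  from continuous_attains_inf[OF ccl this G]
  obtain x0 where x0: "x0 \<in> closure \<Omega>" "\<forall>x\<in>closure \<Omega>. ?G x0 \<le> ?G x" by blast
  have "?G x0 > 0"
  proof (cases "x0 \<in> \<Omega>")
    case True
    have "0 \<le> (\<Sum>b\<in>Basis. (partial b w x0)\<^sup>2)" by (simp add: sum_nonneg)
    moreover have "0 < (w x0)\<^sup>2" using w_range[OF True] by simp
    ultimately show ?thesis by linarith
  next
    case False
    then have x0F: "x0 \<in> ?F" using x0(1) cl by auto
    then have x0V: "x0 \<in> V" "x0 \<in> U" using V U by auto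
    have rd: "(\<lambda>x. r x + \<delta>) differentiable (at x0)" "r differentiable (at x0)"
      using smooth_on_differentiable[OF r x0V(2)] by (auto intro: derivative_intros)
    have flatd: "(flat 0 has_field_derivative flat 2 \<delta>) (at (r x0 + \<delta>))"
      using flat_derivative[of 0 \<delta>] rF[OF x0F] by (simp add: numeral_2_eq_2)
    have pw: "partial b w x0 = - (flat 2 \<delta> * partial b r x0)" for b
    proof -
      have "partial b w x0 = partial b (\<lambda>z. flat 0 \<delta> + - flat 0 (r z + \<delta>)) x0"
        by (rule partial_cong[OF V(1) x0V(1)]) (simp add: w_def)
      also have "\<dots> = - partial b (\<lambda>z. flat 0 (r z + \<delta>)) x0"
        using partial_add[of "\<lambda>_. flat 0 \<delta>" x0 "\<lambda>z. - flat 0 (r z + \<delta>)" b]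
          partial_bounded_linear[OF bounded_linear_minus[OF bounded_linear_ident] differentiable_chain[OF flatd rd(1)], of b]
          differentiable_chain[OF flatd rd(1)] partial_eqI[OF has_derivative_const, of b "flat 0 \<delta>" x0]
        by (simp add: differentiable_minus)
      also have "partial b (\<lambda>z. flat 0 (r z + \<delta>)) x0 = flat 2 \<delta> * partial b (\<lambda>x. r x + \<delta>) x0"
        by (rule partial_chain[OF flatd rd(1)])
      also have "partial b (\<lambda>x. r x + \<delta>) x0 = partial b r x0"
        using partial_add[OF rd(2), of "\<lambda>_. \<delta>" b] partial_eqI[OF has_derivative_const, of b \<delta> x0] by simp
      finally show ?thesis .
    qed
    have "\<exists>b\<in>Basis. partial b r x0 \<noteq> 0"
    proof (rule ccontr)
      assume "\<not> ?thesis"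
      then have d0: "(r has_derivative (\<lambda>_. 0)) (at x0)"
        using has_derivative_partial[OF rd(2)] by simp
      show False by (rule notE[OF dr[rule_format, OF x0F] sym[OF frechet_derivative_at[OF d0]]]) 
    qed
    then obtain b where b: "b \<in> Basis" "partial b r x0 \<noteq> 0" by blast
    have "0 < (partial b w x0)\<^sup>2" using b(2) flat_pos[OF \<delta>(1), of 2] by (simp add: pw)
    also have "\<dots> \<le> (\<Sum>b\<in>Basis. (partial b w x0)\<^sup>2)" by (rule member_le_sum[OF b(1)]) auto
    finally show ?thesis by (simp add: add_pos_nonneg)
  qed
  then show thesis
    using x0(2) closure_subset[of \<Omega>] by (intro that[OF wd, of "?G x0"]) auto
qed

section \<open>Integration\<close>

lemma integrable_continuous_bounded_support:
  fixes G :: "'a::euclidean_space \<Rightarrow> 'b::euclidean_space"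
  assumes "continuous_on UNIV G" "\<And>x. x \<notin> cball 0 R \<Longrightarrow> G x = 0"
  shows "integrable lborel G"
proof -
  have "integrable lborel (\<lambda>x. indicator (cball 0 R) x *\<^sub>R G x)"
    using assms(1) continuous_on_subset by (intro borel_integrable_compact) auto
  moreover have "(\<lambda>x. indicator (cball 0 R) x *\<^sub>R G x) = G"
    using assms(2) by (auto simp: indicator_def fun_eq_iff)
  ultimately show ?thesis by simp
qed

lemma lborel_integral_translation:
  fixes f :: "'a::euclidean_space \<Rightarrow> 'b::euclidean_space"
  assumes "f \<in> borel_measurable borel"
  shows "integral\<^sup>L lborel (\<lambda>x. f (c + x)) = integral\<^sup>L lborel f"
proof -
  have "integral\<^sup>L lborel f = integral\<^sup>L (distr lborel borel ((+) c)) f"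
    by (subst lborel_distr_plus) (rule refl)
  also have "\<dots> = integral\<^sup>L lborel (\<lambda>x. f (c + x))"
    using assms by (intro integral_distr) auto
  finally show ?thesis by simp
qed

text \<open>The difference quotients of a compactly supported function have integral zero by translation
  invariance, and they are dominated by the bound on the derivative.\<close>

lemma integral_partial_zero:
  fixes G :: "'a::euclidean_space \<Rightarrow> complex"
  assumes diff: "\<And>x. G differentiable (at x)" and bd: "\<And>x. cmod (partial b G x) \<le> C"
    and supp: "\<And>x. x \<notin> cball 0 R \<Longrightarrow> G x = 0" and b: "b \<in> Basis"
  shows "integrable lborel (partial b G)" "integral\<^sup>L lborel (partial b G) = 0"
proof -
  define h where "h n = inverse (real (Suc n))" for n
  define q where "q n x = (G (x + h n *\<^sub>R b) - G x) /\<^sub>R h n" for n x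
  have h: "h n > 0" "h n \<le> 1" for n by (auto simp: h_def field_simps)
  have h0: "h \<longlonglongrightarrow> 0" unfolding h_def by (rule LIMSEQ_inverse_real_of_nat)
  have cont: "continuous_on UNIV G"
    by (meson continuous_at_imp_continuous_on diff differentiable_imp_continuous_within)
  have Gm: "G \<in> borel_measurable borel" using cont by (rule borel_measurable_continuous_onI)
  have Gi: "integrable lborel G" by (rule integrable_continuous_bounded_support[OF cont supp])
  have der: "((\<lambda>t. G (x + t *\<^sub>R b)) has_vector_derivative partial b G (x + t *\<^sub>R b)) (at t within S)" for x t S
  proof -
    have "(G has_derivative frechet_derivative G (at (x + t *\<^sub>R b))) (at (x + t *\<^sub>R b))"
      using diff frechet_derivative_works by blast
    moreover have "((\<lambda>t. x + t *\<^sub>R b) has_derivative (\<lambda>s. s *\<^sub>R b)) (at t within S)"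
      by (auto intro!: derivative_eq_intros)
    ultimately have "((\<lambda>t. G (x + t *\<^sub>R b)) has_derivative (\<lambda>s. frechet_derivative G (at (x + t *\<^sub>R b)) (s *\<^sub>R b))) (at t within S)"
      by (intro has_derivative_compose[where f="\<lambda>t. x + t *\<^sub>R b" and g=G])
    then show ?thesis
      using linear_cmul[OF linear_frechet_derivative[OF diff]]
      by (simp add: has_vector_derivative_def partial_def)
  qed
  have lim: "(\<lambda>n. q n x) \<longlonglongrightarrow> partial b G x" for x
  proof -
    have "((\<lambda>t. G (x + t *\<^sub>R b)) has_vector_derivative partial b G x) (at 0)"
      using der[of x 0 UNIV] by simp
    then have l: "((\<lambda>y. norm (G (x + y *\<^sub>R b) - G x - y *\<^sub>R partial b G x) / norm y) \<longlongrightarrow> 0) (at 0)"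
      unfolding has_vector_derivative_def has_derivative_at by simp
    have e: "norm (G (x + y *\<^sub>R b) - G x - y *\<^sub>R partial b G x) / norm y =
        norm ((G (x + y *\<^sub>R b) - G x) /\<^sub>R y - partial b G x)" if "y \<noteq> 0" for y
    proof -
      have "(G (x + y *\<^sub>R b) - G x) /\<^sub>R y - partial b G x =
          (G (x + y *\<^sub>R b) - G x - y *\<^sub>R partial b G x) /\<^sub>R y"
        using that by (simp add: algebra_simps)
      then show ?thesis by (simp add: divide_inverse mult.commute)
    qed
    have "((\<lambda>y. norm ((G (x + y *\<^sub>R b) - G x) /\<^sub>R y - partial b G x)) \<longlongrightarrow> 0) (at 0)"
      by (rule Lim_transform_eventually[OF l])
         (use e in \<open>auto simp: eventually_at_filter intro!: always_eventually\<close>)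
    then have "((\<lambda>y. (G (x + y *\<^sub>R b) - G x) /\<^sub>R y) \<longlongrightarrow> partial b G x) (at 0)"
      by (simp add: tendsto_norm_zero_iff LIM_zero_iff)
    moreover have "filterlim h (at 0) sequentially"
      using h0 h(1) by (auto simp: filterlim_at less_imp_neq[symmetric])
    ultimately show ?thesis unfolding q_def by (rule filterlim_compose)
  qed
  have qb: "cmod (q n x) \<le> C * indicator (cball 0 (R + 1)) x" for n x
  proof (cases "x \<in> cball 0 (R + 1)")
    case True
    have "norm (G (x + h n *\<^sub>R b) - G (x + 0 *\<^sub>R b)) \<le> C * norm (h n - 0)"
    proof (rule differentiable_bound[where S="{0..h n}" and f'="\<lambda>t s. s *\<^sub>R partial b G (x + t *\<^sub>R b)"])
      fix t
      show "onorm (\<lambda>s. s *\<^sub>R partial b G (x + t *\<^sub>R b)) \<le> C"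
      proof (rule onorm_bound)
        show "0 \<le> C" using order_trans[OF norm_ge_zero bd] .
        fix s :: real
        have "\<bar>s\<bar> * cmod (partial b G (x + t *\<^sub>R b)) \<le> \<bar>s\<bar> * C"
          using bd by (intro mult_left_mono) auto
        then show "norm (s *\<^sub>R partial b G (x + t *\<^sub>R b)) \<le> C * norm s"
          by (simp add: mult.commute)
      qed
    qed (use der h in \<open>auto simp: has_vector_derivative_def less_imp_le\<close>)
    moreover have "cmod (q n x) = cmod (G (x + h n *\<^sub>R b) - G x) / h n"
      unfolding q_def norm_scaleR using h(1)[of n] by (simp add: divide_inverse mult.commute)
    ultimately show ?thesis using True h(1)[of n] by (simp add: pos_divide_le_eq)
  next
    case False
    have "x \<notin> cball 0 R" "x + h n *\<^sub>R b \<notin> cball 0 R"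
      using False norm_triangle_ineq4[of "x + h n *\<^sub>R b" "h n *\<^sub>R b"] h[of n] b by (auto simp: less_imp_le)
    then show ?thesis using supp False by (simp add: q_def)
  qed
  have qm: "q n \<in> borel_measurable lborel" for n
  proof -
    have "continuous_on UNIV (q n)" unfolding q_def
      by (intro continuous_intros continuous_on_compose2[OF cont]) auto
    then show ?thesis by (simp add: borel_measurable_continuous_onI)
  qed
  have pm: "partial b G \<in> borel_measurable lborel"
    using borel_measurable_LIMSEQ_metric[OF qm lim] by simp
  have bi: "integrable lborel (\<lambda>x::'a. C * indicator (cball 0 (R + 1)) x)"
    using emeasure_bounded_finite[OF bounded_cball, of "0::'a" "R + 1"]
    by (intro integrable_mult_right integrable_real_indicator) auto
  show "integrable lborel (partial b G)"
    by (rule integrable_dominated_convergence[where s=q, OF pm qm bi]) (use lim qb in auto)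
  have "(\<lambda>n. integral\<^sup>L lborel (q n)) \<longlonglongrightarrow> integral\<^sup>L lborel (partial b G)"
    by (rule integral_dominated_convergence[where s=q, OF pm qm bi]) (use lim qb in auto)
  moreover have "integral\<^sup>L lborel (q n) = 0" for n
  proof -
    have "G (h n *\<^sub>R b + x) = 0" if "x \<notin> cball 0 (R + 1)" for x
    proof (rule supp)
      have "norm x \<le> norm (h n *\<^sub>R b + x) + norm (h n *\<^sub>R b)"
        using norm_triangle_ineq4[of "h n *\<^sub>R b + x" "h n *\<^sub>R b"] by simp
      then show "h n *\<^sub>R b + x \<notin> cball 0 R" using that h[of n] b by simp
    qed
    then have "integrable lborel (\<lambda>x. G (h n *\<^sub>R b + x))"
      by (intro integrable_continuous_bounded_support[where R="R + 1"] continuous_on_compose2[OF cont] continuous_intros) auto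
    then show ?thesis
      unfolding q_def
      using lborel_integral_translation[OF Gm, of "h n *\<^sub>R b"] Gi by (simp add: add.commute)
  qed
  ultimately show "integral\<^sup>L lborel (partial b G) = 0"
    by (simp add: LIMSEQ_const_iff)
qed

lemma lebesgue_on_integral_zero_extension:
  fixes f :: "'a::euclidean_space \<Rightarrow> complex"
  assumes "S \<in> sets lebesgue" "(\<lambda>x. if x \<in> S then f x else 0) \<in> borel_measurable borel"
  shows "integral\<^sup>L (lebesgue_on S) f = integral\<^sup>L lborel (\<lambda>x. if x \<in> S then f x else 0)"
proof -
  let ?F = "\<lambda>x. if x \<in> S then f x else 0"
  have "integral\<^sup>L lebesgue ?F = integral\<^sup>L lborel ?F"
    using assms(2) by (intro integral_completion) simp
  with Lebesgue_Measure.integral_restrict_UNIV[OF assms(1), of f] show ?thesis by simp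
qed

lemma borel_measurable_cnj [measurable (raw)]:
  "f \<in> borel_measurable M \<Longrightarrow> (\<lambda>x. cnj (f x)) \<in> borel_measurable M"
  by (rule measurable_compose[where g=cnj])
     (auto intro: borel_measurable_continuous_onI continuous_intros)

lemma integral_Cauchy_Schwarz:
  fixes u v :: "'a \<Rightarrow> real"
  assumes [measurable]: "u \<in> borel_measurable M" "v \<in> borel_measurable M"
    and i: "integrable M (\<lambda>x. (u x)\<^sup>2)" "integrable M (\<lambda>x. (v x)\<^sup>2)"
  shows "integrable M (\<lambda>x. u x * v x)"
    and "(integral\<^sup>L M (\<lambda>x. u x * v x))\<^sup>2 \<le> integral\<^sup>L M (\<lambda>x. (u x)\<^sup>2) * integral\<^sup>L M (\<lambda>x. (v x)\<^sup>2)"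
proof -
  have "\<bar>u x * v x\<bar> \<le> (u x)\<^sup>2 + (v x)\<^sup>2" for x
  proof -
    have "2 * \<bar>u x\<bar> * \<bar>v x\<bar> \<le> (u x)\<^sup>2 + (v x)\<^sup>2"
      using sum_squares_bound[of "\<bar>u x\<bar>" "\<bar>v x\<bar>"] by simp
    moreover have "0 \<le> \<bar>u x\<bar> * \<bar>v x\<bar>" by simp
    ultimately show ?thesis unfolding abs_mult by linarith
  qed
  then show uv: "integrable M (\<lambda>x. u x * v x)"
    by (intro Bochner_Integration.integrable_bound[OF Bochner_Integration.integrable_add[OF i]]) auto
  let ?a = "integral\<^sup>L M (\<lambda>x. (u x)\<^sup>2)" and ?b = "integral\<^sup>L M (\<lambda>x. u x * v x)" and ?c = "integral\<^sup>L M (\<lambda>x. (v x)\<^sup>2)"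
  have q: "0 \<le> ?a + 2 * t * ?b + t\<^sup>2 * ?c" for t
  proof -
    have "0 \<le> integral\<^sup>L M (\<lambda>x. (u x + t * v x)\<^sup>2)" by simp
    also have "(\<lambda>x. (u x + t * v x)\<^sup>2) = (\<lambda>x. (u x)\<^sup>2 + 2 * t * (u x * v x) + t\<^sup>2 * (v x)\<^sup>2)"
      by (auto simp: power2_eq_square algebra_simps)
    also have "integral\<^sup>L M \<dots> = ?a + 2 * t * ?b + t\<^sup>2 * ?c"
      using uv i by simp
    finally show ?thesis .
  qed
  have c0: "?c \<ge> 0" by simp
  show "?b\<^sup>2 \<le> ?a * ?c"
  proof (cases "?c = 0")
    case True
    have "?b = 0"
    proof (rule ccontr)
      assume b: "?b \<noteq> 0"
      have "0 \<le> ?a + 2 * (- (?a + 1) / (2 * ?b)) * ?b"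
        using q[of "- (?a + 1) / (2 * ?b)"] True by simp
      then show False using b by (simp add: field_simps)
    qed
    then show ?thesis using True by simp
  next
    case False
    then have c: "?c > 0" using c0 by (metis order_less_le)
    have "0 \<le> ?a + 2 * (- ?b / ?c) * ?b + (- ?b / ?c)\<^sup>2 * ?c" by (rule q)
    also have "\<dots> = ?a - ?b\<^sup>2 / ?c" using c by (simp add: power2_eq_square field_simps)
    finally show ?thesis using c by (simp add: field_simps)
  qed
qed

section \<open>The space of square-integrable functions\<close>

lemma L2_measurable: "f \<in> L2 \<Omega> \<Longrightarrow> f \<in> borel_measurable (lebesgue_on \<Omega>)"
  by (simp add: L2_def)

lemma L2_integrable: "f \<in> L2 \<Omega> \<Longrightarrow> integrable (lebesgue_on \<Omega>) (\<lambda>x. (cmod (f x))\<^sup>2)"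
  by (simp add: L2_def)

lemma L2_norm_nonneg: "L2_norm \<Omega> f \<ge> 0"
  by (simp add: L2_norm_def)

lemma L2_norm_square: "(L2_norm \<Omega> f)\<^sup>2 = (LINT x|lebesgue_on \<Omega>. (cmod (f x))\<^sup>2)"
  by (simp add: L2_norm_def)

lemma L2_Cauchy_Schwarz:
  assumes "f \<in> L2 \<Omega>" "g \<in> L2 \<Omega>"
  shows "integrable (lebesgue_on \<Omega>) (\<lambda>x. cmod (f x) * cmod (g x))"
    and "(LINT x|lebesgue_on \<Omega>. cmod (f x) * cmod (g x)) \<le> L2_norm \<Omega> f * L2_norm \<Omega> g"
proof -
  note m = L2_measurable[OF assms(1), measurable] L2_measurable[OF assms(2), measurable]
  note cs = integral_Cauchy_Schwarz[of "\<lambda>x. cmod (f x)" "lebesgue_on \<Omega>" "\<lambda>x. cmod (g x)",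
      OF _ _ L2_integrable[OF assms(1)] L2_integrable[OF assms(2)]]
  show "integrable (lebesgue_on \<Omega>) (\<lambda>x. cmod (f x) * cmod (g x))"
    by (rule cs(1)) measurable
  have "(LINT x|lebesgue_on \<Omega>. cmod (f x) * cmod (g x))\<^sup>2 \<le> (L2_norm \<Omega> f * L2_norm \<Omega> g)\<^sup>2"
    unfolding power_mult_distrib L2_norm_square by (rule cs(2)) measurable
  then show "(LINT x|lebesgue_on \<Omega>. cmod (f x) * cmod (g x)) \<le> L2_norm \<Omega> f * L2_norm \<Omega> g"
    by (rule power2_le_imp_le) (simp add: L2_norm_nonneg)
qed

lemma L2_inner_integrable:
  assumes "f \<in> L2 \<Omega>" "g \<in> L2 \<Omega>"
  shows "integrable (lebesgue_on \<Omega>) (\<lambda>x. f x * cnj (g x))"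
proof -
  note m = L2_measurable[OF assms(1), measurable] L2_measurable[OF assms(2), measurable]
  show ?thesis
    by (rule Bochner_Integration.integrable_bound[OF L2_Cauchy_Schwarz(1)[OF assms]])
       (auto simp: norm_mult)
qed

lemma L2_inner_bound:
  assumes "f \<in> L2 \<Omega>" "g \<in> L2 \<Omega>"
  shows "cmod (L2_inner \<Omega> f g) \<le> L2_norm \<Omega> f * L2_norm \<Omega> g"
proof -
  have "cmod (L2_inner \<Omega> f g) \<le> (LINT x|lebesgue_on \<Omega>. cmod (f x * cnj (g x)))"
    unfolding L2_inner_def by (rule integral_norm_bound)
  then show ?thesis using L2_Cauchy_Schwarz(2)[OF assms] by (simp add: norm_mult)
qed

lemma L2_add:
  assumes "f \<in> L2 \<Omega>" "g \<in> L2 \<Omega>"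
  shows "(\<lambda>x. f x + g x) \<in> L2 \<Omega>"
proof -
  note m = L2_measurable[OF assms(1), measurable] L2_measurable[OF assms(2), measurable]
  have i: "integrable (lebesgue_on \<Omega>) (\<lambda>x. 2 * (cmod (f x))\<^sup>2 + 2 * (cmod (g x))\<^sup>2)"
    using L2_integrable assms by (intro Bochner_Integration.integrable_add integrable_mult_right) auto
  have "(cmod (f x + g x))\<^sup>2 \<le> 2 * (cmod (f x))\<^sup>2 + 2 * (cmod (g x))\<^sup>2" for x
  proof -
    have "(cmod (f x + g x))\<^sup>2 \<le> (cmod (f x) + cmod (g x))\<^sup>2"
      by (intro power_mono norm_triangle_ineq) auto
    also have "\<dots> \<le> 2 * (cmod (f x))\<^sup>2 + 2 * (cmod (g x))\<^sup>2"
      using sum_squares_bound[of "cmod (f x)" "cmod (g x)"] by (simp add: power2_sum)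
    finally show ?thesis .
  qed
  then have "integrable (lebesgue_on \<Omega>) (\<lambda>x. (cmod (f x + g x))\<^sup>2)"
    by (intro Bochner_Integration.integrable_bound[OF i]) auto
  then show ?thesis by (simp add: L2_def)
qed

lemma L2_scale:
  assumes "f \<in> L2 \<Omega>"
  shows "(\<lambda>x. c * f x) \<in> L2 \<Omega>" "L2_norm \<Omega> (\<lambda>x. c * f x) = cmod c * L2_norm \<Omega> f"
proof -
  note m = L2_measurable[OF assms(1), measurable]
  have "integrable (lebesgue_on \<Omega>) (\<lambda>x. (cmod c)\<^sup>2 * (cmod (f x))\<^sup>2)"
    using L2_integrable[OF assms] by simp
  then show "(\<lambda>x. c * f x) \<in> L2 \<Omega>" by (simp add: L2_def norm_mult power_mult_distrib)
  show "L2_norm \<Omega> (\<lambda>x. c * f x) = cmod c * L2_norm \<Omega> f"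
    by (simp add: L2_norm_def norm_mult power_mult_distrib real_sqrt_mult)
qed

lemma L2_diff: "f \<in> L2 \<Omega> \<Longrightarrow> g \<in> L2 \<Omega> \<Longrightarrow> (\<lambda>x. f x - g x) \<in> L2 \<Omega>"
  using L2_add[of f \<Omega> "\<lambda>x. -1 * g x"] L2_scale(1)[of g \<Omega> "-1"] by simp

lemma L2_cnj: "f \<in> L2 \<Omega> \<Longrightarrow> (\<lambda>x. cnj (f x)) \<in> L2 \<Omega>"
  unfolding L2_def by auto

lemma L2_cong: "(\<And>x. x \<in> \<Omega> \<Longrightarrow> f x = g x) \<Longrightarrow> f \<in> L2 \<Omega> \<longleftrightarrow> g \<in> L2 \<Omega>"
proof -
  assume eq: "\<And>x. x \<in> \<Omega> \<Longrightarrow> f x = g x"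
  have "f \<in> borel_measurable (lebesgue_on \<Omega>) \<longleftrightarrow> g \<in> borel_measurable (lebesgue_on \<Omega>)"
    by (rule measurable_cong) (simp add: eq)
  moreover have "integrable (lebesgue_on \<Omega>) (\<lambda>x. (cmod (f x))\<^sup>2) \<longleftrightarrow>
      integrable (lebesgue_on \<Omega>) (\<lambda>x. (cmod (g x))\<^sup>2)"
    by (rule Bochner_Integration.integrable_cong) (simp_all add: eq)
  ultimately show ?thesis by (simp add: L2_def)
qed

lemma L2_inner_cong:
  "(\<And>x. x \<in> \<Omega> \<Longrightarrow> f x = f' x) \<Longrightarrow> (\<And>x. x \<in> \<Omega> \<Longrightarrow> g x = g' x) \<Longrightarrow> L2_inner \<Omega> f g = L2_inner \<Omega> f' g'"
  unfolding L2_inner_def by (intro Bochner_Integration.integral_cong) auto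

lemma L2_inner_add_left:
  assumes "f \<in> L2 \<Omega>" "g \<in> L2 \<Omega>" "h \<in> L2 \<Omega>"
  shows "L2_inner \<Omega> (\<lambda>x. f x + g x) h = L2_inner \<Omega> f h + L2_inner \<Omega> g h"
  unfolding L2_inner_def distrib_right
  by (rule Bochner_Integration.integral_add[OF L2_inner_integrable[OF assms(1,3)] L2_inner_integrable[OF assms(2,3)]])

lemma L2_inner_scale_left: "L2_inner \<Omega> (\<lambda>x. c * f x) h = c * L2_inner \<Omega> f h"
  unfolding L2_inner_def by (simp add: mult.assoc)

lemma L2_inner_diff_left:
  assumes "f \<in> L2 \<Omega>" "g \<in> L2 \<Omega>" "h \<in> L2 \<Omega>"
  shows "L2_inner \<Omega> (\<lambda>x. f x - g x) h = L2_inner \<Omega> f h - L2_inner \<Omega> g h"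
  unfolding L2_inner_def left_diff_distrib
  by (rule Bochner_Integration.integral_diff[OF L2_inner_integrable[OF assms(1,3)] L2_inner_integrable[OF assms(2,3)]])

lemma L2_inner_self: "L2_inner \<Omega> f f = of_real ((L2_norm \<Omega> f)\<^sup>2)"
proof -
  have "L2_inner \<Omega> f f = (LINT x|lebesgue_on \<Omega>. complex_of_real ((cmod (f x))\<^sup>2))"
    unfolding L2_inner_def by (simp only: complex_norm_square)
  then show ?thesis unfolding L2_norm_square by (simp only: integral_complex_of_real)
qed

lemma L2_norm_diff_square:
  assumes "f \<in> L2 \<Omega>" "g \<in> L2 \<Omega>"
  shows "(L2_norm \<Omega> (\<lambda>x. f x - g x))\<^sup>2 = (L2_norm \<Omega> f)\<^sup>2 - 2 * Re (L2_inner \<Omega> f g) + (L2_norm \<Omega> g)\<^sup>2"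
proof -
  define u where "u x = Re (f x * cnj (g x))" for x
  have e: "(cmod (f x - g x))\<^sup>2 = (cmod (f x))\<^sup>2 - 2 * u x + (cmod (g x))\<^sup>2" for x
    unfolding u_def by (simp only: cmod_power2) (simp add: power2_eq_square algebra_simps)
  have i: "integrable (lebesgue_on \<Omega>) u"
    unfolding u_def using L2_inner_integrable[OF assms] by (rule integrable_Re)
  have "integral\<^sup>L (lebesgue_on \<Omega>) u = Re (L2_inner \<Omega> f g)"
    unfolding u_def L2_inner_def using L2_inner_integrable[OF assms] by (rule integral_Re)
  then show ?thesis
    unfolding L2_norm_square e using i L2_integrable[OF assms(1)] L2_integrable[OF assms(2)] by simp
qed

lemma L2_norm_triangle:
  assumes "f \<in> L2 \<Omega>" "g \<in> L2 \<Omega>"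
  shows "L2_norm \<Omega> (\<lambda>x. f x - g x) \<le> L2_norm \<Omega> f + L2_norm \<Omega> g"
proof (rule power2_le_imp_le)
  have "- Re (L2_inner \<Omega> f g) \<le> L2_norm \<Omega> f * L2_norm \<Omega> g"
    using L2_inner_bound[OF assms] abs_Re_le_cmod[of "L2_inner \<Omega> f g"] by linarith
  then show "(L2_norm \<Omega> (\<lambda>x. f x - g x))\<^sup>2 \<le> (L2_norm \<Omega> f + L2_norm \<Omega> g)\<^sup>2"
    unfolding L2_norm_diff_square[OF assms] by (simp add: power2_sum)
qed (simp add: L2_norm_nonneg)

lemma L2_norm_parallelogram:
  assumes "f \<in> L2 \<Omega>" "g \<in> L2 \<Omega>"
  shows "(L2_norm \<Omega> (\<lambda>x. f x + g x))\<^sup>2 + (L2_norm \<Omega> (\<lambda>x. f x - g x))\<^sup>2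
    = 2 * (L2_norm \<Omega> f)\<^sup>2 + 2 * (L2_norm \<Omega> g)\<^sup>2"
proof -
  have s: "L2_norm \<Omega> (\<lambda>x. -1 * g x) = L2_norm \<Omega> g" using L2_scale(2)[OF assms(2), of "-1"] by simp
  have "L2_inner \<Omega> f (\<lambda>x. -1 * g x) = - L2_inner \<Omega> f g" unfolding L2_inner_def by simp
  then show ?thesis
    using L2_norm_diff_square[OF assms(1) L2_scale(1)[OF assms(2), of "-1"]] L2_norm_diff_square[OF assms]
    unfolding s by simp
qed

context
  fixes \<Omega> :: "'a::euclidean_space set"
  assumes bounded: "bounded \<Omega>" and open_\<Omega>: "open \<Omega>"
begin

lemma lmeasurable_bounded_open: "\<Omega> \<in> lmeasurable"
  using bounded open_\<Omega> by (rule lmeasurable_open)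

lemma finite_measure_domain: "finite_measure (lebesgue_on \<Omega>)"
  using lmeasurable_bounded_open by (rule finite_measure_lebesgue_on)

lemma L2_bounded:
  assumes "f \<in> borel_measurable (lebesgue_on \<Omega>)" "\<And>x. x \<in> \<Omega> \<Longrightarrow> cmod (f x) \<le> C" "C \<ge> 0"
  shows "f \<in> L2 \<Omega>" "L2_norm \<Omega> f \<le> C * sqrt (measure lebesgue \<Omega>)"
proof -
  interpret finite_measure "lebesgue_on \<Omega>" by (rule finite_measure_domain)
  note assms(1)[measurable]
  have i: "integrable (lebesgue_on \<Omega>) (\<lambda>x. (cmod (f x))\<^sup>2)"
    by (rule integrable_const_bound[where B="C\<^sup>2"]) (use assms in \<open>auto intro!: AE_I2 power_mono\<close>)
  then show "f \<in> L2 \<Omega>" using assms(1) by (simp add: L2_def)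
  have "(LINT x|lebesgue_on \<Omega>. (cmod (f x))\<^sup>2) \<le> (LINT x|lebesgue_on \<Omega>. C\<^sup>2)"
    by (rule integral_mono[OF i]) (use assms in \<open>auto intro!: power_mono\<close>)
  also have "\<dots> = C\<^sup>2 * measure lebesgue \<Omega>"
    using lmeasurable_bounded_open by (simp add: measure_restrict_space fmeasurableD)
  finally have "L2_norm \<Omega> f \<le> sqrt (C\<^sup>2 * measure lebesgue \<Omega>)"
    unfolding L2_norm_def by (rule real_sqrt_le_mono)
  then show "L2_norm \<Omega> f \<le> C * sqrt (measure lebesgue \<Omega>)"
    using assms(3) by (simp add: real_sqrt_mult)
qed

lemma L2_imp_L1:
  assumes "f \<in> L2 \<Omega>"
  shows "integrable (lebesgue_on \<Omega>) f"
    and "(LINT x|lebesgue_on \<Omega>. cmod (f x)) \<le> sqrt (measure lebesgue \<Omega>) * L2_norm \<Omega> f"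
proof -
  have one: "(\<lambda>x. 1) \<in> L2 \<Omega>" "L2_norm \<Omega> (\<lambda>x. 1) \<le> 1 * sqrt (measure lebesgue \<Omega>)"
    using L2_bounded[of "\<lambda>_. 1" 1] by auto
  show "integrable (lebesgue_on \<Omega>) f"
    using L2_inner_integrable[OF assms one(1)] by simp
  have "(LINT x|lebesgue_on \<Omega>. cmod (f x)) \<le> L2_norm \<Omega> f * L2_norm \<Omega> (\<lambda>x. 1)"
    using L2_Cauchy_Schwarz(2)[OF assms one(1)] by simp
  also have "\<dots> \<le> L2_norm \<Omega> f * sqrt (measure lebesgue \<Omega>)"
    using one(2) by (intro mult_left_mono L2_norm_nonneg) simp
  finally show "(LINT x|lebesgue_on \<Omega>. cmod (f x)) \<le> sqrt (measure lebesgue \<Omega>) * L2_norm \<Omega> f"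
    by (simp add: mult.commute)
qed

lemma continuous_measurable_domain:
  fixes f :: "'a \<Rightarrow> complex"
  shows "continuous_on \<Omega> f \<Longrightarrow> f \<in> borel_measurable (lebesgue_on \<Omega>)"
  using lmeasurable_bounded_open by (intro continuous_imp_measurable_on_sets_lebesgue) auto

lemma L2_integral_product:
  assumes "f \<in> L2 \<Omega>" "h \<in> borel_measurable (lebesgue_on \<Omega>)" "\<And>x. x \<in> \<Omega> \<Longrightarrow> cmod (h x) \<le> C"
  shows "(\<lambda>x. f x * h x) \<in> L2 \<Omega>"
proof -
  note m = L2_measurable[OF assms(1), measurable] assms(2)[measurable]
  have i: "integrable (lebesgue_on \<Omega>) (\<lambda>x. C\<^sup>2 * (cmod (f x))\<^sup>2)"
    using L2_integrable[OF assms(1)] by simp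
  have "integrable (lebesgue_on \<Omega>) (\<lambda>x. (cmod (f x * h x))\<^sup>2)"
  proof (rule Bochner_Integration.integrable_bound[OF i])
    show "AE x in lebesgue_on \<Omega>. norm ((cmod (f x * h x))\<^sup>2) \<le> norm (C\<^sup>2 * (cmod (f x))\<^sup>2)"
    proof (rule AE_I2)
      fix x assume "x \<in> space (lebesgue_on \<Omega>)"
      then have "(cmod (h x))\<^sup>2 \<le> C\<^sup>2" using assms(3) by (intro power_mono) auto
      from mult_right_mono[OF this, of "(cmod (f x))\<^sup>2"]
      show "norm ((cmod (f x * h x))\<^sup>2) \<le> norm (C\<^sup>2 * (cmod (f x))\<^sup>2)"
        by (simp add: norm_mult power_mult_distrib mult.commute)
    qed
  qed measurable
  then show ?thesis by (simp add: L2_def)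
qed

end

section \<open>Reproducing kernels for holomorphic functions\<close>

lemma nn_integral_lborel_translation:
  fixes f :: "'a::euclidean_space \<Rightarrow> ennreal"
  assumes [measurable]: "f \<in> borel_measurable borel"
  shows "(\<integral>\<^sup>+x. f (c + x) \<partial>lborel) = (\<integral>\<^sup>+x. f x \<partial>lborel)"
proof -
  have "(\<integral>\<^sup>+x. f x \<partial>lborel) = (\<integral>\<^sup>+x. f x \<partial>distr lborel borel ((+) c))"
    by (subst lborel_distr_plus) (rule refl)
  also have "\<dots> = (\<integral>\<^sup>+x. f (c + x) \<partial>lborel)"
    by (rule nn_integral_distr) auto
  finally show ?thesis by simp
qed

text \<open>This is the uniqueness argument for Haar measure: with the indicator \<open>f\<close> of the unit ball,
  evaluate the double integral of \<open>f (R x) * g y\<close> by shifting \<open>y\<close> by \<open>R x\<close> and then \<open>x\<close> by the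
  preimage of \<open>-y\<close>.\<close>

lemma lborel_distr_isometry:
  fixes R :: "'a::euclidean_space \<Rightarrow> 'a"
  assumes lin: "linear R" and iso: "\<And>x. norm (R x) = norm x" and surj: "surj R"
  shows "distr lborel borel R = lborel"
proof (rule measure_eqI)
  have Rm [measurable]: "R \<in> borel_measurable borel"
    using linear_continuous_on[of R UNIV] lin
    by (intro borel_measurable_continuous_onI) (simp add: linear_conv_bounded_linear)
  fix X assume "X \<in> sets (distr lborel borel R)"
  then have X [measurable]: "X \<in> sets borel" by simp
  define f :: "'a \<Rightarrow> ennreal" where "f = indicator (ball 0 1)"
  define g :: "'a \<Rightarrow> ennreal" where "g = indicator X"
  have fm [measurable]: "f \<in> borel_measurable borel" unfolding f_def by (rule borel_measurable_indicator) simp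
  have gm [measurable]: "g \<in> borel_measurable borel" unfolding g_def by (rule borel_measurable_indicator) (rule X)
  define V where "V = (\<integral>\<^sup>+y. f y \<partial>lborel)"
  have "V = emeasure lborel (ball (0::'a) 1)" unfolding V_def f_def by simp
  then have V: "V \<noteq> 0" "V < \<infinity>"
    using content_ball_pos[of 1 "0::'a"] emeasure_bounded_finite[OF bounded_ball, of "0::'a" 1]
    by (auto simp: measure_def)
  have V_shift: "(\<integral>\<^sup>+y. f (a - y) \<partial>lborel) = V" for a
  proof -
    have "(\<integral>\<^sup>+y. f (a - y) \<partial>lborel) = (\<integral>\<^sup>+y. f (- a + y) \<partial>lborel)"
      by (intro nn_integral_cong) (auto simp: f_def indicator_def dist_norm norm_minus_commute)
    also have "\<dots> = V" unfolding V_def by (rule nn_integral_lborel_translation) measurable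
    finally show ?thesis .
  qed
  have fR: "f (R x) = f x" for x by (auto simp: f_def indicator_def iso)
  have "V * (\<integral>\<^sup>+y. g y \<partial>lborel) = (\<integral>\<^sup>+x. (\<integral>\<^sup>+y. f (R x) * g y \<partial>lborel) \<partial>lborel)"
    by (simp add: fR nn_integral_cmult nn_integral_multc V_def)
  also have "\<dots> = (\<integral>\<^sup>+x. (\<integral>\<^sup>+y. f (R x) * g (R x + y) \<partial>lborel) \<partial>lborel)"
    by (simp add: nn_integral_cmult nn_integral_lborel_translation)
  also have "\<dots> = (\<integral>\<^sup>+y. (\<integral>\<^sup>+x. f (R x) * g (R x + y) \<partial>lborel) \<partial>lborel)"
    by (rule lborel_pair.Fubini') measurable
  also have "\<dots> = (\<integral>\<^sup>+y. (\<integral>\<^sup>+x. f (R x - y) * g (R x) \<partial>lborel) \<partial>lborel)"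
  proof (rule nn_integral_cong)
    fix y
    obtain z where z: "R z = - y" using surj by (metis surjD)
    have "(\<integral>\<^sup>+x. f (R x) * g (R x + y) \<partial>lborel) = (\<integral>\<^sup>+x. f (R (z + x)) * g (R (z + x) + y) \<partial>lborel)"
      by (rule nn_integral_lborel_translation[symmetric]) measurable
    also have "\<dots> = (\<integral>\<^sup>+x. f (R x - y) * g (R x) \<partial>lborel)"
      by (simp add: linear_add[OF lin] z)
    finally show "(\<integral>\<^sup>+x. f (R x) * g (R x + y) \<partial>lborel) = (\<integral>\<^sup>+x. f (R x - y) * g (R x) \<partial>lborel)" .
  qed
  also have "\<dots> = (\<integral>\<^sup>+x. (\<integral>\<^sup>+y. f (R x - y) * g (R x) \<partial>lborel) \<partial>lborel)"
    by (rule lborel_pair.Fubini') measurable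
  also have "\<dots> = V * (\<integral>\<^sup>+x. g (R x) \<partial>lborel)"
    by (simp add: nn_integral_multc V_shift nn_integral_cmult)
  finally have "(\<integral>\<^sup>+y. g y \<partial>lborel) = (\<integral>\<^sup>+x. g (R x) \<partial>lborel)"
    using V by (auto simp: ennreal_mult_cancel_left)
  also have "(\<integral>\<^sup>+x. g (R x) \<partial>lborel) = (\<integral>\<^sup>+x. g x \<partial>distr lborel borel R)"
    by (rule nn_integral_distr[symmetric]) auto
  finally show "emeasure (distr lborel borel R) X = emeasure lborel X"
    by (simp add: g_def)
qed simp

lemma norm_vector_smult: "norm (c *s w) = norm c * norm (w :: complex ^ 'n)"
  by (simp add: norm_vec_def norm_mult L2_set_right_distrib)

lemma linear_vector_smult: "linear (\<lambda>w :: complex ^ 'n. c *s w)"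
  by (rule linearI) (simp_all add: vec_eq_iff algebra_simps)

lemma lborel_integral_rotation:
  fixes f :: "complex ^ 'n \<Rightarrow> complex"
  assumes "cmod c = 1" "f \<in> borel_measurable borel"
  shows "integral\<^sup>L lborel (\<lambda>w. f (c *s w)) = integral\<^sup>L lborel f"
proof -
  have c: "c \<noteq> 0" using assms(1) by auto
  have "surj (\<lambda>w :: complex ^ 'n. c *s w)"
    by (rule surjI[where f="\<lambda>w. inverse c *s w"]) (simp add: vec_eq_iff c)
  then have d: "distr lborel borel (\<lambda>w :: complex ^ 'n. c *s w) = lborel"
    by (intro lborel_distr_isometry linear_vector_smult) (simp_all add: norm_vector_smult assms(1))
  have "continuous_on UNIV (\<lambda>w :: complex ^ 'n. c *s w)"
    using linear_continuous_on[of "\<lambda>w :: complex ^ 'n. c *s w" UNIV] linear_vector_smult[of c]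
    by (simp add: linear_conv_bounded_linear)
  then have m: "(\<lambda>w :: complex ^ 'n. c *s w) \<in> borel_measurable borel"
    by (rule borel_measurable_continuous_onI)
  have "integral\<^sup>L lborel f = integral\<^sup>L (distr lborel borel (\<lambda>w :: complex ^ 'n. c *s w)) f"
    by (simp add: d)
  also have "\<dots> = integral\<^sup>L lborel (\<lambda>w. f (c *s w))"
    using assms(2) m by (intro integral_distr) auto
  finally show ?thesis by simp
qed

lemma holomorphic_svE:
  assumes "holomorphic_sv \<Omega> h" "z \<in> \<Omega>"
  obtains D where "(h has_derivative D) (at z)" "\<And>c v. D (c *s v) = c * D v"
  using assms unfolding holomorphic_sv_def by blast

lemma holomorphic_sv_continuous: "holomorphic_sv \<Omega> h \<Longrightarrow> continuous_on \<Omega> h"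
  unfolding holomorphic_sv_def
  by (meson continuous_at_imp_continuous_on differentiableI differentiable_imp_continuous_within)

text \<open>Cauchy's formula at the centre of the disc in the complex line through \<open>z\<close> in direction \<open>w\<close>.\<close>

lemma circle_mean_value:
  fixes h :: "complex ^ 'n \<Rightarrow> complex"
  assumes "holomorphic_sv \<Omega> h" "t > 0" "cball z t \<subseteq> \<Omega>" "norm w \<le> 1"
  shows "((\<lambda>\<tau>. h (z + t *\<^sub>R (exp (of_real (2 * pi * \<tau>) * \<i>) *s w))) has_integral h z) {0..1::real}"
proof -
  define g where "g \<zeta> = h (z + t *\<^sub>R (\<zeta> *s w))" for \<zeta>
  have "g field_differentiable (at \<zeta>)" if "\<zeta> \<in> cball 0 1" for \<zeta>
  proof -
    have "cmod \<zeta> * norm w \<le> 1 * 1" using that assms(4) by (intro mult_mono) auto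
    then have "norm (t *\<^sub>R (\<zeta> *s w)) \<le> t * (1 * 1)"
      using assms(2) by (simp add: norm_vector_smult)
    then have "z + t *\<^sub>R (\<zeta> *s w) \<in> \<Omega>" using assms(3) by (auto simp: dist_norm)
    then obtain D where D: "(h has_derivative D) (at (z + t *\<^sub>R (\<zeta> *s w)))" "\<And>c v. D (c *s v) = c * D v"
      using holomorphic_svE[OF assms(1)] by blast
    have "bounded_linear (\<lambda>\<zeta>. t *\<^sub>R (\<zeta> *s w))"
      unfolding linear_conv_bounded_linear[symmetric]
      by (rule linearI) (simp_all add: vec_eq_iff algebra_simps)
    from has_derivative_add[OF has_derivative_const[of z] bounded_linear_imp_has_derivative[OF this]]
    have "((\<lambda>\<zeta>. z + t *\<^sub>R (\<zeta> *s w)) has_derivative (\<lambda>\<zeta>. t *\<^sub>R (\<zeta> *s w))) (at \<zeta>)"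
      by simp
    from has_derivative_compose[where g=h, OF this D(1)]
    have "(g has_derivative (\<lambda>\<xi>. D (t *\<^sub>R (\<xi> *s w)))) (at \<zeta>)" unfolding g_def .
    moreover have "D (t *\<^sub>R (\<xi> *s w)) = (of_real t * D w) * \<xi>" for \<xi>
      unfolding linear_cmul[OF has_derivative_linear[OF D(1)]] D(2)
      by (simp add: scaleR_conv_of_real mult_ac)
    ultimately have "(g has_field_derivative (of_real t * D w)) (at \<zeta>)"
      unfolding has_field_derivative_def by simp
    then show ?thesis unfolding field_differentiable_def by blast
  qed
  then have "continuous_on (cball 0 1) g" "g holomorphic_on ball 0 1"
    by (auto intro!: continuous_at_imp_continuous_on field_differentiable_imp_continuous_at
        simp: holomorphic_on_def intro: field_differentiable_at_within)
  then have "((\<lambda>u. g u / (u - 0)) has_contour_integral (2 * of_real pi * \<i> * g 0)) (circlepath 0 1)"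
    by (intro Cauchy_integral_circlepath) auto
  then have "((\<lambda>x. g (exp (2 * of_real pi * \<i> * of_real x)) / exp (2 * of_real pi * \<i> * of_real x) *
      (2 * of_real pi * \<i> * exp (2 * of_real pi * \<i> * of_real x))) has_integral (2 * of_real pi * \<i> * g 0)) {0..1}"
    unfolding has_contour_integral_def
  proof (rule has_integral_eq[rotated])
    fix x :: real assume x: "x \<in> {0..1}"
    have c: "circlepath 0 1 x = exp (2 * of_real pi * \<i> * of_real x)" by (simp add: circlepath)
    have d: "vector_derivative (circlepath 0 1) (at x within {0..1})
        = 2 * of_real pi * \<i> * exp (2 * of_real pi * \<i> * of_real x)"
      using x by (subst vector_derivative_circlepath01) auto
    show "g (circlepath 0 1 x) / (circlepath 0 1 x - 0) * vector_derivative (circlepath 0 1) (at x within {0..1})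
        = g (exp (2 * of_real pi * \<i> * of_real x)) / exp (2 * of_real pi * \<i> * of_real x) *
          (2 * of_real pi * \<i> * exp (2 * of_real pi * \<i> * of_real x))"
      unfolding d c by simp
  qed
  then have "((\<lambda>x. (1 / (2 * of_real pi * \<i>)) * (g (exp (2 * of_real pi * \<i> * of_real x)) / exp (2 * of_real pi * \<i> * of_real x) *
      (2 * of_real pi * \<i> * exp (2 * of_real pi * \<i> * of_real x)))) has_integral (1 / (2 * of_real pi * \<i>)) * (2 * of_real pi * \<i> * g 0)) {0..1}"
    by (rule has_integral_mult_right)
  then have "((\<lambda>x. g (exp (of_real (2 * pi * x) * \<i>))) has_integral g 0) {0..1}"
    by (simp add: mult_ac)
  then show ?thesis by (simp add: g_def)
qed

subsection \<open>A radial bump function\<close>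

definition bump :: "'a::euclidean_space \<Rightarrow> real" where
  "bump x = flat 0 (1 - x \<bullet> x)"

lemma smooth_on_inner_self: "smooth_on UNIV (\<lambda>x::'a::euclidean_space. x \<bullet> x)"
proof -
  have "smooth_on UNIV (\<lambda>x::'a. \<Sum>b\<in>Basis. (x \<bullet> b) ^ 2)"
    by (intro smooth_on_sum smooth_on_power smooth_on_bounded_linear bounded_linear_inner_left open_UNIV)
  moreover have "(\<Sum>b\<in>Basis. (x \<bullet> b) ^ 2) = x \<bullet> x" for x :: 'a
    by (simp add: euclidean_inner[of x x] power2_eq_square)
  ultimately show ?thesis by simp
qed

lemma smooth_on_bump: "smooth_on UNIV bump"
  unfolding bump_def
  by (intro smooth_on_flat smooth_on_diff smooth_on_const smooth_on_inner_self open_UNIV)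

lemma bump_nonneg: "bump x \<ge> 0"
  by (simp add: bump_def flat_nonneg)

lemma bump_outside: "norm x \<ge> 1 \<Longrightarrow> bump x = 0"
proof -
  assume "norm x \<ge> 1"
  then have "1 \<le> (norm x)\<^sup>2" by (simp add: one_le_power)
  then have "x \<bullet> x \<ge> 1" by (simp add: dot_square_norm)
  then show ?thesis by (simp add: bump_def flat_nonpos)
qed

lemma bump_inside:
  assumes "norm x < 1"
  shows "bump x > 0"
proof -
  have "(norm x)\<^sup>2 < 1" using assms by (simp add: power_less_one_iff)
  then have "x \<bullet> x < 1" by (simp add: dot_square_norm)
  then show ?thesis by (simp add: bump_def flat_pos)
qed

lemma continuous_bump: "continuous_on UNIV bump"
  using smooth_on_bump by (rule smooth_on_continuous)

lemma integrable_bump: "integrable lborel bump"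
  by (rule integrable_continuous_bounded_support[OF continuous_bump, of 1]) (simp add: bump_outside)

lemma integral_bump_pos: "integral\<^sup>L lborel (bump :: 'a::euclidean_space \<Rightarrow> real) > 0"
proof (rule ccontr)
  assume "\<not> ?thesis"
  moreover have "integral\<^sup>L lborel (bump :: 'a \<Rightarrow> real) \<ge> 0"
    by (intro Bochner_Integration.integral_nonneg bump_nonneg)
  ultimately have "integral\<^sup>L lborel (bump :: 'a \<Rightarrow> real) = 0" by linarith
  then have "AE x in lborel. bump (x::'a) = 0"
    using integral_nonneg_eq_0_iff_AE[OF integrable_bump] bump_nonneg by auto
  moreover have "bump x \<noteq> 0" if "x \<in> ball 0 1" for x :: 'a
    using bump_inside[of x] that by simp
  ultimately have "AE x in lborel. (x::'a) \<notin> ball 0 1" by (auto elim: eventually_mono)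
  then have "emeasure lborel (ball (0::'a) 1) = 0"
    by (subst (asm) AE_iff_measurable[of "ball 0 1"]) auto
  then show False using content_ball_pos[of 1 "0::'a"] by (simp add: measure_def)
qed

lemma bump_rotation: "cmod c = 1 \<Longrightarrow> bump (c *s w) = bump (w :: complex ^ 'n)"
  unfolding bump_def by (simp add: dot_square_norm norm_vector_smult)

lemma smooth_bounded_compact_support:
  fixes u :: "'a::euclidean_space \<Rightarrow> complex"
  assumes "smooth_on UNIV u" "\<And>x. x \<notin> cball 0 R \<Longrightarrow> u x = 0"
  shows "smooth_bounded UNIV u"
proof (rule smooth_boundedI[OF assms(1)])
  fix bs :: "'a list" assume bs: "set bs \<subseteq> Basis"
  have "continuous_on (cball 0 R) (partials bs u)"
    using smooth_on_partials_continuous[OF assms(1) bs] by (rule continuous_on_subset) simp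
  then have "bounded (partials bs u ` cball 0 R)"
    by (intro compact_imp_bounded compact_continuous_image compact_cball)
  then obtain C where "\<forall>y\<in>partials bs u ` cball 0 R. cmod y \<le> C"
    unfolding bounded_iff by blast
  then have C: "cmod (partials bs u x) \<le> C" if "x \<in> cball 0 R" for x
    using that by blast
  have "partials bs u x = 0" if "x \<notin> cball 0 R" for x
    using partials_cong[of "- cball 0 R" x u "\<lambda>x. 0" bs] assms(2) that by (simp add: open_Compl partials_zero)
  then have "cmod (partials bs u x) \<le> \<bar>C\<bar>" for x
    using C[of x] by (cases "x \<in> cball 0 R") auto
  then show "\<exists>C. \<forall>x\<in>UNIV. cmod (partials bs u x) \<le> C" by blast
qed

text \<open>The multiplication by complex numbers of modulus \<open>1\<close> preserves the bump and the measure. So the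
  integral does not change when the integrand is averaged over these rotations, and on each
  complex line through \<open>z\<close> the average is given by the mean value property.\<close>

lemma holomorphic_reproducing_formula:
  fixes h :: "complex ^ 'n \<Rightarrow> complex"
  assumes h: "holomorphic_sv \<Omega> h" and \<Omega>: "open \<Omega>" and t: "t > 0" and ball: "cball z t \<subseteq> \<Omega>"
  shows "h z * of_real (t ^ DIM(complex ^ 'n) * integral\<^sup>L lborel (bump :: complex ^ 'n \<Rightarrow> real))
    = (LINT x|lebesgue_on \<Omega>. h x * of_real (bump ((1 / t) *\<^sub>R (z - x))))"
proof -
  define H where "H w = h (z + t *\<^sub>R w) * of_real (bump w)" for w
  define S1 where "S1 = (\<lambda>w. z + t *\<^sub>R w) -` \<Omega>"
  define S2 where "S2 = {w :: complex ^ 'n. norm w > 1}"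
  have ho: "H w = 0" if "norm w \<ge> 1" for w using bump_outside[OF that] by (simp add: H_def)
  have in\<Omega>: "z + t *\<^sub>R w \<in> \<Omega>" if "norm w \<le> 1" for w
    using ball that t by (auto simp: dist_norm)
  have open1: "open S1" unfolding S1_def
    by (rule continuous_open_vimage[OF \<Omega>]) (auto intro!: continuous_intros)
  have "open {w :: complex ^ 'n. 1 < norm w}"
    by (intro open_Collect_less continuous_intros)
  then have open2: "open S2" unfolding S2_def .
  have "continuous_on S1 H" unfolding H_def
    by (intro continuous_intros continuous_on_compose2[OF holomorphic_sv_continuous[OF h]]
        continuous_on_subset[OF continuous_bump]) (auto simp: S1_def)
  moreover have "continuous_on S2 H"
    using ho by (subst continuous_on_cong[of S2 S2 H "\<lambda>_. 0"]) (auto simp: S2_def)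
  ultimately have "continuous_on (S1 \<union> S2) H"
    using continuous_on_open_Un[OF open1 open2] by blast
  moreover have "S1 \<union> S2 = UNIV" using in\<Omega> unfolding S1_def S2_def by (auto simp: not_less)
  ultimately have cont: "continuous_on UNIV H" by simp
  define c where "c \<tau> = exp (of_real (2 * pi * \<tau>) * \<i>)" for \<tau> :: real
  have c1: "cmod (c \<tau>) = 1" for \<tau> unfolding c_def by simp
  define J where "J = integral\<^sup>L lborel H"
  obtain a where a: "cball 0 1 \<subseteq> cbox (- a) (a :: complex ^ 'n)"
    using bounded_subset_cbox_symmetric[OF bounded_cball] by blast
  have HK: "integral (cbox (- a) a) G = integral\<^sup>L lborel G"
    if G: "continuous_on UNIV G" "\<And>w. norm w \<ge> 1 \<Longrightarrow> G w = 0" for G :: "complex ^ 'n \<Rightarrow> complex"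
  proof -
    have "integrable lborel G"
      using G by (intro integrable_continuous_bounded_support[of G 1]) auto
    then have "integral UNIV G = integral\<^sup>L lborel G" by (rule integral_lborel)
    moreover have "(\<lambda>w. if w \<in> cbox (- a) a then G w else 0) = G"
      using a G(2) by (auto simp: fun_eq_iff subset_iff) (metis linear)
    ultimately show ?thesis
      using Henstock_Kurzweil_Integration.integral_restrict_UNIV[of "cbox (- a) a" G] by simp
  qed
  have contc: "continuous_on UNIV (\<lambda>(\<tau>, w). H (c \<tau> *s w))"
    unfolding c_def vector_scalar_mult_def split_beta
    by (intro continuous_on_compose2[OF cont] continuous_intros) auto
  have rot: "integral (cbox (- a) a) (\<lambda>w. H (c \<tau> *s w)) = J" for \<tau>
  proof -
    have "continuous_on UNIV (\<lambda>w. H (c \<tau> *s w))"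
      unfolding vector_scalar_mult_def by (intro continuous_on_compose2[OF cont] continuous_intros) auto
    then have "integral (cbox (- a) a) (\<lambda>w. H (c \<tau> *s w)) = integral\<^sup>L lborel (\<lambda>w. H (c \<tau> *s w))"
      by (rule HK) (simp add: ho norm_vector_smult c1)
    also have "\<dots> = J" unfolding J_def
      by (rule lborel_integral_rotation[OF c1 borel_measurable_continuous_onI[OF cont]])
    finally show ?thesis .
  qed
  have avg: "integral (cbox 0 1) (\<lambda>\<tau>. H (c \<tau> *s w)) = h z * of_real (bump w)" for w
  proof (cases "norm w \<le> 1")
    case True
    have "((\<lambda>\<tau>. H (c \<tau> *s w)) has_integral h z * of_real (bump w)) {0..1}"
      unfolding H_def bump_rotation[OF c1] unfolding c_def
      by (rule has_integral_mult_left[OF circle_mean_value[OF h t ball True]])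
    then show ?thesis by (simp add: integral_unique)
  next
    case False
    then show ?thesis by (simp add: ho norm_vector_smult c1 bump_outside)
  qed
  have "J = integral (cbox 0 1) (\<lambda>\<tau>::real. J)" by simp
  also have "\<dots> = integral (cbox 0 1) (\<lambda>\<tau>. integral (cbox (- a) a) (\<lambda>w. H (c \<tau> *s w)))"
    by (simp only: rot)
  also have "\<dots> = integral (cbox (- a) a) (\<lambda>w. integral (cbox 0 1) (\<lambda>\<tau>. H (c \<tau> *s w)))"
    by (rule integral_swap_continuous) (rule continuous_on_subset[OF contc subset_UNIV])
  also have "\<dots> = integral (cbox (- a) a) (\<lambda>w. h z * of_real (bump w))"
    by (simp only: avg)
  also have "\<dots> = integral\<^sup>L lborel (\<lambda>w :: complex ^ 'n. h z * of_real (bump w))"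
    by (rule HK) (auto intro!: continuous_intros continuous_bump simp: bump_outside)
  also have "\<dots> = h z * of_real (integral\<^sup>L lborel (bump :: complex ^ 'n \<Rightarrow> real))"
    by simp
  finally have J: "J = h z * of_real (integral\<^sup>L lborel (bump :: complex ^ 'n \<Rightarrow> real))" .
  define F where "F x = (if x \<in> \<Omega> then h x * of_real (bump ((1 / t) *\<^sub>R (z - x))) else 0)" for x
  have even: "bump (- y) = bump y" for y :: "complex ^ 'n" by (simp add: bump_def)
  have FH: "F x = H ((1 / t) *\<^sub>R (x - z))" for x
  proof -
    have "bump ((1 / t) *\<^sub>R (z - x)) = bump ((1 / t) *\<^sub>R (x - z))"
      using even[of "(1 / t) *\<^sub>R (x - z)"] by (simp add: scaleR_diff_right)
    moreover have "z + t *\<^sub>R ((1 / t) *\<^sub>R (x - z)) = x" using t by simp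
    moreover have "norm ((1 / t) *\<^sub>R (x - z)) > 1" if "x \<notin> \<Omega>"
      using in\<Omega>[of "(1 / t) *\<^sub>R (x - z)"] that t by (force simp: not_less)
    ultimately show ?thesis
      unfolding F_def H_def using bump_outside[of "(1 / t) *\<^sub>R (x - z)"] by auto
  qed
  have "continuous_on UNIV F"
    unfolding FH by (intro continuous_on_compose2[OF cont] continuous_intros) auto
  then have Fm: "F \<in> borel_measurable borel" by (rule borel_measurable_continuous_onI)
  have FA: "F (z + t *\<^sub>R x) = H x" for x using t by (simp add: FH)
  have "integral\<^sup>L lborel F
      = integral\<^sup>L (density (distr lborel borel (\<lambda>x. z + t *\<^sub>R x)) (\<lambda>_. ennreal (\<bar>t\<bar> ^ DIM(complex ^ 'n)))) F"
    using lborel_affine[of t z] t by simp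
  also have "\<dots> = integral\<^sup>L (distr lborel borel (\<lambda>x. z + t *\<^sub>R x)) (\<lambda>x. \<bar>t\<bar> ^ DIM(complex ^ 'n) *\<^sub>R F x)"
    using Fm by (intro integral_density) auto
  also have "\<dots> = integral\<^sup>L lborel (\<lambda>x. \<bar>t\<bar> ^ DIM(complex ^ 'n) *\<^sub>R F (z + t *\<^sub>R x))"
    using Fm by (intro integral_distr) auto
  also have "\<dots> = of_real (t ^ DIM(complex ^ 'n)) * J"
    using t unfolding FA J_def by (simp add: scaleR_conv_of_real)
  finally have "integral\<^sup>L lborel F = of_real (t ^ DIM(complex ^ 'n)) * J" .
  moreover have "integral\<^sup>L lborel F = (LINT x|lebesgue_on \<Omega>. h x * of_real (bump ((1 / t) *\<^sub>R (z - x))))"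
    using lebesgue_on_integral_zero_extension[of \<Omega> "\<lambda>x. h x * of_real (bump ((1 / t) *\<^sub>R (z - x)))"]
      Fm \<Omega> unfolding F_def by simp
  ultimately show ?thesis using J by (simp add: mult_ac)
qed

subsection \<open>Convolution with smooth kernels\<close>

lemma smooth_bounded_Lipschitz:
  fixes u :: "'a::euclidean_space \<Rightarrow> complex"
  assumes "smooth_bounded UNIV u"
  obtains C where "C \<ge> 0" "\<And>x y. cmod (u y - u x) \<le> C * norm (y - x)"
proof -
  have "\<forall>b\<in>Basis. \<exists>C\<ge>0. \<forall>x. cmod (partial b u x) \<le> C"
    using smooth_boundedE[OF assms, of "[_]"] by (simp add: partials_Cons) metis
  then obtain C where C: "\<And>b x. b \<in> Basis \<Longrightarrow> C b \<ge> 0" "\<And>b x. b \<in> Basis \<Longrightarrow> cmod (partial b u x) \<le> C b"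
    by metis
  have "cmod (u y - u x) \<le> sum C Basis * norm (y - x)" for x y
  proof (rule differentiable_bound[where S=UNIV and f'="\<lambda>x h. \<Sum>b\<in>Basis. (h \<bullet> b) *\<^sub>R partial b u x"])
    fix x
    show "(u has_derivative (\<lambda>h. \<Sum>b\<in>Basis. (h \<bullet> b) *\<^sub>R partial b u x)) (at x within UNIV)"
      using smooth_on_has_derivative[OF smooth_bounded_smooth[OF assms]] by auto
    show "onorm (\<lambda>h. \<Sum>b\<in>Basis. (h \<bullet> b) *\<^sub>R partial b u x) \<le> sum C Basis"
    proof (rule onorm_bound)
      fix h
      have "cmod (\<Sum>b\<in>Basis. (h \<bullet> b) *\<^sub>R partial b u x) \<le> (\<Sum>b\<in>Basis. norm h * C b)"
      proof (rule sum_norm_le)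
        fix b :: 'a assume b: "b \<in> Basis"
        show "cmod ((h \<bullet> b) *\<^sub>R partial b u x) \<le> norm h * C b"
          using Basis_le_norm[OF b, of h] C[OF b] by (auto intro!: mult_mono)
      qed
      also have "\<dots> = norm h * sum C Basis" by (rule sum_distrib_left[symmetric])
      finally show "cmod (\<Sum>b\<in>Basis. (h \<bullet> b) *\<^sub>R partial b u x) \<le> sum C Basis * norm h"
        by (subst mult.commute)
    qed (auto intro: sum_nonneg C)
  qed auto
  then show thesis using that[of "sum C Basis"] C by (auto intro: sum_nonneg)
qed

lemma smooth_bounded_Taylor:
  fixes u :: "'a::euclidean_space \<Rightarrow> complex"
  assumes "smooth_bounded UNIV u"
  obtains C where "C \<ge> 0"
    "\<And>x y. cmod (u y - u x - (\<Sum>b\<in>Basis. ((y - x) \<bullet> b) *\<^sub>R partial b u x)) \<le> C * (norm (y - x))\<^sup>2"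
proof -
  have "\<forall>b\<in>Basis. \<exists>C\<ge>0. \<forall>x y. cmod (partial b u y - partial b u x) \<le> C * norm (y - x)"
    using smooth_bounded_Lipschitz[OF smooth_bounded_partial[OF assms]] by metis
  then obtain C where C: "\<And>b. b \<in> Basis \<Longrightarrow> C b \<ge> 0"
    "\<And>b x y. b \<in> Basis \<Longrightarrow> cmod (partial b u y - partial b u x) \<le> C b * norm (y - x)" by metis
  have S: "sum C Basis \<ge> 0" by (auto intro: sum_nonneg C)
  have "cmod (u y - u x - (\<Sum>b\<in>Basis. ((y - x) \<bullet> b) *\<^sub>R partial b u x)) \<le> sum C Basis * (norm (y - x))\<^sup>2" for x y
  proof -
    define g where "g v = u v - (\<Sum>b\<in>Basis. (v \<bullet> b) *\<^sub>R partial b u x)" for v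
    have "cmod (g y - g x) \<le> (sum C Basis * norm (y - x)) * norm (y - x)"
    proof (rule differentiable_bound[where S="cball x (norm (y - x))"
          and f'="\<lambda>v h. (\<Sum>b\<in>Basis. (h \<bullet> b) *\<^sub>R partial b u v) - (\<Sum>b\<in>Basis. (h \<bullet> b) *\<^sub>R partial b u x)"])
      fix v assume v: "v \<in> cball x (norm (y - x))"
      have "(u has_derivative (\<lambda>h. \<Sum>b\<in>Basis. (h \<bullet> b) *\<^sub>R partial b u v)) (at v)"
        using smooth_on_has_derivative[OF smooth_bounded_smooth[OF assms]] by auto
      moreover have "((\<lambda>v. \<Sum>b\<in>Basis. (v \<bullet> b) *\<^sub>R partial b u x) has_derivative
          (\<lambda>h. \<Sum>b\<in>Basis. (h \<bullet> b) *\<^sub>R partial b u x)) (at v)"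
        by (intro bounded_linear_imp_has_derivative bounded_linear_sum
            bounded_linear_compose[OF bounded_linear_scaleR_left] bounded_linear_inner_left)
      ultimately show "(g has_derivative (\<lambda>h. (\<Sum>b\<in>Basis. (h \<bullet> b) *\<^sub>R partial b u v) -
          (\<Sum>b\<in>Basis. (h \<bullet> b) *\<^sub>R partial b u x))) (at v within cball x (norm (y - x)))"
        unfolding g_def by (rule has_derivative_at_withinI[OF has_derivative_diff])
      show "onorm (\<lambda>h. (\<Sum>b\<in>Basis. (h \<bullet> b) *\<^sub>R partial b u v) - (\<Sum>b\<in>Basis. (h \<bullet> b) *\<^sub>R partial b u x))
          \<le> sum C Basis * norm (y - x)"
      proof (rule onorm_bound)
        fix h
        have "cmod (\<Sum>b\<in>Basis. (h \<bullet> b) *\<^sub>R (partial b u v - partial b u x)) \<le> (\<Sum>b\<in>Basis. norm h * (C b * norm (y - x)))"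
        proof (rule sum_norm_le)
          fix b :: 'a assume b: "b \<in> Basis"
          have "cmod (partial b u v - partial b u x) \<le> C b * norm (v - x)" by (rule C(2)[OF b])
          also have "\<dots> \<le> C b * norm (y - x)"
            using v C(1)[OF b] by (intro mult_left_mono) (auto simp: dist_norm norm_minus_commute)
          finally show "cmod ((h \<bullet> b) *\<^sub>R (partial b u v - partial b u x)) \<le> norm h * (C b * norm (y - x))"
            using Basis_le_norm[OF b, of h] by (auto intro!: mult_mono)
        qed
        also have "\<dots> = norm h * (sum C Basis * norm (y - x))"
          by (simp only: sum_distrib_left[symmetric] sum_distrib_right[symmetric])
        finally show "cmod ((\<Sum>b\<in>Basis. (h \<bullet> b) *\<^sub>R partial b u v) - (\<Sum>b\<in>Basis. (h \<bullet> b) *\<^sub>R partial b u x))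
            \<le> sum C Basis * norm (y - x) * norm h"
          by (simp only: sum_subtractf[symmetric] scaleR_diff_right[symmetric] mult.commute[of "norm h"])
      qed (use S in auto)
    qed (auto simp: dist_norm norm_minus_commute)
    moreover have "g y - g x = u y - u x - (\<Sum>b\<in>Basis. ((y - x) \<bullet> b) *\<^sub>R partial b u x)"
      unfolding g_def by (simp add: inner_diff_left scaleR_diff_left sum_subtractf)
    ultimately show ?thesis by (simp add: power2_eq_square mult.assoc)
  qed
  then show thesis using that S by blast
qed

lemma has_derivative_quadratic_error:
  fixes f :: "'a::real_normed_vector \<Rightarrow> 'b::real_normed_vector"
  assumes "bounded_linear D" "\<And>y. norm (f y - f x - D (y - x)) \<le> C * (norm (y - x))\<^sup>2"
  shows "(f has_derivative D) (at x)"
proof -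
  interpret D: bounded_linear D by fact
  have "((\<lambda>y. f y - f x - D (y - x)) has_derivative (\<lambda>_. 0)) (at x)"
    using assms(2) by (intro quadratic_has_derivative_zero[of _ C]) (simp add: dist_norm)
  moreover have "((\<lambda>y. f x + D (y - x)) has_derivative (\<lambda>h. 0 + D (h - 0))) (at x)"
    by (intro has_derivative_add has_derivative_const D.has_derivative has_derivative_diff has_derivative_ident)
  ultimately have "((\<lambda>y. (f y - f x - D (y - x)) + (f x + D (y - x))) has_derivative (\<lambda>h. 0 + (0 + D (h - 0)))) (at x)"
    by (rule has_derivative_add)
  then show ?thesis by simp
qed

context
  fixes \<Omega> :: "'a::euclidean_space set" and f :: "'a \<Rightarrow> complex"
  assumes bounded: "bounded \<Omega>" and open_\<Omega>: "open \<Omega>" and f: "integrable (lebesgue_on \<Omega>) f"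
begin

lemma integrable_convolution:
  assumes "smooth_bounded UNIV k"
  shows "integrable (lebesgue_on \<Omega>) (\<lambda>x. f x * k (z - x))"
proof -
  obtain C where C: "C \<ge> 0" "\<And>x. cmod (k x) \<le> C"
    using smooth_boundedE[OF assms, of "[]"] by auto
  have "continuous_on \<Omega> (\<lambda>x. k (z - x))"
    by (intro continuous_on_compose2[OF smooth_on_continuous[OF smooth_bounded_smooth[OF assms]]] continuous_intros) auto
  then have m [measurable]: "(\<lambda>x. k (z - x)) \<in> borel_measurable (lebesgue_on \<Omega>)"
    by (rule continuous_measurable_domain[OF bounded open_\<Omega>])
  note borel_measurable_integrable[OF f, measurable]
  have i: "integrable (lebesgue_on \<Omega>) (\<lambda>x. C * cmod (f x))"
    using f by (intro integrable_mult_right integrable_norm)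
  show ?thesis
  proof (rule Bochner_Integration.integrable_bound[OF i])
    show "AE x in lebesgue_on \<Omega>. norm (f x * k (z - x)) \<le> norm (C * cmod (f x))"
    proof (rule AE_I2)
      fix x
      have "cmod (k (z - x)) * cmod (f x) \<le> C * cmod (f x)"
        by (intro mult_right_mono C) simp
      then show "norm (f x * k (z - x)) \<le> norm (C * cmod (f x))"
        using C(1) by (simp add: norm_mult mult.commute)
    qed
  qed measurable
qed

text \<open>The quadratic error in the Taylor expansion of the kernel is uniform and can be integrated.\<close>

lemma convolution_has_derivative:
  assumes k: "smooth_bounded UNIV k"
  shows "((\<lambda>z. LINT x|lebesgue_on \<Omega>. f x * k (z - x)) has_derivative
    (\<lambda>h. \<Sum>b\<in>Basis. (h \<bullet> b) *\<^sub>R (LINT x|lebesgue_on \<Omega>. f x * partial b k (z - x)))) (at z)"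
proof -
  let ?\<Phi> = "\<lambda>z. LINT x|lebesgue_on \<Omega>. f x * k (z - x)"
  let ?D = "\<lambda>h. \<Sum>b\<in>Basis. (h \<bullet> b) *\<^sub>R (LINT x|lebesgue_on \<Omega>. f x * partial b k (z - x))"
  obtain C where C: "C \<ge> 0"
    "\<And>x y. cmod (k y - k x - (\<Sum>b\<in>Basis. ((y - x) \<bullet> b) *\<^sub>R partial b k x)) \<le> C * (norm (y - x))\<^sup>2"
    using smooth_bounded_Taylor[OF k] by blast
  have ib: "integrable (lebesgue_on \<Omega>) (\<lambda>x. (a \<bullet> b) *\<^sub>R (f x * partial b k (z - x)))" if "b \<in> Basis" for a b
    using integrable_convolution[OF smooth_bounded_partial[OF k that]] by simp
  have i: "integrable (lebesgue_on \<Omega>) (\<lambda>x. cmod (f x))" using f by simp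
  show ?thesis
  proof (rule has_derivative_quadratic_error[where C="C * (LINT x|lebesgue_on \<Omega>. cmod (f x))"])
    show "bounded_linear ?D"
      by (intro bounded_linear_sum bounded_linear_compose[OF bounded_linear_scaleR_left] bounded_linear_inner_left)
    fix y
    let ?e = "\<lambda>x. f x * k (y - x) - f x * k (z - x) - (\<Sum>b\<in>Basis. ((y - z) \<bullet> b) *\<^sub>R (f x * partial b k (z - x)))"
    have e: "integrable (lebesgue_on \<Omega>) ?e"
      by (intro Bochner_Integration.integrable_diff Bochner_Integration.integrable_sum ib integrable_convolution k)
    have s: "(LINT x|lebesgue_on \<Omega>. (\<Sum>b\<in>Basis. ((y - z) \<bullet> b) *\<^sub>R (f x * partial b k (z - x)))) = ?D (y - z)"
      by (subst Bochner_Integration.integral_sum[OF ib]) simp_all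
    have "(LINT x|lebesgue_on \<Omega>. ?e x) = (LINT x|lebesgue_on \<Omega>. f x * k (y - x) - f x * k (z - x)) -
        (LINT x|lebesgue_on \<Omega>. (\<Sum>b\<in>Basis. ((y - z) \<bullet> b) *\<^sub>R (f x * partial b k (z - x))))"
      by (rule Bochner_Integration.integral_diff)
         (intro Bochner_Integration.integrable_diff Bochner_Integration.integrable_sum ib integrable_convolution k)+
    also have "(LINT x|lebesgue_on \<Omega>. f x * k (y - x) - f x * k (z - x)) = ?\<Phi> y - ?\<Phi> z"
      by (rule Bochner_Integration.integral_diff) (intro integrable_convolution k)+
    finally have eq: "?\<Phi> y - ?\<Phi> z - ?D (y - z) = (LINT x|lebesgue_on \<Omega>. ?e x)"
      by (simp only: s)
    have b1: "cmod (LINT x|lebesgue_on \<Omega>. ?e x) \<le> (LINT x|lebesgue_on \<Omega>. cmod (?e x))"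
      by (rule integral_norm_bound)
    have b2: "(LINT x|lebesgue_on \<Omega>. cmod (?e x)) \<le> (LINT x|lebesgue_on \<Omega>. C * (norm (y - z))\<^sup>2 * cmod (f x))"
    proof (rule integral_mono)
      fix x
      have "?e x = f x * (k (y - x) - k (z - x) - (\<Sum>b\<in>Basis. (((y - x) - (z - x)) \<bullet> b) *\<^sub>R partial b k (z - x)))"
        by (simp add: algebra_simps sum_distrib_left)
      then have "cmod (?e x) = cmod (f x) * cmod (k (y - x) - k (z - x) -
          (\<Sum>b\<in>Basis. (((y - x) - (z - x)) \<bullet> b) *\<^sub>R partial b k (z - x)))"
        by (simp only: norm_mult)
      also have "\<dots> \<le> cmod (f x) * (C * (norm ((y - x) - (z - x)))\<^sup>2)"
        by (intro mult_left_mono C(2)) simp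
      finally show "cmod (?e x) \<le> C * (norm (y - z))\<^sup>2 * cmod (f x)" by (simp add: mult.commute)
    qed (use e i in auto)
    have b3: "(LINT x|lebesgue_on \<Omega>. C * (norm (y - z))\<^sup>2 * cmod (f x)) =
        C * (LINT x|lebesgue_on \<Omega>. cmod (f x)) * (norm (y - z))\<^sup>2" by simp
    show "cmod (?\<Phi> y - ?\<Phi> z - ?D (y - z)) \<le> C * (LINT x|lebesgue_on \<Omega>. cmod (f x)) * (norm (y - z))\<^sup>2"
      unfolding eq by (rule order_trans[OF b1 order_trans[OF b2 eq_refl[OF b3]]])
  qed
qed

lemma partial_convolution:
  assumes "smooth_bounded UNIV k" "b \<in> Basis"
  shows "partial b (\<lambda>z. LINT x|lebesgue_on \<Omega>. f x * k (z - x)) = (\<lambda>z. LINT x|lebesgue_on \<Omega>. f x * partial b k (z - x))"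
  using partial_eqI[OF convolution_has_derivative[OF assms(1)], of b] assms(2)
  by (simp add: fun_eq_iff inner_Basis if_distrib[of "\<lambda>c. c *\<^sub>R _"] sum.delta cong: if_cong)

lemma partials_convolution:
  assumes "smooth_bounded UNIV k" "set bs \<subseteq> Basis"
  shows "partials bs (\<lambda>z. LINT x|lebesgue_on \<Omega>. f x * k (z - x)) = (\<lambda>z. LINT x|lebesgue_on \<Omega>. f x * partials bs k (z - x))"
  using assms(2,1)
proof (induction bs arbitrary: k rule: rev_induct)
  case (snoc b bs)
  then show ?case
    by (simp add: partials_snoc partial_convolution smooth_bounded_partial)
qed simp

lemma smooth_on_convolution:
  assumes "smooth_bounded UNIV k"
  shows "smooth_on UNIV (\<lambda>z. LINT x|lebesgue_on \<Omega>. f x * k (z - x))"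
proof (rule smooth_on_coinduct[where F="{\<lambda>z. LINT x|lebesgue_on \<Omega>. f x * k (z - x) | k. smooth_bounded UNIV k}"])
  fix g b assume "g \<in> {\<lambda>z. LINT x|lebesgue_on \<Omega>. f x * k (z - x) | k. smooth_bounded UNIV k}" and b: "b \<in> (Basis :: 'a set)"
  then obtain k where k: "g = (\<lambda>z. LINT x|lebesgue_on \<Omega>. f x * k (z - x))" "smooth_bounded UNIV k" by blast
  have "(\<lambda>z. LINT x|lebesgue_on \<Omega>. f x * partial b k (z - x)) \<in> {\<lambda>z. LINT x|lebesgue_on \<Omega>. f x * k (z - x) | k. smooth_bounded UNIV k}"
    using smooth_bounded_partial[OF k(2) b] by blast
  then show "\<exists>h\<in>{\<lambda>z. LINT x|lebesgue_on \<Omega>. f x * k (z - x) | k. smooth_bounded UNIV k}. \<forall>x\<in>UNIV. partial b g x = h x"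
    unfolding k(1) partial_convolution[OF k(2) b]
    by (intro bexI[where x="\<lambda>z. LINT x|lebesgue_on \<Omega>. f x * partial b k (z - x)"]) simp_all
qed (use assms convolution_has_derivative in \<open>auto simp: differentiable_def\<close>)

end

section \<open>Cauchy estimates\<close>

definition kernel :: "real \<Rightarrow> 'a::euclidean_space \<Rightarrow> complex" where
  "kernel t y = of_real (bump ((1 / t) *\<^sub>R y))"

lemma smooth_on_complex_bump: "smooth_on UNIV (\<lambda>x. complex_of_real (bump x))"
  by (rule smooth_on_compose_bounded_linear[OF open_UNIV bounded_linear_of_real smooth_on_bump])

lemma kernel_affine: "kernel t = (\<lambda>y. (\<lambda>x. complex_of_real (bump x)) (0 + (1 / t) *\<^sub>R y))"
  by (simp add: kernel_def fun_eq_iff)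

lemma smooth_bounded_kernel:
  assumes "t > 0"
  shows "smooth_bounded UNIV (kernel t)"
proof (rule smooth_bounded_compact_support[of _ t])
  show "smooth_on UNIV (kernel t)"
    unfolding kernel_affine by (rule smooth_on_affine_UNIV[OF smooth_on_complex_bump])
  show "kernel t x = 0" if "x \<notin> cball 0 t" for x
    using that assms by (auto simp: kernel_def intro!: bump_outside)
qed

lemma partials_kernel:
  assumes "set bs \<subseteq> Basis"
  shows "partials bs (kernel t) y = (1 / t) ^ length bs *\<^sub>R partials bs (\<lambda>x. complex_of_real (bump x)) ((1 / t) *\<^sub>R y)"
  unfolding kernel_affine partials_affine_UNIV[OF smooth_on_complex_bump assms] by simp

abbreviation bump_mass :: "'n::finite itself \<Rightarrow> real" where
  "bump_mass _ \<equiv> integral\<^sup>L lborel (bump :: complex ^ 'n \<Rightarrow> real)"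

lemma holomorphic_convolution:
  fixes h :: "complex ^ 'n \<Rightarrow> complex"
  assumes h: "holomorphic_sv \<Omega> h" and \<Omega>: "open \<Omega>" and t: "t > 0" and ball: "cball z0 (2 * t) \<subseteq> \<Omega>"
    and z: "z \<in> ball z0 t"
  shows "h z = inverse (of_real (t ^ DIM(complex ^ 'n) * bump_mass TYPE('n))) *
    (LINT x|lebesgue_on \<Omega>. h x * kernel t (z - x))"
proof -
  have "cball z t \<subseteq> \<Omega>"
  proof
    fix y assume "y \<in> cball z t"
    then have "dist z0 y \<le> 2 * t" using z dist_triangle[of z0 y z] by auto
    then show "y \<in> \<Omega>" using ball by auto
  qed
  note ball' = this
  define k where "k = complex_of_real (t ^ DIM(complex ^ 'n) * bump_mass TYPE('n))"
  have eq: "h z * k = (LINT x|lebesgue_on \<Omega>. h x * kernel t (z - x))"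
    unfolding k_def kernel_def by (rule holomorphic_reproducing_formula[OF h \<Omega> t ball'])
  have "t ^ DIM(complex ^ 'n) * bump_mass TYPE('n) > 0"
    using integral_bump_pos[where 'a="complex ^ 'n"] t by simp
  then have "k \<noteq> 0" unfolding k_def by (metis less_irrefl of_real_eq_0_iff)
  then show ?thesis
    unfolding k_def[symmetric] eq[symmetric] by (simp add: field_simps)
qed

text \<open>A function that locally is its own convolution with a smooth kernel is smooth, and its
  derivatives are convolutions with the derivatives of the kernel.\<close>

lemma local_convolution_smooth:
  fixes h :: "'a::euclidean_space \<Rightarrow> complex"
  assumes \<Omega>: "bounded \<Omega>" "open \<Omega>" and i: "integrable (lebesgue_on \<Omega>) h" and t: "t > 0"
    and eq: "\<And>z. z \<in> ball z0 t \<Longrightarrow> h z = c * (LINT x|lebesgue_on \<Omega>. h x * kernel t (z - x))"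
  shows "smooth_on (ball z0 t) h"
    and "set bs \<subseteq> Basis \<Longrightarrow> partials bs h z0 = c * (LINT x|lebesgue_on \<Omega>. h x * partials bs (kernel t) (z0 - x))"
proof -
  let ?\<Phi> = "\<lambda>z. LINT x|lebesgue_on \<Omega>. h x * kernel t (z - x)"
  have \<Phi>: "smooth_on UNIV ?\<Phi>"
    by (rule smooth_on_convolution[OF \<Omega> i smooth_bounded_kernel[OF t]])
  have "smooth_on UNIV (\<lambda>z. c * ?\<Phi> z)"
    by (rule smooth_on_compose_bounded_linear[OF open_UNIV bounded_linear_mult_right \<Phi>])
  then show "smooth_on (ball z0 t) h"
    using smooth_on_cong[of "ball z0 t" h "\<lambda>z. c * ?\<Phi> z"] eq smooth_on_subset by blast
  assume bs: "set bs \<subseteq> Basis"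
  have "partials bs h z0 = partials bs (\<lambda>z. c * ?\<Phi> z) z0"
    by (rule partials_cong[of "ball z0 t"]) (use eq t in auto)
  also have "\<dots> = c * partials bs ?\<Phi> z0"
    by (rule partials_bounded_linear[OF open_UNIV bounded_linear_mult_right \<Phi> UNIV_I bs])
  also have "partials bs ?\<Phi> z0 = (LINT x|lebesgue_on \<Omega>. h x * partials bs (kernel t) (z0 - x))"
    by (simp only: partials_convolution[OF \<Omega> i smooth_bounded_kernel[OF t] bs])
  finally show "partials bs h z0 = c * (LINT x|lebesgue_on \<Omega>. h x * partials bs (kernel t) (z0 - x))" .
qed

lemma interior_radius:
  fixes z :: "'a::euclidean_space"
  assumes "open \<Omega>" "z \<in> \<Omega>"
  obtains t where "t > 0" "cball z (2 * t) \<subseteq> \<Omega>"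
proof -
  obtain e where "e > 0" "cball z e \<subseteq> \<Omega>" using assms open_contains_cball by blast
  then show thesis using that[of "e / 2"] by simp
qed

lemma holomorphic_smooth:
  fixes h :: "complex ^ 'n \<Rightarrow> complex"
  assumes "holomorphic_sv \<Omega> h" "bounded \<Omega>" "open \<Omega>" "integrable (lebesgue_on \<Omega>) h"
  shows "smooth_on \<Omega> h"
proof (rule smooth_on_local)
  fix z assume "z \<in> \<Omega>"
  then obtain t where t: "t > 0" "cball z (2 * t) \<subseteq> \<Omega>" using interior_radius[OF assms(3)] by blast
  have "smooth_on (ball z t) h"
    by (rule local_convolution_smooth(1)[OF assms(2,3,4) t(1) holomorphic_convolution[OF assms(1,3) t]])
  then show "\<exists>T. z \<in> T \<and> smooth_on T h" using t(1) by (intro exI[of _ "ball z t"]) auto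
qed

lemma Cauchy_estimate:
  assumes "set bs \<subseteq> (Basis :: (complex ^ 'n) set)"
  obtains C where "C \<ge> 0"
    "\<And>\<Omega> h z t. holomorphic_sv \<Omega> h \<Longrightarrow> bounded \<Omega> \<Longrightarrow> open \<Omega> \<Longrightarrow> integrable (lebesgue_on \<Omega>) h \<Longrightarrow>
      t > 0 \<Longrightarrow> cball z (2 * t) \<subseteq> \<Omega> \<Longrightarrow>
      cmod (partials bs h z) \<le> C * (1 / t) ^ (DIM(complex ^ 'n) + length bs) * (LINT x|lebesgue_on \<Omega>. cmod (h x))"
proof -
  let ?N = "DIM(complex ^ 'n)"
  let ?I = "bump_mass TYPE('n)"
  have "smooth_bounded UNIV (\<lambda>x :: complex ^ 'n. complex_of_real (bump x))"
    by (rule smooth_bounded_compact_support[OF smooth_on_complex_bump, of 1]) (simp add: bump_outside)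
  from smooth_boundedE[OF this assms]
  obtain M where M: "M \<ge> 0" "\<And>x. cmod (partials bs (\<lambda>x. complex_of_real (bump x)) x) \<le> M"
    by (metis UNIV_I)
  have I: "?I > 0" by (rule integral_bump_pos)
  show thesis
  proof (rule that[of "M / ?I"])
    fix \<Omega> :: "(complex ^ 'n) set" and h z t
    assume h: "holomorphic_sv \<Omega> h" and \<Omega>: "bounded \<Omega>" "open \<Omega>" and i: "integrable (lebesgue_on \<Omega>) h"
      and t: "t > 0" "cball z (2 * t) \<subseteq> \<Omega>"
    define c where "c = inverse (complex_of_real (t ^ ?N * ?I))"
    have c: "cmod c = (1 / t) ^ ?N / ?I"
      using t I unfolding c_def norm_inverse norm_of_real by (simp add: field_simps power_divide)
    have k: "cmod (partials bs (kernel t) y) \<le> (1 / t) ^ length bs * M" for y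
      unfolding partials_kernel[OF assms] norm_scaleR using t M(2) by (simp add: mult_left_mono)
    have ii: "integrable (lebesgue_on \<Omega>) (\<lambda>x. h x * partials bs (kernel t) (z - x))"
    proof (rule integrable_convolution[OF \<Omega> i])
      show "smooth_bounded UNIV (partials bs (kernel t))"
        using assms
      proof (induction bs)
        case (Cons b bs)
        then show ?case unfolding partials_Cons by (auto intro: smooth_bounded_partial)
      qed (use smooth_bounded_kernel t in auto)
    qed
    have "cmod (LINT x|lebesgue_on \<Omega>. h x * partials bs (kernel t) (z - x))
        \<le> (LINT x|lebesgue_on \<Omega>. cmod (h x * partials bs (kernel t) (z - x)))"
      by (rule integral_norm_bound)
    also have "\<dots> \<le> (LINT x|lebesgue_on \<Omega>. ((1 / t) ^ length bs * M) * cmod (h x))"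
    proof (rule integral_mono)
      show "integrable (lebesgue_on \<Omega>) (\<lambda>x. cmod (h x * partials bs (kernel t) (z - x)))"
        using ii by (rule integrable_norm)
      show "integrable (lebesgue_on \<Omega>) (\<lambda>x. ((1 / t) ^ length bs * M) * cmod (h x))"
        using i by (intro integrable_mult_right integrable_norm)
      fix x
      show "cmod (h x * partials bs (kernel t) (z - x)) \<le> ((1 / t) ^ length bs * M) * cmod (h x)"
        unfolding norm_mult by (subst mult.commute) (rule mult_right_mono[OF k norm_ge_zero])
    qed
    also have "\<dots> = ((1 / t) ^ length bs * M) * (LINT x|lebesgue_on \<Omega>. cmod (h x))" by simp
    finally have b: "cmod (LINT x|lebesgue_on \<Omega>. h x * partials bs (kernel t) (z - x)) \<le> \<dots>" .
    have "partials bs h z = c * (LINT x|lebesgue_on \<Omega>. h x * partials bs (kernel t) (z - x))"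
      unfolding c_def
      by (rule local_convolution_smooth(2)[OF \<Omega> i t(1) holomorphic_convolution[OF h \<Omega>(2) t] assms])
    then have "cmod (partials bs h z) \<le> cmod c * (((1 / t) ^ length bs * M) * (LINT x|lebesgue_on \<Omega>. cmod (h x)))"
      using b by (simp add: norm_mult mult_left_mono)
    also have "\<dots> = M / ?I * (1 / t) ^ (?N + length bs) * (LINT x|lebesgue_on \<Omega>. cmod (h x))"
      unfolding c power_add by simp
    finally show "cmod (partials bs h z) \<le> M / ?I * (1 / t) ^ (?N + length bs) * (LINT x|lebesgue_on \<Omega>. cmod (h x))" .
  qed (use M I in simp)
qed

lemma symbols_cnj:
  assumes "open \<Omega>" "symbols \<Omega> w N m G"
  shows "symbols \<Omega> w N m ((\<lambda>g x. cnj (g x)) ` G)"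
proof -
  obtain C where C: "\<And>g bs x. g \<in> G \<Longrightarrow> set bs \<subseteq> Basis \<Longrightarrow> length bs \<le> N \<Longrightarrow> x \<in> \<Omega> \<Longrightarrow>
    cmod (partials bs g x) \<le> C * w x powr (m - real (length bs))"
    using symbolsE[OF assms(2)] by metis
  have "cmod (partials bs (\<lambda>x. cnj (g x)) x) \<le> C * w x powr (m - real (length bs))"
    if "g \<in> G" "set bs \<subseteq> Basis" "length bs \<le> N" "x \<in> \<Omega>" for g bs x
    using C[OF that] partials_bounded_linear[OF assms(1) bounded_linear_cnj symbols_smooth[OF assms(2) that(1)] that(4,2)]
    by simp
  then show ?thesis
    unfolding symbols_def
    using smooth_on_compose_bounded_linear[OF assms(1) bounded_linear_cnj symbols_smooth[OF assms(2)]]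
    by (intro conjI exI[of _ C]) auto
qed

text \<open>Since the weight is at most a multiple of the distance to the boundary, the Cauchy estimates
  say that the unit ball of the Bergman space is bounded in a symbol class of negative order.\<close>

lemma symbols_bergman_ball:
  fixes \<Omega> :: "(complex ^ 'n) set"
  assumes "weighted_domain \<Omega> w K"
  shows "symbols \<Omega> w N (- real DIM(complex ^ 'n)) {h \<in> bergman_space \<Omega>. L2_norm \<Omega> h \<le> 1}"
proof -
  interpret weighted_domain \<Omega> w K by fact
  let ?n = "DIM(complex ^ 'n)"
  let ?B = "{bs :: (complex ^ 'n) list. set bs \<subseteq> Basis \<and> length bs \<le> N}"
  have finB: "finite ?B" by (rule finite_lists_length_le) simp
  have "\<forall>bs\<in>?B. \<exists>C\<ge>0. \<forall>h z t. holomorphic_sv \<Omega> h \<longrightarrow> integrable (lebesgue_on \<Omega>) h \<longrightarrow>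
      t > 0 \<longrightarrow> cball z (2 * t) \<subseteq> \<Omega> \<longrightarrow>
      cmod (partials bs h z) \<le> C * (1 / t) ^ (?n + length bs) * (LINT x|lebesgue_on \<Omega>. cmod (h x))"
  proof
    fix bs assume "bs \<in> ?B"
    then have "set bs \<subseteq> Basis" by simp
    from Cauchy_estimate[OF this]
    show "\<exists>C\<ge>0. \<forall>h z t. holomorphic_sv \<Omega> h \<longrightarrow> integrable (lebesgue_on \<Omega>) h \<longrightarrow>
      t > 0 \<longrightarrow> cball z (2 * t) \<subseteq> \<Omega> \<longrightarrow>
      cmod (partials bs h z) \<le> C * (1 / t) ^ (?n + length bs) * (LINT x|lebesgue_on \<Omega>. cmod (h x))"
      using bounded_domain open_domain by metis
  qed
  from bchoice[OF this] obtain C where Cx: "\<forall>bs\<in>?B. C bs \<ge> 0 \<and> (\<forall>h z t. holomorphic_sv \<Omega> h \<longrightarrow>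
      integrable (lebesgue_on \<Omega>) h \<longrightarrow> t > 0 \<longrightarrow> cball z (2 * t) \<subseteq> \<Omega> \<longrightarrow>
      cmod (partials bs h z) \<le> C bs * (1 / t) ^ (?n + length bs) * (LINT x|lebesgue_on \<Omega>. cmod (h x)))" ..
  have C: "C bs \<ge> 0" if "bs \<in> ?B" for bs using Cx that by blast
  have Cb: "cmod (partials bs h z) \<le> C bs * (1 / t) ^ (?n + length bs) * (LINT x|lebesgue_on \<Omega>. cmod (h x))"
    if "bs \<in> ?B" "holomorphic_sv \<Omega> h" "integrable (lebesgue_on \<Omega>) h" "t > 0" "cball z (2 * t) \<subseteq> \<Omega>" for bs h z t
    using Cx that by blast
  let ?V = "sqrt (measure lebesgue \<Omega>)"
  have V: "?V \<ge> 0" by simp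
  let ?c = "\<lambda>bs. C bs * (4 * K) ^ (?n + length bs) * ?V"
  have c0: "?c bs \<ge> 0" if "bs \<in> ?B" for bs
    using C[OF that] K_pos V by (intro mult_nonneg_nonneg zero_le_power) auto
  show ?thesis unfolding symbols_def
  proof (intro conjI ballI exI[of _ "sum ?c ?B"] allI impI)
    fix h assume "h \<in> {h \<in> bergman_space \<Omega>. L2_norm \<Omega> h \<le> 1}"
    then have h: "h \<in> L2 \<Omega>" "holomorphic_sv \<Omega> h" "L2_norm \<Omega> h \<le> 1" by (auto simp: bergman_space_def)
    have i: "integrable (lebesgue_on \<Omega>) h" by (rule L2_imp_L1[OF bounded_domain open_domain h(1)])
    show "smooth_on \<Omega> h" by (rule holomorphic_smooth[OF h(2) bounded_domain open_domain i])
    fix bs :: "(complex ^ 'n) list" and z assume bs: "set bs \<subseteq> Basis \<and> length bs \<le> N" and z: "z \<in> \<Omega>"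
    then have bsB: "bs \<in> ?B" by simp
    \<comment> \<open>The distance of \<open>z\<close> to the complement is at least \<open>w z / K\<close>, which exceeds \<open>2 * t\<close>.\<close>
    define t where "t = w z / (4 * K)"
    have wz: "w z > 0" using w_range[OF z] by simp
    have t: "t > 0" using wz K_pos by (simp add: t_def)
    have ball: "cball z (2 * t) \<subseteq> \<Omega>"
    proof (rule ccontr)
      assume "\<not> ?thesis"
      then obtain y where "y \<in> cball z (2 * t)" and y1: "y \<notin> \<Omega>" by blast
      then have y: "y \<notin> \<Omega>" "dist z y \<le> 2 * t" by auto
      have "w z \<le> K * (2 * t)" using w_dist[OF z y(1)] y(2) K_pos mult_left_mono[of "dist z y" "2 * t" K] by linarith
      then show False using wz K_pos by (simp add: t_def)
    qed
    have "(LINT x|lebesgue_on \<Omega>. cmod (h x)) \<le> ?V * L2_norm \<Omega> h"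
      by (rule L2_imp_L1[OF bounded_domain open_domain h(1)])
    also have "\<dots> \<le> ?V * 1" by (intro mult_left_mono h(3) V)
    finally have I: "(LINT x|lebesgue_on \<Omega>. cmod (h x)) \<le> ?V" by simp
    have "cmod (partials bs h z) \<le> C bs * (1 / t) ^ (?n + length bs) * (LINT x|lebesgue_on \<Omega>. cmod (h x))"
      by (rule Cb[OF bsB h(2) i t ball])
    also have "\<dots> \<le> C bs * (1 / t) ^ (?n + length bs) * ?V"
      using C[OF bsB] t by (intro mult_left_mono I mult_nonneg_nonneg zero_le_power) auto
    also have "(1 / t) ^ (?n + length bs) = (4 * K) ^ (?n + length bs) * w z powr (- real ?n - real (length bs))"
    proof -
      have "- real ?n - real (length bs) = - real (?n + length bs)" by simp
      then have p: "w z powr (- real ?n - real (length bs)) = inverse (w z ^ (?n + length bs))"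
        by (simp only: powr_minus powr_realpow[OF wz])
      have "1 / t = 4 * K * inverse (w z)" using wz K_pos by (simp add: t_def field_simps)
      then have "(1 / t) ^ (?n + length bs) = (4 * K * inverse (w z)) ^ (?n + length bs)" by (rule arg_cong)
      also have "\<dots> = (4 * K) ^ (?n + length bs) * inverse (w z) ^ (?n + length bs)" by (rule power_mult_distrib)
      finally show ?thesis unfolding p power_inverse .
    qed
    also have "C bs * ((4 * K) ^ (?n + length bs) * w z powr (- real ?n - real (length bs))) * ?V
        = ?c bs * w z powr (- real ?n - real (length bs))" by (simp only: mult.assoc mult.commute[of ?V])
    also have "\<dots> \<le> sum ?c ?B * w z powr (- real ?n - real (length bs))"
      by (intro mult_right_mono member_le_sum bsB finB c0) auto
    finally show "cmod (partials bs h z) \<le> sum ?c ?B * w z powr (- real ?n - real (length bs))" .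
  qed
qed

section \<open>The Bergman space and its projection\<close>

lemma holomorphic_sv_linear:
  assumes "holomorphic_sv \<Omega> f" "holomorphic_sv \<Omega> g"
  shows "holomorphic_sv \<Omega> (\<lambda>z. a * f z + b * g z)"
  unfolding holomorphic_sv_def
proof
  fix z assume z: "z \<in> \<Omega>"
  obtain D where D: "(f has_derivative D) (at z)" "\<And>c v. D (c *s v) = c * D v"
    using holomorphic_svE[OF assms(1) z] by blast
  obtain E where E: "(g has_derivative E) (at z)" "\<And>c v. E (c *s v) = c * E v"
    using holomorphic_svE[OF assms(2) z] by blast
  show "\<exists>F. ((\<lambda>z. a * f z + b * g z) has_derivative F) (at z) \<and> (\<forall>c v. F (c *s v) = c * F v)"
    by (intro exI[of _ "\<lambda>h. a * D h + b * E h"] conjI has_derivative_add has_derivative_mult_right D(1) E(1))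
       (simp add: D E algebra_simps)
qed

lemma bergman_space_linear:
  assumes "f \<in> bergman_space \<Omega>" "g \<in> bergman_space \<Omega>"
  shows "(\<lambda>z. a * f z + b * g z) \<in> bergman_space \<Omega>"
  using assms unfolding bergman_space_def
  by (auto intro: L2_add L2_scale(1) holomorphic_sv_linear)

lemma bergman_space_diff:
  "f \<in> bergman_space \<Omega> \<Longrightarrow> g \<in> bergman_space \<Omega> \<Longrightarrow> (\<lambda>z. f z - g z) \<in> bergman_space \<Omega>"
  using bergman_space_linear[of f \<Omega> g 1 "-1"] by simp

lemma bergman_space_zero: "bounded \<Omega> \<Longrightarrow> open \<Omega> \<Longrightarrow> (\<lambda>z. 0) \<in> bergman_space \<Omega>"
  unfolding bergman_space_def holomorphic_sv_def
  using L2_bounded[of \<Omega> "\<lambda>_. 0" 0] by (auto intro!: exI[of _ "\<lambda>_. 0"])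

context
  fixes \<Omega> :: "(complex ^ 'n) set"
  assumes bounded: "bounded \<Omega>" and open_\<Omega>: "open \<Omega>"
begin

lemma bergman_smooth: "h \<in> bergman_space \<Omega> \<Longrightarrow> smooth_on \<Omega> h"
  using holomorphic_smooth[OF _ bounded open_\<Omega>] L2_imp_L1[OF bounded open_\<Omega>]
  by (auto simp: bergman_space_def)

lemma bergman_point_evaluation:
  assumes "set bs \<subseteq> Basis" "z \<in> \<Omega>"
  obtains C where "C \<ge> 0" "\<And>h. h \<in> bergman_space \<Omega> \<Longrightarrow> cmod (partials bs h z) \<le> C * L2_norm \<Omega> h"
proof -
  obtain t where t: "t > 0" "cball z (2 * t) \<subseteq> \<Omega>" using interior_radius[OF open_\<Omega> assms(2)] by blast
  obtain C where C: "C \<ge> 0"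
    "\<And>\<Omega> h z t. holomorphic_sv \<Omega> h \<Longrightarrow> bounded \<Omega> \<Longrightarrow> open \<Omega> \<Longrightarrow> integrable (lebesgue_on \<Omega>) h \<Longrightarrow>
      t > 0 \<Longrightarrow> cball z (2 * t) \<subseteq> \<Omega> \<Longrightarrow>
      cmod (partials bs h z) \<le> C * (1 / t) ^ (DIM(complex ^ 'n) + length bs) * (LINT x|lebesgue_on \<Omega>. cmod (h x))"
    using Cauchy_estimate[OF assms(1)] by metis
  let ?C = "C * (1 / t) ^ (DIM(complex ^ 'n) + length bs)"
  have C0: "?C \<ge> 0" using C(1) t by (intro mult_nonneg_nonneg zero_le_power) auto
  show thesis
  proof (rule that[of "?C * sqrt (measure lebesgue \<Omega>)"])
    fix h assume "h \<in> bergman_space \<Omega>"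
    then have h: "h \<in> L2 \<Omega>" "holomorphic_sv \<Omega> h" by (auto simp: bergman_space_def)
    have "cmod (partials bs h z) \<le> ?C * (LINT x|lebesgue_on \<Omega>. cmod (h x))"
      by (rule C(2)[OF h(2) bounded open_\<Omega> L2_imp_L1(1)[OF bounded open_\<Omega> h(1)] t])
    also have "\<dots> \<le> ?C * (sqrt (measure lebesgue \<Omega>) * L2_norm \<Omega> h)"
      by (intro mult_left_mono C0 L2_imp_L1(2)[OF bounded open_\<Omega> h(1)])
    finally show "cmod (partials bs h z) \<le> ?C * sqrt (measure lebesgue \<Omega>) * L2_norm \<Omega> h"
      by (simp add: mult.assoc)
  qed (use C0 in simp)
qed

lemma bergman_norm_zero:
  assumes "h \<in> bergman_space \<Omega>" "L2_norm \<Omega> h = 0" "z \<in> \<Omega>"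
  shows "h z = 0"
proof -
  obtain C where "\<And>h. h \<in> bergman_space \<Omega> \<Longrightarrow> cmod (partials [] h z) \<le> C * L2_norm \<Omega> h"
    using bergman_point_evaluation[of "[]" z] assms(3) by auto
  from this[OF assms(1)] show ?thesis using assms(2) by simp
qed

lemma bergman_L2: "h \<in> bergman_space \<Omega> \<Longrightarrow> h \<in> L2 \<Omega>"
  by (simp add: bergman_space_def)

text \<open>Point evaluations are bounded, so that a Cauchy sequence converges pointwise, Fatou's lemma gives norm convergence, and the limit
  inherits the local convolution formula.\<close>

lemma bergman_space_complete:
  fixes h :: "nat \<Rightarrow> complex ^ 'n \<Rightarrow> complex"
  assumes h: "\<And>j. h j \<in> bergman_space \<Omega>"
    and Cauchy: "\<And>e. e > 0 \<Longrightarrow> \<exists>N. \<forall>m\<ge>N. \<forall>n\<ge>N. L2_norm \<Omega> (\<lambda>z. h m z - h n z) \<le> e"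
  obtains g where "g \<in> bergman_space \<Omega>" "(\<lambda>j. L2_norm \<Omega> (\<lambda>z. h j z - g z)) \<longlonglongrightarrow> 0"
proof -
  have hL: "h j \<in> L2 \<Omega>" for j using h bergman_L2 by blast
  have pc: "convergent (\<lambda>j. partials bs (h j) z)" if bs: "set bs \<subseteq> Basis" and z: "z \<in> \<Omega>" for bs z
  proof -
    obtain C where C: "C \<ge> 0" "\<And>h. h \<in> bergman_space \<Omega> \<Longrightarrow> cmod (partials bs h z) \<le> C * L2_norm \<Omega> h"
      using bergman_point_evaluation[OF bs z] by blast
    have "Cauchy (\<lambda>j. partials bs (h j) z)"
    proof (rule metric_CauchyI)
      fix e :: real assume e: "e > 0"
      obtain N where N: "\<forall>m\<ge>N. \<forall>n\<ge>N. L2_norm \<Omega> (\<lambda>z. h m z - h n z) \<le> e / (C + 1) / 2"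
        using Cauchy[of "e / (C + 1) / 2"] e C(1) by auto
      have "dist (partials bs (h m) z) (partials bs (h n) z) < e" if "m \<ge> N" "n \<ge> N" for m n
      proof -
        have "dist (partials bs (h m) z) (partials bs (h n) z) = cmod (partials bs (\<lambda>z. h m z - h n z) z)"
          using partials_diff[OF open_\<Omega> bergman_smooth[OF h] bergman_smooth[OF h] z bs]
          by (simp add: dist_norm)
        also have "\<dots> \<le> C * L2_norm \<Omega> (\<lambda>z. h m z - h n z)"
          by (intro C(2) bergman_space_diff h)
        also have "\<dots> \<le> C * (e / (C + 1) / 2)"
          using N that by (intro mult_left_mono C(1)) auto
        also have "\<dots> < e" using C(1) e by (simp add: field_simps) (smt (verit) mult_nonneg_nonneg)
        finally show ?thesis .
      qed
      then show "\<exists>M. \<forall>m\<ge>M. \<forall>n\<ge>M. dist (partials bs (h m) z) (partials bs (h n) z) < e" by blast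
    qed
    then show ?thesis by (rule Cauchy_convergent)
  qed
  define g where "g z = lim (\<lambda>j. h j z)" for z
  have lim: "(\<lambda>j. h j z) \<longlonglongrightarrow> g z" if "z \<in> \<Omega>" for z
    using pc[of "[]" z] that by (simp add: g_def convergent_LIMSEQ_iff)
  have hm: "h j \<in> borel_measurable (lebesgue_on \<Omega>)" for j using L2_measurable[OF hL] .
  have gm: "g \<in> borel_measurable (lebesgue_on \<Omega>)"
    by (rule borel_measurable_LIMSEQ_metric[OF hm]) (use lim in auto)
  note hm[measurable] gm[measurable]
  have Fatou: "(\<lambda>z. h j z - g z) \<in> L2 \<Omega> \<and> L2_norm \<Omega> (\<lambda>z. h j z - g z) \<le> e"
    if e: "e \<ge> 0" and j: "\<And>m. m \<ge> N \<Longrightarrow> L2_norm \<Omega> (\<lambda>z. h j z - h m z) \<le> e" for e j N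
  proof -
    let ?M = "lebesgue_on \<Omega>"
    let ?u = "\<lambda>m z. ennreal ((cmod (h j z - h m z))\<^sup>2)"
    have nn: "(\<integral>\<^sup>+z. ?u m z \<partial>?M) \<le> ennreal (e\<^sup>2)" if "m \<ge> N" for m
    proof -
      have "(\<integral>\<^sup>+z. ?u m z \<partial>?M) = ennreal ((L2_norm \<Omega> (\<lambda>z. h j z - h m z))\<^sup>2)"
        unfolding L2_norm_square
        by (rule nn_integral_eq_integral) (use L2_integrable[OF L2_diff[OF hL hL]] in auto)
      also have "\<dots> \<le> ennreal (e\<^sup>2)"
        using j[OF that] by (intro ennreal_leI power_mono L2_norm_nonneg)
      finally show ?thesis .
    qed
    have "(\<integral>\<^sup>+z. ennreal ((cmod (h j z - g z))\<^sup>2) \<partial>?M) = (\<integral>\<^sup>+z. liminf (\<lambda>m. ?u m z) \<partial>?M)"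
    proof (rule nn_integral_cong)
      fix z assume "z \<in> space ?M"
      then have "(\<lambda>m. ?u m z) \<longlonglongrightarrow> ennreal ((cmod (h j z - g z))\<^sup>2)"
        by (intro tendsto_ennrealI tendsto_intros lim) simp
      then show "ennreal ((cmod (h j z - g z))\<^sup>2) = liminf (\<lambda>m. ?u m z)"
        using lim_imp_Liminf[OF sequentially_bot] by metis
    qed
    also have "\<dots> \<le> liminf (\<lambda>m. (\<integral>\<^sup>+z. ?u m z \<partial>?M))"
      by (rule nn_integral_liminf) measurable
    also have "\<dots> \<le> liminf (\<lambda>m. ennreal (e\<^sup>2))"
      by (rule Liminf_mono) (use nn in \<open>auto simp: eventually_sequentially\<close>)
    also have "\<dots> = ennreal (e\<^sup>2)" by (simp add: Liminf_const)
    finally have b: "(\<integral>\<^sup>+z. ennreal ((cmod (h j z - g z))\<^sup>2) \<partial>?M) \<le> ennreal (e\<^sup>2)" .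
    have i: "integrable ?M (\<lambda>z. (cmod (h j z - g z))\<^sup>2)"
      by (rule integrableI_bounded) (use b in \<open>auto simp: le_less_trans\<close>)
    then have L: "(\<lambda>z. h j z - g z) \<in> L2 \<Omega>" by (simp add: L2_def)
    have "ennreal ((L2_norm \<Omega> (\<lambda>z. h j z - g z))\<^sup>2) \<le> ennreal (e\<^sup>2)"
      unfolding L2_norm_square using nn_integral_eq_integral[OF i] b by simp
    then have "(L2_norm \<Omega> (\<lambda>z. h j z - g z))\<^sup>2 \<le> e\<^sup>2" by simp
    then show ?thesis using L e by (auto intro: power2_le_imp_le)
  qed
  have conv: "(\<lambda>j. L2_norm \<Omega> (\<lambda>z. h j z - g z)) \<longlonglongrightarrow> 0"
  proof (rule LIMSEQ_I)
    fix e :: real assume e: "e > 0"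
    obtain N where N: "\<forall>m\<ge>N. \<forall>n\<ge>N. L2_norm \<Omega> (\<lambda>z. h m z - h n z) \<le> e / 2"
      using Cauchy[of "e / 2"] e by auto
    have "norm (L2_norm \<Omega> (\<lambda>z. h j z - g z) - 0) < e" if "j \<ge> N" for j
      using Fatou[of "e / 2" N j] N that e L2_norm_nonneg[of \<Omega> "\<lambda>z. h j z - g z"] by auto
    then show "\<exists>N. \<forall>j\<ge>N. norm (L2_norm \<Omega> (\<lambda>z. h j z - g z) - 0) < e" by blast
  qed
  obtain N1 where "\<forall>m\<ge>N1. \<forall>n\<ge>N1. L2_norm \<Omega> (\<lambda>z. h m z - h n z) \<le> 1" using Cauchy[of 1] by auto
  then have "(\<lambda>z. h N1 z - g z) \<in> L2 \<Omega>" using Fatou[of 1 N1 N1] by auto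
  from L2_diff[OF hL[of N1] this] have gL: "g \<in> L2 \<Omega>" by simp
  have gi: "integrable (lebesgue_on \<Omega>) g" using L2_imp_L1(1)[OF bounded open_\<Omega> gL] .
  have "holomorphic_sv \<Omega> g" unfolding holomorphic_sv_def
  proof
    fix z0 assume z0: "z0 \<in> \<Omega>"
    obtain t where t: "t > 0" "cball z0 (2 * t) \<subseteq> \<Omega>" using interior_radius[OF open_\<Omega> z0] by blast
    define c where "c = inverse (complex_of_real (t ^ DIM(complex ^ 'n) * bump_mass TYPE('n)))"
    have int_lim: "(\<lambda>j. LINT x|lebesgue_on \<Omega>. h j x * k (z - x)) \<longlonglongrightarrow> (LINT x|lebesgue_on \<Omega>. g x * k (z - x))"
      if k: "smooth_bounded UNIV k" for k :: "complex ^ 'n \<Rightarrow> complex" and z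
    proof -
      obtain M where M: "M \<ge> 0" "\<And>x. cmod (k x) \<le> M"
        using smooth_boundedE[OF k, of "[]"] by auto
      let ?d = "\<lambda>j. (LINT x|lebesgue_on \<Omega>. h j x * k (z - x)) - (LINT x|lebesgue_on \<Omega>. g x * k (z - x))"
      have "cmod (?d j) \<le> M * (sqrt (measure lebesgue \<Omega>) * L2_norm \<Omega> (\<lambda>z. h j z - g z))" for j
      proof -
        have dL: "(\<lambda>z. h j z - g z) \<in> L2 \<Omega>" by (rule L2_diff[OF hL gL])
        have di: "integrable (lebesgue_on \<Omega>) (\<lambda>z. h j z - g z)" by (rule L2_imp_L1(1)[OF bounded open_\<Omega> dL])
        have ii: "integrable (lebesgue_on \<Omega>) (\<lambda>x. (h j x - g x) * k (z - x))"
          by (rule integrable_convolution[OF bounded open_\<Omega> di k])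
        have "?d j = (LINT x|lebesgue_on \<Omega>. (h j x - g x) * k (z - x))"
          unfolding left_diff_distrib
          by (rule Bochner_Integration.integral_diff[symmetric])
             (rule integrable_convolution[OF bounded open_\<Omega> _ k], rule L2_imp_L1(1)[OF bounded open_\<Omega>], rule hL gL)+
        also have "cmod \<dots> \<le> (LINT x|lebesgue_on \<Omega>. cmod ((h j x - g x) * k (z - x)))"
          by (rule integral_norm_bound)
        also have "\<dots> \<le> (LINT x|lebesgue_on \<Omega>. M * cmod (h j x - g x))"
        proof (rule integral_mono)
          fix x show "cmod ((h j x - g x) * k (z - x)) \<le> M * cmod (h j x - g x)"
            unfolding norm_mult by (subst mult.commute) (rule mult_right_mono[OF M(2) norm_ge_zero])
        qed (use ii di in auto)
        also have "\<dots> = M * (LINT x|lebesgue_on \<Omega>. cmod (h j x - g x))" by simp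
        also have "\<dots> \<le> M * (sqrt (measure lebesgue \<Omega>) * L2_norm \<Omega> (\<lambda>z. h j z - g z))"
          by (intro mult_left_mono M L2_imp_L1(2)[OF bounded open_\<Omega> dL])
        finally show ?thesis .
      qed
      moreover have "(\<lambda>j. M * (sqrt (measure lebesgue \<Omega>) * L2_norm \<Omega> (\<lambda>z. h j z - g z))) \<longlonglongrightarrow> 0"
        using tendsto_mult_right_zero[OF tendsto_mult_right_zero[OF conv]] .
      ultimately have "?d \<longlonglongrightarrow> 0"
        by (intro Lim_null_comparison[of ?d]) (auto intro: always_eventually)
      then show ?thesis by (rule LIM_zero_cancel)
    qed
    have gloc: "g z = c * (LINT x|lebesgue_on \<Omega>. g x * kernel t (z - x))" if z: "z \<in> ball z0 t" for z
    proof -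
      have z\<Omega>: "z \<in> \<Omega>" using z t by (auto simp: subset_iff)
      have "h j z = c * (LINT x|lebesgue_on \<Omega>. h j x * kernel t (z - x))" for j
        unfolding c_def using h[of j] by (intro holomorphic_convolution[OF _ open_\<Omega> t z]) (simp add: bergman_space_def)
      then have "(\<lambda>j. h j z) \<longlonglongrightarrow> c * (LINT x|lebesgue_on \<Omega>. g x * kernel t (z - x))"
        using tendsto_mult_left[OF int_lim[OF smooth_bounded_kernel[OF t(1)], of z], of c] by simp
      then show ?thesis using lim[OF z\<Omega>] LIMSEQ_unique by blast
    qed
    have gsm: "smooth_on (ball z0 t) g"
      by (rule local_convolution_smooth(1)[OF bounded open_\<Omega> gi t(1) gloc])
    have gd: "g differentiable (at z0)" using smooth_on_differentiable[OF gsm] t(1) by simp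
    have gc: "partials bs g z0 = c * (LINT x|lebesgue_on \<Omega>. g x * partials bs (kernel t) (z0 - x))"
      if "set bs \<subseteq> Basis" for bs
      by (rule local_convolution_smooth(2)[OF bounded open_\<Omega> gi t(1) gloc that])
    let ?D = "\<lambda>v. \<Sum>b\<in>Basis. (v \<bullet> b) *\<^sub>R partial b g z0"
    let ?Dj = "\<lambda>j v. \<Sum>b\<in>Basis. (v \<bullet> b) *\<^sub>R partial b (h j) z0"
    have pl: "(\<lambda>j. partial b (h j) z0) \<longlonglongrightarrow> partial b g z0" if b: "b \<in> Basis" for b
    proof -
      have bs: "set [b] \<subseteq> Basis" using b by simp
      have "partials [b] (h j) z0 = c * (LINT x|lebesgue_on \<Omega>. h j x * partials [b] (kernel t) (z0 - x))" for j
        unfolding c_def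
        by (rule local_convolution_smooth(2)[OF bounded open_\<Omega> L2_imp_L1(1)[OF bounded open_\<Omega> hL] t(1)
              holomorphic_convolution[OF _ open_\<Omega> t] bs])
           (use h[of j] in \<open>auto simp: bergman_space_def\<close>)
      then show ?thesis
        using tendsto_mult_left[OF int_lim[OF smooth_bounded_partial[OF smooth_bounded_kernel[OF t(1)] b], of z0], of c]
          gc[OF bs] by (simp add: partials_Cons)
    qed
    have Dl: "(\<lambda>j. ?Dj j v) \<longlonglongrightarrow> ?D v" for v
      by (intro tendsto_sum tendsto_scaleR tendsto_const pl)
    have "?Dj j (a *s v) = a * ?Dj j v" for j a v
    proof -
      obtain E where E: "(h j has_derivative E) (at z0)" "\<And>c v. E (c *s v) = c * E v"
        using holomorphic_svE[of \<Omega> "h j" z0] h[of j] z0 by (auto simp: bergman_space_def)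
      have "?Dj j = E"
        using has_derivative_unique[OF has_derivative_partial[OF differentiableI[OF E(1)]] E(1)] .
      then have "?Dj j v = E v" for v by (rule fun_cong)
      then show ?thesis using E(2) by simp
    qed
    then have "(\<lambda>j. ?Dj j (a *s v)) \<longlonglongrightarrow> a * ?D v" for a v
      using tendsto_mult_left[OF Dl] by simp
    then have "?D (a *s v) = a * ?D v" for a v
      using Dl LIMSEQ_unique by blast
    then show "\<exists>D. (g has_derivative D) (at z0) \<and> (\<forall>c v. D (c *s v) = c * D v)"
      using has_derivative_partial[OF gd] by blast
  qed
  then have "g \<in> bergman_space \<Omega>" using gL by (simp add: bergman_space_def)
  then show thesis using that conv by blast
qed

text \<open>A minimizing sequence for the distance to \<open>f\<close> is Cauchy by the parallelogram law. At the minimum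
  \<open>g\<close> the difference \<open>f - g\<close> is orthogonal to every \<open>k\<close>, since otherwise a small step in the
  direction of \<open>k\<close> would decrease the distance.\<close>

lemma bergman_projection_exists:
  assumes f: "f \<in> L2 \<Omega>"
  obtains h where "h \<in> bergman_space \<Omega>" "\<And>g. g \<in> bergman_space \<Omega> \<Longrightarrow> L2_inner \<Omega> (\<lambda>z. f z - h z) g = 0"
proof -
  let ?A = "bergman_space \<Omega>"
  let ?q = "\<lambda>g. (L2_norm \<Omega> (\<lambda>z. f z - g z))\<^sup>2"
  define d where "d = Inf (?q ` ?A)"
  have bdd: "bdd_below (?q ` ?A)" by (rule bdd_belowI[of _ 0]) auto
  have ne: "?A \<noteq> {}" using bergman_space_zero[OF bounded open_\<Omega>] by blast
  have d: "d \<le> ?q g" if "g \<in> ?A" for g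
    unfolding d_def using that bdd by (intro cInf_lower) auto
  have "\<exists>g\<in>?A. ?q g < d + e" if "e > 0" for e
    using cInf_lessD[of "?q ` ?A" "d + e"] ne that by (auto simp: d_def)
  then have "\<forall>j. \<exists>g\<in>?A. ?q g < d + 1 / real (Suc j)" by simp
  then obtain h where h: "\<And>j. h j \<in> ?A" "\<And>j. ?q (h j) < d + 1 / real (Suc j)" by metis
  have fh: "(\<lambda>z. f z - h j z) \<in> L2 \<Omega>" for j by (intro L2_diff f bergman_L2 h)
  have par: "(L2_norm \<Omega> (\<lambda>z. h m z - h n z))\<^sup>2 \<le> 2 / real (Suc m) + 2 / real (Suc n)" for m n
  proof -
    have "(\<lambda>z. (1/2) * h m z + (1/2) * h n z) \<in> ?A" by (intro bergman_space_linear h)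
    then have "d \<le> ?q (\<lambda>z. (1/2) * h m z + (1/2) * h n z)" by (rule d)
    moreover have "L2_norm \<Omega> (\<lambda>z. (f z - h m z) + (f z - h n z)) = 2 * L2_norm \<Omega> (\<lambda>z. f z - ((1/2) * h m z + (1/2) * h n z))"
    proof -
      have mid: "(\<lambda>z. f z - ((1/2) * h m z + (1/2) * h n z)) \<in> L2 \<Omega>"
        by (intro L2_diff f bergman_L2 bergman_space_linear h)
      have "(\<lambda>z. (f z - h m z) + (f z - h n z)) = (\<lambda>z. 2 * (f z - ((1/2) * h m z + (1/2) * h n z)))"
        by (simp add: fun_eq_iff algebra_simps)
      then show ?thesis using L2_scale(2)[OF mid, of 2] by simp
    qed
    moreover have "L2_norm \<Omega> (\<lambda>z. (f z - h m z) - (f z - h n z)) = L2_norm \<Omega> (\<lambda>z. h m z - h n z)"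
      unfolding L2_norm_def by (simp add: norm_minus_commute)
    ultimately show ?thesis
      using L2_norm_parallelogram[OF fh[of m] fh[of n]] h(2)[of m] h(2)[of n] by (simp add: power_mult_distrib)
  qed
  have "\<exists>N. \<forall>m\<ge>N. \<forall>n\<ge>N. L2_norm \<Omega> (\<lambda>z. h m z - h n z) \<le> e" if e: "e > 0" for e
  proof -
    obtain N where N: "4 / e\<^sup>2 < real N" using reals_Archimedean2 by blast
    have "L2_norm \<Omega> (\<lambda>z. h m z - h n z) \<le> e" if mn: "m \<ge> N" "n \<ge> N" for m n
    proof (rule power2_le_imp_le)
      have "2 / real (Suc k) \<le> e\<^sup>2 / 2" if "k \<ge> N" for k
      proof -
        have "4 / e\<^sup>2 < real (Suc k)" using N that by simp
        then show ?thesis using e by (simp add: field_simps)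
      qed
      then show "(L2_norm \<Omega> (\<lambda>z. h m z - h n z))\<^sup>2 \<le> e\<^sup>2"
        using par[of m n] mn by (smt (verit) field_sum_of_halves)
    qed (use e in simp)
    then show ?thesis by blast
  qed
  from bergman_space_complete[OF h(1) this]
  obtain g where g: "g \<in> ?A" "(\<lambda>j. L2_norm \<Omega> (\<lambda>z. h j z - g z)) \<longlonglongrightarrow> 0" by blast
  have fg: "(\<lambda>z. f z - g z) \<in> L2 \<Omega>" by (intro L2_diff f bergman_L2 g)
  have d0: "d \<ge> 0" unfolding d_def using ne by (intro cInf_greatest) auto
  have "L2_norm \<Omega> (\<lambda>z. f z - g z) \<le> sqrt d"
  proof (rule LIMSEQ_le_const)
    have "(\<lambda>j. sqrt (d + 1 / real (Suc j)) + L2_norm \<Omega> (\<lambda>z. h j z - g z)) \<longlonglongrightarrow> sqrt (d + 0) + 0"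
      by (intro tendsto_add tendsto_real_sqrt tendsto_const g(2) LIMSEQ_Suc[OF lim_1_over_n])
    then show "(\<lambda>j. sqrt (d + 1 / real (Suc j)) + L2_norm \<Omega> (\<lambda>z. h j z - g z)) \<longlonglongrightarrow> sqrt d" by simp
    have "L2_norm \<Omega> (\<lambda>z. f z - g z) \<le> sqrt (d + 1 / real (Suc j)) + L2_norm \<Omega> (\<lambda>z. h j z - g z)" for j
    proof -
      have "L2_norm \<Omega> (\<lambda>z. f z - g z) = L2_norm \<Omega> (\<lambda>z. (f z - h j z) - (g z - h j z))" by simp
      also have "\<dots> \<le> L2_norm \<Omega> (\<lambda>z. f z - h j z) + L2_norm \<Omega> (\<lambda>z. g z - h j z)"
        by (intro L2_norm_triangle fh L2_diff bergman_L2 g h)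
      also have "L2_norm \<Omega> (\<lambda>z. g z - h j z) = L2_norm \<Omega> (\<lambda>z. h j z - g z)"
        unfolding L2_norm_def by (simp add: norm_minus_commute)
      also have "L2_norm \<Omega> (\<lambda>z. f z - h j z) \<le> sqrt (d + 1 / real (Suc j))"
        using h(2)[of j] by (intro real_le_rsqrt) simp
      finally show ?thesis by simp
    qed
    then show "\<exists>N. \<forall>j\<ge>N. L2_norm \<Omega> (\<lambda>z. f z - g z) \<le> sqrt (d + 1 / real (Suc j)) + L2_norm \<Omega> (\<lambda>z. h j z - g z)" by blast
  qed
  then have qg: "?q g \<le> d" using d0 power_mono[OF _ L2_norm_nonneg, of \<Omega> "\<lambda>z. f z - g z" "sqrt d" 2] by simp
  have "L2_inner \<Omega> (\<lambda>z. f z - g z) k = 0" if k: "k \<in> ?A" for k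
  proof (rule ccontr)
    define a where "a = L2_inner \<Omega> (\<lambda>z. f z - g z) k"
    assume "\<not> ?thesis"
    then have a: "cmod a > 0" by (simp add: a_def)
    define s where "s = 1 / ((L2_norm \<Omega> k)\<^sup>2 + 1)"
    have s: "s > 0" "s * (L2_norm \<Omega> k)\<^sup>2 < 1"
      unfolding s_def by (auto simp: field_simps add_pos_nonneg add_nonneg_pos)
    define c where "c = complex_of_real s * a"
    have ck: "(\<lambda>z. c * k z) \<in> L2 \<Omega>" by (intro L2_scale bergman_L2 k)
    have "(\<lambda>z. 1 * g z + c * k z) \<in> ?A" by (intro bergman_space_linear g k)
    from d[OF this] have "d \<le> (L2_norm \<Omega> (\<lambda>z. (f z - g z) - c * k z))\<^sup>2" by (simp add: algebra_simps)
    also have "\<dots> = ?q g - 2 * Re (L2_inner \<Omega> (\<lambda>z. f z - g z) (\<lambda>z. c * k z)) + (cmod c * L2_norm \<Omega> k)\<^sup>2"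
      unfolding L2_norm_diff_square[OF fg ck] using L2_scale(2)[OF bergman_L2[OF k]] by simp
    also have "L2_inner \<Omega> (\<lambda>z. f z - g z) (\<lambda>z. c * k z) = cnj c * a"
      unfolding a_def L2_inner_def by (simp add: mult.left_commute)
    also have "Re (cnj c * a) = s * (cmod a)\<^sup>2"
      unfolding c_def by (simp only: cmod_power2) (simp add: power2_eq_square algebra_simps)
    also have "(cmod c * L2_norm \<Omega> k)\<^sup>2 = s * (cmod a)\<^sup>2 * (s * (L2_norm \<Omega> k)\<^sup>2)"
      using s(1) unfolding c_def by (simp add: norm_mult power_mult_distrib power2_eq_square)
    finally have "d \<le> ?q g - 2 * (s * (cmod a)\<^sup>2) + s * (cmod a)\<^sup>2 * (s * (L2_norm \<Omega> k)\<^sup>2)" .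
    moreover have "s * (cmod a)\<^sup>2 * (s * (L2_norm \<Omega> k)\<^sup>2) \<le> s * (cmod a)\<^sup>2 * 1"
      using s a by (intro mult_left_mono) auto
    moreover have "s * (cmod a)\<^sup>2 > 0" using s a by simp
    ultimately show False using qg by linarith
  qed
  then show thesis using that g(1) by blast
qed

lemma bergman_projection_unique:
  assumes f: "f \<in> L2 \<Omega>" and h: "h \<in> bergman_space \<Omega>" "\<And>g. g \<in> bergman_space \<Omega> \<Longrightarrow> L2_inner \<Omega> (\<lambda>z. f z - h z) g = 0"
    and k: "k \<in> bergman_space \<Omega>" "\<And>g. g \<in> bergman_space \<Omega> \<Longrightarrow> L2_inner \<Omega> (\<lambda>z. f z - k z) g = 0"
    and z: "z \<in> \<Omega>"
  shows "h z = k z"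
proof -
  have hk: "(\<lambda>z. h z - k z) \<in> bergman_space \<Omega>" by (intro bergman_space_diff h k)
  have "L2_inner \<Omega> (\<lambda>z. (f z - k z) - (f z - h z)) (\<lambda>z. h z - k z) = 0"
    using L2_inner_diff_left[OF L2_diff[OF f bergman_L2[OF k(1)]] L2_diff[OF f bergman_L2[OF h(1)]] bergman_L2[OF hk]]
      h(2)[OF hk] k(2)[OF hk] by simp
  then have "L2_inner \<Omega> (\<lambda>z. h z - k z) (\<lambda>z. h z - k z) = 0" by simp
  then have "L2_norm \<Omega> (\<lambda>z. h z - k z) = 0" unfolding L2_inner_self by simp
  then show ?thesis using bergman_norm_zero[OF hk _ z] by simp
qed

lemma bergman_projection:
  assumes f: "f \<in> L2 \<Omega>"
  shows "bergman_projection \<Omega> f \<in> bergman_space \<Omega>"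
    and "\<And>g. g \<in> bergman_space \<Omega> \<Longrightarrow> L2_inner \<Omega> (\<lambda>z. f z - bergman_projection \<Omega> f z) g = 0"
proof -
  obtain h where h: "h \<in> bergman_space \<Omega>" "\<And>g. g \<in> bergman_space \<Omega> \<Longrightarrow> L2_inner \<Omega> (\<lambda>z. f z - h z) g = 0"
    using bergman_projection_exists[OF f] by blast
  define h0 where "h0 z = (if z \<in> \<Omega> then h z else 0)" for z
  have eq: "h0 z = h z" if "z \<in> \<Omega>" for z using that by (simp add: h0_def)
  have "holomorphic_sv \<Omega> h0" unfolding holomorphic_sv_def
  proof
    fix z assume z: "z \<in> \<Omega>"
    obtain D where D: "(h has_derivative D) (at z)" "\<And>c v. D (c *s v) = c * D v"
      using holomorphic_svE[of \<Omega> h z] h(1) z by (auto simp: bergman_space_def)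
    have "(h0 has_derivative D) (at z)"
      using has_derivative_cong_open[of \<Omega> z h0 h D, OF open_\<Omega> z eq] D(1) by simp
    then show "\<exists>D. (h0 has_derivative D) (at z) \<and> (\<forall>c v. D (c *s v) = c * D v)"
      using D(2) by blast
  qed
  moreover have "h0 \<in> L2 \<Omega>" using L2_cong[of \<Omega> h0 h, OF eq] bergman_L2[OF h(1)] by simp
  ultimately have h0: "h0 \<in> bergman_space \<Omega>" by (simp add: bergman_space_def)
  have h0i: "L2_inner \<Omega> (\<lambda>z. f z - h0 z) g = 0" if "g \<in> bergman_space \<Omega>" for g
    using h(2)[OF that] L2_inner_cong[of \<Omega> "\<lambda>z. f z - h0 z" "\<lambda>z. f z - h z" g g] eq by simp
  let ?P = "\<lambda>h. h \<in> bergman_space \<Omega> \<and> (\<forall>z. z \<notin> \<Omega> \<longrightarrow> h z = 0) \<and>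
     (\<forall>g\<in>bergman_space \<Omega>. L2_inner \<Omega> (\<lambda>z. f z - h z) g = 0)"
  have P: "?P h0" using h0 h0i by (simp add: h0_def)
  have "bergman_projection \<Omega> f = h0"
    unfolding bergman_projection_def
  proof (rule the_equality[of ?P, OF P])
    fix k assume k: "?P k"
    show "k = h0"
    proof
      fix z
      show "k z = h0 z"
      proof (cases "z \<in> \<Omega>")
        case True
        then show ?thesis using k by (intro bergman_projection_unique[OF f _ _ h0 h0i]) blast+
      qed (use k in \<open>simp add: h0_def\<close>)
    qed
  qed
  then show "bergman_projection \<Omega> f \<in> bergman_space \<Omega>"
    "\<And>g. g \<in> bergman_space \<Omega> \<Longrightarrow> L2_inner \<Omega> (\<lambda>z. f z - bergman_projection \<Omega> f z) g = 0"
    using h0 h0i by auto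
qed

lemma bergman_projection_eqI:
  assumes "f \<in> L2 \<Omega>" "h \<in> bergman_space \<Omega>"
    "\<And>g. g \<in> bergman_space \<Omega> \<Longrightarrow> L2_inner \<Omega> (\<lambda>z. f z - h z) g = 0" "z \<in> \<Omega>"
  shows "bergman_projection \<Omega> f z = h z"
  using bergman_projection_unique[OF assms(1) bergman_projection[OF assms(1)] assms(2-4)] by simp

lemma bergman_projection_linear:
  assumes "f \<in> L2 \<Omega>" "g \<in> L2 \<Omega>" "z \<in> \<Omega>"
  shows "bergman_projection \<Omega> (\<lambda>z. a * f z + b * g z) z = a * bergman_projection \<Omega> f z + b * bergman_projection \<Omega> g z"
proof (rule bergman_projection_eqI[OF _ _ _ assms(3)])
  let ?F = "bergman_projection \<Omega> f" and ?G = "bergman_projection \<Omega> g"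
  note F = bergman_projection[OF assms(1)] and G = bergman_projection[OF assms(2)]
  show "(\<lambda>z. a * f z + b * g z) \<in> L2 \<Omega>" by (intro L2_add L2_scale assms)
  show "(\<lambda>z. a * ?F z + b * ?G z) \<in> bergman_space \<Omega>" by (intro bergman_space_linear F G)
  fix k assume k: "k \<in> bergman_space \<Omega>"
  have fF: "(\<lambda>z. f z - ?F z) \<in> L2 \<Omega>" "(\<lambda>z. g z - ?G z) \<in> L2 \<Omega>"
    by (intro L2_diff assms bergman_L2 F G)+
  have "(\<lambda>z. a * f z + b * g z - (a * ?F z + b * ?G z)) = (\<lambda>z. a * (f z - ?F z) + b * (g z - ?G z))"
    by (simp add: fun_eq_iff algebra_simps)
  then show "L2_inner \<Omega> (\<lambda>z. a * f z + b * g z - (a * ?F z + b * ?G z)) k = 0"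
    using L2_inner_add_left[OF L2_scale(1)[OF fF(1)] L2_scale(1)[OF fF(2)] bergman_L2[OF k]]
    by (simp add: L2_inner_scale_left F(2)[OF k] G(2)[OF k])
qed

lemma bergman_projection_norm:
  assumes f: "f \<in> L2 \<Omega>"
  shows "L2_norm \<Omega> (bergman_projection \<Omega> f) \<le> L2_norm \<Omega> f"
proof -
  let ?F = "bergman_projection \<Omega> f"
  note F = bergman_projection[OF f]
  have FL: "?F \<in> L2 \<Omega>" using F(1) bergman_L2 by blast
  have "L2_inner \<Omega> f ?F = L2_inner \<Omega> ?F ?F"
    using F(2)[OF F(1)] L2_inner_diff_left[OF f FL FL] by simp
  then have "cmod (L2_inner \<Omega> f ?F) = (L2_norm \<Omega> ?F)\<^sup>2"
    by (simp only: L2_inner_self norm_of_real) simp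
  then have "(L2_norm \<Omega> ?F)\<^sup>2 \<le> L2_norm \<Omega> f * L2_norm \<Omega> ?F"
    using L2_inner_bound[OF f FL] by simp
  then show ?thesis
    using L2_norm_nonneg[of \<Omega> ?F] L2_norm_nonneg[of \<Omega> f] by (cases "L2_norm \<Omega> ?F = 0") (auto simp: power2_eq_square)
qed

lemma bergman_projection_eq:
  assumes "f \<in> L2 \<Omega>" "f' \<in> L2 \<Omega>" "z \<in> \<Omega>"
    "\<And>g. g \<in> bergman_space \<Omega> \<Longrightarrow> L2_inner \<Omega> f g = L2_inner \<Omega> f' g"
  shows "bergman_projection \<Omega> f z = bergman_projection \<Omega> f' z"
proof (rule bergman_projection_eqI[OF assms(1) bergman_projection(1)[OF assms(2)] _ assms(3)])
  fix g assume g: "g \<in> bergman_space \<Omega>"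
  have F: "bergman_projection \<Omega> f' \<in> L2 \<Omega>" by (rule bergman_L2[OF bergman_projection(1)[OF assms(2)]])
  show "L2_inner \<Omega> (\<lambda>z. f z - bergman_projection \<Omega> f' z) g = 0"
    using L2_inner_diff_left[OF assms(1) F bergman_L2[OF g]] L2_inner_diff_left[OF assms(2) F bergman_L2[OF g]]
      bergman_projection(2)[OF assms(2) g] assms(4)[OF g] by simp
qed

lemma bergman_projection_derivative_bound:
  assumes "set bs \<subseteq> Basis" "z \<in> \<Omega>"
  obtains C where "C \<ge> 0" "\<And>f. f \<in> L2 \<Omega> \<Longrightarrow> cmod (partials bs (bergman_projection \<Omega> f) z) \<le> C * L2_norm \<Omega> f"
proof -
  obtain C where C: "C \<ge> 0" "\<And>h. h \<in> bergman_space \<Omega> \<Longrightarrow> cmod (partials bs h z) \<le> C * L2_norm \<Omega> h"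
    using bergman_point_evaluation[OF assms] by blast
  have "cmod (partials bs (bergman_projection \<Omega> f) z) \<le> C * L2_norm \<Omega> f" if "f \<in> L2 \<Omega>" for f
    using C(2)[OF bergman_projection(1)[OF that]] mult_left_mono[OF bergman_projection_norm[OF that] C(1)] by linarith
  then show thesis using that C(1) by blast
qed

end

section \<open>Integrals of conjugate holomorphic functions\<close>

lemma partial_of_real:
  assumes "f differentiable (at x)"
  shows "partial b (\<lambda>x. complex_of_real (f x)) x = of_real (partial b f x)"
  by (rule partial_bounded_linear[OF bounded_linear_of_real assms])

lemma inner_ii_self: "(\<i> *s v) \<bullet> v = 0" for v :: "complex ^ 'n"
  by (simp add: inner_vec_def inner_complex_def)

locale strict_weighted_domain = weighted_domain \<Omega> w K for \<Omega> :: "(complex ^ 'n) set" and w K +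
  fixes c :: real
  assumes c_pos: "c > 0" and gradient: "\<And>x. x \<in> \<Omega> \<Longrightarrow> c \<le> (\<Sum>b\<in>Basis. (partial b w x)\<^sup>2) + (w x)\<^sup>2"
begin

text \<open>The square of the length of the gradient of the weight. The term \<open>W x * W x\<close> keeps it away from
  zero in the interior, where the gradient may vanish.\<close>

definition q where "q x = (\<Sum>b\<in>Basis. partial b W x * partial b W x) + W x * W x"

text \<open>The vector field \<open>\<Sum>b. a b * \<partial>b\<close> is \<open>(\<nabla>w - \<i> J \<nabla>w) / q\<close>, where \<open>J\<close> is the multiplication by \<open>\<i>\<close>.
  It is of type \<open>(1,0)\<close>, so it annihilates conjugate holomorphic functions, and its value on the
  weight is \<open>1\<close> up to second order at the boundary.\<close>

definition a where "a b x = (partial b W x +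
    (- \<i>) * (\<Sum>e\<in>Basis. of_real ((\<i> *s e) \<bullet> b) * partial e W x)) * inverse (q x)"

definition grad where "grad x = (\<Sum>b\<in>Basis. partial b w x *\<^sub>R b)"

definition divergence where "divergence u x = (\<Sum>b\<in>Basis. partial b (\<lambda>x. a b x * u x) x)"

lemma w_differentiable: "x \<in> \<Omega> \<Longrightarrow> w differentiable (at x)"
proof -
  assume x: "x \<in> \<Omega>"
  obtain D where "(W has_derivative D) (at x)"
    using smooth_on_differentiable[OF W_smooth x] unfolding differentiable_def by blast
  from has_derivative_Re[OF this] show ?thesis by (auto intro: differentiableI)
qed

lemma partial_W: "x \<in> \<Omega> \<Longrightarrow> partial b W x = of_real (partial b w x)"
  by (rule partial_of_real[OF w_differentiable])

lemma q_eq: "x \<in> \<Omega> \<Longrightarrow> q x = of_real ((\<Sum>b\<in>Basis. (partial b w x)\<^sup>2) + (w x)\<^sup>2)"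
  by (simp add: q_def partial_W power2_eq_square)

lemma q_bound: "x \<in> \<Omega> \<Longrightarrow> c \<le> cmod (q x)"
  using gradient[of x] c_pos unfolding q_eq norm_of_real by simp

lemma q_nz: "x \<in> \<Omega> \<Longrightarrow> q x \<noteq> 0"
  using q_bound[of x] c_pos by auto

lemma smooth_bounded_q: "smooth_bounded \<Omega> q"
  unfolding q_def
  by (intro smooth_bounded_add smooth_bounded_sum smooth_bounded_mult smooth_bounded_partial w_smooth open_domain)

lemma smooth_bounded_inverse_q: "smooth_bounded \<Omega> (\<lambda>x. inverse (q x))"
  using smooth_bounded_inverse[OF open_domain smooth_bounded_q c_pos q_bound] .

lemma smooth_bounded_a: "b \<in> Basis \<Longrightarrow> smooth_bounded \<Omega> (a b)"
  unfolding a_def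
  by (intro smooth_bounded_mult smooth_bounded_add smooth_bounded_sum smooth_bounded_const
      smooth_bounded_partial w_smooth open_domain smooth_bounded_inverse_q)

lemma smooth_bounded_divergence:
  "smooth_bounded \<Omega> u \<Longrightarrow> smooth_bounded \<Omega> (divergence u)"
  unfolding divergence_def
  by (intro smooth_bounded_sum smooth_bounded_partial smooth_bounded_mult smooth_bounded_a open_domain)

lemma grad_inner: "b \<in> Basis \<Longrightarrow> grad x \<bullet> b = partial b w x"
  unfolding grad_def by (rule inner_sum_left_Basis)

lemma a_eq:
  assumes "x \<in> \<Omega>" "b \<in> Basis"
  shows "a b x = (of_real (grad x \<bullet> b) + (- \<i>) * of_real ((\<i> *s grad x) \<bullet> b)) * inverse (q x)"
proof -
  have "\<i> *s grad x = (\<Sum>e\<in>Basis. partial e w x *\<^sub>R (\<i> *s e))"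
    unfolding grad_def by (simp only: linear_sum[OF linear_vector_smult] linear_cmul[OF linear_vector_smult])
  then have "(\<i> *s grad x) \<bullet> b = (\<Sum>e\<in>Basis. partial e w x * ((\<i> *s e) \<bullet> b))"
    by (simp add: inner_sum_left)
  then have "(\<Sum>e\<in>Basis. of_real ((\<i> *s e) \<bullet> b) * partial e W x) = complex_of_real ((\<i> *s grad x) \<bullet> b)"
    by (simp add: partial_W[OF assms(1)] mult.commute)
  then show ?thesis unfolding a_def partial_W[OF assms(1)] grad_inner[OF assms(2)] by simp
qed

lemma a_field:
  assumes "x \<in> \<Omega>" "F differentiable (at x)"
  shows "(\<Sum>b\<in>Basis. a b x * partial b F x) =
    inverse (q x) * (partial (grad x) F x + (- \<i>) * partial (\<i> *s grad x) F x)"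
proof -
  have "(\<Sum>b\<in>Basis. a b x * partial b F x) =
      (\<Sum>b\<in>Basis. inverse (q x) * ((grad x \<bullet> b) *\<^sub>R partial b F x + (- \<i>) * (((\<i> *s grad x) \<bullet> b) *\<^sub>R partial b F x)))"
    by (rule sum.cong) (simp_all add: a_eq[OF assms(1)] scaleR_conv_of_real algebra_simps)
  also have "\<dots> = inverse (q x) * ((\<Sum>b\<in>Basis. (grad x \<bullet> b) *\<^sub>R partial b F x) +
      (- \<i>) * (\<Sum>b\<in>Basis. ((\<i> *s grad x) \<bullet> b) *\<^sub>R partial b F x))"
    by (simp only: sum_distrib_left[symmetric] sum.distrib)
  finally show ?thesis by (simp only: partial_expand[OF assms(2), symmetric])
qed

lemma a_field_conj_holomorphic:
  assumes "conj_holomorphic_sv \<Omega> F" "x \<in> \<Omega>"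
  shows "F differentiable (at x)" "(\<Sum>b\<in>Basis. a b x * partial b F x) = 0"
proof -
  obtain D where D: "((\<lambda>z. cnj (F z)) has_derivative D) (at x)" "\<And>c v. D (c *s v) = c * D v"
    using assms holomorphic_svE[of \<Omega> "\<lambda>z. cnj (F z)"] unfolding conj_holomorphic_sv_def by blast
  have E: "(F has_derivative (\<lambda>v. cnj (D v))) (at x)"
    using bounded_linear.has_derivative[OF bounded_linear_cnj D(1)] by simp
  then show F: "F differentiable (at x)" by (rule differentiableI)
  have "partial (\<i> *s v) F x = - \<i> * partial v F x" for v
    using partial_eqI[OF E] D(2) by simp
  then show "(\<Sum>b\<in>Basis. a b x * partial b F x) = 0"
    unfolding a_field[OF assms(2) F] by simp
qed

lemma a_field_W:
  assumes "x \<in> \<Omega>"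
  shows "(\<Sum>b\<in>Basis. a b x * partial b W x) = 1 + (- 1) * (W x * W x * inverse (q x))"
proof -
  have "partial v W x = of_real (v \<bullet> grad x)" for v
  proof -
    have "partial v W x = of_real (partial v w x)" by (rule partial_W[OF assms])
    also have "partial v w x = (\<Sum>b\<in>Basis. (v \<bullet> b) *\<^sub>R partial b w x)"
      by (rule partial_expand[OF w_differentiable[OF assms]])
    also have "\<dots> = (\<Sum>b\<in>Basis. (v \<bullet> b) * (grad x \<bullet> b))" by (simp add: grad_inner)
    also have "\<dots> = v \<bullet> grad x" by (rule euclidean_inner[symmetric])
    finally show ?thesis .
  qed
  then have "(\<Sum>b\<in>Basis. a b x * partial b W x) = inverse (q x) * of_real (grad x \<bullet> grad x)"
    unfolding a_field[OF assms smooth_on_differentiable[OF W_smooth assms]] by (simp add: inner_ii_self)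
  also have "of_real (grad x \<bullet> grad x) = q x - W x * W x"
    unfolding q_eq[OF assms] by (simp add: euclidean_inner[of "grad x" "grad x"] grad_inner power2_eq_square)
  also have "inverse (q x) * (q x - W x * W x) = 1 + (- 1) * (W x * W x * inverse (q x))"
    using q_nz[OF assms] by (simp add: field_simps)
  finally show ?thesis .
qed

text \<open>These are the integrands of the inner products of conjugate holomorphic with holomorphic
  functions: they may blow up at the boundary like a power of the weight.\<close>

definition admissible where
  "admissible F \<longleftrightarrow> conj_holomorphic_sv \<Omega> F \<and> smooth_on \<Omega> F \<and> integrable (lebesgue_on \<Omega>) F \<and>
    (\<exists>p::nat. symbols \<Omega> w 1 (- real p) {F})"

lemma smooth_bounded_measurable: "smooth_bounded \<Omega> v \<Longrightarrow> v \<in> borel_measurable (lebesgue_on \<Omega>)"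
  by (rule continuous_measurable_domain[OF bounded_domain open_domain smooth_on_continuous[OF smooth_bounded_smooth]])

lemma integrable_times_bounded:
  fixes F v :: "complex ^ 'n \<Rightarrow> complex"
  assumes "integrable (lebesgue_on \<Omega>) F" "v \<in> borel_measurable (lebesgue_on \<Omega>)" "\<And>x. x \<in> \<Omega> \<Longrightarrow> cmod (v x) \<le> C"
  shows "integrable (lebesgue_on \<Omega>) (\<lambda>x. F x * v x)"
proof (rule Bochner_Integration.integrable_bound)
  show "integrable (lebesgue_on \<Omega>) (\<lambda>x. C * cmod (F x))"
    using assms(1) by (intro integrable_mult_right integrable_norm)
  show "(\<lambda>x. F x * v x) \<in> borel_measurable (lebesgue_on \<Omega>)"
    using borel_measurable_integrable[OF assms(1)] assms(2) by (rule borel_measurable_times)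
  show "AE x in lebesgue_on \<Omega>. norm (F x * v x) \<le> norm (C * cmod (F x))"
  proof (rule AE_I2)
    fix x assume "x \<in> space (lebesgue_on \<Omega>)"
    then have "cmod (v x) \<le> C" using assms(3) by simp
    then have "cmod (v x) * cmod (F x) \<le> \<bar>C\<bar> * cmod (F x)" by (intro mult_right_mono) auto
    then show "norm (F x * v x) \<le> norm (C * cmod (F x))" by (simp add: norm_mult abs_mult mult.commute)
  qed
qed

lemma integrable_times_smooth_bounded:
  assumes "integrable (lebesgue_on \<Omega>) F" "smooth_bounded \<Omega> v"
  shows "integrable (lebesgue_on \<Omega>) (\<lambda>x. F x * v x)"
proof -
  obtain C where "\<And>x. x \<in> \<Omega> \<Longrightarrow> cmod (partials [] v x) \<le> C"
    using smooth_boundedE[OF assms(2), of "[]"] by auto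
  then show ?thesis
    using integrable_times_bounded[OF assms(1) smooth_bounded_measurable[OF assms(2)], of C] by simp
qed

text \<open>A function that vanishes to second order at the boundary is differentiable on the whole space
  after extension by zero.\<close>

lemma integral_partial_domain_zero:
  assumes G: "symbols \<Omega> w 1 2 {G}" and b: "b \<in> Basis"
  shows "integrable (lebesgue_on \<Omega>) (partial b G)" "(LINT x|lebesgue_on \<Omega>. partial b G x) = 0"
proof -
  obtain C where C: "C \<ge> 0" "\<And>g bs x. g \<in> {G} \<Longrightarrow> set bs \<subseteq> Basis \<Longrightarrow> length bs \<le> 1 \<Longrightarrow> x \<in> \<Omega> \<Longrightarrow>
    cmod (partials bs g x) \<le> C * w x powr (2 - real (length bs))"
    using symbolsE[OF G] by metis
  have sm: "smooth_on \<Omega> G" using symbols_smooth[OF G] by simp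
  have C0: "cmod (G x) \<le> C * (w x)\<^sup>2" if "x \<in> \<Omega>" for x
    using C(2)[of G "[]" x] w_range[OF that] that by (simp add: powr_numeral)
  have C1: "cmod (partial b G x) \<le> C" if "x \<in> \<Omega>" for x
  proof -
    have "cmod (partial b G x) \<le> C * w x"
      using C(2)[of G "[b]" x] w_range[OF that] that b by (simp add: partials_Cons)
    also have "\<dots> \<le> C * 1" using w_range[OF that] C(1) by (intro mult_left_mono) auto
    finally show ?thesis by simp
  qed
  let ?E = "\<lambda>x. if x \<in> \<Omega> then G x else 0"
  have pE: "partial b ?E = (\<lambda>x. if x \<in> \<Omega> then partial b G x else 0)"
    by (rule ext) (rule zero_extension(2)[OF smooth_on_differentiable[OF sm] C0])
  obtain R where "\<Omega> \<subseteq> ball 0 R" using bounded_subset_ballD[OF bounded_domain, of 0] by blast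
  then have R: "\<Omega> \<subseteq> cball 0 R" using ball_subset_cball by blast
  have Ed: "?E differentiable (at x)" for x
    using zero_extension(1)[OF smooth_on_differentiable[OF sm] C0] .
  have Eb: "cmod (partial b ?E x) \<le> C" for x
    unfolding pE using C1[of x] C(1) by simp
  have Es: "?E x = 0" if "x \<notin> cball 0 R" for x using R that by auto
  have i: "integrable lborel (partial b ?E)" and z0: "integral\<^sup>L lborel (partial b ?E) = 0"
    using integral_partial_zero[of ?E b C R, OF Ed Eb Es b] by (blast, blast)
  have m: "(\<lambda>x. if x \<in> \<Omega> then partial b G x else 0) \<in> borel_measurable borel"
    using borel_measurable_integrable[OF i] unfolding pE by simp
  show "(LINT x|lebesgue_on \<Omega>. partial b G x) = 0"
    using lebesgue_on_integral_zero_extension[OF _ m] z0 open_domain unfolding pE by simp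
  have pm: "partial b G \<in> borel_measurable (lebesgue_on \<Omega>)"
    by (rule continuous_measurable_domain[OF bounded_domain open_domain smooth_on_continuous[OF smooth_on_partial[OF sm b]]])
  show "integrable (lebesgue_on \<Omega>) (partial b G)"
    by (rule L2_imp_L1(1)[OF bounded_domain open_domain L2_bounded(1)[OF bounded_domain open_domain pm C1 C(1)]])
qed

lemma cut_bounds:
  assumes "\<epsilon> > 0" "x \<in> \<Omega>"
  shows "cmod (cut 0 \<epsilon> x) \<le> 1" "cmod (cut 1 \<epsilon> x) \<le> 1"
proof -
  have e: "\<epsilon> / w x \<ge> 0" using assms w_range[OF assms(2)] by simp
  show "cmod (cut 0 \<epsilon> x) \<le> 1" unfolding cut_def norm_of_real using e by simp
  have "(\<epsilon> / w x) ^ 1 * exp (- (\<epsilon> / w x)) \<le> fact 1" by (rule power_exp_minus_bounded[OF e])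
  moreover have "0 \<le> (\<epsilon> / w x) ^ 1 * exp (- (\<epsilon> / w x))"
    using e by (intro mult_nonneg_nonneg zero_le_power) auto
  ultimately show "cmod (cut 1 \<epsilon> x) \<le> 1"
    unfolding cut_def norm_of_real by (simp only: abs_of_nonneg fact_1)
qed

text \<open>The cutoff functions make the divergence theorem applicable although \<open>F\<close> may blow up at the
  boundary. The error term contains the derivative of the cutoff along the vector field, which
  is bounded after multiplication by \<open>w\<close> and tends to \<open>0\<close> pointwise.\<close>

lemma integral_divergence_zero:
  assumes F: "admissible F" and v: "smooth_bounded \<Omega> v"
  shows "(LINT x|lebesgue_on \<Omega>. F x * divergence (\<lambda>x. W x * v x) x) = 0"
proof -
  obtain p :: nat where F1: "conj_holomorphic_sv \<Omega> F" "smooth_on \<Omega> F" "integrable (lebesgue_on \<Omega>) F"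
    "symbols \<Omega> w 1 (- real p) {F}" using F unfolding admissible_def by blast
  let ?Wv = "\<lambda>x. W x * v x"
  let ?r = "\<lambda>x. v x * (1 + (- 1) * (W x * W x * inverse (q x)))"
  have Wv: "smooth_bounded \<Omega> ?Wv" by (intro smooth_bounded_mult open_domain w_smooth v)
  have r: "smooth_bounded \<Omega> ?r"
    by (intro smooth_bounded_mult smooth_bounded_add smooth_bounded_const open_domain w_smooth v smooth_bounded_inverse_q)
  have d: "smooth_bounded \<Omega> (divergence ?Wv)" by (rule smooth_bounded_divergence[OF Wv])
  define e where "e j = inverse (real (Suc j))" for j
  have e: "e j > 0" for j by (simp add: e_def)
  have e0: "e \<longlonglongrightarrow> 0" unfolding e_def by (rule LIMSEQ_inverse_real_of_nat)
  define G where "G j b x = cut 0 (e j) x * F x * (a b x * ?Wv x)" for j b x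
  have Gs: "symbols \<Omega> w 1 2 {G j b}" if b: "b \<in> Basis" for j b
  proof -
    have av: "symbols \<Omega> w 1 0 ((\<lambda>_ x. a b x * ?Wv x) ` {()})"
      using symbols_smooth_bounded[OF w_range smooth_bounded_mult[OF open_domain smooth_bounded_a[OF b] Wv]] by simp
    \<comment> \<open>The order of flatness is chosen to compensate the blow-up of \<open>F\<close> and to leave order \<open>2\<close>.\<close>
    have c: "symbols \<Omega> w 1 (real (p + 2)) ((\<lambda>_. cut 0 (e j)) ` {()})"
      using symbols_cut_flat[OF e] by (simp only: image_insert image_empty)
    have F': "symbols \<Omega> w 1 (- real p) ((\<lambda>_. F) ` {()})"
      using F1(4) by (simp only: image_insert image_empty)
    have cF: "symbols \<Omega> w 1 (real (p + 2) + - real p) ((\<lambda>_ x. cut 0 (e j) x * F x) ` {()})"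
      by (rule symbols_family_mult[OF open_domain _ c F']) (use w_range in auto)
    have "symbols \<Omega> w 1 ((real (p + 2) + - real p) + 0) ((\<lambda>_ x. (cut 0 (e j) x * F x) * (a b x * ?Wv x)) ` {()})"
      by (rule symbols_family_mult[OF open_domain _ cF av]) (use w_range in auto)
    moreover have "G j b = (\<lambda>x. (cut 0 (e j) x * F x) * (a b x * ?Wv x))" by (simp add: G_def fun_eq_iff)
    ultimately show ?thesis by simp
  qed
  have sum_G: "(\<Sum>b\<in>Basis. partial b (G j b) x) = F x * (cut 0 (e j) x * divergence ?Wv x + cut 1 (e j) x * ?r x)"
    if x: "x \<in> \<Omega>" for j x
  proof -
    have dF: "F differentiable (at x)" using a_field_conj_holomorphic[OF F1(1) x] by blast
    have dc: "cut 0 (e j) differentiable (at x)" by (rule partial_cut(1)[OF x])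
    have dcF: "(\<lambda>x. cut 0 (e j) x * F x) differentiable (at x)" by (rule differentiable_mult[OF dc dF])
    have t: "partial b (G j b) x = cut 0 (e j) x * F x * partial b (\<lambda>x. a b x * ?Wv x) x
        + (cut 0 (e j) x * ?Wv x * (a b x * partial b F x)
        + cut 1 (e j) x * (inverse (W x) * ?Wv x) * F x * (a b x * partial b W x))" if b: "b \<in> Basis" for b
    proof -
      have da: "(\<lambda>x. a b x * ?Wv x) differentiable (at x)"
        by (rule smooth_on_differentiable[OF smooth_bounded_smooth[OF smooth_bounded_mult[OF open_domain smooth_bounded_a[OF b] Wv]] x])
      have "G j b = (\<lambda>x. (cut 0 (e j) x * F x) * (a b x * ?Wv x))" by (simp add: G_def fun_eq_iff)
      then have "partial b (G j b) x = partial b (\<lambda>x. cut 0 (e j) x * F x) x * (a b x * ?Wv x)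
          + cut 0 (e j) x * F x * partial b (\<lambda>x. a b x * ?Wv x) x"
        using partial_mult[OF dcF da, of b] by simp
      also have "partial b (\<lambda>x. cut 0 (e j) x * F x) x = partial b (cut 0 (e j)) x * F x + cut 0 (e j) x * partial b F x"
        by (rule partial_mult[OF dc dF])
      also have "partial b (cut 0 (e j)) x = cut 1 (e j) x * (partial b W x * inverse (W x))"
        using partial_cut(2)[OF x, where k=0 and b=b and \<epsilon>="e j"] by simp
      finally show ?thesis by (simp only: algebra_simps)
    qed
    have "(\<Sum>b\<in>Basis. partial b (G j b) x) = cut 0 (e j) x * F x * divergence ?Wv x
        + (cut 0 (e j) x * ?Wv x * (\<Sum>b\<in>Basis. a b x * partial b F x)
        + cut 1 (e j) x * (inverse (W x) * ?Wv x) * F x * (\<Sum>b\<in>Basis. a b x * partial b W x))"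
      unfolding divergence_def by (simp only: sum_distrib_left sum.distrib[symmetric]) (rule sum.cong[OF refl t])
    also have "inverse (W x) * ?Wv x = v x" using W_nz[OF x] by simp
    finally show ?thesis
      unfolding a_field_conj_holomorphic(2)[OF F1(1) x] a_field_W[OF x] by (simp add: algebra_simps)
  qed
  let ?S = "\<lambda>j x. F x * (cut 0 (e j) x * divergence ?Wv x + cut 1 (e j) x * ?r x)"
  have zero: "(LINT x|lebesgue_on \<Omega>. ?S j x) = 0" for j
  proof -
    have "(LINT x|lebesgue_on \<Omega>. ?S j x) = (LINT x|lebesgue_on \<Omega>. (\<Sum>b\<in>Basis. partial b (G j b) x))"
      by (rule Bochner_Integration.integral_cong) (simp_all add: sum_G)
    also have "\<dots> = (\<Sum>b\<in>Basis. (LINT x|lebesgue_on \<Omega>. partial b (G j b) x))"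
      by (rule Bochner_Integration.integral_sum) (rule integral_partial_domain_zero(1)[OF Gs])
    also have "\<dots> = 0" by (rule sum.neutral) (use integral_partial_domain_zero(2)[OF Gs] in blast)
    finally show ?thesis .
  qed
  obtain Cd where Cd: "Cd \<ge> 0" "\<And>x. x \<in> \<Omega> \<Longrightarrow> cmod (divergence ?Wv x) \<le> Cd"
    using smooth_boundedE[OF d, of "[]"] by auto
  obtain Cr where Cr: "Cr \<ge> 0" "\<And>x. x \<in> \<Omega> \<Longrightarrow> cmod (?r x) \<le> Cr"
    using smooth_boundedE[OF r, of "[]"] by auto
  have cm: "cut k (e j) \<in> borel_measurable (lebesgue_on \<Omega>)" for k j
    by (rule continuous_measurable_domain[OF bounded_domain open_domain smooth_on_continuous[OF smooth_on_cut]])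
  note meas = borel_measurable_integrable[OF F1(3), measurable] smooth_bounded_measurable[OF d, measurable]
    smooth_bounded_measurable[OF r, measurable] cm[measurable]
  have "(\<lambda>j. LINT x|lebesgue_on \<Omega>. ?S j x) \<longlonglongrightarrow> (LINT x|lebesgue_on \<Omega>. F x * divergence ?Wv x)"
  proof (rule integral_dominated_convergence[where w="\<lambda>x. (Cd + Cr) * cmod (F x)"])
    show "(\<lambda>x. F x * divergence ?Wv x) \<in> borel_measurable (lebesgue_on \<Omega>)" by measurable
    show "?S j \<in> borel_measurable (lebesgue_on \<Omega>)" for j by measurable
    show "integrable (lebesgue_on \<Omega>) (\<lambda>x. (Cd + Cr) * cmod (F x))"
      using F1(3) by (intro integrable_mult_right integrable_norm)
    show "AE x in lebesgue_on \<Omega>. (\<lambda>j. ?S j x) \<longlonglongrightarrow> F x * divergence ?Wv x"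
    proof (rule AE_I2)
      fix x assume "x \<in> space (lebesgue_on \<Omega>)"
      then have x: "x \<in> \<Omega>" by simp
      have ex: "(\<lambda>j. e j / w x) \<longlonglongrightarrow> 0 / w x" using w_range[OF x] by (intro tendsto_divide e0 tendsto_const) simp
      have "(\<lambda>j. cut k (e j) x) \<longlonglongrightarrow> of_real ((0 / w x) ^ k * exp (- (0 / w x)))" for k
        unfolding cut_def by (intro tendsto_intros ex)
      from this[of 0] this[of 1] have "(\<lambda>j. cut 0 (e j) x) \<longlonglongrightarrow> 1" "(\<lambda>j. cut 1 (e j) x) \<longlonglongrightarrow> 0" by auto
      then have "(\<lambda>j. ?S j x) \<longlonglongrightarrow> F x * (1 * divergence ?Wv x + 0 * ?r x)"
        by (intro tendsto_mult tendsto_add tendsto_const)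
      then show "(\<lambda>j. ?S j x) \<longlonglongrightarrow> F x * divergence ?Wv x" by simp
    qed
    show "AE x in lebesgue_on \<Omega>. norm (?S j x) \<le> (Cd + Cr) * cmod (F x)" for j
    proof (rule AE_I2)
      fix x assume "x \<in> space (lebesgue_on \<Omega>)"
      then have x: "x \<in> \<Omega>" by simp
      have "cmod (cut 0 (e j) x * divergence ?Wv x + cut 1 (e j) x * ?r x) \<le> 1 * Cd + 1 * Cr"
      proof (rule norm_triangle_le[OF add_mono])
        show "cmod (cut 0 (e j) x * divergence ?Wv x) \<le> 1 * Cd"
          unfolding norm_mult by (rule mult_mono[OF cut_bounds(1)[OF e x] Cd(2)[OF x]]) auto
        show "cmod (cut 1 (e j) x * ?r x) \<le> 1 * Cr"
          unfolding norm_mult[of "cut 1 (e j) x"] by (rule mult_mono[OF cut_bounds(2)[OF e x] Cr(2)[OF x]]) auto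
      qed
      then have "cmod (F x) * cmod (cut 0 (e j) x * divergence ?Wv x + cut 1 (e j) x * ?r x) \<le> cmod (F x) * (Cd + Cr)"
        by (intro mult_left_mono) auto
      then show "norm (?S j x) \<le> (Cd + Cr) * cmod (F x)" unfolding norm_mult by (simp only: mult.commute)
    qed
  qed
  then show ?thesis unfolding zero using LIMSEQ_unique[OF tendsto_const] by metis
qed

text \<open>Each integration by parts gains one power of the weight: modulo divergences the function
  \<open>w ^ m * \<theta>\<close> equals \<open>w ^ (m + 1)\<close> times another function with bounded derivatives.\<close>

lemma integral_vanishing_weight:
  "\<exists>\<theta>. smooth_bounded \<Omega> \<theta> \<and> (\<forall>F. admissible F \<longrightarrow>
     (LINT x|lebesgue_on \<Omega>. F x) = (LINT x|lebesgue_on \<Omega>. F x * (W x ^ m * \<theta> x)))"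
proof (induction m)
  case 0
  show ?case by (intro exI[of _ "\<lambda>_. 1"]) (simp add: smooth_bounded_const open_domain)
next
  case (Suc m)
  then obtain \<theta> where \<theta>: "smooth_bounded \<Omega> \<theta>"
    "\<And>F. admissible F \<Longrightarrow> (LINT x|lebesgue_on \<Omega>. F x) = (LINT x|lebesgue_on \<Omega>. F x * (W x ^ m * \<theta> x))" by blast
  let ?k = "inverse (of_nat (Suc m)) :: complex"
  \<comment> \<open>The factor \<open>?k\<close> cancels the exponent that comes from differentiating \<open>W x ^ Suc m\<close>; the first
    summand of \<open>\<theta>'\<close> is the defect of the field on the weight, the second one the derivative of \<open>\<theta>\<close>.\<close>
  define \<theta>' where "\<theta>' x = W x * \<theta> x * inverse (q x) + (- ?k) * divergence \<theta> x" for x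
  have \<theta>': "smooth_bounded \<Omega> \<theta>'" unfolding \<theta>'_def
    by (intro smooth_bounded_add smooth_bounded_mult smooth_bounded_const smooth_bounded_divergence
        open_domain w_smooth \<theta>(1) smooth_bounded_inverse_q)
  let ?v = "\<lambda>x. ?k * (W x ^ m * \<theta> x)"
  have v: "smooth_bounded \<Omega> ?v"
    by (intro smooth_bounded_mult smooth_bounded_const smooth_bounded_power open_domain w_smooth \<theta>(1))
  have eq: "W x ^ m * \<theta> x = divergence (\<lambda>x. W x * ?v x) x + W x ^ Suc m * \<theta>' x" if x: "x \<in> \<Omega>" for x
  proof -
    have dW: "W differentiable (at x)" using smooth_on_differentiable[OF W_smooth x] .
    have pow: "((\<lambda>z. z ^ Suc m) has_field_derivative of_nat (Suc m) * z ^ m) (at z)" for z :: complex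
      by (rule DERIV_cong[OF DERIV_power[OF DERIV_ident]]) simp
    have dWm: "(\<lambda>x. W x ^ Suc m) differentiable (at x)" by (rule differentiable_chain[OF pow dW])
    have t: "partial b (\<lambda>x. a b x * (W x * ?v x)) x =
        ?k * W x ^ Suc m * partial b (\<lambda>x. a b x * \<theta> x) x + W x ^ m * \<theta> x * (a b x * partial b W x)" if b: "b \<in> Basis" for b
    proof -
      have da: "(\<lambda>x. a b x * \<theta> x) differentiable (at x)"
        by (rule smooth_on_differentiable[OF smooth_bounded_smooth[OF smooth_bounded_mult[OF open_domain smooth_bounded_a[OF b] \<theta>(1)]] x])
      have "(\<lambda>x. a b x * (W x * ?v x)) = (\<lambda>x. ?k * (W x ^ Suc m * (a b x * \<theta> x)))"
        by (simp add: fun_eq_iff mult_ac)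
      then have "partial b (\<lambda>x. a b x * (W x * ?v x)) x = ?k * partial b (\<lambda>x. W x ^ Suc m * (a b x * \<theta> x)) x"
        using partial_bounded_linear[OF bounded_linear_mult_right[of ?k] differentiable_mult[OF dWm da], of b] by simp
      also have "partial b (\<lambda>x. W x ^ Suc m * (a b x * \<theta> x)) x =
          (of_nat (Suc m) * W x ^ m * partial b W x) * (a b x * \<theta> x) + W x ^ Suc m * partial b (\<lambda>x. a b x * \<theta> x) x"
        unfolding partial_mult[OF dWm da] partial_chain[OF pow dW] ..
      also have "?k * \<dots> = (?k * of_nat (Suc m)) * (W x ^ m * \<theta> x * (a b x * partial b W x)) + ?k * W x ^ Suc m * partial b (\<lambda>x. a b x * \<theta> x) x"
        by (simp only: algebra_simps)
      also have "?k * of_nat (Suc m) = 1" by (simp del: of_nat_Suc)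
      finally show ?thesis by (simp add: algebra_simps)
    qed
    have "divergence (\<lambda>x. W x * ?v x) x = ?k * W x ^ Suc m * divergence \<theta> x + W x ^ m * \<theta> x * (\<Sum>b\<in>Basis. a b x * partial b W x)"
      unfolding divergence_def by (simp only: sum_distrib_left sum.distrib[symmetric]) (rule sum.cong[OF refl t])
    then show ?thesis unfolding a_field_W[OF x] \<theta>'_def by (simp add: algebra_simps)
  qed
  have "(LINT x|lebesgue_on \<Omega>. F x) = (LINT x|lebesgue_on \<Omega>. F x * (W x ^ Suc m * \<theta>' x))" if F: "admissible F" for F
  proof -
    have Fi: "integrable (lebesgue_on \<Omega>) F" using F unfolding admissible_def by blast
    have Wv: "smooth_bounded \<Omega> (divergence (\<lambda>x. W x * ?v x))"
      by (intro smooth_bounded_divergence smooth_bounded_mult open_domain w_smooth v)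
    have Wt: "smooth_bounded \<Omega> (\<lambda>x. W x ^ Suc m * \<theta>' x)"
      by (intro smooth_bounded_mult smooth_bounded_power open_domain w_smooth \<theta>')
    have "(LINT x|lebesgue_on \<Omega>. F x) = (LINT x|lebesgue_on \<Omega>. F x * (W x ^ m * \<theta> x))" by (rule \<theta>(2)[OF F])
    also have "\<dots> = (LINT x|lebesgue_on \<Omega>. F x * divergence (\<lambda>x. W x * ?v x) x + F x * (W x ^ Suc m * \<theta>' x))"
    proof (rule Bochner_Integration.integral_cong[OF refl])
      fix x assume "x \<in> space (lebesgue_on \<Omega>)"
      then have x: "x \<in> \<Omega>" by simp
      show "F x * (W x ^ m * \<theta> x) = F x * divergence (\<lambda>x. W x * ?v x) x + F x * (W x ^ Suc m * \<theta>' x)"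
        by (simp only: eq[OF x] distrib_left)
    qed
    also have "\<dots> = (LINT x|lebesgue_on \<Omega>. F x * divergence (\<lambda>x. W x * ?v x) x) + (LINT x|lebesgue_on \<Omega>. F x * (W x ^ Suc m * \<theta>' x))"
      by (rule Bochner_Integration.integral_add[OF integrable_times_smooth_bounded[OF Fi Wv] integrable_times_smooth_bounded[OF Fi Wt]])
    finally show ?thesis unfolding integral_divergence_zero[OF F v] by simp
  qed
  then show ?case using \<theta>' by blast
qed

lemma bergman_symbols:
  assumes "h \<in> bergman_space \<Omega>"
  shows "symbols \<Omega> w N (- real DIM(complex ^ 'n)) {h}"
proof -
  define s where "s = L2_norm \<Omega> h + 1"
  have s: "s > 0" using L2_norm_nonneg[of \<Omega> h] by (simp add: s_def)
  have hs: "(\<lambda>z. of_real (1 / s) * h z) \<in> bergman_space \<Omega>"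
    using bergman_space_linear[OF assms assms, of "of_real (1 / s)" 0] by simp
  have "L2_norm \<Omega> (\<lambda>z. of_real (1 / s) * h z) = (1 / s) * L2_norm \<Omega> h"
    unfolding L2_scale(2)[OF bergman_L2[OF bounded_domain open_domain assms]] norm_of_real using s by simp
  also have "\<dots> \<le> 1" using s L2_norm_nonneg[of \<Omega> h] by (simp add: s_def)
  finally have "symbols \<Omega> w N (- real DIM(complex ^ 'n)) ((\<lambda>_ z. of_real (1 / s) * h z) ` {()})"
    using hs by (intro symbols_cong[OF open_domain symbols_bergman_ball[OF weighted_domain_axioms]]) auto
  from symbols_family_scalar[where c="\<lambda>_. of_real s" and C=s, OF open_domain _ _ this]
  have "symbols \<Omega> w N (- real DIM(complex ^ 'n)) {\<lambda>z. of_real s * (of_real (1 / s) * h z)}"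
    using w_range s by simp
  moreover have "(\<lambda>z. of_real s * (of_real (1 / s) * h z)) = h" using s by (simp add: fun_eq_iff)
  ultimately show ?thesis by simp
qed

lemma conj_holomorphic_bergman:
  "f \<in> L2 \<Omega> \<Longrightarrow> conj_holomorphic_sv \<Omega> f \<Longrightarrow> (\<lambda>z. cnj (f z)) \<in> bergman_space \<Omega>"
  by (simp add: bergman_space_def conj_holomorphic_sv_def L2_cnj)

lemma holomorphic_sv_mult:
  assumes "holomorphic_sv \<Omega> f" "holomorphic_sv \<Omega> g"
  shows "holomorphic_sv \<Omega> (\<lambda>z. f z * g z)"
  unfolding holomorphic_sv_def
proof
  fix z assume z: "z \<in> \<Omega>"
  obtain D where D: "(f has_derivative D) (at z)" "\<And>c v. D (c *s v) = c * D v"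
    using holomorphic_svE[OF assms(1) z] by blast
  obtain E where E: "(g has_derivative E) (at z)" "\<And>c v. E (c *s v) = c * E v"
    using holomorphic_svE[OF assms(2) z] by blast
  show "\<exists>F. ((\<lambda>z. f z * g z) has_derivative F) (at z) \<and> (\<forall>c v. F (c *s v) = c * F v)"
    by (intro exI[of _ "\<lambda>h. f z * E h + D h * g z"] conjI has_derivative_mult D(1) E(1))
       (simp add: D E algebra_simps)
qed

lemma admissible_product:
  assumes f: "f \<in> L2 \<Omega>" "conj_holomorphic_sv \<Omega> f" and g: "g \<in> bergman_space \<Omega>"
  shows "admissible (\<lambda>z. f z * cnj (g z))"
proof -
  have cf: "(\<lambda>z. cnj (f z)) \<in> bergman_space \<Omega>" by (rule conj_holomorphic_bergman[OF f])
  let ?n = "real DIM(complex ^ 'n)"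
  have F: "symbols \<Omega> w N (- ?n + - ?n) {\<lambda>z. f z * cnj (g z)}" for N
  proof -
    have "symbols \<Omega> w N (- ?n) ((\<lambda>_. f) ` {()})"
      using symbols_cnj[OF open_domain bergman_symbols[OF cf, of N]] by simp
    moreover have "symbols \<Omega> w N (- ?n) ((\<lambda>_ z. cnj (g z)) ` {()})"
      using symbols_cnj[OF open_domain bergman_symbols[OF g, of N]] by simp
    ultimately have "symbols \<Omega> w N (- ?n + - ?n) ((\<lambda>_ z. f z * cnj (g z)) ` {()})"
      by (intro symbols_family_mult open_domain) (use w_range in auto)
    then show ?thesis by simp
  qed
  have "holomorphic_sv \<Omega> (\<lambda>z. cnj (f z) * g z)"
    using holomorphic_sv_mult f(2) g unfolding conj_holomorphic_sv_def bergman_space_def by blast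
  then have "conj_holomorphic_sv \<Omega> (\<lambda>z. f z * cnj (g z))" by (simp add: conj_holomorphic_sv_def)
  moreover have "integrable (lebesgue_on \<Omega>) (\<lambda>z. f z * cnj (g z))"
    by (rule L2_inner_integrable[OF f(1) bergman_L2[OF bounded_domain open_domain g]])
  moreover have "smooth_on \<Omega> (\<lambda>z. f z * cnj (g z))" using symbols_smooth[OF F] by blast
  moreover have "- ?n + - ?n = - real (2 * DIM(complex ^ 'n))" by simp
  then have "symbols \<Omega> w 1 (- real (2 * DIM(complex ^ 'n))) {\<lambda>z. f z * cnj (g z)}" using F[of 1] by simp
  ultimately show ?thesis unfolding admissible_def by blast
qed

text \<open>Consequently the projection does not see the difference between \<open>f\<close> and a function that
  vanishes to high order at the boundary.\<close>

lemma bergman_projection_vanishing_weight: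
  obtains \<theta> where "smooth_bounded \<Omega> \<theta>"
    "\<And>f. f \<in> L2 \<Omega> \<Longrightarrow> conj_holomorphic_sv \<Omega> f \<Longrightarrow> (\<lambda>z. f z * (W z ^ m * \<theta> z)) \<in> L2 \<Omega>"
    "\<And>f z. f \<in> L2 \<Omega> \<Longrightarrow> conj_holomorphic_sv \<Omega> f \<Longrightarrow> z \<in> \<Omega> \<Longrightarrow>
      bergman_projection \<Omega> f z = bergman_projection \<Omega> (\<lambda>z. f z * (W z ^ m * \<theta> z)) z"
proof -
  obtain \<theta> where \<theta>: "smooth_bounded \<Omega> \<theta>"
    "\<And>F. admissible F \<Longrightarrow> (LINT x|lebesgue_on \<Omega>. F x) = (LINT x|lebesgue_on \<Omega>. F x * (W x ^ m * \<theta> x))"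
    using integral_vanishing_weight[of m] by blast
  have Wt: "smooth_bounded \<Omega> (\<lambda>x. W x ^ m * \<theta> x)"
    by (intro smooth_bounded_mult smooth_bounded_power open_domain w_smooth \<theta>(1))
  obtain C where C: "\<And>x. x \<in> \<Omega> \<Longrightarrow> cmod (W x ^ m * \<theta> x) \<le> C"
    using smooth_boundedE[OF Wt, of "[]"] by auto
  have L: "(\<lambda>z. f z * (W z ^ m * \<theta> z)) \<in> L2 \<Omega>" if "f \<in> L2 \<Omega>" for f
    by (rule L2_integral_product[OF bounded_domain open_domain that smooth_bounded_measurable[OF Wt] C])
  show thesis
  proof (rule that[OF \<theta>(1) L])
    fix f z assume f: "f \<in> L2 \<Omega>" "conj_holomorphic_sv \<Omega> f" and z: "z \<in> \<Omega>"
    show "bergman_projection \<Omega> f z = bergman_projection \<Omega> (\<lambda>z. f z * (W z ^ m * \<theta> z)) z"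
    proof (rule bergman_projection_eq[OF bounded_domain open_domain f(1) L[OF f(1)] z])
      fix g assume g: "g \<in> bergman_space \<Omega>"
      show "L2_inner \<Omega> f g = L2_inner \<Omega> (\<lambda>z. f z * (W z ^ m * \<theta> z)) g"
        unfolding L2_inner_def \<theta>(2)[OF admissible_product[OF f g]] by (simp add: mult_ac)
    qed
  qed
qed

end

section \<open>Uniform limits and uniform boundedness\<close>

lemma uniform_limit_derivative:
  fixes f :: "nat \<Rightarrow> 'a::euclidean_space \<Rightarrow> complex"
  assumes "open S" and d: "\<And>n x. x \<in> S \<Longrightarrow> f n differentiable (at x)"
    and u: "uniform_limit S f g sequentially"
    and v: "\<And>b. b \<in> Basis \<Longrightarrow> uniform_limit S (\<lambda>n. partial b (f n)) (g' b) sequentially"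
    and x: "x \<in> S"
  shows "(g has_derivative (\<lambda>h. \<Sum>b\<in>Basis. (h \<bullet> b) *\<^sub>R g' b x)) (at x)"
proof -
  obtain r where r: "r > 0" "ball x r \<subseteq> S" using assms(1) x open_contains_ball by blast
  let ?D = "\<lambda>x h. \<Sum>b\<in>Basis. (h \<bullet> b) *\<^sub>R g' b x"
  have "\<exists>k. \<forall>y\<in>ball x r. (\<lambda>n. f n y) \<longlonglongrightarrow> k y \<and> (k has_derivative ?D y) (at y within ball x r)"
  proof (rule has_derivative_sequence[where f'="\<lambda>n y h. \<Sum>b\<in>Basis. (h \<bullet> b) *\<^sub>R partial b (f n) y"])
    show "(f n has_derivative (\<lambda>h. \<Sum>b\<in>Basis. (h \<bullet> b) *\<^sub>R partial b (f n) y)) (at y within ball x r)"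
      if "y \<in> ball x r" for n y
    proof -
      have "y \<in> S" using that r(2) by blast
      then show ?thesis by (rule has_derivative_at_withinI[OF has_derivative_partial[OF d]])
    qed
    show "\<forall>\<^sub>F n in sequentially. \<forall>y\<in>ball x r. \<forall>h.
        norm ((\<Sum>b\<in>Basis. (h \<bullet> b) *\<^sub>R partial b (f n) y) - ?D y h) \<le> e * norm h" if e: "e > 0" for e
    proof -
      let ?e = "e / real DIM('a)"
      have e': "?e > 0" using e by simp
      have "\<forall>\<^sub>F n in sequentially. \<forall>b\<in>Basis. \<forall>y\<in>S. dist (partial b (f n) y) (g' b y) < ?e"
        using uniform_limitD[OF v e'] by (intro eventually_ball_finite) auto
      then show ?thesis
      proof eventually_elim
        case (elim n)
        show ?case
        proof (intro ballI allI)
          fix y h assume "y \<in> ball x r"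
          then have y: "y \<in> S" using r(2) by blast
          have "norm ((\<Sum>b\<in>Basis. (h \<bullet> b) *\<^sub>R partial b (f n) y) - ?D y h)
              = norm (\<Sum>b\<in>Basis. (h \<bullet> b) *\<^sub>R (partial b (f n) y - g' b y))"
            by (simp add: sum_subtractf scaleR_diff_right)
          also have "\<dots> \<le> (\<Sum>b\<in>(Basis::'a set). norm h * ?e)"
          proof (rule sum_norm_le)
            fix b :: 'a assume b: "b \<in> Basis"
            have "norm (partial b (f n) y - g' b y) \<le> ?e" using elim b y by (auto simp: dist_norm less_imp_le)
            then show "norm ((h \<bullet> b) *\<^sub>R (partial b (f n) y - g' b y)) \<le> norm h * ?e"
              unfolding norm_scaleR real_norm_def by (rule mult_mono[OF Basis_le_norm[OF b]]) simp_all
          qed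
          also have "\<dots> = e * norm h" by simp
          finally show "norm ((\<Sum>b\<in>Basis. (h \<bullet> b) *\<^sub>R partial b (f n) y) - ?D y h) \<le> e * norm h" .
        qed
      qed
    qed
    show "(\<lambda>n. f n x) \<longlonglongrightarrow> g x" by (rule tendsto_uniform_limitI[OF u x])
  qed (use r in auto)
  then obtain k where k: "\<And>y. y \<in> ball x r \<Longrightarrow> (\<lambda>n. f n y) \<longlonglongrightarrow> k y"
    "\<And>y. y \<in> ball x r \<Longrightarrow> (k has_derivative ?D y) (at y within ball x r)" by blast
  have kg: "k y = g y" if "y \<in> ball x r" for y
    using LIMSEQ_unique[OF k(1)[OF that] tendsto_uniform_limitI[OF u]] that r(2) by blast
  have xr: "x \<in> ball x r" using r by simp
  have "(k has_derivative ?D x) (at x)"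
    using k(2)[OF xr] at_within_open[OF xr open_ball] by simp
  then show ?thesis
    using has_derivative_cong_open[of "ball x r" x k g "?D x", OF open_ball xr kg] by simp
qed

lemma smooth_uniform_limit:
  fixes f :: "nat \<Rightarrow> 'a::euclidean_space \<Rightarrow> complex"
  assumes S: "open S" and f: "\<And>n. smooth_on S (f n)"
    and g: "\<And>bs. set bs \<subseteq> Basis \<Longrightarrow> uniform_limit S (\<lambda>n. partials bs (f n)) (g bs) sequentially"
  shows "smooth_on S (g [])" and "set bs \<subseteq> Basis \<Longrightarrow> x \<in> S \<Longrightarrow> partials bs (g []) x = g bs x"
proof -
  have d: "(g bs has_derivative (\<lambda>h. \<Sum>b\<in>Basis. (h \<bullet> b) *\<^sub>R g (b # bs) x)) (at x)"
    if bs: "set bs \<subseteq> Basis" and x: "x \<in> S" for bs x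
  proof (rule uniform_limit_derivative[OF S _ g[OF bs] _ x, of "\<lambda>b. g (b # bs)"])
    show "partials bs (f n) differentiable (at y)" if "y \<in> S" for n y
      by (rule smooth_on_differentiable[OF smooth_on_partials[OF f bs] that])
    show "uniform_limit S (\<lambda>n. partial b (partials bs (f n))) (g (b # bs)) sequentially" if "b \<in> Basis" for b
      using g[of "b # bs"] bs that by (simp add: partials_Cons)
  qed
  have p: "partial b (g bs) x = g (b # bs) x" if "set bs \<subseteq> Basis" "x \<in> S" "b \<in> Basis" for b bs x
  proof -
    have "partial b (g bs) x = (\<Sum>e\<in>Basis. (b \<bullet> e) *\<^sub>R g (e # bs) x)"
      by (rule partial_eqI[OF d[OF that(1,2)]])
    also have "\<dots> = (\<Sum>e\<in>Basis. if e = b then g (e # bs) x else 0)"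
      using that(3) by (intro sum.cong) (auto simp: inner_Basis)
    finally show ?thesis using that(3) by simp
  qed
  show "smooth_on S (g [])"
  proof (rule smooth_on_coinduct[OF S, where F="{g bs | bs. set bs \<subseteq> Basis}"])
    fix h and b :: 'a assume "h \<in> {g bs | bs. set bs \<subseteq> Basis}" and b: "b \<in> Basis"
    then obtain bs where bs: "h = g bs" "set bs \<subseteq> Basis" by blast
    show "\<exists>k\<in>{g bs | bs. set bs \<subseteq> Basis}. \<forall>x\<in>S. partial b h x = k x"
    proof (rule bexI[of _ "g (b # bs)"])
      show "\<forall>x\<in>S. partial b h x = g (b # bs) x" using p[OF bs(2) _ b] bs(1) by blast
      show "g (b # bs) \<in> {g bs | bs. set bs \<subseteq> Basis}"
        by (intro CollectI exI[of _ "b # bs"]) (use bs b in simp)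
    qed
  next
    show "h differentiable (at x)" if "h \<in> {g bs | bs. set bs \<subseteq> Basis}" "x \<in> S" for h x
      using that d unfolding differentiable_def by blast
  qed (auto intro!: exI[of _ "[]"])
  show "set bs \<subseteq> Basis \<Longrightarrow> x \<in> S \<Longrightarrow> partials bs (g []) x = g bs x"
  proof (induction bs arbitrary: x)
    case (Cons b bs)
    have "partials (b # bs) (g []) x = partial b (g bs) x"
      unfolding partials_Cons by (rule partial_cong[OF S Cons.prems(2)]) (use Cons in auto)
    then show ?case using p[of bs x b] Cons.prems by simp
  qed simp
qed

lemma uniformly_continuous_uniform_limit:
  fixes f :: "nat \<Rightarrow> 'a::metric_space \<Rightarrow> 'b::metric_space"
  assumes u: "uniform_limit S f g sequentially" and f: "\<And>n. uniformly_continuous_on S (f n)"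
  shows "uniformly_continuous_on S g"
  unfolding uniformly_continuous_on_def
proof (intro allI impI)
  fix e :: real assume e: "e > 0"
  then have "e / 3 > 0" by simp
  from uniform_limitD[OF u this] obtain n where n: "\<forall>x\<in>S. dist (f n x) (g x) < e / 3"
    by (auto simp: eventually_sequentially)
  obtain d where d: "d > 0" "\<And>x y. x \<in> S \<Longrightarrow> y \<in> S \<Longrightarrow> dist y x < d \<Longrightarrow> dist (f n y) (f n x) < e / 3"
    using f[of n] \<open>e / 3 > 0\<close> unfolding uniformly_continuous_on_def by metis
  have "dist (g y) (g x) < e" if "x \<in> S" "y \<in> S" "dist y x < d" for x y
  proof -
    have "dist (g y) (g x) \<le> dist (g y) (f n y) + dist (f n y) (f n x) + dist (f n x) (g x)"
      using dist_triangle[of "g y" "g x" "f n y"] dist_triangle[of "f n y" "g x" "f n x"] by linarith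
    also have "\<dots> < e / 3 + e / 3 + e / 3"
      using n that d(2)[OF that] by (intro add_strict_mono) (auto simp: dist_commute)
    finally show ?thesis by simp
  qed
  then show "\<exists>d>0. \<forall>x\<in>S. \<forall>x'\<in>S. dist x' x < d \<longrightarrow> dist (g x') (g x) < e"
    using d(1) by blast
qed

lemma geometric_uniform_limit:
  fixes u :: "nat \<Rightarrow> 'a \<Rightarrow> complex"
  assumes "\<And>m x. m \<ge> N \<Longrightarrow> x \<in> S \<Longrightarrow> cmod (u (Suc m) x - u m x) \<le> c * (1 / 2) ^ m"
  obtains g where "uniform_limit S u g sequentially"
    "\<And>m x. m \<ge> N \<Longrightarrow> x \<in> S \<Longrightarrow> cmod (g x - u m x) \<le> 2 * c * (1 / 2) ^ m"
proof -
  have step: "cmod (u (m + k) x - u m x) \<le> 2 * c * ((1 / 2) ^ m - (1 / 2) ^ (m + k))" if "m \<ge> N" "x \<in> S" for m k x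
  proof (induction k)
    case (Suc k)
    have "cmod (u (m + Suc k) x - u m x) \<le> cmod (u (Suc (m + k)) x - u (m + k) x) + cmod (u (m + k) x - u m x)"
      using norm_triangle_ineq[of "u (Suc (m + k)) x - u (m + k) x" "u (m + k) x - u m x"] by simp
    also have "\<dots> \<le> c * (1 / 2) ^ (m + k) + 2 * c * ((1 / 2) ^ m - (1 / 2) ^ (m + k))"
      by (intro add_mono Suc assms) (use that in auto)
    also have "\<dots> = 2 * c * ((1 / 2) ^ m - (1 / 2) ^ (m + Suc k))" by (simp add: algebra_simps)
    finally show ?case .
  qed simp
  have c0: "c \<ge> 0 \<or> S = {}"
  proof (cases "S = {}")
    case False
    then obtain x where "x \<in> S" by blast
    from order_trans[OF norm_ge_zero assms[OF order_refl this]] have "0 \<le> c * (1 / 2) ^ N" .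
    moreover have "(1 / 2 :: real) ^ N > 0" by simp
    ultimately show ?thesis by (metis zero_le_mult_iff not_le)
  qed simp
  have bound: "cmod (u (m + k) x - u m x) \<le> 2 * c * (1 / 2) ^ m" if "m \<ge> N" "x \<in> S" for m k x
  proof -
    have "c \<ge> 0" using c0 that by auto
    then have "2 * c * ((1 / 2) ^ m - (1 / 2) ^ (m + k)) \<le> 2 * c * (1 / 2) ^ m"
      by (intro mult_left_mono) auto
    then show ?thesis using step[OF that, of k] by linarith
  qed
  have lim0: "(\<lambda>m. 2 * c * (1 / 2) ^ m) \<longlonglongrightarrow> 0"
    by (intro tendsto_mult_right_zero LIMSEQ_power_zero) simp
  have conv: "convergent (\<lambda>n. u n x)" if x: "x \<in> S" for x
  proof (rule Cauchy_convergent, rule metric_CauchyI)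
    fix e :: real assume e: "e > 0"
    obtain M where M: "\<And>m. m \<ge> M \<Longrightarrow> norm (2 * c * (1 / 2) ^ m - 0) < e / 2"
      using LIMSEQ_D[OF lim0, of "e / 2"] e by auto
    let ?M = "max M N"
    have b: "dist (u m x) (u ?M x) < e / 2" if "m \<ge> ?M" for m
      using bound[of ?M x "m - ?M"] x that M[of ?M] by (simp add: dist_norm)
    have "dist (u m x) (u n x) < e" if "m \<ge> ?M" "n \<ge> ?M" for m n
      using b[OF that(1)] b[OF that(2)] dist_triangle_half_l by blast
    then show "\<exists>M. \<forall>m\<ge>M. \<forall>n\<ge>M. dist (u m x) (u n x) < e" by blast
  qed
  define g where "g x = lim (\<lambda>n. u n x)" for x
  have gl: "(\<lambda>n. u n x) \<longlonglongrightarrow> g x" if "x \<in> S" for x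
    using conv[OF that] by (simp add: g_def convergent_LIMSEQ_iff)
  have gb: "cmod (g x - u m x) \<le> 2 * c * (1 / 2) ^ m" if "m \<ge> N" "x \<in> S" for m x
  proof (rule LIMSEQ_le_const2)
    show "(\<lambda>k. cmod (u (k + m) x - u m x)) \<longlonglongrightarrow> cmod (g x - u m x)"
      by (intro tendsto_intros LIMSEQ_ignore_initial_segment gl that)
    show "\<exists>M. \<forall>k\<ge>M. cmod (u (k + m) x - u m x) \<le> 2 * c * (1 / 2) ^ m"
      using bound[OF that] by (auto simp: add.commute)
  qed
  have "uniform_limit S u g sequentially"
  proof (rule uniform_limitI)
    fix e :: real assume e: "e > 0"
    obtain M where M: "\<And>m. m \<ge> M \<Longrightarrow> norm (2 * c * (1 / 2) ^ m - 0) < e"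
      using LIMSEQ_D[OF lim0 e] by blast
    have "dist (u m x) (g x) < e" if "m \<ge> max M N" "x \<in> S" for m x
      using gb[of m x] M[of m] that by (simp add: dist_norm norm_minus_commute)
    then show "\<forall>\<^sub>F n in sequentially. \<forall>x\<in>S. dist (u n x) (g x) < e"
      unfolding eventually_sequentially by blast
  qed
  then show thesis using that gb by blast
qed

section \<open>Condition R as an estimate\<close>

context
  fixes \<Omega> :: "(complex ^ 'n) set"
  assumes bounded: "bounded \<Omega>" and open_\<Omega>: "open \<Omega>"
begin

lemma smooth_up_to_boundary_smooth: "f \<in> smooth_up_to_boundary \<Omega> \<Longrightarrow> smooth_on \<Omega> f"
  by (simp add: smooth_up_to_boundary_def)

lemma smooth_up_to_boundary_bounded:
  assumes "f \<in> smooth_up_to_boundary \<Omega>" "set bs \<subseteq> Basis"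
  obtains C where "C \<ge> 0" "\<And>x. x \<in> \<Omega> \<Longrightarrow> cmod (partials bs f x) \<le> C"
proof -
  obtain g where g: "continuous_on (closure \<Omega>) g" "\<forall>x\<in>\<Omega>. g x = partials bs f x"
    using assms unfolding smooth_up_to_boundary_def by blast
  have "bounded (g ` closure \<Omega>)"
    using bounded by (intro compact_imp_bounded compact_continuous_image g(1)) simp
  then obtain C where "\<forall>y\<in>g ` closure \<Omega>. cmod y \<le> C" unfolding bounded_iff by blast
  then have "cmod (partials bs f x) \<le> \<bar>C\<bar>" if "x \<in> \<Omega>" for x
    using g(2) that closure_subset[of \<Omega>] by force
  then show thesis using that[of "\<bar>C\<bar>"] by auto
qed

lemma smooth_up_to_boundary_L2:
  assumes "f \<in> smooth_up_to_boundary \<Omega>"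
  shows "f \<in> L2 \<Omega>"
proof -
  obtain C where "C \<ge> 0" "\<And>x. x \<in> \<Omega> \<Longrightarrow> cmod (f x) \<le> C"
    using smooth_up_to_boundary_bounded[OF assms, of "[]"] by auto
  then show ?thesis
    using continuous_measurable_domain[OF bounded open_\<Omega> smooth_on_continuous[OF smooth_up_to_boundary_smooth[OF assms]]]
    by (intro L2_bounded[OF bounded open_\<Omega>]) auto
qed

lemma smooth_up_to_boundary_add:
  assumes "f \<in> smooth_up_to_boundary \<Omega>" "g \<in> smooth_up_to_boundary \<Omega>"
  shows "(\<lambda>x. f x + g x) \<in> smooth_up_to_boundary \<Omega>"
proof -
  note sm = smooth_up_to_boundary_smooth[OF assms(1)] smooth_up_to_boundary_smooth[OF assms(2)]
  have "\<exists>k. continuous_on (closure \<Omega>) k \<and> (\<forall>x\<in>\<Omega>. k x = partials bs (\<lambda>x. f x + g x) x)" if bs: "set bs \<subseteq> Basis" for bs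
  proof -
    obtain k l where "continuous_on (closure \<Omega>) k" "\<forall>x\<in>\<Omega>. k x = partials bs f x"
      "continuous_on (closure \<Omega>) l" "\<forall>x\<in>\<Omega>. l x = partials bs g x"
      using assms bs unfolding smooth_up_to_boundary_def by blast
    then show ?thesis
      using partials_add[OF open_\<Omega> sm _ bs] by (intro exI[of _ "\<lambda>x. k x + l x"]) (auto intro: continuous_on_add)
  qed
  then show ?thesis using smooth_on_add[OF open_\<Omega> sm] by (simp add: smooth_up_to_boundary_def)
qed

lemma smooth_up_to_boundary_scale:
  assumes "f \<in> smooth_up_to_boundary \<Omega>"
  shows "(\<lambda>x. a * f x) \<in> smooth_up_to_boundary \<Omega>"
proof -
  note sm = smooth_up_to_boundary_smooth[OF assms]
  have "\<exists>k. continuous_on (closure \<Omega>) k \<and> (\<forall>x\<in>\<Omega>. k x = partials bs (\<lambda>x. a * f x) x)" if bs: "set bs \<subseteq> Basis" for bs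
  proof -
    obtain k where "continuous_on (closure \<Omega>) k" "\<forall>x\<in>\<Omega>. k x = partials bs f x"
      using assms bs unfolding smooth_up_to_boundary_def by blast
    then show ?thesis
      using partials_bounded_linear[OF open_\<Omega> bounded_linear_mult_right sm _ bs]
      by (intro exI[of _ "\<lambda>x. a * k x"]) (auto intro: continuous_on_mult_left)
  qed
  then show ?thesis
    using smooth_on_compose_bounded_linear[OF open_\<Omega> bounded_linear_mult_right sm]
    by (simp add: smooth_up_to_boundary_def)
qed

lemma smooth_up_to_boundary_diff:
  "f \<in> smooth_up_to_boundary \<Omega> \<Longrightarrow> g \<in> smooth_up_to_boundary \<Omega> \<Longrightarrow> (\<lambda>x. f x - g x) \<in> smooth_up_to_boundary \<Omega>"
  using smooth_up_to_boundary_add[of f "\<lambda>x. -1 * g x"] smooth_up_to_boundary_scale[of g "-1"] by simp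

lemma partials_bergman_projection_linear:
  assumes "f \<in> L2 \<Omega>" "g \<in> L2 \<Omega>" "z \<in> \<Omega>" "set bs \<subseteq> Basis"
  shows "partials bs (bergman_projection \<Omega> (\<lambda>z. a * f z + b * g z)) z =
    a * partials bs (bergman_projection \<Omega> f) z + b * partials bs (bergman_projection \<Omega> g) z"
proof -
  let ?F = "bergman_projection \<Omega> f" and ?G = "bergman_projection \<Omega> g"
  have sm: "smooth_on \<Omega> ?F" "smooth_on \<Omega> ?G"
    using bergman_smooth[OF bounded open_\<Omega>] bergman_projection(1)[OF bounded open_\<Omega>] assms by blast+
  note ml = bounded_linear_mult_right
  have sm': "smooth_on \<Omega> (\<lambda>z. a * ?F z)" "smooth_on \<Omega> (\<lambda>z. b * ?G z)"
    using smooth_on_compose_bounded_linear[OF open_\<Omega> ml] sm by blast+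
  have "partials bs (bergman_projection \<Omega> (\<lambda>z. a * f z + b * g z)) z = partials bs (\<lambda>z. a * ?F z + b * ?G z) z"
    by (rule partials_cong[OF open_\<Omega> assms(3)]) (rule bergman_projection_linear[OF bounded open_\<Omega> assms(1,2)])
  also have "\<dots> = partials bs (\<lambda>z. a * ?F z) z + partials bs (\<lambda>z. b * ?G z) z"
    by (rule partials_add[OF open_\<Omega> sm' assms(3,4)])
  also have "partials bs (\<lambda>z. a * ?F z) z = a * partials bs ?F z"
    by (rule partials_bounded_linear[OF open_\<Omega> ml sm(1) assms(3,4)])
  also have "partials bs (\<lambda>z. b * ?G z) z = b * partials bs ?G z"
    by (rule partials_bounded_linear[OF open_\<Omega> ml sm(2) assms(3,4)])
  finally show ?thesis .
qed

lemma bergman_projection_sup_bound: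
  assumes "z \<in> \<Omega>" "set bs \<subseteq> Basis"
  obtains C where "C \<ge> 0" "\<And>f s. f \<in> L2 \<Omega> \<Longrightarrow> (\<And>x. x \<in> \<Omega> \<Longrightarrow> cmod (f x) \<le> s) \<Longrightarrow> s \<ge> 0 \<Longrightarrow>
    cmod (partials bs (bergman_projection \<Omega> f) z) \<le> C * s"
proof -
  obtain C where C: "C \<ge> 0" "\<And>f. f \<in> L2 \<Omega> \<Longrightarrow> cmod (partials bs (bergman_projection \<Omega> f) z) \<le> C * L2_norm \<Omega> f"
    using bergman_projection_derivative_bound[OF bounded open_\<Omega> assms(2,1)] by blast
  show thesis
  proof (rule that[of "C * sqrt (measure lebesgue \<Omega>)"])
    fix f s assume f: "f \<in> L2 \<Omega>" "\<And>x. x \<in> \<Omega> \<Longrightarrow> cmod (f x) \<le> s" "s \<ge> 0"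
    have "cmod (partials bs (bergman_projection \<Omega> f) z) \<le> C * L2_norm \<Omega> f" by (rule C(2)[OF f(1)])
    also have "\<dots> \<le> C * (s * sqrt (measure lebesgue \<Omega>))"
      by (intro mult_left_mono C(1) L2_bounded(2)[OF bounded open_\<Omega> L2_measurable[OF f(1)] f(2,3)])
    finally show "cmod (partials bs (bergman_projection \<Omega> f) z) \<le> C * sqrt (measure lebesgue \<Omega>) * s" by (simp add: mult_ac)
  qed (use C(1) in simp)
qed

text \<open>The closed graph theorem for the projection on the Frechet space \<open>C\<^sup>\<infinity>\<close> up to the boundary, by
  a gliding hump: otherwise a sum of smooth functions with rapidly decreasing derivatives is
  mapped to a function with an unbounded derivative. Each summand is chosen so small that it
  hardly changes the derivatives at the points where the previous images are large.\<close>

lemma condition_R_estimate: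
  assumes R: "condition_R \<Omega>" and bs: "set bs \<subseteq> Basis"
  obtains k C where "C \<ge> 0"
    "\<And>\<phi> s z. \<phi> \<in> smooth_up_to_boundary \<Omega> \<Longrightarrow> s > 0 \<Longrightarrow>
      (\<And>cs x. set cs \<subseteq> Basis \<Longrightarrow> length cs \<le> k \<Longrightarrow> x \<in> \<Omega> \<Longrightarrow> cmod (partials cs \<phi> x) \<le> s) \<Longrightarrow> z \<in> \<Omega> \<Longrightarrow>
      cmod (partials bs (bergman_projection \<Omega> \<phi>) z) \<le> C * s"
proof -
  let ?X = "smooth_up_to_boundary \<Omega>"
  define T where "T z \<phi> = partials bs (bergman_projection \<Omega> \<phi>) z" for z \<phi>
  define small where "small k s \<phi> \<longleftrightarrow> (\<forall>cs x. set cs \<subseteq> Basis \<longrightarrow> length cs \<le> k \<longrightarrow> x \<in> \<Omega> \<longrightarrow> cmod (partials cs \<phi> x) \<le> s)"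
    for k :: nat and s :: real and \<phi> :: "complex ^ 'n \<Rightarrow> complex"
  have Tlin: "T z (\<lambda>x. a * f x + b * g x) = a * T z f + b * T z g" if "z \<in> \<Omega>" "f \<in> ?X" "g \<in> ?X" for z f g a b
    unfolding T_def by (rule partials_bergman_projection_linear[OF smooth_up_to_boundary_L2 smooth_up_to_boundary_L2]) (use that bs in auto)
  have Tdiff: "T z (\<lambda>x. f x - g x) = T z f - T z g" if "z \<in> \<Omega>" "f \<in> ?X" "g \<in> ?X" for z f g
    using Tlin[OF that, of 1 "-1"] by simp
  have Tscale: "T z (\<lambda>x. a * f x) = a * T z f" if "z \<in> \<Omega>" "f \<in> ?X" for z f a
    using Tlin[OF that that(2), of a 0] by simp
  have Tadd: "T z (\<lambda>x. f x + a * g x) = T z f + a * T z g" if "z \<in> \<Omega>" "f \<in> ?X" "g \<in> ?X" for z f g a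
    using Tlin[OF that, of 1 a] by simp
  have "\<exists>C\<ge>0. \<forall>f s. f \<in> L2 \<Omega> \<longrightarrow> (\<forall>x\<in>\<Omega>. cmod (f x) \<le> s) \<longrightarrow> s \<ge> 0 \<longrightarrow> cmod (T z f) \<le> C * s" if zin: "z \<in> \<Omega>" for z
  proof -
    obtain C where "C \<ge> 0" "\<And>f s. f \<in> L2 \<Omega> \<Longrightarrow> (\<And>x. x \<in> \<Omega> \<Longrightarrow> cmod (f x) \<le> s) \<Longrightarrow> s \<ge> 0 \<Longrightarrow>
      cmod (partials bs (bergman_projection \<Omega> f) z) \<le> C * s"
      using bergman_projection_sup_bound[OF zin bs] by blast
    then show ?thesis unfolding T_def by (intro exI[of _ C]) blast
  qed
  then have "\<forall>z\<in>\<Omega>. \<exists>C. C \<ge> 0 \<and> (\<forall>f s. f \<in> L2 \<Omega> \<longrightarrow> (\<forall>x\<in>\<Omega>. cmod (f x) \<le> s) \<longrightarrow> s \<ge> 0 \<longrightarrow> cmod (T z f) \<le> C * s)"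
    by blast
  from bchoice[OF this] obtain K where K: "\<forall>z\<in>\<Omega>. K z \<ge> 0 \<and>
      (\<forall>f s. f \<in> L2 \<Omega> \<longrightarrow> (\<forall>x\<in>\<Omega>. cmod (f x) \<le> s) \<longrightarrow> s \<ge> 0 \<longrightarrow> cmod (T z f) \<le> K z * s)" ..
  have K0: "K z \<ge> 0" if "z \<in> \<Omega>" for z using K that by blast
  have TK: "cmod (T z f) \<le> K z * s" if "z \<in> \<Omega>" "f \<in> L2 \<Omega>" "\<And>x. x \<in> \<Omega> \<Longrightarrow> cmod (f x) \<le> s" "s \<ge> 0" for z f s
    using K that by blast
  have TA: "\<exists>A\<ge>0. \<forall>z\<in>\<Omega>. cmod (T z \<phi>) \<le> A" if "\<phi> \<in> ?X" for \<phi>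
  proof -
    have "bergman_projection \<Omega> \<phi> \<in> ?X" using R that unfolding condition_R_def by blast
    from smooth_up_to_boundary_bounded[OF this bs] show ?thesis unfolding T_def by metis
  qed
  have "\<exists>k C. \<forall>\<phi>\<in>?X. small k 1 \<phi> \<longrightarrow> (\<forall>z\<in>\<Omega>. cmod (T z \<phi>) \<le> C)"
  proof (rule ccontr)
    assume "\<not> ?thesis"
    then have neg: "\<exists>\<phi>\<in>?X. small k 1 \<phi> \<and> (\<exists>z\<in>\<Omega>. cmod (T z \<phi>) > C)" for k C
      by (auto simp: not_le)
    \<comment> \<open>The state consists of a partial sum and of the sum of the constants \<open>K z\<close> of the points used so
      far. The latter bounds the effect of later summands at these points.\<close>
    define P where "P n st \<longleftrightarrow> fst st \<in> ?X \<and> snd st \<ge> 0" for n :: nat and st :: "(complex ^ 'n \<Rightarrow> complex) \<times> real"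
    define Q where "Q n st st' \<longleftrightarrow> small n ((1 / 2) ^ n / (1 + snd st)) (\<lambda>x. fst st' x - fst st x) \<and>
        (\<exists>z\<in>\<Omega>. snd st' = snd st + K z \<and> cmod (T z (fst st')) > real n + 2)"
      for n :: nat and st st' :: "(complex ^ 'n \<Rightarrow> complex) \<times> real"
    have "\<exists>st. P 0 st"
    proof -
      have "(\<lambda>x. 0) \<in> ?X" unfolding smooth_up_to_boundary_iff[OF bounded]
      proof (intro conjI allI impI smooth_on_const)
        fix cs :: "(complex ^ 'n) list" assume "set cs \<subseteq> Basis"
        show "uniformly_continuous_on \<Omega> (partials cs (\<lambda>x :: complex ^ 'n. 0 :: complex))"
          by (simp add: partials_zero uniformly_continuous_on_const)
      qed
      then show ?thesis by (intro exI[of _ "(\<lambda>x. 0, 0)"]) (simp add: P_def)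
    qed
    moreover have "\<exists>st'. P (Suc n) st' \<and> Q n st st'" if Pst: "P n st" for n st
    proof -
      obtain S \<kappa> where st: "st = (S, \<kappa>)" by (cases st)
      have S: "S \<in> ?X" "\<kappa> \<ge> 0" using Pst unfolding P_def st by auto
      obtain A where A: "A \<ge> 0" "\<forall>z\<in>\<Omega>. cmod (T z S) \<le> A" using TA[OF S(1)] by blast
      define \<delta> where "\<delta> = (1 / 2) ^ n / (1 + \<kappa>)"
      have \<delta>: "\<delta> > 0" using S(2) by (simp add: \<delta>_def)
      obtain \<phi> z where \<phi>: "\<phi> \<in> ?X" "small n 1 \<phi>" "z \<in> \<Omega>" "cmod (T z \<phi>) > (real n + 2 + A) / \<delta>"
        using neg[of n "(real n + 2 + A) / \<delta>"] by blast
      let ?S' = "\<lambda>x. S x + of_real \<delta> * \<phi> x"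
      have S': "?S' \<in> ?X" by (intro smooth_up_to_boundary_add smooth_up_to_boundary_scale S \<phi>(1))
      have "real n + 2 + A < \<delta> * cmod (T z \<phi>)" using \<phi>(4) \<delta> by (simp add: field_simps)
      also have "\<delta> * cmod (T z \<phi>) = cmod (T z ?S' - T z S)"
        unfolding Tadd[OF \<phi>(3) S(1) \<phi>(1)] using \<delta> by (simp add: norm_mult)
      also have "\<dots> \<le> cmod (T z ?S') + A"
        using norm_triangle_ineq4[of "T z ?S'" "T z S"] A(2) \<phi>(3) by force
      finally have big: "cmod (T z ?S') > real n + 2" by simp
      have "small n \<delta> (\<lambda>x. of_real \<delta> * \<phi> x)" unfolding small_def
      proof (intro allI impI)
        fix cs :: "(complex ^ 'n) list" and x assume c: "set cs \<subseteq> Basis" "length cs \<le> n" "x \<in> \<Omega>"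
        have "partials cs (\<lambda>x. of_real \<delta> * \<phi> x) x = of_real \<delta> * partials cs \<phi> x"
          by (rule partials_bounded_linear[OF open_\<Omega> bounded_linear_mult_right smooth_up_to_boundary_smooth[OF \<phi>(1)] c(3,1)])
        then have "cmod (partials cs (\<lambda>x. of_real \<delta> * \<phi> x) x) = \<delta> * cmod (partials cs \<phi> x)"
          using \<delta> by (simp add: norm_mult)
        also have "\<dots> \<le> \<delta> * 1" using \<phi>(2) c \<delta> unfolding small_def by (intro mult_left_mono) auto
        finally show "cmod (partials cs (\<lambda>x. of_real \<delta> * \<phi> x) x) \<le> \<delta>" by simp
      qed
      then have "Q n st (?S', \<kappa> + K z)"
        unfolding Q_def st using big \<phi>(3) by (auto simp: \<delta>_def)
      moreover have "P (Suc n) (?S', \<kappa> + K z)"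
        unfolding P_def using S' S(2) K0[OF \<phi>(3)] by simp
      ultimately show ?thesis by blast
    qed
    ultimately have "\<exists>st. \<forall>n. P n (st n) \<and> Q n (st n) (st (Suc n))"
      by (rule dependent_nat_choice)
    then obtain st where st: "\<And>n. P n (st n)" "\<And>n. Q n (st n) (st (Suc n))" by blast
    define S where "S n = fst (st n)" for n
    define \<kappa> where "\<kappa> n = snd (st n)" for n
    have SX: "S n \<in> ?X" and \<kappa>0: "\<kappa> n \<ge> 0" for n using st(1)[of n] unfolding P_def S_def \<kappa>_def by auto
    have Ssm: "small n ((1 / 2) ^ n / (1 + \<kappa> n)) (\<lambda>x. S (Suc n) x - S n x)" for n
      using st(2)[of n] unfolding Q_def S_def \<kappa>_def by blast
    have "\<forall>n. \<exists>z\<in>\<Omega>. \<kappa> (Suc n) = \<kappa> n + K z \<and> cmod (T z (S (Suc n))) > real n + 2"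
      using st(2) unfolding Q_def S_def \<kappa>_def by blast
    then obtain z where z: "\<And>n. z n \<in> \<Omega>" "\<And>n. \<kappa> (Suc n) = \<kappa> n + K (z n)" "\<And>n. cmod (T (z n) (S (Suc n))) > real n + 2"
      by metis
    have "\<kappa> n \<le> \<kappa> (Suc n)" for n using z(2)[of n] K0[OF z(1)] by simp
    then have \<kappa>_mono: "\<kappa> m \<le> \<kappa> n" if "m \<le> n" for m n using lift_Suc_mono_le[of \<kappa>] that by blast
    have step: "cmod (partials cs (S (Suc m)) x - partials cs (S m) x) \<le> 1 / (1 + \<kappa> N) * (1 / 2) ^ m"
      if cs: "set cs \<subseteq> Basis" "length cs \<le> m" "x \<in> \<Omega>" "N \<le> m" for cs m x N
    proof -
      have "partials cs (S (Suc m)) x - partials cs (S m) x = partials cs (\<lambda>x. S (Suc m) x - S m x) x"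
        by (rule partials_diff[OF open_\<Omega> smooth_up_to_boundary_smooth[OF SX] smooth_up_to_boundary_smooth[OF SX] cs(3,1), symmetric])
      moreover have "cmod (partials cs (\<lambda>x. S (Suc m) x - S m x) x) \<le> (1 / 2) ^ m / (1 + \<kappa> m)"
        using Ssm[of m] cs unfolding small_def by blast
      ultimately have "cmod (partials cs (S (Suc m)) x - partials cs (S m) x) \<le> (1 / 2) ^ m / (1 + \<kappa> m)"
        by simp
      also have "\<dots> \<le> (1 / 2) ^ m / (1 + \<kappa> N)"
        using \<kappa>_mono[OF cs(4)] \<kappa>0 by (intro divide_left_mono) (auto simp: add_pos_nonneg)
      finally show ?thesis by simp
    qed
    have "\<exists>g. uniform_limit \<Omega> (\<lambda>n. partials cs (S n)) g sequentially" if cs: "set cs \<subseteq> Basis" for cs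
    proof -
      have "cmod (partials cs (S (Suc m)) x - partials cs (S m) x) \<le> 1 / (1 + \<kappa> 0) * (1 / 2) ^ m"
        if "m \<ge> length cs" "x \<in> \<Omega>" for m x
        by (rule step[OF cs that le0])
      then show ?thesis
      proof (rule geometric_uniform_limit)
        fix g assume "uniform_limit \<Omega> (\<lambda>n. partials cs (S n)) g sequentially"
        then show ?thesis by (rule exI[of _ g])
      qed
    qed
    then have "\<forall>cs. \<exists>g. set cs \<subseteq> Basis \<longrightarrow> uniform_limit \<Omega> (\<lambda>n. partials cs (S n)) g sequentially"
      by blast
    from choice[OF this] obtain g where
      "\<forall>cs. set cs \<subseteq> Basis \<longrightarrow> uniform_limit \<Omega> (\<lambda>n. partials cs (S n)) (g cs) sequentially" ..
    then have g: "uniform_limit \<Omega> (\<lambda>n. partials cs (S n)) (g cs) sequentially" if "set cs \<subseteq> Basis" for cs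
      using that by blast
    note lim = smooth_uniform_limit[of \<Omega> S g, OF open_\<Omega> smooth_up_to_boundary_smooth[OF SX] g]
    define \<phi> where "\<phi> = g []"
    have uc: "uniformly_continuous_on \<Omega> (partials cs \<phi>)" if cs: "set cs \<subseteq> Basis" for cs
    proof -
      have "uniformly_continuous_on \<Omega> (g cs)"
        by (rule uniformly_continuous_uniform_limit[OF g[OF cs]])
           (use SX smooth_up_to_boundary_iff[OF bounded] cs in blast)
      moreover have "partials cs \<phi> x = g cs x" if "x \<in> \<Omega>" for x unfolding \<phi>_def using lim(2)[OF _ cs that] by blast
      ultimately show ?thesis unfolding uniformly_continuous_on_def by simp
    qed
    have "smooth_on \<Omega> \<phi>" unfolding \<phi>_def using lim(1) by blast
    then have \<phi>X: "\<phi> \<in> ?X" using uc smooth_up_to_boundary_iff[OF bounded] by blast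
    obtain A where A: "\<forall>z\<in>\<Omega>. cmod (T z \<phi>) \<le> A" using TA[OF \<phi>X] by blast
    have "real n + 1 \<le> A" for n
    proof -
      let ?N = "Suc n"
      have nil: "set ([] :: (complex ^ 'n) list) \<subseteq> Basis" by simp
      have near: "cmod (partials [] (S (Suc m)) x - partials [] (S m) x) \<le> 1 / (1 + \<kappa> ?N) * (1 / 2) ^ m"
        if "m \<ge> ?N" "x \<in> \<Omega>" for m x
        by (rule step[OF nil _ that(2,1)]) simp
      obtain h where h: "uniform_limit \<Omega> (\<lambda>n. partials [] (S n)) h sequentially"
        "\<And>m x. m \<ge> ?N \<Longrightarrow> x \<in> \<Omega> \<Longrightarrow> cmod (h x - partials [] (S m) x) \<le> 2 * (1 / (1 + \<kappa> ?N)) * (1 / 2) ^ m"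
        by (rule geometric_uniform_limit[where N="?N" and S=\<Omega> and u="\<lambda>n. partials [] (S n)", OF near])
           (assumption, assumption, rule that, assumption+)
      have hg: "h x = \<phi> x" if "x \<in> \<Omega>" for x
        unfolding \<phi>_def using tendsto_uniform_limitI[OF h(1) that] tendsto_uniform_limitI[OF g[OF nil] that] LIMSEQ_unique by blast
      have half: "2 * a * (1 / 2) ^ Suc n = a * (1 / 2) ^ n" for a :: real by simp
      have close: "cmod (\<phi> x - S ?N x) \<le> 1 / (1 + \<kappa> ?N)" if x: "x \<in> \<Omega>" for x
      proof -
        have "cmod (\<phi> x - S ?N x) \<le> 2 * (1 / (1 + \<kappa> ?N)) * (1 / 2) ^ ?N"
          using h(2)[OF order_refl x] hg[OF x] by simp
        also have "\<dots> = 1 / (1 + \<kappa> ?N) * (1 / 2) ^ n" by (rule half)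
        also have "\<dots> \<le> 1 / (1 + \<kappa> ?N) * 1"
          using \<kappa>0[of ?N] by (intro mult_left_mono power_le_one) auto
        finally show ?thesis by simp
      qed
      have dX: "(\<lambda>x. \<phi> x - S ?N x) \<in> ?X" by (intro smooth_up_to_boundary_diff \<phi>X SX)
      have "cmod (T (z n) (\<lambda>x. \<phi> x - S ?N x)) \<le> K (z n) * (1 / (1 + \<kappa> ?N))"
        using \<kappa>0[of ?N] by (intro TK z(1) smooth_up_to_boundary_L2 dX close) auto
      also have "\<dots> \<le> 1"
        using z(2)[of n] \<kappa>0[of n] \<kappa>0[of ?N] K0[OF z(1)[of n]] by (simp add: field_simps)
      finally have "cmod (T (z n) \<phi> - T (z n) (S ?N)) \<le> 1" unfolding Tdiff[OF z(1) \<phi>X SX] .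
      moreover have "cmod (T (z n) (S ?N)) \<le> cmod (T (z n) \<phi>) + cmod (T (z n) \<phi> - T (z n) (S ?N))"
        using norm_triangle_ineq4[of "T (z n) \<phi>" "T (z n) \<phi> - T (z n) (S ?N)"] by simp
      ultimately show ?thesis using z(3)[of n] A z(1)[of n] by force
    qed
    then show False using reals_Archimedean2[of A] by (metis add_increasing2 less_eq_real_def linorder_not_le zero_le_one order.strict_trans2)
  qed
  then obtain k C where kC: "\<And>\<phi> z. \<phi> \<in> ?X \<Longrightarrow> small k 1 \<phi> \<Longrightarrow> z \<in> \<Omega> \<Longrightarrow> cmod (T z \<phi>) \<le> C" by blast
  show thesis
  proof (rule that[of "\<bar>C\<bar>" k])
    fix \<phi> s z
    assume \<phi>: "\<phi> \<in> ?X" and s: "(s::real) > 0" and b: "\<And>cs x. set cs \<subseteq> Basis \<Longrightarrow> length cs \<le> k \<Longrightarrow> x \<in> \<Omega> \<Longrightarrow> cmod (partials cs \<phi> x) \<le> s"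
      and z: "z \<in> \<Omega>"
    have "small k 1 (\<lambda>x. of_real (1 / s) * \<phi> x)" unfolding small_def
    proof (intro allI impI)
      fix cs :: "(complex ^ 'n) list" and x assume c: "set cs \<subseteq> Basis" "length cs \<le> k" "x \<in> \<Omega>"
      have "partials cs (\<lambda>x. of_real (1 / s) * \<phi> x) x = of_real (1 / s) * partials cs \<phi> x"
        by (rule partials_bounded_linear[OF open_\<Omega> bounded_linear_mult_right smooth_up_to_boundary_smooth[OF \<phi>] c(3,1)])
      then have n: "cmod (partials cs (\<lambda>x. of_real (1 / s) * \<phi> x) x) = cmod (partials cs \<phi> x) / s"
        using s by (simp add: norm_mult norm_divide)
      show "cmod (partials cs (\<lambda>x. of_real (1 / s) * \<phi> x) x) \<le> 1"
        unfolding n using b[OF c] s by (simp add: pos_divide_le_eq)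
    qed
    from kC[OF smooth_up_to_boundary_scale[OF \<phi>] this z]
    have "cmod (T z \<phi>) / s \<le> C" unfolding Tscale[OF z \<phi>] using s by (simp add: norm_mult norm_divide)
    then have "cmod (T z \<phi>) \<le> C * s" using s by (simp add: field_simps)
    also have "\<dots> \<le> \<bar>C\<bar> * s" using s by (intro mult_right_mono) auto
    finally show "cmod (partials bs (bergman_projection \<Omega> \<phi>) z) \<le> \<bar>C\<bar> * s" by (simp only: T_def)
  qed simp
qed

end

section \<open>Smoothing of conjugate holomorphic functions\<close>

context strict_weighted_domain
begin

lemma conj_holomorphic_scale:
  assumes "conj_holomorphic_sv \<Omega> f"
  shows "conj_holomorphic_sv \<Omega> (\<lambda>z. k * f z)"
  using holomorphic_sv_linear[of \<Omega> "\<lambda>z. cnj (f z)" "\<lambda>z. cnj (f z)" "cnj k" 0] assms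
  unfolding conj_holomorphic_sv_def by simp

definition cut_product where
  "cut_product m \<theta> h \<epsilon> x = (cnj (h x) * (W x ^ m * \<theta> x)) * cut 0 \<epsilon> x"

text \<open>Multiplication by a cutoff makes the high order vanishing into flatness. The price is
  \<open>1 - cut\<close>, which is \<open>\<epsilon>\<close> times a symbol of order \<open>-1\<close>; the resulting functions
  therefore form a Cauchy family in every fixed \<open>C\<^sup>k\<close> norm once the order of vanishing is large.\<close>

lemma cutoff_products:
  fixes k :: nat
  assumes \<theta>: "smooth_bounded \<Omega> \<theta>"
  defines "m \<equiv> k + DIM(complex ^ 'n) + 1"
  defines "\<phi> \<equiv> cut_product m \<theta>"
  obtains C where "C \<ge> 0"
    "\<And>h \<epsilon>. h \<in> bergman_space \<Omega> \<Longrightarrow> L2_norm \<Omega> h \<le> 1 \<Longrightarrow> \<epsilon> > 0 \<Longrightarrow> \<phi> h \<epsilon> \<in> smooth_up_to_boundary \<Omega>"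
    "\<And>h \<epsilon> bs x. h \<in> bergman_space \<Omega> \<Longrightarrow> L2_norm \<Omega> h \<le> 1 \<Longrightarrow> \<epsilon> > 0 \<Longrightarrow> set bs \<subseteq> Basis \<Longrightarrow>
      length bs \<le> k \<Longrightarrow> x \<in> \<Omega> \<Longrightarrow> cmod (partials bs (\<phi> h \<epsilon>) x) \<le> C"
    "\<And>h \<epsilon> \<eta> bs x. h \<in> bergman_space \<Omega> \<Longrightarrow> L2_norm \<Omega> h \<le> 1 \<Longrightarrow> \<epsilon> > 0 \<Longrightarrow> \<eta> > 0 \<Longrightarrow> set bs \<subseteq> Basis \<Longrightarrow>
      length bs \<le> k \<Longrightarrow> x \<in> \<Omega> \<Longrightarrow> cmod (partials bs (\<lambda>x. \<phi> h \<epsilon> x - \<phi> h \<eta> x) x) \<le> C * (\<epsilon> + \<eta>)"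
    "\<And>h \<epsilon> x. h \<in> bergman_space \<Omega> \<Longrightarrow> L2_norm \<Omega> h \<le> 1 \<Longrightarrow> \<epsilon> > 0 \<Longrightarrow> x \<in> \<Omega> \<Longrightarrow>
      cmod (\<phi> h \<epsilon> x - cnj (h x) * (W x ^ m * \<theta> x)) \<le> C * \<epsilon>"
proof -
  let ?n = "real DIM(complex ^ 'n)"
  let ?U = "{h \<in> bergman_space \<Omega>. L2_norm \<Omega> h \<le> 1}"
  let ?I = "?U \<times> {0::real<..}"
  have wpos: "w x > 0" if "x \<in> \<Omega>" for x using w_range[OF that] by simp
  define F where "F = (\<lambda>(h, \<epsilon>::real) x. cnj (h x) * (W x ^ m * \<theta> x))"
  have F: "symbols \<Omega> w N (- ?n + (real m + 0)) (F ` ?I)" for N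
  proof -
    have a1: "symbols \<Omega> w N (- ?n) ((\<lambda>(h, \<epsilon>::real) x. cnj (h x)) ` ?I)"
      by (rule symbols_cong[OF open_domain symbols_cnj[OF open_domain symbols_bergman_ball[OF weighted_domain_axioms, of N]]]) auto
    have a2: "symbols \<Omega> w N (real m + 0) ((\<lambda>(h :: complex ^ 'n \<Rightarrow> complex, \<epsilon>::real) x. W x ^ m * \<theta> x) ` ?I)"
    proof -
      have "symbols \<Omega> w N (real m + 0) ((\<lambda>_ x. W x ^ m * \<theta> x) ` {()})"
        by (rule symbols_family_mult[OF open_domain])
           (use w_range symbols_W_power symbols_smooth_bounded[OF w_range \<theta>] in auto)
      then show ?thesis by (rule symbols_cong[OF open_domain]) auto
    qed
    have "symbols \<Omega> w N (- ?n + (real m + 0)) ((\<lambda>i x. (\<lambda>(h, \<epsilon>::real) x. cnj (h x)) i x *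
        (\<lambda>(h :: complex ^ 'n \<Rightarrow> complex, \<epsilon>::real) x. W x ^ m * \<theta> x) i x) ` ?I)"
      by (rule symbols_family_mult[OF open_domain wpos a1 a2])
    then show ?thesis by (rule symbols_cong[OF open_domain]) (auto simp: F_def)
  qed
  have "symbols \<Omega> w k 0 ((\<lambda>i. cut 0 (snd i)) ` ?I)"
    by (rule symbols_cong[OF open_domain symbols_cut[of k 0]]) auto
  from symbols_family_mult[OF open_domain wpos F this]
  have P: "symbols \<Omega> w k (- ?n + (real m + 0) + 0) ((\<lambda>i x. F i x * cut 0 (snd i) x) ` ?I)" .
  have "symbols \<Omega> w k (- 1) ((\<lambda>i x. of_real (1 / snd i) * (1 - cut 0 (snd i) x)) ` ?I)"
    by (rule symbols_cong[OF open_domain symbols_one_minus_cut[of k]]) auto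
  from symbols_family_mult[OF open_domain wpos F this]
  have Q: "symbols \<Omega> w k (- ?n + (real m + 0) + - 1) ((\<lambda>i x. F i x * (of_real (1 / snd i) * (1 - cut 0 (snd i) x))) ` ?I)" .
  have bound: "\<exists>C\<ge>0. \<forall>g\<in>G. \<forall>bs x. set bs \<subseteq> Basis \<longrightarrow> length bs \<le> k \<longrightarrow> x \<in> \<Omega> \<longrightarrow> cmod (partials bs g x) \<le> C"
    if G: "symbols \<Omega> w k r G" "r \<ge> real k" for r G
  proof -
    obtain C where C: "C \<ge> 0" "\<And>g bs x. g \<in> G \<Longrightarrow> set bs \<subseteq> Basis \<Longrightarrow> length bs \<le> k \<Longrightarrow> x \<in> \<Omega> \<Longrightarrow>
      cmod (partials bs g x) \<le> C * w x powr (r - real (length bs))"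
      using symbolsE[OF G(1)] by blast
    have "cmod (partials bs g x) \<le> C" if "g \<in> G" "set bs \<subseteq> Basis" "length bs \<le> k" "x \<in> \<Omega>" for g bs x
    proof -
      have "w x powr (r - real (length bs)) \<le> 1"
        using w_range[OF that(4)] that(3) G(2) by (intro powr_le1) auto
      then have "C * w x powr (r - real (length bs)) \<le> C * 1" by (intro mult_left_mono C(1))
      then show ?thesis using C(2)[OF that] by simp
    qed
    then show ?thesis using C(1) by blast
  qed
  obtain C1 where C1: "C1 \<ge> 0" "\<And>i bs x. i \<in> ?I \<Longrightarrow> set bs \<subseteq> Basis \<Longrightarrow> length bs \<le> k \<Longrightarrow> x \<in> \<Omega> \<Longrightarrow>
      cmod (partials bs (\<lambda>x. F i x * cut 0 (snd i) x) x) \<le> C1"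
    using bound[OF P] unfolding m_def by auto
  obtain C2 where C2: "C2 \<ge> 0" "\<And>i bs x. i \<in> ?I \<Longrightarrow> set bs \<subseteq> Basis \<Longrightarrow> length bs \<le> k \<Longrightarrow> x \<in> \<Omega> \<Longrightarrow>
      cmod (partials bs (\<lambda>x. F i x * (of_real (1 / snd i) * (1 - cut 0 (snd i) x))) x) \<le> C2"
    using bound[OF Q] unfolding m_def by auto
  have \<phi>F: "\<phi> h \<epsilon> = (\<lambda>x. F (h, \<epsilon>) x * cut 0 \<epsilon> x)" for h \<epsilon>
    by (simp add: \<phi>_def cut_product_def F_def fun_eq_iff)
  define D where "D h \<epsilon> = (\<lambda>x. F (h, \<epsilon>) x * (of_real (1 / \<epsilon>) * (1 - cut 0 \<epsilon> x)))" for h and \<epsilon> :: real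
  have C2': "cmod (partials bs (D h \<epsilon>) x) \<le> C2"
    if "h \<in> bergman_space \<Omega>" "L2_norm \<Omega> h \<le> 1" "\<epsilon> > 0" "set bs \<subseteq> Basis" "length bs \<le> k" "x \<in> \<Omega>" for h \<epsilon> bs x
    using C2(2)[of "(h, \<epsilon>)" bs x] that by (simp add: D_def)
  have Dsm: "smooth_on \<Omega> (D h \<epsilon>)" if "h \<in> bergman_space \<Omega>" "L2_norm \<Omega> h \<le> 1" "\<epsilon> > 0" for h \<epsilon>
    by (rule symbols_smooth[OF Q]) (use that in \<open>auto simp: D_def intro!: image_eqI[of _ _ "(h, \<epsilon>)"]\<close>)
  show thesis
  proof (rule that[of "max C1 C2"])
    fix h \<epsilon> assume h: "h \<in> bergman_space \<Omega>" "L2_norm \<Omega> h \<le> 1" and \<epsilon>: "(\<epsilon>::real) > 0"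
    have i: "(h, \<epsilon>) \<in> ?I" using h \<epsilon> by simp
    have sym: "symbols \<Omega> w N (- ?n + (real m + 0) + real l) {\<phi> h \<epsilon>}" for N l
    proof -
      have b1: "symbols \<Omega> w N (- ?n + (real m + 0)) ((\<lambda>_. F (h, \<epsilon>)) ` {()})"
        by (rule symbols_cong[OF open_domain F]) (use i in blast)
      have b2: "symbols \<Omega> w N (real l) ((\<lambda>_. cut 0 \<epsilon>) ` {()})"
        using symbols_cut_flat[OF \<epsilon>] by (simp only: image_insert image_empty)
      have "symbols \<Omega> w N (- ?n + (real m + 0) + real l) ((\<lambda>_ x. F (h, \<epsilon>) x * cut 0 \<epsilon> x) ` {()})"
        by (rule symbols_family_mult[OF open_domain wpos b1 b2])
      then show ?thesis unfolding \<phi>F by (simp only: image_insert image_empty)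
    qed
    show "\<phi> h \<epsilon> \<in> smooth_up_to_boundary \<Omega>"
    proof (rule flat_imp_smooth_up_to_boundary)
      show "smooth_on \<Omega> (\<phi> h \<epsilon>)" using symbols_smooth[OF sym] by blast
      fix bs :: "(complex ^ 'n) list" assume bs: "set bs \<subseteq> Basis"
      obtain C where C: "C \<ge> 0" "\<And>g cs x. g \<in> {\<phi> h \<epsilon>} \<Longrightarrow> set cs \<subseteq> Basis \<Longrightarrow> length cs \<le> length bs \<Longrightarrow> x \<in> \<Omega> \<Longrightarrow>
        cmod (partials cs g x) \<le> C * w x powr (- ?n + (real m + 0) + real (length bs) - real (length cs))"
        using symbolsE[OF sym[of "length bs" "length bs"]] by blast
      have "cmod (partials bs (\<phi> h \<epsilon>) x) \<le> C * w x" if x: "x \<in> \<Omega>" for x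
      proof -
        have "- ?n + (real m + 0) + real (length bs) - real (length bs) \<ge> 1" unfolding m_def by simp
        then have "w x powr (- ?n + (real m + 0) + real (length bs) - real (length bs)) \<le> w x powr 1"
          using w_range[OF x] by (intro powr_mono') auto
        also have "w x powr 1 = w x" using w_range[OF x] by simp
        finally have "C * w x powr (- ?n + (real m + 0) + real (length bs) - real (length bs)) \<le> C * w x"
          by (rule mult_left_mono[OF _ C(1)])
        then show ?thesis using C(2)[OF _ bs order_refl x, of "\<phi> h \<epsilon>"] by simp
      qed
      then show "\<exists>C. \<forall>x\<in>\<Omega>. cmod (partials bs (\<phi> h \<epsilon>) x) \<le> C * w x" by blast
    qed
    show "cmod (\<phi> h \<epsilon> x - cnj (h x) * (W x ^ m * \<theta> x)) \<le> max C1 C2 * \<epsilon>" if x: "x \<in> \<Omega>" for x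
    proof -
      have "\<phi> h \<epsilon> x - cnj (h x) * (W x ^ m * \<theta> x) = - (of_real \<epsilon> * D h \<epsilon> x)"
        using \<epsilon> by (simp add: \<phi>_def cut_product_def D_def F_def field_simps)
      then have "cmod (\<phi> h \<epsilon> x - cnj (h x) * (W x ^ m * \<theta> x)) = \<epsilon> * cmod (D h \<epsilon> x)"
        using \<epsilon> by (simp add: norm_mult)
      also have "\<dots> \<le> \<epsilon> * max C1 C2" using C2'[OF h \<epsilon>, of "[]" x] x \<epsilon> by (intro mult_left_mono) auto
      finally show ?thesis by (simp add: mult.commute)
    qed
    fix bs :: "(complex ^ 'n) list" and x assume bs: "set bs \<subseteq> Basis" "length bs \<le> k" and x: "x \<in> \<Omega>"
    show "cmod (partials bs (\<phi> h \<epsilon>) x) \<le> max C1 C2"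
      using C1(2)[OF i bs x] unfolding \<phi>F by simp
    fix \<eta> :: real assume \<eta>: "\<eta> > 0"
    have DF: "F (h, \<epsilon>) = F (h, \<eta>)" by (simp add: F_def)
    have eq: "(\<lambda>x. \<phi> h \<epsilon> x - \<phi> h \<eta> x) = (\<lambda>x. of_real \<eta> * D h \<eta> x - of_real \<epsilon> * D h \<epsilon> x)"
      using \<epsilon> \<eta> by (simp add: \<phi>_def cut_product_def D_def F_def fun_eq_iff field_simps)
    note ml = bounded_linear_mult_right
    have sm: "smooth_on \<Omega> (\<lambda>x. of_real r * D h r x)" if "r > 0" for r
      by (rule smooth_on_compose_bounded_linear[OF open_domain ml Dsm[OF h that]])
    have "partials bs (\<lambda>x. \<phi> h \<epsilon> x - \<phi> h \<eta> x) x
        = partials bs (\<lambda>x. of_real \<eta> * D h \<eta> x) x - partials bs (\<lambda>x. of_real \<epsilon> * D h \<epsilon> x) x"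
      unfolding eq by (rule partials_diff[OF open_domain sm[OF \<eta>] sm[OF \<epsilon>] x bs(1)])
    also have "\<dots> = of_real \<eta> * partials bs (D h \<eta>) x - of_real \<epsilon> * partials bs (D h \<epsilon>) x"
      by (simp only: partials_bounded_linear[OF open_domain ml Dsm[OF h \<eta>] x bs(1)]
          partials_bounded_linear[OF open_domain ml Dsm[OF h \<epsilon>] x bs(1)])
    finally have "cmod (partials bs (\<lambda>x. \<phi> h \<epsilon> x - \<phi> h \<eta> x) x) \<le>
        \<eta> * cmod (partials bs (D h \<eta>) x) + \<epsilon> * cmod (partials bs (D h \<epsilon>) x)"
      using norm_triangle_ineq4[of "of_real \<eta> * partials bs (D h \<eta>) x" "of_real \<epsilon> * partials bs (D h \<epsilon>) x"] \<epsilon> \<eta>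
      by (simp add: norm_mult)
    also have "\<dots> \<le> \<eta> * max C1 C2 + \<epsilon> * max C1 C2"
      using C2'[OF h \<eta> bs x] C2'[OF h \<epsilon> bs x] \<epsilon> \<eta> by (intro add_mono mult_left_mono) auto
    finally show "cmod (partials bs (\<lambda>x. \<phi> h \<epsilon> x - \<phi> h \<eta> x) x) \<le> max C1 C2 * (\<epsilon> + \<eta>)"
      by (simp add: algebra_simps)
  qed (use C1(1) in auto)
qed

text \<open>The estimates for condition R turn the Cauchy family of cutoff products into a uniform Cauchy
  family of derivatives of projections. Its limit is identified pointwise, since at a single point
  the derivatives of the projection are bounded by the supremum norm.\<close>

lemma smoothing_unit_ball:
  assumes R: "condition_R \<Omega>" and bs: "set bs \<subseteq> Basis"
  obtains C where "C \<ge> 0"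
    "\<And>f z. f \<in> L2 \<Omega> \<Longrightarrow> conj_holomorphic_sv \<Omega> f \<Longrightarrow> L2_norm \<Omega> f \<le> 1 \<Longrightarrow> z \<in> \<Omega> \<Longrightarrow>
      cmod (partials bs (bergman_projection \<Omega> f) z) \<le> C"
    "\<And>f. f \<in> L2 \<Omega> \<Longrightarrow> conj_holomorphic_sv \<Omega> f \<Longrightarrow> L2_norm \<Omega> f \<le> 1 \<Longrightarrow>
      uniformly_continuous_on \<Omega> (partials bs (bergman_projection \<Omega> f))"
proof -
  let ?B = "bergman_projection \<Omega>"
  let ?X = "smooth_up_to_boundary \<Omega>"
  note bo = bounded_domain open_domain
  have "\<exists>k A. A \<ge> 0 \<and> (\<forall>\<phi> s z. \<phi> \<in> ?X \<longrightarrow> s > 0 \<longrightarrow>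
      (\<forall>cs x. set cs \<subseteq> Basis \<longrightarrow> length cs \<le> k \<longrightarrow> x \<in> \<Omega> \<longrightarrow> cmod (partials cs \<phi> x) \<le> s) \<longrightarrow> z \<in> \<Omega> \<longrightarrow>
      cmod (partials bs (?B \<phi>) z) \<le> A * s)"
  proof (rule condition_R_estimate[OF bo R bs])
    fix k C assume C: "(C::real) \<ge> 0" and E: "\<And>\<phi> s z. \<phi> \<in> ?X \<Longrightarrow> s > 0 \<Longrightarrow>
      (\<And>cs x. set cs \<subseteq> Basis \<Longrightarrow> length cs \<le> k \<Longrightarrow> x \<in> \<Omega> \<Longrightarrow> cmod (partials cs \<phi> x) \<le> s) \<Longrightarrow> z \<in> \<Omega> \<Longrightarrow>
      cmod (partials bs (?B \<phi>) z) \<le> C * s"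
    show ?thesis
      by (intro exI[of _ k] exI[of _ C] conjI allI impI C) (rule E; blast)
  qed
  then obtain k A where A: "A \<ge> 0"
    and A': "\<forall>\<phi> s z. \<phi> \<in> ?X \<longrightarrow> s > 0 \<longrightarrow>
      (\<forall>cs x. set cs \<subseteq> Basis \<longrightarrow> length cs \<le> k \<longrightarrow> x \<in> \<Omega> \<longrightarrow> cmod (partials cs \<phi> x) \<le> s) \<longrightarrow> z \<in> \<Omega> \<longrightarrow>
      cmod (partials bs (?B \<phi>) z) \<le> A * s"
    by (elim exE conjE)
  have A2: "cmod (partials bs (?B \<phi>) z) \<le> A * s"
    if "\<phi> \<in> ?X" "s > 0" "\<And>cs x. set cs \<subseteq> Basis \<Longrightarrow> length cs \<le> k \<Longrightarrow> x \<in> \<Omega> \<Longrightarrow> cmod (partials cs \<phi> x) \<le> s" "z \<in> \<Omega>" for \<phi> s z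
    by (rule A'[rule_format]) (use that in auto)
  let ?m = "k + DIM(complex ^ 'n) + 1"
  obtain \<theta> where \<theta>: "smooth_bounded \<Omega> \<theta>"
    "\<And>f. f \<in> L2 \<Omega> \<Longrightarrow> conj_holomorphic_sv \<Omega> f \<Longrightarrow> (\<lambda>z. f z * (W z ^ ?m * \<theta> z)) \<in> L2 \<Omega>"
    "\<And>f z. f \<in> L2 \<Omega> \<Longrightarrow> conj_holomorphic_sv \<Omega> f \<Longrightarrow> z \<in> \<Omega> \<Longrightarrow>
      ?B f z = ?B (\<lambda>z. f z * (W z ^ ?m * \<theta> z)) z"
    by (rule bergman_projection_vanishing_weight[of ?m]) (rule that, assumption+)
  let ?\<phi> = "cut_product ?m \<theta>"
  obtain C where C: "C \<ge> 0"
    "\<And>h \<epsilon>. h \<in> bergman_space \<Omega> \<Longrightarrow> L2_norm \<Omega> h \<le> 1 \<Longrightarrow> \<epsilon> > 0 \<Longrightarrow> ?\<phi> h \<epsilon> \<in> ?X"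
    "\<And>h \<epsilon> bs x. h \<in> bergman_space \<Omega> \<Longrightarrow> L2_norm \<Omega> h \<le> 1 \<Longrightarrow> \<epsilon> > 0 \<Longrightarrow> set bs \<subseteq> Basis \<Longrightarrow>
      length bs \<le> k \<Longrightarrow> x \<in> \<Omega> \<Longrightarrow> cmod (partials bs (?\<phi> h \<epsilon>) x) \<le> C"
    "\<And>h \<epsilon> \<eta> bs x. h \<in> bergman_space \<Omega> \<Longrightarrow> L2_norm \<Omega> h \<le> 1 \<Longrightarrow> \<epsilon> > 0 \<Longrightarrow> \<eta> > 0 \<Longrightarrow> set bs \<subseteq> Basis \<Longrightarrow>
      length bs \<le> k \<Longrightarrow> x \<in> \<Omega> \<Longrightarrow> cmod (partials bs (\<lambda>x. ?\<phi> h \<epsilon> x - ?\<phi> h \<eta> x) x) \<le> C * (\<epsilon> + \<eta>)"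
    "\<And>h \<epsilon> x. h \<in> bergman_space \<Omega> \<Longrightarrow> L2_norm \<Omega> h \<le> 1 \<Longrightarrow> \<epsilon> > 0 \<Longrightarrow> x \<in> \<Omega> \<Longrightarrow>
      cmod (?\<phi> h \<epsilon> x - cnj (h x) * (W x ^ ?m * \<theta> x)) \<le> C * \<epsilon>"
    by (rule cutoff_products[OF \<theta>(1), of k]) (rule that, assumption+)
  have main: "(\<forall>z\<in>\<Omega>. cmod (partials bs (?B f) z) \<le> A * (C + 1)) \<and> uniformly_continuous_on \<Omega> (partials bs (?B f))"
    if f: "f \<in> L2 \<Omega>" "conj_holomorphic_sv \<Omega> f" "L2_norm \<Omega> f \<le> 1" for f
  proof -
    define h where "h z = cnj (f z)" for z
    have h: "h \<in> bergman_space \<Omega>" unfolding h_def by (rule conj_holomorphic_bergman[OF f(1,2)])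
    have hn: "L2_norm \<Omega> h \<le> 1" using f(3) unfolding h_def L2_norm_def by simp
    define g where "g z = f z * (W z ^ ?m * \<theta> z)" for z
    have gL: "g \<in> L2 \<Omega>" unfolding g_def by (rule \<theta>(2)[OF f(1,2)])
    have Bg: "partials bs (?B f) z = partials bs (?B g) z" if "z \<in> \<Omega>" for z
      unfolding g_def by (rule partials_cong[OF open_domain that \<theta>(3)[OF f(1,2)]])
    define e where "e j = inverse (real (Suc j))" for j
    have e: "e j > 0" for j by (simp add: e_def)
    have e0: "e \<longlonglongrightarrow> 0" unfolding e_def by (rule LIMSEQ_inverse_real_of_nat)
    define p where "p j = ?\<phi> h (e j)" for j
    have pX: "p j \<in> ?X" for j unfolding p_def by (rule C(2)[OF h hn e])
    have pL: "p j \<in> L2 \<Omega>" for j by (rule smooth_up_to_boundary_L2[OF bo pX])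
    have Tp: "cmod (partials bs (?B (p j)) z) \<le> A * (C + 1)" if z: "z \<in> \<Omega>" for j z
    proof (rule A2[OF pX _ _ z])
      fix cs :: "(complex ^ 'n) list" and x assume "set cs \<subseteq> Basis" "length cs \<le> k" "x \<in> \<Omega>"
      from C(3)[OF h hn e this] show "cmod (partials cs (p j) x) \<le> C + 1" unfolding p_def by (rule add_increasing2[rotated]) simp
    qed (use C(1) in simp)
    have lin: "partials bs (?B (\<lambda>x. u x - v x)) z = partials bs (?B u) z - partials bs (?B v) z"
      if "u \<in> L2 \<Omega>" "v \<in> L2 \<Omega>" "z \<in> \<Omega>" for u v z
      using partials_bergman_projection_linear[OF bo that bs, of 1 "-1"] by simp
    have Td: "cmod (partials bs (?B (p i)) z - partials bs (?B (p j)) z) \<le> A * ((C + 1) * (e i + e j))" if z: "z \<in> \<Omega>" for i j z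
      unfolding lin[OF pL pL z, symmetric]
    proof (rule A2[OF smooth_up_to_boundary_diff[OF bo pX pX] _ _ z])
      fix cs :: "(complex ^ 'n) list" and x assume c: "set cs \<subseteq> Basis" "length cs \<le> k" "x \<in> \<Omega>"
      have "cmod (partials cs (\<lambda>x. p i x - p j x) x) \<le> C * (e i + e j)"
        unfolding p_def by (rule C(4)[OF h hn e e c])
      also have "\<dots> \<le> (C + 1) * (e i + e j)" using e[of i] e[of j] by (intro mult_right_mono) auto
      finally show "cmod (partials cs (\<lambda>x. p i x - p j x) x) \<le> (C + 1) * (e i + e j)" .
    qed (use C(1) e[of i] e[of j] in \<open>auto intro!: mult_pos_pos add_pos_pos\<close>)
    have pw: "(\<lambda>j. partials bs (?B (p j)) z) \<longlonglongrightarrow> partials bs (?B g) z" if z: "z \<in> \<Omega>" for z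
    proof -
      obtain Cz where Cz: "Cz \<ge> 0" "\<And>f s. f \<in> L2 \<Omega> \<Longrightarrow> (\<And>x. x \<in> \<Omega> \<Longrightarrow> cmod (f x) \<le> s) \<Longrightarrow> s \<ge> 0 \<Longrightarrow>
        cmod (partials bs (?B f) z) \<le> Cz * s"
        by (rule bergman_projection_sup_bound[OF bo z bs]) (erule that, blast)
      have "cmod (partials bs (?B (p j)) z - partials bs (?B g) z) \<le> Cz * (C * e j)" for j
        unfolding lin[OF pL gL z, symmetric]
      proof (rule Cz(2)[OF L2_diff[OF pL gL]])
        show "cmod (p j x - g x) \<le> C * e j" if "x \<in> \<Omega>" for x
          using C(5)[OF h hn e that, of j] unfolding p_def g_def h_def by simp
      qed (use C(1) e[of j] in simp)
      moreover have "(\<lambda>j. Cz * (C * e j)) \<longlonglongrightarrow> 0" using e0 by (intro tendsto_mult_right_zero)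
      ultimately have "(\<lambda>j. partials bs (?B (p j)) z - partials bs (?B g) z) \<longlonglongrightarrow> 0"
        by (intro Lim_null_comparison[of "\<lambda>j. partials bs (?B (p j)) z - partials bs (?B g) z"] always_eventually) auto
      then show ?thesis by (rule LIM_zero_cancel)
    qed
    have b: "cmod (partials bs (?B g) z) \<le> A * (C + 1)" if z: "z \<in> \<Omega>" for z
      by (rule LIMSEQ_le_const2[OF tendsto_norm[OF pw[OF z]]]) (use Tp[OF z] in blast)
    have unif: "cmod (partials bs (?B (p i)) z - partials bs (?B g) z) \<le> A * ((C + 1) * e i)" if z: "z \<in> \<Omega>" for i z
    proof (rule tendsto_le[OF sequentially_bot])
      show "(\<lambda>j. cmod (partials bs (?B (p i)) z - partials bs (?B (p j)) z)) \<longlonglongrightarrow> cmod (partials bs (?B (p i)) z - partials bs (?B g) z)"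
        by (intro tendsto_intros pw z)
      have "(\<lambda>j. A * ((C + 1) * (e i + e j))) \<longlonglongrightarrow> A * ((C + 1) * (e i + 0))" by (intro tendsto_intros e0)
      then show "(\<lambda>j. A * ((C + 1) * (e i + e j))) \<longlonglongrightarrow> A * ((C + 1) * e i)" by simp
      show "\<forall>\<^sub>F j in sequentially. cmod (partials bs (?B (p i)) z - partials bs (?B (p j)) z) \<le> A * ((C + 1) * (e i + e j))"
        using Td[OF z] by (intro always_eventually) blast
    qed
    have "uniform_limit \<Omega> (\<lambda>j. partials bs (?B (p j))) (partials bs (?B g)) sequentially"
    proof (rule uniform_limitI)
      fix \<delta> :: real assume \<delta>: "\<delta> > 0"
      have "(\<lambda>i. A * ((C + 1) * e i)) \<longlonglongrightarrow> 0" by (intro tendsto_mult_right_zero e0)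
      then have "\<forall>\<^sub>F i in sequentially. A * ((C + 1) * e i) < \<delta>" using \<delta> by (rule order_tendstoD)
      then show "\<forall>\<^sub>F i in sequentially. \<forall>z\<in>\<Omega>. dist (partials bs (?B (p i)) z) (partials bs (?B g) z) < \<delta>"
        by eventually_elim (unfold dist_norm, intro ballI, rule le_less_trans[OF unif])
    qed
    moreover have "uniformly_continuous_on \<Omega> (partials bs (?B (p j)))" for j
    proof -
      have "?B (p j) \<in> ?X" using R pX[of j] unfolding condition_R_def by blast
      then show ?thesis using smooth_up_to_boundary_iff[OF bounded_domain] bs by blast
    qed
    ultimately have "uniformly_continuous_on \<Omega> (partials bs (?B g))" by (rule uniformly_continuous_uniform_limit)
    then have "uniformly_continuous_on \<Omega> (partials bs (?B f))"
      using Bg unfolding uniformly_continuous_on_def by simp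
    then show ?thesis using b Bg by simp
  qed
  show thesis
    by (rule that[of "A * (C + 1)"]) (use main A C(1) in auto)
qed

text \<open>Homogeneity extends the estimate from the unit ball. Functions of norm \<open>0\<close> are covered by
  letting the scaling parameter tend to the norm.\<close>

lemma smoothing_estimate:
  assumes R: "condition_R \<Omega>" and bs: "set bs \<subseteq> Basis"
  obtains C where "C \<ge> 0"
    "\<And>f z. f \<in> L2 \<Omega> \<Longrightarrow> conj_holomorphic_sv \<Omega> f \<Longrightarrow> z \<in> \<Omega> \<Longrightarrow>
      cmod (partials bs (bergman_projection \<Omega> f) z) \<le> C * L2_norm \<Omega> f"
    "\<And>f. f \<in> L2 \<Omega> \<Longrightarrow> conj_holomorphic_sv \<Omega> f \<Longrightarrow>
      uniformly_continuous_on \<Omega> (partials bs (bergman_projection \<Omega> f))"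
proof -
  let ?B = "bergman_projection \<Omega>"
  obtain C where C: "C \<ge> 0"
    "\<And>f z. f \<in> L2 \<Omega> \<Longrightarrow> conj_holomorphic_sv \<Omega> f \<Longrightarrow> L2_norm \<Omega> f \<le> 1 \<Longrightarrow> z \<in> \<Omega> \<Longrightarrow>
      cmod (partials bs (?B f) z) \<le> C"
    "\<And>f. f \<in> L2 \<Omega> \<Longrightarrow> conj_holomorphic_sv \<Omega> f \<Longrightarrow> L2_norm \<Omega> f \<le> 1 \<Longrightarrow> uniformly_continuous_on \<Omega> (partials bs (?B f))"
    by (rule smoothing_unit_ball[OF R bs]) (rule that, assumption+)
  have scaled: "(\<lambda>z. of_real (1 / s) * f z) \<in> L2 \<Omega> \<and> conj_holomorphic_sv \<Omega> (\<lambda>z. of_real (1 / s) * f z) \<and>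
      L2_norm \<Omega> (\<lambda>z. of_real (1 / s) * f z) \<le> 1 \<and>
      (\<forall>z\<in>\<Omega>. partials bs (?B f) z = of_real s * partials bs (?B (\<lambda>z. of_real (1 / s) * f z)) z)"
    if f: "f \<in> L2 \<Omega>" "conj_holomorphic_sv \<Omega> f" and s: "s > 0" "L2_norm \<Omega> f \<le> s" for f and s :: real
  proof (intro conjI ballI)
    show L: "(\<lambda>z. of_real (1 / s) * f z) \<in> L2 \<Omega>" by (rule L2_scale(1)[OF f(1)])
    show "conj_holomorphic_sv \<Omega> (\<lambda>z. of_real (1 / s) * f z)" by (rule conj_holomorphic_scale[OF f(2)])
    have "L2_norm \<Omega> (\<lambda>z. of_real (1 / s) * f z) = (1 / s) * L2_norm \<Omega> f"
      unfolding L2_scale(2)[OF f(1)] norm_of_real using s by simp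
    then show "L2_norm \<Omega> (\<lambda>z. of_real (1 / s) * f z) \<le> 1" using s by simp
    fix z assume z: "z \<in> \<Omega>"
    have "partials bs (?B (\<lambda>z. of_real (1 / s) * f z)) z = of_real (1 / s) * partials bs (?B f) z"
      using partials_bergman_projection_linear[OF bounded_domain open_domain f(1) f(1) z bs, of "of_real (1 / s)" 0] by simp
    then show "partials bs (?B f) z = of_real s * partials bs (?B (\<lambda>z. of_real (1 / s) * f z)) z"
      using s by simp
  qed
  show thesis
  proof (rule that[OF C(1)])
    fix f assume f: "f \<in> L2 \<Omega>" "conj_holomorphic_sv \<Omega> f"
    define s where "s = L2_norm \<Omega> f + 1"
    have s: "s > 0" "L2_norm \<Omega> f \<le> s" using L2_norm_nonneg[of \<Omega> f] by (auto simp: s_def)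
    note sc = scaled[OF f s]
    have "uniformly_continuous_on \<Omega> (\<lambda>z. of_real s * partials bs (?B (\<lambda>z. of_real (1 / s) * f z)) z)"
      by (rule bounded_linear.uniformly_continuous_on[OF bounded_linear_mult_right]) (use C(3) sc in blast)
    then show "uniformly_continuous_on \<Omega> (partials bs (?B f))"
      using sc unfolding uniformly_continuous_on_def by metis
    fix z assume z: "z \<in> \<Omega>"
    have le: "cmod (partials bs (?B f) z) \<le> C * s" if s: "s > 0" "L2_norm \<Omega> f \<le> s" for s
    proof -
      note sc = scaled[OF f s]
      have "cmod (partials bs (?B f) z) = s * cmod (partials bs (?B (\<lambda>z. of_real (1 / s) * f z)) z)"
        using sc z s by (simp add: norm_mult)
      also have "\<dots> \<le> s * C" using C(2) sc z s by (intro mult_left_mono) auto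
      finally show ?thesis by (simp add: mult.commute)
    qed
    show "cmod (partials bs (?B f) z) \<le> C * L2_norm \<Omega> f"
    proof (rule LIMSEQ_le_const)
      have "(\<lambda>j. C * (L2_norm \<Omega> f + inverse (real (Suc j)))) \<longlonglongrightarrow> C * (L2_norm \<Omega> f + 0)"
        by (intro tendsto_intros LIMSEQ_inverse_real_of_nat)
      then show "(\<lambda>j. C * (L2_norm \<Omega> f + inverse (real (Suc j)))) \<longlonglongrightarrow> C * L2_norm \<Omega> f" by simp
      show "\<exists>N. \<forall>j\<ge>N. cmod (partials bs (?B f) z) \<le> C * (L2_norm \<Omega> f + inverse (real (Suc j)))"
        using le L2_norm_nonneg[of \<Omega> f] by (auto simp: add_nonneg_pos)
    qed
  qed
qed

end

section \<open>Weak derivatives\<close>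

lemma test_functions_partials:
  assumes "\<phi> \<in> test_functions \<Omega>" "set bs \<subseteq> Basis"
  shows "partials bs \<phi> \<in> test_functions \<Omega>"
proof -
  obtain K where K: "smooth_on UNIV \<phi>" "compact K" "K \<subseteq> \<Omega>" "\<And>x. x \<notin> K \<Longrightarrow> \<phi> x = 0"
    using assms(1) unfolding test_functions_def by blast
  have "partials bs \<phi> x = 0" if "x \<notin> K" for x
    using partials_cong[of "- K" x \<phi> "\<lambda>_. 0" bs] K(4) that compact_imp_closed[OF K(2)]
    by (simp add: open_Compl partials_zero)
  then show ?thesis
    unfolding test_functions_def using smooth_on_partials[OF K(1) assms(2)] K(2,3) by blast
qed

lemma test_functions_smooth_bounded:
  assumes "\<phi> \<in> test_functions \<Omega>"
  shows "smooth_bounded UNIV \<phi>"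
proof -
  obtain K where K: "smooth_on UNIV \<phi>" "compact K" "\<And>x. x \<notin> K \<Longrightarrow> \<phi> x = 0"
    using assms unfolding test_functions_def by blast
  obtain R where "\<forall>x\<in>K. norm x \<le> R" using compact_imp_bounded[OF K(2)] unfolding bounded_iff by blast
  then show ?thesis by (intro smooth_bounded_compact_support[OF K(1), of R]) (use K(3) in auto)
qed

lemma integral_compact_support:
  fixes u :: "'a::euclidean_space \<Rightarrow> complex"
  assumes \<Omega>: "open \<Omega>" and K: "compact K" "K \<subseteq> \<Omega>" and u: "continuous_on \<Omega> u" "\<And>x. x \<notin> K \<Longrightarrow> u x = 0"
  defines "U \<equiv> \<lambda>x. if x \<in> \<Omega> then u x else 0"
  shows "continuous_on UNIV U" "integrable lborel U" "integral\<^sup>L (lebesgue_on \<Omega>) u = integral\<^sup>L lborel U"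
proof -
  have "continuous_on (\<Omega> \<union> - K) U"
  proof (rule continuous_on_open_Un)
    show "open (- K)" using compact_imp_closed[OF K(1)] by (rule open_Compl)
    show "continuous_on \<Omega> U" using u(1) by (rule continuous_on_eq) (simp add: U_def)
    show "continuous_on (- K) U"
      by (rule continuous_on_eq[of _ "\<lambda>_. 0"]) (use u(2) in \<open>auto simp: U_def\<close>)
  qed fact
  moreover have "\<Omega> \<union> - K = UNIV" using K(2) by blast
  ultimately show c: "continuous_on UNIV U" by simp
  obtain R where "\<forall>x\<in>K. norm x \<le> R" using compact_imp_bounded[OF K(1)] unfolding bounded_iff by blast
  then show "integrable lborel U"
    by (intro integrable_continuous_bounded_support[OF c, of R]) (use u(2) in \<open>auto simp: U_def\<close>)
  show "integral\<^sup>L (lebesgue_on \<Omega>) u = integral\<^sup>L lborel U"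
    unfolding U_def
  proof (rule lebesgue_on_integral_zero_extension)
    show "\<Omega> \<in> sets lebesgue" using \<Omega> by simp
    show "(\<lambda>x. if x \<in> \<Omega> then u x else 0) \<in> borel_measurable borel"
      using c unfolding U_def by (rule borel_measurable_continuous_onI)
  qed
qed

text \<open>The product of a smooth function on \<open>\<Omega>\<close> and a test function extends by zero to a
  differentiable function on the whole space, the derivatives of which have mean zero.\<close>

lemma integration_by_parts:
  fixes h :: "'a::euclidean_space \<Rightarrow> complex"
  assumes \<Omega>: "open \<Omega>" and h: "smooth_on \<Omega> h" and \<phi>: "\<phi> \<in> test_functions \<Omega>" and b: "b \<in> Basis"
  shows "(LINT x|lebesgue_on \<Omega>. h x * partial b \<phi> x) = - (LINT x|lebesgue_on \<Omega>. partial b h x * \<phi> x)"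
proof -
  obtain K where K: "smooth_on UNIV \<phi>" "compact K" "K \<subseteq> \<Omega>" "\<And>x. x \<notin> K \<Longrightarrow> \<phi> x = 0"
    using \<phi> unfolding test_functions_def by blast
  have oK: "open (- K)" using compact_imp_closed[OF K(2)] by (rule open_Compl)
  have p0: "partial b \<phi> x = 0" if "x \<notin> K" for x
    using partial_cong[OF oK, of x \<phi> "\<lambda>_. 0" b] K(4) that by (simp add: partial_eqI[OF has_derivative_const])
  define G where "G = (\<lambda>x. if x \<in> \<Omega> then h x * \<phi> x else 0)"
  define A where "A = (\<lambda>x. if x \<in> \<Omega> then h x * partial b \<phi> x else 0)"
  define B where "B = (\<lambda>x. if x \<in> \<Omega> then partial b h x * \<phi> x else 0)"
  note sc = smooth_on_continuous
  have c\<phi>: "continuous_on \<Omega> \<phi>" "continuous_on \<Omega> (partial b \<phi>)"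
    using sc[OF smooth_on_subset[OF K(1)]] sc[OF smooth_on_subset[OF smooth_on_partial[OF K(1) b]]] by auto
  have ch: "continuous_on \<Omega> h" "continuous_on \<Omega> (partial b h)"
    using sc[OF h] sc[OF smooth_on_partial[OF h b]] by auto
  have cA: "continuous_on \<Omega> (\<lambda>x. h x * partial b \<phi> x)" by (rule continuous_on_mult[OF ch(1) c\<phi>(2)])
  have cB: "continuous_on \<Omega> (\<lambda>x. partial b h x * \<phi> x)" by (rule continuous_on_mult[OF ch(2) c\<phi>(1)])
  have sA: "h x * partial b \<phi> x = 0" and sB: "partial b h x * \<phi> x = 0" if "x \<notin> K" for x
    using that by (simp_all add: p0 K(4))
  note A = integral_compact_support[OF \<Omega> K(2,3) cA sA, folded A_def]
  note B = integral_compact_support[OF \<Omega> K(2,3) cB sB, folded B_def]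
  have GD: "G differentiable (at x) \<and> partial b G x = A x + B x" for x
  proof (cases "x \<in> \<Omega>")
    case True
    have d: "h differentiable (at x)" "\<phi> differentiable (at x)"
      using smooth_on_differentiable[OF h True] smooth_on_differentiable[OF K(1)] by auto
    have "G differentiable (at x) \<longleftrightarrow> (\<lambda>x. h x * \<phi> x) differentiable (at x)"
      by (rule differentiable_cong_open[OF \<Omega> True]) (simp add: G_def)
    moreover have "partial b G x = partial b (\<lambda>x. h x * \<phi> x) x"
      by (rule partial_cong[OF \<Omega> True]) (simp add: G_def)
    ultimately show ?thesis using True d by (simp add: A_def B_def partial_mult differentiable_mult)
  next
    case False
    then have x: "x \<in> - K" using K(3) by blast
    have G0: "G y = 0" if "y \<in> - K" for y using K(4) that by (simp add: G_def)
    have "G differentiable (at x) \<longleftrightarrow> (\<lambda>x. 0 :: complex) differentiable (at x)"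
      by (rule differentiable_cong_open[OF oK x G0])
    moreover have "partial b G x = partial b (\<lambda>x. 0) x"
      by (rule partial_cong[OF oK x G0])
    ultimately show ?thesis using False by (simp add: A_def B_def partial_eqI[OF has_derivative_const])
  qed
  have Gp: "partial b G = (\<lambda>x. A x + B x)" using GD by blast
  obtain R where R: "\<forall>x\<in>K. norm x \<le> R" using compact_imp_bounded[OF K(2)] unfolding bounded_iff by blast
  have "continuous_on K (\<lambda>x. A x + B x)"
    using A(1) B(1) by (intro continuous_intros) (auto intro: continuous_on_subset)
  then have "bounded ((\<lambda>x. A x + B x) ` K)" by (intro compact_imp_bounded compact_continuous_image K(2))
  then obtain C where C: "\<And>x. x \<in> K \<Longrightarrow> cmod (A x + B x) \<le> C" unfolding bounded_iff by blast
  have bd: "cmod (partial b G x) \<le> \<bar>C\<bar>" for x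
  proof (cases "x \<in> K")
    case True
    then show ?thesis using C[OF True] by (simp add: Gp)
  next
    case False
    then show ?thesis by (simp add: Gp A_def B_def p0 K(4))
  qed
  have "integral\<^sup>L lborel (partial b G) = 0"
    by (rule integral_partial_zero(2)[OF _ bd _ b, of R]) (use GD R K(4) in \<open>auto simp: G_def\<close>)
  then have "integral\<^sup>L lborel A + integral\<^sup>L lborel B = 0"
    unfolding Gp using A(2) B(2) by simp
  then show ?thesis using A(3) B(3) by (metis eq_neg_iff_add_eq_0)
qed

lemma partials_integration_by_parts:
  fixes h :: "'a::euclidean_space \<Rightarrow> complex"
  assumes "open \<Omega>" "smooth_on \<Omega> h" "\<phi> \<in> test_functions \<Omega>" "set bs \<subseteq> Basis"
  shows "(LINT x|lebesgue_on \<Omega>. h x * partials bs \<phi> x) =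
    (-1) ^ length bs * (LINT x|lebesgue_on \<Omega>. partials (rev bs) h x * \<phi> x)"
  using assms(2,4)
proof (induction bs arbitrary: h)
  case (Cons b bs)
  have "(LINT x|lebesgue_on \<Omega>. h x * partials (b # bs) \<phi> x) = - (LINT x|lebesgue_on \<Omega>. partial b h x * partials bs \<phi> x)"
    unfolding partials_Cons
    by (rule integration_by_parts[OF assms(1) Cons.prems(1) test_functions_partials[OF assms(3)]]) (use Cons.prems in auto)
  also have "(LINT x|lebesgue_on \<Omega>. partial b h x * partials bs \<phi> x) =
    (-1) ^ length bs * (LINT x|lebesgue_on \<Omega>. partials (rev bs) (partial b h) x * \<phi> x)"
    by (rule Cons.IH) (use Cons.prems smooth_on_partial in auto)
  finally show ?case by (simp add: partials_snoc)
qed simp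

text \<open>The positive and the negative part of \<open>f\<close> are densities of finite measures that agree on the open
  sets, hence everywhere.\<close>

lemma AE_zero_open_integrals:
  fixes f :: "'a::euclidean_space \<Rightarrow> real"
  assumes f: "integrable lborel f" and zero: "\<And>S. open S \<Longrightarrow> (LINT x|lborel. f x * indicator S x) = 0"
  shows "AE x in lborel. f x = 0"
proof -
  have [measurable]: "f \<in> borel_measurable borel" using f by auto
  let ?P = "density lborel (\<lambda>x. ennreal (f x))" and ?N = "density lborel (\<lambda>x. ennreal (- f x))"
  have eq: "emeasure ?P S = emeasure ?N S \<and> emeasure ?P S \<noteq> \<infinity>" if S: "open S" for S
  proof -
    have i: "integrable lborel (\<lambda>x. f x * indicator S x)"
      using integrable_mult_indicator[of S lborel f] f S by (simp add: mult.commute)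
    note fin = real_integrable_def[THEN iffD1, OF i]
    have P: "emeasure ?P S = (\<integral>\<^sup>+x. ennreal (f x * indicator S x) \<partial>lborel)"
      using S by (subst emeasure_density) (auto simp: indicator_def intro!: nn_integral_cong)
    have N: "emeasure ?N S = (\<integral>\<^sup>+x. ennreal (- (f x * indicator S x)) \<partial>lborel)"
      using S by (subst emeasure_density) (auto simp: indicator_def intro!: nn_integral_cong)
    have "enn2real (emeasure ?P S) = enn2real (emeasure ?N S)"
      using zero[OF S] unfolding real_lebesgue_integral_def[OF i] P N by simp
    moreover have lt: "emeasure ?P S < top" "emeasure ?N S < top"
      using fin unfolding P N by (simp_all add: less_top)
    ultimately have "emeasure ?P S = emeasure ?N S"
      by (subst (1 2) ennreal_enn2real[symmetric]) (assumption | rule arg_cong[of _ _ ennreal])+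
    then show ?thesis using lt by auto
  qed
  have "?P = ?N"
  proof (rule measure_eqI_generator_eq[where \<Omega>=UNIV and E="{S. open S}" and A="\<lambda>_. UNIV"])
    show "Int_stable {S :: 'a set. open S}" by (auto simp: Int_stable_def)
  qed (use eq eq[OF open_UNIV] in \<open>auto simp: borel_def\<close>)
  then have "AE x in lborel. ennreal (f x) = ennreal (- f x)"
    by (intro sigma_finite_measure.density_unique[OF sigma_finite_lborel]) auto
  then show ?thesis
  proof eventually_elim
    case (elim x)
    then show ?case by (cases "f x \<ge> 0") (auto simp: ennreal_neg ennreal_eq_0_iff)
  qed
qed

text \<open>The partial sums of bumps over a countable cover of \<open>S\<close>
  by balls are positive on larger and larger parts of \<open>S\<close>, and \<open>flat 0 (j * s)\<close> tends to \<open>1\<close> for \<open>s > 0\<close>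
  and vanishes for \<open>s = 0\<close>.\<close>

lemma test_functions_exhaust:
  fixes S :: "'a::euclidean_space set"
  assumes S: "open S" "S \<subseteq> \<Omega>"
  obtains \<rho> where "\<And>j. \<rho> j \<in> test_functions \<Omega>" "\<And>j x. cmod (\<rho> j x) \<le> 1"
    "\<And>x. (\<lambda>j::nat. \<rho> j x) \<longlonglongrightarrow> indicator S x"
proof (cases "S = {}")
  case True
  show thesis
    by (rule that[of "\<lambda>_ _. 0"]) (auto simp: True test_functions_def smooth_on_const)
next
  case False
  have "\<exists>r>0. cball x r \<subseteq> S" if "x \<in> S" for x
    using open_contains_cball S(1) that by blast
  then obtain r where r: "\<And>x. x \<in> S \<Longrightarrow> r x > 0" "\<And>x. x \<in> S \<Longrightarrow> cball x (r x) \<subseteq> S" by metis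
  obtain F where F: "F \<subseteq> (\<lambda>x. ball x (r x)) ` S" "countable F" "\<Union>F = \<Union>((\<lambda>x. ball x (r x)) ` S)"
    by (rule Lindelof[of "(\<lambda>x. ball x (r x)) ` S"]) auto
  obtain T where T: "countable T" "T \<subseteq> S" "F = (\<lambda>x. ball x (r x)) ` T"
    using F(1,2) countable_subset_image[of F "\<lambda>x. ball x (r x)" S] by blast
  have cover: "\<exists>c\<in>T. x \<in> ball c (r c)" if "x \<in> S" for x
  proof -
    have "x \<in> \<Union>F" unfolding F(3) using that r(1) by force
    then show ?thesis unfolding T(3) by blast
  qed
  then have Tne: "T \<noteq> {}" using False by blast
  define c where "c = from_nat_into T"
  have cS: "c i \<in> S" for i unfolding c_def using from_nat_into[OF Tne] T(2) by blast
  define \<psi> where "\<psi> i x = bump ((- (1 / r (c i))) *\<^sub>R c i + (1 / r (c i)) *\<^sub>R x)" for i x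
  have arg: "norm ((- (1 / r (c i))) *\<^sub>R c i + (1 / r (c i)) *\<^sub>R x) = dist (c i) x / r (c i)" for i x
  proof -
    have "(- (1 / r (c i))) *\<^sub>R c i + (1 / r (c i)) *\<^sub>R x = (1 / r (c i)) *\<^sub>R (x - c i)"
      by (simp add: scaleR_diff_right)
    then show ?thesis using r(1)[OF cS[of i]] by (simp add: dist_norm norm_minus_commute)
  qed
  have \<psi>0: "\<psi> i x = 0" if "x \<notin> cball (c i) (r (c i))" for i x
    unfolding \<psi>_def by (rule bump_outside, unfold arg) (use that r(1)[OF cS[of i]] in simp)
  have \<psi>1: "\<psi> i x > 0" if "x \<in> ball (c i) (r (c i))" for i x
    unfolding \<psi>_def by (rule bump_inside, unfold arg) (use that r(1)[OF cS[of i]] in simp)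
  have \<psi>_nonneg: "\<psi> i x \<ge> 0" for i x by (simp add: \<psi>_def bump_nonneg)
  have \<psi>_smooth: "smooth_on UNIV (\<psi> i)" for i unfolding \<psi>_def by (rule smooth_on_affine_UNIV[OF smooth_on_bump])
  define \<sigma> where "\<sigma> j x = (\<Sum>i<j. \<psi> i x)" for j x
  define \<rho> where "\<rho> j x = complex_of_real (flat 0 (real j * \<sigma> j x))" for j x
  show thesis
  proof (rule that[of \<rho>])
    fix j
    have "smooth_on UNIV (\<rho> j)" unfolding \<rho>_def \<sigma>_def
      by (intro smooth_on_compose_bounded_linear[OF open_UNIV bounded_linear_of_real] smooth_on_flat
          smooth_on_mult smooth_on_const smooth_on_sum \<psi>_smooth open_UNIV)
    moreover have "compact (\<Union>i<j. cball (c i) (r (c i)))" by (intro compact_UN) auto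
    moreover have "(\<Union>i<j. cball (c i) (r (c i))) \<subseteq> \<Omega>" using r(2)[OF cS] S(2) by blast
    moreover have "\<rho> j x = 0" if "x \<notin> (\<Union>i<j. cball (c i) (r (c i)))" for x
    proof -
      have "\<sigma> j x = 0" unfolding \<sigma>_def by (rule sum.neutral) (use \<psi>0 that in blast)
      then show ?thesis by (simp add: \<rho>_def flat_nonpos)
    qed
    ultimately show "\<rho> j \<in> test_functions \<Omega>" unfolding test_functions_def by blast
    show "cmod (\<rho> j x) \<le> 1" for x using flat_0_le_1 flat_nonneg by (simp add: \<rho>_def)
  next
    fix x
    show "(\<lambda>j::nat. \<rho> j x) \<longlonglongrightarrow> indicator S x"
    proof (cases "x \<in> S")
      case True
      then obtain p where p: "p \<in> T" "x \<in> ball p (r p)" using cover by blast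
      obtain i where "c i = p" using from_nat_into_surj[OF T(1) p(1)] unfolding c_def by blast
      then have i: "\<psi> i x > 0" using p(2) \<psi>1 by blast
      have ge: "\<psi> i x \<le> \<sigma> j x" if "j > i" for j
        unfolding \<sigma>_def using that \<psi>_nonneg by (intro member_le_sum) auto
      have "filterlim (\<lambda>j. real j * \<sigma> j x) at_top sequentially"
      proof (rule filterlim_at_top_mono)
        show "filterlim (\<lambda>j. \<psi> i x * real j) at_top sequentially"
          by (rule filterlim_tendsto_pos_mult_at_top[OF tendsto_const i filterlim_real_sequentially])
        show "\<forall>\<^sub>F j in sequentially. \<psi> i x * real j \<le> real j * \<sigma> j x"
          using eventually_gt_at_top[of i] by eventually_elim (simp add: mult.commute mult_left_mono ge)
      qed
      moreover have "((\<lambda>t. flat 0 t) \<longlongrightarrow> 1) at_top"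
      proof -
        have "((\<lambda>t::real. exp (- (1 / t))) \<longlongrightarrow> exp (- 0)) at_top"
          by (intro tendsto_intros) (simp add: tendsto_inverse_0_at_top filterlim_ident flip: inverse_eq_divide)
        moreover have "\<forall>\<^sub>F t in at_top. exp (- (1 / t)) = flat 0 t"
          using eventually_gt_at_top[of "0::real"] by eventually_elim (simp add: flat_def)
        ultimately show ?thesis using tendsto_cong by fastforce
      qed
      ultimately have "(\<lambda>j. flat 0 (real j * \<sigma> j x)) \<longlonglongrightarrow> 1" by (rule filterlim_compose[rotated])
      then have "(\<lambda>j. \<rho> j x) \<longlonglongrightarrow> of_real 1" unfolding \<rho>_def by (rule tendsto_of_real)
      then show ?thesis using True by simp
    next
      case False
      then have "\<psi> i x = 0" for i using \<psi>0 r(2)[OF cS] by blast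
      then show ?thesis using False by (simp add: \<rho>_def \<sigma>_def flat_nonpos)
    qed
  qed
qed

context
  fixes \<Omega> :: "'a::euclidean_space set"
  assumes bounded: "bounded \<Omega>" and open_\<Omega>: "open \<Omega>"
begin

lemma test_function_product_integrable:
  assumes "g \<in> L2 \<Omega>" "\<phi> \<in> test_functions \<Omega>"
  shows "integrable (lebesgue_on \<Omega>) (\<lambda>x. g x * \<phi> x)"
proof -
  note sb = test_functions_smooth_bounded[OF assms(2)]
  obtain C where "C \<ge> 0" "\<And>x. cmod (\<phi> x) \<le> C" using smooth_boundedE[OF sb, of "[]"] by auto
  moreover have "continuous_on \<Omega> \<phi>"
    using smooth_on_continuous[OF smooth_bounded_smooth[OF sb]] by (rule continuous_on_subset) simp
  ultimately show ?thesis
    by (intro L2_imp_L1(1)[OF bounded open_\<Omega>] L2_integral_product[OF bounded open_\<Omega> assms(1)]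
        continuous_measurable_domain[OF bounded open_\<Omega>])
qed

text \<open>Test functions increase to the indicator of any open subset of \<open>\<Omega>\<close>, so a function that is
  orthogonal to all of them has vanishing integral over every open set, hence over every Borel set.\<close>

lemma AE_zero_test_functions:
  assumes g: "g \<in> L2 \<Omega>" and zero: "\<And>\<phi>. \<phi> \<in> test_functions \<Omega> \<Longrightarrow> (LINT x|lebesgue_on \<Omega>. g x * \<phi> x) = 0"
  shows "AE x in lebesgue_on \<Omega>. g x = 0"
proof -
  have gi: "integrable (lebesgue_on \<Omega>) g" by (rule L2_imp_L1(1)[OF bounded open_\<Omega> g])
  have gm[measurable]: "g \<in> borel_measurable (lebesgue_on \<Omega>)" by (rule L2_measurable[OF g])
  have \<Omega>L: "\<Omega> \<in> sets lebesgue" using open_\<Omega> by simp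
  have open_zero: "(LINT x|lebesgue_on \<Omega>. g x * indicator S x) = 0" if S: "open S" for S
  proof -
    obtain \<rho> where \<rho>: "\<And>j. \<rho> j \<in> test_functions \<Omega>" "\<And>j x. cmod (\<rho> j x) \<le> 1"
      "\<And>x. (\<lambda>j::nat. \<rho> j x) \<longlonglongrightarrow> indicator (S \<inter> \<Omega>) x"
      by (rule test_functions_exhaust[OF open_Int[OF S open_\<Omega>] Int_lower2]) (rule that, assumption+)
    have "(\<lambda>j. LINT x|lebesgue_on \<Omega>. g x * \<rho> j x) \<longlonglongrightarrow> (LINT x|lebesgue_on \<Omega>. g x * indicator (S \<inter> \<Omega>) x)"
    proof (rule integral_dominated_convergence[where w="\<lambda>x. cmod (g x)"])
      show m: "(\<lambda>x. g x * \<rho> j x) \<in> borel_measurable (lebesgue_on \<Omega>)" for j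
        using test_function_product_integrable[OF g \<rho>(1)] by auto
      show lim: "AE x in lebesgue_on \<Omega>. (\<lambda>j. g x * \<rho> j x) \<longlonglongrightarrow> g x * indicator (S \<inter> \<Omega>) x"
        by (intro AE_I2 tendsto_intros \<rho>(3))
      show "(\<lambda>x. g x * indicator (S \<inter> \<Omega>) x) \<in> borel_measurable (lebesgue_on \<Omega>)"
        by (rule borel_measurable_LIMSEQ_metric[where f="\<lambda>j x. g x * \<rho> j x", OF m]) (intro tendsto_intros \<rho>(3))
      show "integrable (lebesgue_on \<Omega>) (\<lambda>x. cmod (g x))" using gi by simp
      show "AE x in lebesgue_on \<Omega>. cmod (g x * \<rho> j x) \<le> cmod (g x)" for j
        using \<rho>(2) by (intro AE_I2) (simp add: norm_mult mult_left_le)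
    qed
    then have "(LINT x|lebesgue_on \<Omega>. g x * indicator (S \<inter> \<Omega>) x) = 0"
      by (simp add: zero \<rho>(1) LIMSEQ_const_iff)
    also have "(LINT x|lebesgue_on \<Omega>. g x * indicator (S \<inter> \<Omega>) x) = (LINT x|lebesgue_on \<Omega>. g x * indicator S x)"
      by (rule Bochner_Integration.integral_cong) (auto simp: indicator_def)
    finally show ?thesis .
  qed
  have part: "AE x in lebesgue_on \<Omega>. R (g x) = 0" if R: "bounded_linear (R :: complex \<Rightarrow> real)" for R
  proof -
    interpret R: bounded_linear R by (rule R)
    define u where "u x = (if x \<in> \<Omega> then R (g x) else 0)" for x
    have ui: "integrable lebesgue u"
      using integrable_bounded_linear[OF R gi] unfolding u_def
        Lebesgue_Measure.integrable_restrict_UNIV[OF \<Omega>L] .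
    then have "u \<in> borel_measurable lebesgue" by auto
    then obtain v where v[measurable]: "v \<in> borel_measurable lborel" and uv: "AE x in lborel. u x = v x"
      using completion_ex_borel_measurable_real by blast
    have vm: "v \<in> borel_measurable lebesgue" using v by (intro measurable_completion)
    have uv': "AE x in lebesgue. u x = v x" by (rule AE_completion[OF uv])
    have "integrable lebesgue v"
      by (rule integrable_cong_AE_imp[OF ui vm]) (use uv' in \<open>auto elim: eventually_mono\<close>)
    then have vi: "integrable lborel v" using integrable_completion[OF v] by simp
    have "AE x in lborel. v x = 0"
    proof (rule AE_zero_open_integrals[OF vi])
      fix S :: "'a set" assume S: "open S"
      have "(LINT x|lborel. v x * indicator S x) = (LINT x|lebesgue. v x * indicator S x)"
        using S by (intro integral_completion[symmetric]) auto
      also have "\<dots> = (LINT x|lebesgue. u x * indicator S x)"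
      proof (rule integral_cong_AE)
        have "indicator S \<in> borel_measurable lborel" using S by simp
        then have i: "(indicator S :: 'a \<Rightarrow> real) \<in> borel_measurable lebesgue" by (intro measurable_completion)
        show "(\<lambda>x. v x * indicator S x) \<in> borel_measurable lebesgue" by (intro borel_measurable_times vm i)
        show "(\<lambda>x. u x * indicator S x) \<in> borel_measurable lebesgue"
          by (intro borel_measurable_times i) (use ui in auto)
        show "AE x in lebesgue. v x * indicator S x = u x * indicator S x" using uv' by eventually_elim simp
      qed
      also have "\<dots> = (LINT x|lebesgue. (if x \<in> \<Omega> then R (g x * indicator S x) else 0))"
        by (rule Bochner_Integration.integral_cong) (auto simp: u_def indicator_def R.zero)
      also have "\<dots> = (LINT x|lebesgue_on \<Omega>. R (g x * indicator S x))"
        by (rule Lebesgue_Measure.integral_restrict_UNIV[OF \<Omega>L])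
      also have "\<dots> = R (LINT x|lebesgue_on \<Omega>. g x * indicator S x)"
      proof (rule integral_bounded_linear[OF R])
        have "S \<inter> \<Omega> \<in> sets lebesgue" using S open_\<Omega> by (simp add: open_Int)
        then have "S \<inter> \<Omega> \<in> sets (lebesgue_on \<Omega>)" using \<Omega>L by (auto simp: sets_restrict_space_iff)
        from integrable_mult_indicator[OF this gi]
        have "integrable (lebesgue_on \<Omega>) (\<lambda>x. indicat_real (S \<inter> \<Omega>) x *\<^sub>R g x)" .
        then show "integrable (lebesgue_on \<Omega>) (\<lambda>x. g x * indicator S x)"
          by (rule Bochner_Integration.integrable_cong[THEN iffD1, rotated 2]) (auto simp: indicator_def)
      qed
      finally show "(LINT x|lborel. v x * indicator S x) = 0" using open_zero[OF S] by (simp add: R.zero)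
    qed
    with uv have "AE x in lborel. u x = 0" by eventually_elim simp
    then have "AE x in lebesgue. x \<in> \<Omega> \<longrightarrow> R (g x) = 0"
      by (intro AE_completion) (auto simp: u_def elim: eventually_mono)
    then show ?thesis using \<Omega>L by (subst AE_restrict_space_iff) auto
  qed
  show ?thesis using part[OF bounded_linear_Re] part[OF bounded_linear_Im]
    by eventually_elim (simp add: complex_eq_iff)
qed

text \<open>Weak derivatives agree almost everywhere, so the choice among them does not affect the norm.\<close>

lemma weak_derivative_norm:
  assumes "is_weak_derivative \<Omega> \<alpha> f g"
  shows "L2_norm \<Omega> (weak_derivative \<Omega> \<alpha> f) = L2_norm \<Omega> g"
proof -
  let ?h = "weak_derivative \<Omega> \<alpha> f"
  have h: "is_weak_derivative \<Omega> \<alpha> f ?h" 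
    unfolding weak_derivative_def by (rule someI[of "is_weak_derivative \<Omega> \<alpha> f" g, OF assms])
  have L: "?h \<in> L2 \<Omega>" "g \<in> L2 \<Omega>" using h assms unfolding is_weak_derivative_def by auto
  note [measurable] = L2_measurable[OF L(1)] L2_measurable[OF L(2)]
  have "(LINT x|lebesgue_on \<Omega>. (?h x - g x) * \<phi> x) = 0" if \<phi>: "\<phi> \<in> test_functions \<Omega>" for \<phi>
  proof -
    have "(LINT x|lebesgue_on \<Omega>. ?h x * \<phi> x) = (LINT x|lebesgue_on \<Omega>. g x * \<phi> x)"
      using h assms \<phi> unfolding is_weak_derivative_def by force
    then show ?thesis
      using test_function_product_integrable[OF L(1) \<phi>] test_function_product_integrable[OF L(2) \<phi>]
      by (simp add: left_diff_distrib)
  qed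
  then have "AE x in lebesgue_on \<Omega>. ?h x - g x = 0" by (rule AE_zero_test_functions[OF L2_diff[OF L]])
  then have "(LINT x|lebesgue_on \<Omega>. (cmod (?h x))\<^sup>2) = (LINT x|lebesgue_on \<Omega>. (cmod (g x))\<^sup>2)"
    by (intro integral_cong_AE) auto
  then show ?thesis by (simp add: L2_norm_def)
qed

text \<open>The order of differentiation is reversed because integration by parts peels off the outermost
  derivative first.\<close>

lemma multi_index_weak_derivative:
  fixes \<alpha> :: "'a \<Rightarrow> nat"
  assumes \<alpha>: "\<alpha> \<in> multi_indices k"
  obtains bs where "set bs \<subseteq> Basis"
    "\<And>h. smooth_on \<Omega> h \<Longrightarrow> partials bs h \<in> L2 \<Omega> \<Longrightarrow> is_weak_derivative \<Omega> \<alpha> h (partials bs h)"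
proof -
  define bs where "bs = (SOME bs. \<forall>b. count_list bs b = \<alpha> b)"
  have bs: "count_list bs b = \<alpha> b" for b
    unfolding bs_def using someI_ex[OF multi_index_list_exists[OF \<alpha>]] by blast
  have set: "set bs \<subseteq> Basis"
  proof
    fix b assume "b \<in> set bs"
    then have "\<alpha> b \<noteq> 0" by (metis bs count_list_0_iff)
    then show "b \<in> Basis" using \<alpha> by (auto simp: multi_indices_def)
  qed
  have len: "length bs = (\<Sum>b\<in>Basis. \<alpha> b)"
    using sum_count_set[OF set finite_Basis] by (simp add: bs)
  have mp: "multi_partial \<alpha> = partials bs" by (simp add: multi_partial_def bs_def)
  show thesis
  proof (rule that[of "rev bs"])
    fix h assume "smooth_on \<Omega> h" "partials (rev bs) h \<in> L2 \<Omega>"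
    then show "is_weak_derivative \<Omega> \<alpha> h (partials (rev bs) h)"
      using partials_integration_by_parts[OF open_\<Omega> _ _ set]
      unfolding is_weak_derivative_def mp len[symmetric] by blast
  qed (use set in simp)
qed

end

context strict_weighted_domain
begin

lemma smoothing_weak_derivative:
  fixes \<alpha> :: "complex ^ 'n \<Rightarrow> nat"
  assumes R: "condition_R \<Omega>" and \<alpha>: "\<alpha> \<in> multi_indices k"
  shows "\<exists>D\<ge>0. \<forall>f\<in>L2 \<Omega>. conj_holomorphic_sv \<Omega> f \<longrightarrow>
    (\<exists>g. is_weak_derivative \<Omega> \<alpha> (bergman_projection \<Omega> f) g) \<and>
    L2_norm \<Omega> (weak_derivative \<Omega> \<alpha> (bergman_projection \<Omega> f)) \<le> D * L2_norm \<Omega> f"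
proof -
  note bo = bounded_domain open_domain
  obtain bs where bs: "set bs \<subseteq> Basis"
    "\<And>h. smooth_on \<Omega> h \<Longrightarrow> partials bs h \<in> L2 \<Omega> \<Longrightarrow> is_weak_derivative \<Omega> \<alpha> h (partials bs h)"
    by (rule multi_index_weak_derivative[OF bo \<alpha>]) (rule that, assumption+)
  obtain C where C: "C \<ge> 0" "\<And>f z. f \<in> L2 \<Omega> \<Longrightarrow> conj_holomorphic_sv \<Omega> f \<Longrightarrow> z \<in> \<Omega> \<Longrightarrow>
      cmod (partials bs (bergman_projection \<Omega> f) z) \<le> C * L2_norm \<Omega> f"
    by (rule smoothing_estimate[OF R bs(1)]) (rule that, assumption+)
  show ?thesis
  proof (intro exI[of _ "C * sqrt (measure lebesgue \<Omega>)"] conjI ballI impI)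
    fix f assume f: "f \<in> L2 \<Omega>" "conj_holomorphic_sv \<Omega> f"
    let ?h = "bergman_projection \<Omega> f"
    have sm: "smooth_on \<Omega> ?h" by (rule bergman_smooth[OF bo bergman_projection(1)[OF bo f(1)]])
    have m: "partials bs ?h \<in> borel_measurable (lebesgue_on \<Omega>)"
      by (rule continuous_measurable_domain[OF bo smooth_on_partials_continuous[OF sm bs(1)]])
    note b = L2_bounded[OF bo m C(2)[OF f] mult_nonneg_nonneg[OF C(1) L2_norm_nonneg]]
    note wd = bs(2)[OF sm b(1)]
    then show "\<exists>g. is_weak_derivative \<Omega> \<alpha> ?h g" by blast
    show "L2_norm \<Omega> (weak_derivative \<Omega> \<alpha> ?h) \<le> C * sqrt (measure lebesgue \<Omega>) * L2_norm \<Omega> f"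
      using b(2) weak_derivative_norm[OF bo wd] by (simp add: mult_ac)
  qed (use C(1) in simp)
qed

lemma smoothing_sobolev:
  assumes R: "condition_R \<Omega>"
  shows "\<exists>C>0. \<forall>f\<in>L2 \<Omega>. conj_holomorphic_sv \<Omega> f \<longrightarrow>
    bergman_projection \<Omega> f \<in> sobolev_space \<Omega> k \<and>
    sobolev_norm \<Omega> k (bergman_projection \<Omega> f) \<le> C * L2_norm \<Omega> f"
proof -
  have "\<forall>\<alpha>\<in>multi_indices k. \<exists>D\<ge>0. \<forall>f\<in>L2 \<Omega>. conj_holomorphic_sv \<Omega> f \<longrightarrow>
    (\<exists>g. is_weak_derivative \<Omega> \<alpha> (bergman_projection \<Omega> f) g) \<and>
    L2_norm \<Omega> (weak_derivative \<Omega> \<alpha> (bergman_projection \<Omega> f)) \<le> D * L2_norm \<Omega> f"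
    using smoothing_weak_derivative[OF R] by blast
  then obtain D where D: "\<And>\<alpha> f. \<alpha> \<in> multi_indices k \<Longrightarrow> f \<in> L2 \<Omega> \<Longrightarrow> conj_holomorphic_sv \<Omega> f \<Longrightarrow>
    (\<exists>g. is_weak_derivative \<Omega> \<alpha> (bergman_projection \<Omega> f) g) \<and>
    L2_norm \<Omega> (weak_derivative \<Omega> \<alpha> (bergman_projection \<Omega> f)) \<le> D \<alpha> * L2_norm \<Omega> f"
    unfolding bchoice_iff by blast
  define A where "A = sqrt (\<Sum>\<alpha>\<in>multi_indices k. (D \<alpha>)\<^sup>2)"
  have A: "A \<ge> 0" by (simp add: A_def sum_nonneg)
  show ?thesis
  proof (intro exI[of _ "A + 1"] conjI ballI impI)
    fix f assume f: "f \<in> L2 \<Omega>" "conj_holomorphic_sv \<Omega> f"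
    let ?h = "bergman_projection \<Omega> f"
    have "?h \<in> L2 \<Omega>"
      using bergman_projection(1)[OF bounded_domain open_domain f(1)] by (simp add: bergman_space_def)
    then show "?h \<in> sobolev_space \<Omega> k" using D f by (simp add: sobolev_space_def)
    have "(\<Sum>\<alpha>\<in>multi_indices k. (L2_norm \<Omega> (weak_derivative \<Omega> \<alpha> ?h))\<^sup>2)
        \<le> (\<Sum>\<alpha>\<in>multi_indices k. (D \<alpha> * L2_norm \<Omega> f)\<^sup>2)"
      using D f L2_norm_nonneg by (intro sum_mono power_mono) auto
    also have "\<dots> = (\<Sum>\<alpha>\<in>multi_indices k. (D \<alpha>)\<^sup>2) * (L2_norm \<Omega> f)\<^sup>2"
      by (simp add: power_mult_distrib sum_distrib_right)
    finally have "sobolev_norm \<Omega> k ?h \<le> sqrt ((\<Sum>\<alpha>\<in>multi_indices k. (D \<alpha>)\<^sup>2) * (L2_norm \<Omega> f)\<^sup>2)"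
      unfolding sobolev_norm_def by (rule real_sqrt_le_mono)
    also have "\<dots> = A * L2_norm \<Omega> f" by (simp add: A_def real_sqrt_mult L2_norm_nonneg)
    also have "\<dots> \<le> (A + 1) * L2_norm \<Omega> f" by (intro mult_right_mono L2_norm_nonneg) simp
    finally show "sobolev_norm \<Omega> k ?h \<le> (A + 1) * L2_norm \<Omega> f" .
  qed (use A in simp)
qed

lemma smoothing_smooth_up_to_boundary:
  assumes "condition_R \<Omega>" and f: "f \<in> L2 \<Omega>" "conj_holomorphic_sv \<Omega> f"
  shows "bergman_projection \<Omega> f \<in> smooth_up_to_boundary \<Omega>"
  unfolding smooth_up_to_boundary_iff[OF bounded_domain]
proof (intro conjI allI impI)
  show "smooth_on \<Omega> (bergman_projection \<Omega> f)"
    by (rule bergman_smooth[OF bounded_domain open_domain bergman_projection(1)[OF bounded_domain open_domain f(1)]])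
  show "uniformly_continuous_on \<Omega> (partials bs (bergman_projection \<Omega> f))" if "set bs \<subseteq> Basis" for bs
    by (rule smoothing_estimate[OF assms(1) that]) (use f in blast)
qed

end

theorem corollary1p12:
  fixes \<Omega> :: "(complex ^ 'n) set"
  assumes "smoothly_bounded_domain \<Omega>"
    and "condition_R \<Omega>"
  shows "(\<forall>k\<ge>1. \<exists>C>0. \<forall>f\<in>L2 \<Omega>. conj_holomorphic_sv \<Omega> f \<longrightarrow>
            bergman_projection \<Omega> f \<in> sobolev_space \<Omega> k \<and>
            sobolev_norm \<Omega> k (bergman_projection \<Omega> f) \<le> C * L2_norm \<Omega> f)
       \<and> (\<forall>f\<in>L2 \<Omega>. conj_holomorphic_sv \<Omega> f \<longrightarrow>
            bergman_projection \<Omega> f \<in> smooth_up_to_boundary \<Omega>)"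
proof -
  obtain w K c where "weighted_domain \<Omega> w K" "c > 0"
    "\<And>x. x \<in> \<Omega> \<Longrightarrow> c \<le> (\<Sum>b\<in>Basis. (partial b w x)\<^sup>2) + (w x)\<^sup>2"
    by (rule smoothly_bounded_domain_weight[OF assms(1)]) (rule that, assumption+)
  then interpret strict_weighted_domain \<Omega> w K c
    by (intro strict_weighted_domain.intro strict_weighted_domain_axioms.intro)
  show ?thesis using smoothing_sobolev smoothing_smooth_up_to_boundary assms(2) by blast
qed

end
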